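(* Let $(Y_t)_{t\in\mathbb Z}$ be an i.i.d. sequence of real random variables and let $(\mathbf G_t)_{t\in\mathbb Z}$ be a strictly stationary sequence of random vectors in $\mathbb R^d$ with $P(\mathbf G_1\neq \mathbf 0)>0$, adapted to the filtration $\mathcal F_t=\sigma(Y_{t-1},Y_{t-2},\dots)$, $t\in\mathbb Z$ (i.e. $\mathbf G_t$ is $\mathcal F_t$-measurable), such that the sequence $\mathbf Y_t=\mathbf G_tY_t$, $t\in\mathbb Z$, is strictly stationary. Put $\mathbf S_n=\sum_{t=1}^n\mathbf Y_t$. Let $(a_n)$ be a sequence of positive numbers with $P(|Y_1|>a_n)\sim n^{-1}$ as $n\to\infty$. Assume: (A.1) $Y_1$ is regularly varying with index $\alpha\in(0,2)$; (A.2) $E|\mathbf G_1|^{\alpha+\epsilon}<\infty$ for some $\epsilon>0$; (A.3) $(\mathbf Y_t)$ satisfies the mixing condition $\mathcal A(a_n)$ with a sequence $(r_n)$ such that, for the same $\epsilon$ as in (A.2), $$n\,r_n\left(\frac{a_{r_n}}{a_n}\right)^{\alpha+\epsilon}\to 0,\qquad n\to\infty .$$ Moreover, if $\alpha\in(1,2)$ assume $EY_1=0$, and if $\alpha=1$ assume that $Y_1$ is symmetric. Then the finite-dimensional distributions of $(\mathbf Y_t)$ are regularly varying with index $\alpha$ and, with $\operatorname{vec}(\boldsymbol\theta^{(k)}_{-k},\dots,\boldsymbol\theta^{(k)}_k)$ denoting a random vector distributed according to the spectral measure of $\operatorname{vec}(\mathbf Y_{-k},\dots,\mathbf Y_k)$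 with respect to the max-norm, the limit $$\gamma=\lim_{k\to\infty}\frac{E\Big(|\boldsymbol\theta_0^{(k)}|^\alpha-\bigvee_{j=1}^k|\boldsymbol\theta_j^{(k)}|^\alpha\Big)_+}{E|\boldsymbol\theta_0^{(k)}|^\alpha}$$ exists. If $\gamma>0$, then $$a_n^{-1}\mathbf S_n\xrightarrow{d}\mathbf X_\alpha,\qquad n\to\infty,$$ for some $\alpha$-stable random vector $\mathbf X_\alpha$ in $\mathbb R^d$.
   Context: Regular variation: a random vector $\mathbf X$ in $\mathbb R^m$ is regularly varying with index $\alpha\ge 0$ (with respect to a norm $|\cdot|$) if there is a random vector $\boldsymbol\Theta$ with values in the unit sphere $\mathbb S^{m-1}$ of that norm such that for every $t>0$, as $x\to\infty$, $P(|\mathbf X|>tx,\ \mathbf X/|\mathbf X|\in\cdot)/P(|\mathbf X|>x)\to t^{-\alpha}P(\boldsymbol\Theta\in\cdot)$ vaguely on the Borel $\sigma$-field of $\mathbb S^{m-1}$. The law of $\boldsymbol\Theta$ is called the spectral measure of $\mathbf X$. The property of regular variation with index $\alpha$ does not depend on the norm (the spectral measure does). Unless stated otherwise $|\cdot|$ is the Euclidean norm. The finite-dimensional distributions of $(\mathbf Y_t)$ are regularly varying with index $\alpha$ if every vector $\operatorname{vec}(\mathbf Y_1,\dots,\mathbf Y_h)$, $h\ge1$ (the concatenation of the vectors), is regularly varying with index $\alpha$. In the definition of $\gamma$, for each $k\ge 0$, $\operatorname{vec}(\boldsymbol\theta^{(k)}_{-k},\dots,\boldsymbol\theta^{(k)}_k)$,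 with $\boldsymbol\theta_j^{(k)}\in\mathbb R^d$, is the vector $\boldsymbol\Theta$ in the definition of regular variation of $\operatorname{vec}(\mathbf Y_{-k},\dots,\mathbf Y_k)\in\mathbb R^{(2k+1)d}$ with respect to the max-norm of $\mathbb R^{(2k+1)d}$, and $|\boldsymbol\theta_j^{(k)}|$ is the max-norm in $\mathbb R^d$; $x_+=\max(x,0)$ and $\bigvee$ denotes maximum. Condition $\mathcal A(a_n)$: a stationary sequence $(\mathbf Y_t)$ in $\mathbb R^d$ satisfies $\mathcal A(a_n)$ if there is a sequence of positive integers $r_n$ with $r_n\to\infty$, $k_n=[n/r_n]\to\infty$, and $$E\exp\Big\{-\sum_{t=1}^n f(\mathbf Y_t/a_n)\Big\}-\Big(E\exp\Big\{-\sum_{t=1}^{r_n}f(\mathbf Y_t/a_n)\Big\}\Big)^{k_n}\to0,\qquad n\to\infty,$$ for every $f$ in the collection of bounded nonnegative step functions on $\overline{\mathbb R}^d\setminus\{\mathbf 0\}$, $\overline{\mathbb R}=[-\infty,\infty]$ (convergence need not be uniform in $f$; $f(\mathbf 0)$ is read as $0$). $\alpha$-stable vectors, $\alpha\in(0,2)$: $\mathbf X$ in $\mathbb R^d$ is $\alpha$-stable if there are a finite Borel measure $\Gamma$ on the Euclidean unit sphere $\mathbb S^{d-1}$ and $\boldsymbol\mu\in\mathbb R^d$ such that for all $\mathbf x\in\mathbb R^d$, $$Ee^{i(\mathbf x,\mathbf X)}=\exp\Big\{-\int_{\mathbb S^{d-1}}|(\mathbf x,\mathbf y)|^\alpha\big(1-i\operatorname{sign}((\mathbf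 x,\mathbf y))\tan(\pi\alpha/2)\big)\Gamma(d\mathbf y)+i(\mathbf x,\boldsymbol\mu)\Big\}\quad(\alpha\ne1),$$ $$Ee^{i(\mathbf x,\mathbf X)}=\exp\Big\{-\int_{\mathbb S^{d-1}}|(\mathbf x,\mathbf y)|\big(1+i\tfrac2\pi\operatorname{sign}((\mathbf x,\mathbf y))\log|(\mathbf x,\mathbf y)|\big)\Gamma(d\mathbf y)+i(\mathbf x,\boldsymbol\mu)\Big\}\quad(\alpha=1).$$ *)

theory Defs
  imports "HOL-Probability.Probability" "HOL-Library.Landau_Symbols"
begin

section \<open>Regular variation\<close>

text \<open>
  The concatenation of finitely many random vectors \<open>X t\<close> with values in a Euclidean space
  \<open>'a\<close>, \<open>t \<in> I\<close>, is represented as an element of the finite product of copies of \<open>'a\<close> over \<open>I\<close>,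
  so the dimension may vary inside a statement.
\<close>

definition block_vec :: "'i set \<Rightarrow> ('i \<Rightarrow> 'w \<Rightarrow> 'a) \<Rightarrow> 'w \<Rightarrow> 'i \<Rightarrow> 'a" where
  "block_vec I X \<omega> = (\<lambda>t\<in>I. X t \<omega>)"

definition block_euclidean_norm :: "'i set \<Rightarrow> ('i \<Rightarrow> 'a::euclidean_space) \<Rightarrow> real" where
  "block_euclidean_norm I x = L2_set (\<lambda>t. norm (x t)) I"

text \<open>\<open>infnorm\<close> is the max-norm of a single block.\<close>

definition block_max_norm :: "'i set \<Rightarrow> ('i \<Rightarrow> 'a::euclidean_space) \<Rightarrow> real" where
  "block_max_norm I x = Max ((\<lambda>t. infnorm (x t)) ` I)"

definition block_sphere :: "'i set \<Rightarrow> (('i \<Rightarrow> 'a::euclidean_space) \<Rightarrow> real) \<Rightarrow> ('i \<Rightarrow> 'a) set" where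
  "block_sphere I N = {x \<in> I \<rightarrow>\<^sub>E UNIV. N x = 1}"

text \<open>
  \<open>spectral_measure M I N X \<alpha> Q\<close>: with respect to the norm \<open>N\<close>, the vector with blocks
  \<open>X t\<close>, \<open>t \<in> I\<close>, is regularly varying with index \<open>\<alpha>\<close> and \<open>Q\<close> is the law of \<open>\<Theta>\<close>.
  Vague convergence is tested on continuous functions; as the sphere is compact, each of them has
  compact support. Taking \<open>g = 1\<close> shows that the probability in the denominator is eventually
  nonzero, so division by zero plays no role.
\<close>

definition spectral_measure ::
  "'w measure \<Rightarrow> 'i set \<Rightarrow> (('i \<Rightarrow> 'a::euclidean_space) \<Rightarrow> real) \<Rightarrow> ('i \<Rightarrow> 'w \<Rightarrow> 'a) \<Rightarrow> real
     \<Rightarrow> ('i \<Rightarrow> 'a) measure \<Rightarrow> bool" where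
  "spectral_measure M I N X \<alpha> Q \<longleftrightarrow>
     finite I \<and> I \<noteq> {} \<and> (\<forall>t\<in>I. X t \<in> borel_measurable M) \<and> 0 \<le> \<alpha> \<and>
     prob_space Q \<and>
     sets Q = sets (restrict_space (PiM I (\<lambda>_. borel)) (block_sphere I N)) \<and>
     (\<forall>t>0. \<forall>g::('i \<Rightarrow> 'a) \<Rightarrow> real. continuous_on (block_sphere I N) g \<longrightarrow>
       ((\<lambda>x.
          (\<integral>\<omega>. (if N (block_vec I X \<omega>) > t * x
                 then g (\<lambda>s\<in>I. X s \<omega> /\<^sub>R N (block_vec I X \<omega>)) else 0) \<partial>M)
          / measure M {\<omega> \<in> space M. N (block_vec I X \<omega>) > x})
        \<longlongrightarrow> t powr (-\<alpha>) * (\<integral>\<theta>. g \<theta> \<partial>Q)) at_top)"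

definition regularly_varying ::
  "'w measure \<Rightarrow> 'i set \<Rightarrow> ('i \<Rightarrow> 'w \<Rightarrow> 'a::euclidean_space) \<Rightarrow> real \<Rightarrow> bool" where
  "regularly_varying M I X \<alpha> \<longleftrightarrow> (\<exists>Q. spectral_measure M I (block_euclidean_norm I) X \<alpha> Q)"

definition fdds_regularly_varying ::
  "'w measure \<Rightarrow> (int \<Rightarrow> 'w \<Rightarrow> 'a::euclidean_space) \<Rightarrow> real \<Rightarrow> bool" where
  "fdds_regularly_varying M X \<alpha> \<longleftrightarrow> (\<forall>h::nat. h \<ge> 1 \<longrightarrow> regularly_varying M {1..int h} X \<alpha>)"

text \<open>
  The term with index \<open>k\<close> in the definition of \<open>\<gamma>\<close>, where \<open>Q\<close> is the law of
  \<open>(\<theta>\<^sub>t)\<close>, \<open>-k \<le> t \<le> k\<close>. The inserted \<open>0\<close> only fixes the value of the empty maximum.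
\<close>

definition extremal_ratio :: "real \<Rightarrow> nat \<Rightarrow> (int \<Rightarrow> 'a::euclidean_space) measure \<Rightarrow> real" where
  "extremal_ratio \<alpha> k Q =
     (\<integral>\<theta>. max 0 (infnorm (\<theta> 0) powr \<alpha> -
                 Max (insert 0 ((\<lambda>j. infnorm (\<theta> j) powr \<alpha>) ` {1..int k}))) \<partial>Q)
     / (\<integral>\<theta>. infnorm (\<theta> 0) powr \<alpha> \<partial>Q)"

section \<open>Stationary sequences\<close>

definition strictly_stationary ::
  "'w measure \<Rightarrow> (int \<Rightarrow> 'w \<Rightarrow> 'a::topological_space) \<Rightarrow> bool" where
  "strictly_stationary M X \<longleftrightarrow>
     (\<forall>t. X t \<in> borel_measurable M) \<and>
     (\<forall>J h. finite J \<longrightarrow>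
        distr M (PiM J (\<lambda>_. borel)) (block_vec J (\<lambda>t. X (t + h))) =
        distr M (PiM J (\<lambda>_. borel)) (block_vec J X))"

definition iid_seq :: "'w measure \<Rightarrow> (int \<Rightarrow> 'w \<Rightarrow> 'a::topological_space) \<Rightarrow> bool" where
  "iid_seq M X \<longleftrightarrow>
     prob_space.indep_vars M (\<lambda>_. borel) X UNIV \<and>
     (\<forall>s t. distr M borel (X s) = distr M borel (X t))"

definition past_sigma :: "'w measure \<Rightarrow> (int \<Rightarrow> 'w \<Rightarrow> 'a::topological_space) \<Rightarrow> int \<Rightarrow> 'w measure" where
  "past_sigma M X t = sigma (space M) {X s -` A \<inter> space M | s A. s < t \<and> A \<in> sets borel}"

section \<open>The mixing condition\<close>

text \<open>
  Step functions on the punctured extended space are finite linear combinations of indicators of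
  boxes whose edges are arbitrary (possibly infinite or degenerate) intervals of extended reals;
  they are extended by the value \<open>0\<close> at the origin, and are bounded by construction. Supports are
  not required to stay away from the origin.
\<close>

definition ereal_box :: "(ereal ^ 'd) set \<Rightarrow> bool" where
  "ereal_box R \<longleftrightarrow>
     (\<exists>J :: 'd \<Rightarrow> ereal set.
        (\<forall>i. \<forall>a\<in>J i. \<forall>b\<in>J i. {a..b} \<subseteq> J i) \<and> R = {x. \<forall>i. x $ i \<in> J i})"

definition nonneg_step_function :: "(ereal ^ 'd \<Rightarrow> real) \<Rightarrow> bool" where
  "nonneg_step_function f \<longleftrightarrow>
     (\<forall>x. 0 \<le> f x) \<and>
     (\<exists>\<R> c. finite \<R> \<and> (\<forall>R\<in>\<R>. ereal_box R) \<and>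
        f = (\<lambda>x. if x = 0 then 0 else (\<Sum>R\<in>\<R>. c R * indicator R x)))"

definition mixing_A ::
  "'w measure \<Rightarrow> (int \<Rightarrow> 'w \<Rightarrow> real ^ 'd) \<Rightarrow> (nat \<Rightarrow> real) \<Rightarrow> (nat \<Rightarrow> nat) \<Rightarrow> bool" where
  "mixing_A M X a r \<longleftrightarrow>
     (\<forall>n\<ge>1. 0 < r n) \<and> filterlim r at_top sequentially \<and>
     filterlim (\<lambda>n. n div r n) at_top sequentially \<and>
     (\<forall>f. nonneg_step_function f \<longrightarrow>
       (\<lambda>n. (\<integral>\<omega>. exp (- (\<Sum>t=1..int n. f (\<chi> i. ereal (X t \<omega> $ i / a n)))) \<partial>M)
           - (\<integral>\<omega>. exp (- (\<Sum>t=1..int (r n). f (\<chi> i. ereal (X t \<omega> $ i / a n)))) \<partial>M)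
               ^ (n div r n)) \<longlonglongrightarrow> 0)"

section \<open>Stable laws and convergence in distribution\<close>

text \<open>The conventions \<open>0 powr \<alpha> = 0\<close> and \<open>0 * ln 0 = 0\<close> are those of the library.\<close>

definition stable_exponent :: "real \<Rightarrow> real \<Rightarrow> complex" where
  "stable_exponent \<alpha> u =
     (if \<alpha> \<noteq> 1
      then of_real (\<bar>u\<bar> powr \<alpha>) * (1 - \<i> * of_real (sgn u * tan (pi * \<alpha> / 2)))
      else of_real \<bar>u\<bar> * (1 + \<i> * of_real (2 / pi * sgn u * ln \<bar>u\<bar>)))"

definition stable_law :: "real \<Rightarrow> ('a::euclidean_space) measure \<Rightarrow> bool" where
  "stable_law \<alpha> L \<longleftrightarrow>
     0 < \<alpha> \<and> \<alpha> < 2 \<and> prob_space L \<and> sets L = sets borel \<and>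
     (\<exists>\<Gamma> \<mu>. finite_measure \<Gamma> \<and> sets \<Gamma> = sets (restrict_space borel (sphere 0 1)) \<and>
        (\<forall>x. (\<integral>z. exp (\<i> * of_real (x \<bullet> z)) \<partial>L) =
              exp (- (\<integral>y. stable_exponent \<alpha> (x \<bullet> y) \<partial>\<Gamma>) + \<i> * of_real (x \<bullet> \<mu>))))"

definition conv_in_distr ::
  "'w measure \<Rightarrow> (nat \<Rightarrow> 'w \<Rightarrow> 'a::euclidean_space) \<Rightarrow> 'a measure \<Rightarrow> bool" where
  "conv_in_distr M Z L \<longleftrightarrow>
     (\<forall>g::'a \<Rightarrow> real. continuous_on UNIV g \<and> bounded (range g) \<longrightarrow>
        (\<lambda>n. \<integral>\<omega>. g (Z n \<omega>) \<partial>M) \<longlonglongrightarrow> (\<integral>z. g z \<partial>L))"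

end

theory Submission
  imports Defs
begin

text \<open>
  Since \<open>G\<^sub>t\<close> is determined by the variables before \<open>Y\<^sub>t\<close> and has a moment of order above \<open>\<alpha>\<close>, by
  Potter's bounds two blocks of \<open>(Y\<^sub>t G\<^sub>t)\<close> are large simultaneously only with probability
  \<open>o(P(\<bar>Y\<^sub>1\<bar> > x))\<close>. The limit measure is therefore concentrated on the axes, at most one of the
  \<open>\<theta>\<^sub>j\<close> is nonzero, and \<open>\<gamma> = 1\<close>.

  For the limit theorem no mixing is needed. Put \<open>\<psi>(u) = lim n (1 - E exp(i u Y\<^sub>1 / a\<^sub>n))\<close>. Conditioning
  successively on the past turns \<open>E exp(i (x, S\<^sub>n) / a\<^sub>n)\<close> into the expectation of
  \<open>exp(- n\<^sup>-\<^sup>1 \<Sum>\<^sub>t \<psi>((x, G\<^sub>t)))\<close> up to \<open>o(1)\<close>. A stationary sequence adapted to the past of an i.i.d. sequence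
  has asymptotically vanishing correlations, so by the law of large numbers the limit is
  \<open>exp(- E \<psi>((x, G\<^sub>1)))\<close>. By homogeneity of \<open>\<psi>\<close> this is a stable characteristic function, whose
  spectral measure is the law of \<open>\<plusminus> G\<^sub>1 / \<bar>G\<^sub>1\<bar>\<close> weighted by \<open>\<bar>G\<^sub>1\<bar>\<^sup>\<alpha>\<close>.
\<close>

section \<open>Potter bounds and quantiles\<close>

text \<open>What makes the argument quantitative is a bound
  \<open>D * (1 + |u|^(\<alpha>+\<epsilon>))\<close>, uniform in \<open>n\<close>, on
  \<open>n * (1 - E exp(i u Y_1 / a_n))\<close>: with \<open>u\<close> replaced by
  \<open>(x, G_1)\<close> it is integrable, so convergence for fixed \<open>u\<close> is enough.
  Limit and bound come from one dominated convergence. For each of the two parts of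
  \<open>Y_1\<close>, the quantile transform turns \<open>n\<close> times the expectation into a
  Lebesgue integral over the half-line; rescaled quantiles converge to
  \<open>(p / y)^(1/\<alpha>)\<close>, and inverting Potter's bounds dominates them. The kernel must
  vanish at zero with order above \<alpha> and grow at infinity with order below \<alpha>, which is
  why mean zero (\<alpha> > 1) and symmetry (\<alpha> = 1) are used before the limit is taken. A
  substitution extracts \<open>u^\<alpha>\<close> and leaves one constant; for \<alpha> \<noteq> 1,
  rotating the ray of integration by a right angle reveals its argument, hence the tangent in the
  stable exponent. In several dimensions, the selection of weak limits is reduced to the unit
  interval by a space-filling curve.\<close>

lemma Potter_ge_1:
  fixes T :: "real \<Rightarrow> real"
  assumes anti: "antimono T" and x0: "0 < x0" and \<beta>: "0 < \<beta>"
    and step: "\<And>x. x \<ge> x0 \<Longrightarrow> T (2 * x) \<le> 2 powr (-\<beta>) * T x"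
    and pos: "\<And>x. T x \<ge> 0" and x: "x \<ge> x0" and s: "s \<ge> 1"
  shows "T (s * x) \<le> 2 powr \<beta> * s powr (-\<beta>) * T x"
proof -
  have it: "T (2 ^ k * x) \<le> 2 powr (- \<beta> * k) * T x" for k :: nat
  proof (induction k)
    case (Suc k)
    have "x0 \<le> 2 ^ k * x"
      using x x0 mult_mono[of 1 "2 ^ k :: real" x0 x] by simp
    then have "T (2 * (2 ^ k * x)) \<le> 2 powr (-\<beta>) * T (2 ^ k * x)" by (rule step)
    also have "\<dots> \<le> 2 powr (-\<beta>) * (2 powr (- \<beta> * k) * T x)"
      using Suc by (intro mult_left_mono) auto
    also have "\<dots> = 2 powr (- \<beta> * Suc k) * T x"
      by (simp add: powr_add[symmetric] mult.assoc[symmetric] algebra_simps)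
    finally show ?case by (simp add: mult.assoc)
  qed simp
  \<comment> \<open>\<open>k\<close> full doublings stay below \<open>s\<close>; the factor
    \<open>s / 2 ^ k < 2\<close> left over is absorbed by monotonicity and costs
    \<open>2 powr \<beta>\<close>.\<close>
  define k where "k = nat \<lfloor>log 2 s\<rfloor>"
  have l: "log 2 s \<ge> 0" using s by simp
  have k: "real k \<le> log 2 s" "log 2 s < real k + 1" using l unfolding k_def by linarith+
  have k1: "2 ^ k \<le> s" using k(1) s by (simp add: powr_realpow le_log_iff)
  have k2: "s \<le> 2 powr (k + 1)" using k(2) s by (simp add: log_less_iff add.commute)
  have x_pos: "0 < x" using x x0 by linarith
  have "T (s * x) \<le> T (2 ^ k * x)"
    using k1 x_pos by (intro antimonoD[OF anti] mult_right_mono) auto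
  also have "\<dots> \<le> 2 powr (- \<beta> * k) * T x" by (rule it)
  also have "2 powr (- \<beta> * k) = 2 powr \<beta> * (2 powr (k + 1)) powr (-\<beta>)"
    by (simp add: powr_powr powr_add[symmetric] algebra_simps)
  also have "\<dots> \<le> 2 powr \<beta> * s powr (-\<beta>)"
    using k2 s \<beta> by (intro mult_left_mono powr_mono2') auto
  finally show ?thesis using pos by (simp add: mult_right_mono)
qed

text \<open>Doubling now runs upwards from \<open>s * x\<close>: the least \<open>k\<close> with
  \<open>2 ^ k \<ge> 1 / s\<close> carries it past \<open>x\<close>, overshooting by at most a
  factor 2. All points on the way lie above \<open>x0\<close> because the starting point does, so
  \<open>step\<close> applies throughout.\<close>

lemma Potter_le_1:
  fixes T :: "real \<Rightarrow> real"
  assumes anti: "antimono T" and x0: "0 < x0" and \<beta>: "0 < \<beta>"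
    and step: "\<And>x. x \<ge> x0 \<Longrightarrow> T x \<le> 2 powr \<beta> * T (2 * x)"
    and pos: "\<And>x. T x \<ge> 0" and x: "s * x \<ge> x0" and s: "0 < s" "s \<le> 1"
  shows "T (s * x) \<le> 2 powr \<beta> * s powr (-\<beta>) * T x"
proof -
  define y where "y = s * x"
  define k where "k = nat \<lceil>log 2 (1 / s)\<rceil>"
  have it: "T y \<le> 2 powr (\<beta> * k) * T (2 ^ k * y)" for k :: nat
  proof (induction k)
    case (Suc k)
    have "x0 \<le> 2 ^ k * y"
      using x x0 mult_mono[of 1 "2 ^ k :: real" x0 y] by (simp add: y_def)
    then have "T (2 ^ k * y) \<le> 2 powr \<beta> * T (2 * (2 ^ k * y))" by (rule step)
    then have "2 powr (\<beta> * k) * T (2 ^ k * y) \<le> 2 powr (\<beta> * k) * (2 powr \<beta> * T (2 * (2 ^ k * y)))"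
      by (intro mult_left_mono) auto
    also have "\<dots> = 2 powr (\<beta> * Suc k) * T (2 * (2 ^ k * y))"
      by (simp add: distrib_left powr_add mult_ac)
    finally show ?case using Suc by (simp add: mult.assoc)
  qed simp
  have l: "log 2 (1 / s) \<ge> 0" using s by (simp add: log_divide)
  have k: "log 2 (1 / s) \<le> real k" "real k < log 2 (1 / s) + 1" using l unfolding k_def by linarith+
  have k1: "1 / s \<le> 2 ^ k" using k(1) s by (simp add: powr_realpow log_le_iff)
  have k2: "2 powr real k \<le> 2 / s"
  proof -
    have "2 powr real k \<le> 2 powr (log 2 (1 / s) + 1)" using k(2) by simp
    also have "\<dots> = 2 / s" using s by (simp add: powr_add)
    finally show ?thesis .
  qed
  have y: "0 < y" using x x0 by (simp add: y_def)
  have "x \<le> 2 ^ k * y"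
    using k1 s y mult_right_mono[OF k1, of y] by (simp add: y_def)
  then have "T (2 ^ k * y) \<le> T x" by (rule antimonoD[OF anti])
  have "T y \<le> 2 powr (\<beta> * k) * T (2 ^ k * y)" by (rule it)
  also have "\<dots> \<le> 2 powr (\<beta> * k) * T x" using \<open>T (2 ^ k * y) \<le> T x\<close> by (intro mult_left_mono) auto
  also have "2 powr (\<beta> * k) = (2 powr real k) powr \<beta>" by (simp add: powr_powr mult.commute)
  also have "\<dots> \<le> (2 / s) powr \<beta>" using k2 \<beta> by (intro powr_mono2) auto
  also have "\<dots> = 2 powr \<beta> * s powr (-\<beta>)" using s by (simp add: powr_divide powr_minus divide_simps)
  finally show ?thesis using pos by (simp add: mult_right_mono y_def)
qed

text \<open>The limit at \<open>t = 2\<close> supplies the doubling bounds, with \<delta> as margin,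
  and these settle all \<open>s\<close> with \<open>s * x \<ge> x0\<close>. Below \<open>x0\<close>
  the only information is \<open>T \<le> 1\<close>; the polynomial lower bound \<open>low\<close>
  for \<open>T x\<close> compensates for it, so that the estimate holds for every
  \<open>s > 0\<close>.\<close>

lemma Potter:
  fixes T :: "real \<Rightarrow> real"
  assumes anti: "antimono T" and bd: "\<And>x. 0 \<le> T x" "\<And>x. T x \<le> 1"
    and lim: "\<And>t. t > 0 \<Longrightarrow> ((\<lambda>x. T (t * x) / T x) \<longlongrightarrow> t powr (-\<alpha>)) at_top"
    and \<delta>: "0 < \<delta>" "\<delta> < \<alpha>"
  shows "\<exists>C>0. \<exists>x0>0. \<forall>x\<ge>x0. T x > 0 \<and>
      (\<forall>s>0. T (s * x) \<le> C * max (s powr (-\<alpha>-\<delta>)) (s powr (-\<alpha>+\<delta>)) * T x)"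
proof -
  have "\<forall>\<^sub>F x in at_top. T (2 * x) / T x < 2 powr (-\<alpha>+\<delta>)"
    using order_tendstoD(2)[OF lim[of 2], of "2 powr (-\<alpha>+\<delta>)"] \<delta> by simp
  moreover have "\<forall>\<^sub>F x in at_top. T (2 * x) / T x > 2 powr (-\<alpha>-\<delta>)"
    using order_tendstoD(1)[OF lim[of 2], of "2 powr (-\<alpha>-\<delta>)"] \<delta> by simp
  ultimately have "\<forall>\<^sub>F x in at_top. T (2 * x) / T x < 2 powr (-\<alpha>+\<delta>) \<and>
      T (2 * x) / T x > 2 powr (-\<alpha>-\<delta>) \<and> x > 0"
    using eventually_gt_at_top[of "0::real"] by eventually_elim simp
  then obtain x0 where x0: "\<And>x. x \<ge> x0 \<Longrightarrow> T (2 * x) / T x < 2 powr (-\<alpha>+\<delta>) \<and>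
      T (2 * x) / T x > 2 powr (-\<alpha>-\<delta>) \<and> x > 0"
    unfolding eventually_at_top_linorder by blast
  have x0_pos: "x0 > 0" using x0[of x0] by simp
  \<comment> \<open>If \<open>T x\<close> vanished, the quotient would be 0 by the convention for
    division, contradicting its positive lower bound.\<close>
  have Tpos: "T x > 0" if "x \<ge> x0" for x
  proof (rule ccontr)
    assume "\<not> T x > 0"
    then have "T x = 0" using bd[of x] by simp
    then have "T (2 * x) / T x = 0" by simp
    then show False using x0[OF that] by (metis less_asym powr_gt_zero zero_neq_numeral)
  qed
  have s1: "T (2 * x) \<le> 2 powr (-(\<alpha>-\<delta>)) * T x" if "x \<ge> x0" for x
    using x0[OF that] Tpos[OF that] by (simp add: divide_simps)
  have s2: "T x \<le> 2 powr (\<alpha>+\<delta>) * T (2 * x)" if "x \<ge> x0" for x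
  proof -
    have "2 powr (-\<alpha>-\<delta>) * T x \<le> T (2 * x)"
      using x0[OF that] Tpos[OF that] by (simp add: divide_simps)
    then have "2 powr (\<alpha>+\<delta>) * (2 powr (-\<alpha>-\<delta>) * T x) \<le> 2 powr (\<alpha>+\<delta>) * T (2 * x)"
      by (intro mult_left_mono) auto
    then show ?thesis by (simp add: mult.assoc[symmetric] powr_add[symmetric])
  qed
  define c where "c = 2 powr (-(\<alpha>+\<delta>)) * x0 powr (\<alpha>+\<delta>) * T x0"
  have c: "c > 0" using Tpos[of x0] x0_pos by (simp add: c_def)
  have low: "T x \<ge> c * x powr (-(\<alpha>+\<delta>))" if "x \<ge> x0" for x
  proof -
    have xp: "x > 0" using that x0_pos by simp
    have "T ((x0 / x) * x) \<le> 2 powr (\<alpha>+\<delta>) * (x0 / x) powr (-(\<alpha>+\<delta>)) * T x"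
      by (rule Potter_le_1[OF anti x0_pos _ s2]) (use that x0_pos bd \<delta> xp in auto)
    moreover have "(x0 / x) powr (-(\<alpha>+\<delta>)) = x powr (\<alpha>+\<delta>) / x0 powr (\<alpha>+\<delta>)"
      unfolding powr_minus using xp x0_pos by (simp add: powr_divide)
    ultimately have 1: "T x0 \<le> 2 powr (\<alpha>+\<delta>) * (x powr (\<alpha>+\<delta>) / x0 powr (\<alpha>+\<delta>)) * T x"
      using xp by simp
    define A B D where "A = x powr (\<alpha>+\<delta>)" and "B = x0 powr (\<alpha>+\<delta>)" and "D = (2::real) powr (\<alpha>+\<delta>)"
    have "A > 0" "B > 0" "D > 0" using xp x0_pos by (auto simp: A_def B_def D_def)
    then show ?thesis using 1
      unfolding c_def powr_minus A_def[symmetric] B_def[symmetric] D_def[symmetric]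
      by (simp add: field_simps)
  qed
  \<comment> \<open>The third entry treats \<open>s * x \<le> x0\<close>: there
    \<open>1 \<le> (x0 / (s * x)) powr (\<alpha>+\<delta>)\<close>, and \<open>low\<close> replaces
    \<open>x powr (-(\<alpha>+\<delta>))\<close> by \<open>T x / c\<close>.\<close>
  define C where "C = max (max (2 powr (\<alpha>-\<delta>)) (2 powr (\<alpha>+\<delta>))) (x0 powr (\<alpha>+\<delta>) / c)"
  have C: "C > 0" by (simp add: C_def less_max_iff_disj)
  have "T (s * x) \<le> C * max (s powr (-\<alpha>-\<delta>)) (s powr (-\<alpha>+\<delta>)) * T x" if x: "x \<ge> x0" and s: "s > 0" for x s
  proof -
    have xp: "x > 0" using x x0_pos by simp
    consider "s \<ge> 1" | "s \<le> 1" "s * x \<ge> x0" | "s \<le> 1" "s * x \<le> x0" by linarith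
    then show ?thesis
    proof cases
      case 1
      have "T (s * x) \<le> 2 powr (\<alpha>-\<delta>) * s powr (-(\<alpha>-\<delta>)) * T x"
        by (rule Potter_ge_1[OF anti x0_pos _ s1]) (use 1 x bd \<delta> in auto)
      also have "\<dots> \<le> C * max (s powr (-\<alpha>-\<delta>)) (s powr (-\<alpha>+\<delta>)) * T x"
        using bd C by (intro mult_right_mono mult_mono) (auto simp: C_def)
      finally show ?thesis .
    next
      case 2
      have "T (s * x) \<le> 2 powr (\<alpha>+\<delta>) * s powr (-(\<alpha>+\<delta>)) * T x"
        by (rule Potter_le_1[OF anti x0_pos _ s2]) (use 2 s bd \<delta> in auto)
      also have "\<dots> \<le> C * max (s powr (-\<alpha>-\<delta>)) (s powr (-\<alpha>+\<delta>)) * T x"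
        using bd C by (intro mult_right_mono mult_mono) (auto simp: C_def)
      finally show ?thesis .
    next
      case 3
      have "s powr (\<alpha>+\<delta>) * x powr (\<alpha>+\<delta>) \<le> x0 powr (\<alpha>+\<delta>)"
        using 3 s xp x0_pos \<delta> by (simp add: powr_mult[symmetric] powr_mono2)
      then have h: "x0 powr (\<alpha>+\<delta>) / (s powr (\<alpha>+\<delta>) * x powr (\<alpha>+\<delta>)) \<ge> 1"
        using s xp by (simp add: divide_simps)
      have "T (s * x) \<le> 1" by (rule bd)
      also have "1 \<le> x0 powr (\<alpha>+\<delta>) / c * s powr (-\<alpha>-\<delta>) * (c * x powr (-(\<alpha>+\<delta>)))"
      proof -
        define A B where "A = s powr (\<alpha>+\<delta>)" and "B = x powr (\<alpha>+\<delta>)"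
        have "A > 0" "B > 0" using s xp by (auto simp: A_def B_def)
        moreover have "-\<alpha>-\<delta> = -(\<alpha>+\<delta>)" by simp
        ultimately show ?thesis using h c
          unfolding powr_minus A_def[symmetric] B_def[symmetric]
          by (simp only: powr_minus A_def[symmetric] B_def[symmetric]) (simp add: field_simps)
      qed
      also have "\<dots> \<le> x0 powr (\<alpha>+\<delta>) / c * s powr (-\<alpha>-\<delta>) * T x"
        using low[OF x] c by (intro mult_left_mono) auto
      also have "\<dots> \<le> C * max (s powr (-\<alpha>-\<delta>)) (s powr (-\<alpha>+\<delta>)) * T x"
        using bd C by (intro mult_right_mono mult_mono) (auto simp: C_def)
      finally show ?thesis .
    qed
  qed
  then show ?thesis using C x0_pos Tpos by blast
qed

section \<open>Integrable bounds for quantile functions\<close>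

lemma nonneg_has_integral_imp_set_integrable:
  fixes f :: "real \<Rightarrow> real"
  assumes "(f has_integral I) S" "S \<in> sets borel" "f \<in> borel_measurable borel" "\<And>x. x \<in> S \<Longrightarrow> 0 \<le> f x"
  shows "set_integrable lborel S f"
proof -
  have "((\<lambda>x. if x \<in> S then f x else 0) has_integral I) UNIV"
    using assms(1) by (simp add: has_integral_restrict_UNIV)
  then have h: "((\<lambda>x. indicator S x * f x) has_integral I) UNIV"
    by (rule has_integral_eq[rotated]) auto
  have "(\<integral>\<^sup>+x. ennreal (indicator S x * f x) \<partial>lborel) = ennreal I"
    by (rule nn_integral_has_integral_lborel[OF _ _ h]) (use assms in \<open>auto simp: indicator_def\<close>)
  then show ?thesis unfolding set_integrable_def
    by (intro integrableI_nonneg) (use assms in \<open>auto simp: indicator_def\<close>)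
qed

lemma set_integrable_powr_0:
  fixes c e :: real
  assumes "0 < c" "e < 1"
  shows "set_integrable lborel {0<..c} (\<lambda>y. (c / y) powr e)"
proof -
  have "(\<lambda>x::real. x powr (-e)) integrable_on {0<..c}"
    using integrable_on_powr_from_0'[of "-e" c] assms by simp
  then obtain I where "((\<lambda>x::real. x powr (-e)) has_integral I) {0<..c}" by (auto simp: integrable_on_def)
  then have "set_integrable lborel {0<..c} (\<lambda>x. x powr (-e))"
    by (rule nonneg_has_integral_imp_set_integrable) auto
  then have "set_integrable lborel {0<..c} (\<lambda>x. c powr e * x powr (-e))"
    by simp
  then show ?thesis
    by (rule set_integrable_cong[OF refl refl, THEN iffD1, rotated])
       (use assms in \<open>auto simp: powr_divide powr_minus divide_simps\<close>)
qed

lemma set_integrable_powr_inf: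
  fixes c e :: real
  assumes "0 < c" "e > 1"
  shows "set_integrable lborel {c..} (\<lambda>y. (c / y) powr e)"
proof -
  have "set_integrable lborel {c..} (\<lambda>x. x powr (-e))"
    by (rule nonneg_has_integral_imp_set_integrable[OF has_integral_powr_to_inf]) (use assms in auto)
  then have "set_integrable lborel {c..} (\<lambda>x. c powr e * x powr (-e))"
    by simp
  then show ?thesis
    by (rule set_integrable_cong[OF refl refl, THEN iffD1, rotated])
       (use assms in \<open>auto simp: powr_divide powr_minus divide_simps\<close>)
qed

text \<open>Potter's bound solved for the quantile: the least \<open>s\<close> at which both
  \<open>C * s powr (-h)\<close> and \<open>C * s powr (-l)\<close> are at most
  \<open>y\<close>.\<close>

definition quantile_bound :: "real \<Rightarrow> real \<Rightarrow> real \<Rightarrow> real \<Rightarrow> real" where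
  "quantile_bound C l h y = max ((C / y) powr (1 / h)) ((C / y) powr (1 / l))"

text \<open>Near zero the exponent \<open>1 / l\<close> dominates and the power \<open>b\<close>
  leaves \<open>(C / y) powr (b / l)\<close> with \<open>b / l < 1\<close>; near infinity
  \<open>1 / h\<close> dominates and the power \<open>a\<close> leaves the exponent
  \<open>a / h > 1\<close>. The two branches of the maximum cross at \<open>y = C\<close>, the point
  of splitting.\<close>

lemma set_integrable_quantile_bound:
  assumes "0 < C" "0 < l" "l \<le> h" "0 \<le> b" "b < l" "h < a"
  shows "set_integrable lborel {0<..}
    (\<lambda>y. min (quantile_bound C l h y powr a) (quantile_bound C l h y powr b))"
proof -
  let ?W = "\<lambda>y. min (quantile_bound C l h y powr a) (quantile_bound C l h y powr b)"
  have m: "?W \<in> borel_measurable borel" unfolding quantile_bound_def by measurable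
  have 1: "set_integrable lborel {0<..C} ?W"
  proof (rule set_integrable_bound[OF set_integrable_powr_0[of C "b / l"]])
    show "AE x in lborel. x \<in> {0<..C} \<longrightarrow> norm (?W x) \<le> norm ((C / x) powr (b / l))"
    proof (intro AE_I2 impI)
      fix y assume y: "y \<in> {0<..C}"
      have "(C / y) powr (1 / h) \<le> (C / y) powr (1 / l)"
        using y assms by (intro powr_mono) (auto simp: divide_simps)
      then have "quantile_bound C l h y = (C / y) powr (1 / l)" by (simp add: quantile_bound_def max_def)
      then show "norm (?W y) \<le> norm ((C / y) powr (b / l))"
        by (simp add: powr_powr min_def)
    qed
  qed (use assms m in \<open>auto simp: set_borel_measurable_def\<close>)
  have 2: "set_integrable lborel {C..} ?W"
  proof (rule set_integrable_bound[OF set_integrable_powr_inf[of C "a / h"]])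
    show "AE x in lborel. x \<in> {C..} \<longrightarrow> norm (?W x) \<le> norm ((C / x) powr (a / h))"
    proof (intro AE_I2 impI)
      fix y assume y: "y \<in> {C..}"
      have "(C / y) powr (1 / l) \<le> (C / y) powr (1 / h)"
        using y assms by (intro powr_mono') (auto simp: divide_simps)
      then have "quantile_bound C l h y = (C / y) powr (1 / h)" by (simp add: quantile_bound_def max_def)
      then show "norm (?W y) \<le> norm ((C / y) powr (a / h))"
        by (simp add: powr_powr min_def)
    qed
  qed (use assms m in \<open>auto simp: set_borel_measurable_def\<close>)
  have "{0<..} = {0<..C} \<union> {C..}" using assms by auto
  then show ?thesis using set_integrable_Un[OF 1 2] by simp
qed

section \<open>Scaled expectations as integrals of rescaled quantiles\<close>

locale regularly_varying_tail = \<mu>: cdf_distribution \<mu>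
  for \<mu> :: "real measure" +
  fixes a :: "nat \<Rightarrow> real" and p \<alpha> \<delta> C :: real and n0 :: nat
  assumes nonneg: "AE x in \<mu>. 0 \<le> x"
    and a_pos: "\<And>n. n \<ge> 1 \<Longrightarrow> 0 < a n"
    and p: "0 \<le> p" and \<delta>: "0 < \<delta>" "\<delta> < \<alpha>" and C: "0 < C" and n0: "1 \<le> n0"
    and lim: "\<And>s. s > 0 \<Longrightarrow> (\<lambda>n. real n * measure \<mu> {s * a n<..}) \<longlonglongrightarrow> p * s powr (-\<alpha>)"
    and dom: "\<And>n s. n \<ge> n0 \<Longrightarrow> s > 0 \<Longrightarrow>
       real n * measure \<mu> {s * a n<..} \<le> C * max (s powr (-\<alpha>-\<delta>)) (s powr (-\<alpha>+\<delta>))"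
begin

text \<open>The quantile function in the variable \<open>y = n * (1 - \<omega>)\<close>, in units of
  \<open>a n\<close>, so that Lebesgue measure in \<open>y\<close> is \<open>n\<close> times the
  probability. The value 0 outside \<open>(0, n)\<close> lets kernels that vanish at 0 ignore the
  rest of the half-line.\<close>

definition q :: "nat \<Rightarrow> real \<Rightarrow> real" where
  "q n y = (if 0 < y \<and> y < real n then \<mu>.I (1 - y / real n) / a n else 0)"

lemma I_nonneg:
  assumes "\<omega> \<in> {0<..<1}" shows "0 \<le> \<mu>.I \<omega>"
proof (rule ccontr)
  assume "\<not> 0 \<le> \<mu>.I \<omega>"
  then have "\<omega> \<le> cdf \<mu> (\<mu>.I \<omega>)" using \<mu>.pseudoinverse[of \<omega> "\<mu>.I \<omega>"] assms by auto
  also have "cdf \<mu> (\<mu>.I \<omega>) = 0"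
  proof -
    have "AE x in \<mu>. x \<notin> {..\<mu>.I \<omega>}" using nonneg \<open>\<not> 0 \<le> \<mu>.I \<omega>\<close> by (auto elim!: eventually_mono)
    then show ?thesis by (simp add: cdf_def \<mu>.prob_eq_0)
  qed
  finally show False using assms by auto
qed

lemma q_nonneg: "n \<ge> 1 \<Longrightarrow> 0 \<le> q n y"
  using I_nonneg[of "1 - y / real n"] a_pos[of n] by (auto simp: q_def divide_simps)

text \<open>The Galois connection between quantile and distribution function, read for upper tails.
  For \<open>y \<ge> n\<close> both sides hold: the quantile is 0 there and the scaled tail is at
  most \<open>n\<close>.\<close>

lemma q_le_iff:
  assumes "n \<ge> 1" "0 < y" "0 < s"
  shows "q n y \<le> s \<longleftrightarrow> real n * measure \<mu> {s * a n<..} \<le> y"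
proof (cases "y < real n")
  case True
  have 1: "1 - y / real n \<in> {0<..<1}" using assms True by (auto simp: divide_simps)
  have "q n y \<le> s \<longleftrightarrow> \<mu>.I (1 - y / real n) \<le> s * a n"
    using True assms a_pos[of n] by (simp add: q_def divide_simps)
  also have "\<dots> \<longleftrightarrow> 1 - y / real n \<le> cdf \<mu> (s * a n)"
    using \<mu>.pseudoinverse[of "1 - y / real n" "s * a n"] 1 by simp
  also have "cdf \<mu> (s * a n) = 1 - measure \<mu> {s * a n<..}"
    using \<mu>.prob_compl[of "{s * a n<..}"] by (simp add: cdf_def Compl_eq_Diff_UNIV[symmetric] not_less atMost_def Compl_eq greaterThan_def)
  finally show ?thesis using assms by (simp add: divide_simps algebra_simps)
next
  case False
  have "real n * measure \<mu> {s * a n<..} \<le> real n * 1" by (intro mult_left_mono) auto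
  then have "real n * measure \<mu> {s * a n<..} \<le> y" using False by linarith
  then show ?thesis using False assms by (simp add: q_def)
qed

text \<open>By \<open>q_le_iff\<close>, the position of the tail limit
  \<open>p * s powr (-\<alpha>)\<close> relative to \<open>y\<close> decides on which side of
  \<open>s\<close> the quantile eventually lies, so the limit is the \<open>s\<close> at which the
  two agree. Testing at the midpoint of \<open>b\<close> and the limit preserves strict
  inequalities. A vanishing weight \<open>p\<close> correctly gives the limit 0.\<close>

lemma q_tendsto:
  assumes y: "0 < y"
  shows "(\<lambda>n. q n y) \<longlonglongrightarrow> (p / y) powr (1 / \<alpha>)"
proof (rule order_tendstoI)
  let ?L = "(p / y) powr (1 / \<alpha>)"
  have \<alpha>: "\<alpha> > 0" using \<delta> by simp
  fix b
  { assume b: "b < ?L"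
    show "\<forall>\<^sub>F n in sequentially. b < q n y"
    proof (cases "b < 0")
      case True
      show ?thesis using eventually_ge_at_top[of 1]
        by (rule eventually_mono) (rule less_le_trans[OF True q_nonneg])
    next
      case False
      define s where "s = (b + ?L) / 2"
      have s: "0 < s" "b < s" "s < ?L" using b False by (auto simp: s_def)
      have "s powr \<alpha> < ?L powr \<alpha>" using s \<alpha> by (intro powr_less_mono2) auto
      also have "?L powr \<alpha> = p / y" using p y \<alpha> by (simp add: powr_powr)
      finally have "y < p * s powr (-\<alpha>)" using y s by (simp add: powr_minus divide_simps mult.commute)
      then have "\<forall>\<^sub>F n in sequentially. y < real n * measure \<mu> {s * a n<..}"
        by (rule order_tendstoD(1)[OF lim[OF s(1)]])
      then show ?thesis using eventually_ge_at_top[of 1]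
        by eventually_elim (use q_le_iff[OF _ y s(1)] s(2) in \<open>smt (verit)\<close>)
    qed }
  { assume b: "?L < b"
    define s where "s = (b + ?L) / 2"
    have "0 \<le> ?L" by simp
    then have "0 < b + ?L" using b by linarith
    then have s: "0 < s" "s < b" "?L < s" using b by (auto simp: s_def)
    have "p / y = ?L powr \<alpha>" using p y \<alpha> by (simp add: powr_powr)
    also have "?L powr \<alpha> < s powr \<alpha>" using s \<alpha> by (intro powr_less_mono2) auto
    finally have "p * s powr (-\<alpha>) < y" using y s by (simp add: powr_minus divide_simps mult.commute)
    then have "\<forall>\<^sub>F n in sequentially. real n * measure \<mu> {s * a n<..} < y"
      by (rule order_tendstoD(2)[OF lim[OF s(1)]])
    then show "\<forall>\<^sub>F n in sequentially. q n y < b" using eventually_ge_at_top[of 1]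
      by eventually_elim (use q_le_iff[OF _ y s(1)] s(2) in \<open>smt (verit)\<close>) }
qed

text \<open>At this level both Potter powers are at most \<open>y / C\<close>, so the scaled tail is
  at most \<open>y\<close> and \<open>q_le_iff\<close> applies.\<close>

lemma q_le_bound:
  assumes "n \<ge> n0" "0 < y"
  shows "q n y \<le> quantile_bound C (\<alpha> - \<delta>) (\<alpha> + \<delta>) y"
proof -
  let ?s = "quantile_bound C (\<alpha> - \<delta>) (\<alpha> + \<delta>) y"
  have s: "0 < ?s" using C assms by (simp add: quantile_bound_def less_max_iff_disj)
  have "?s powr (-\<alpha>-\<delta>) \<le> ((C / y) powr (1 / (\<alpha> + \<delta>))) powr (-\<alpha>-\<delta>)"
    using C assms \<delta> by (intro powr_mono2') (auto simp: quantile_bound_def)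
  also have "\<dots> = (C / y) powr ((1 / (\<alpha> + \<delta>)) * (-\<alpha>-\<delta>))" by (rule powr_powr)
  also have "(1 / (\<alpha> + \<delta>)) * (-\<alpha>-\<delta>) = -1" using \<delta> by (simp add: divide_simps)
  finally have 1: "?s powr (-\<alpha>-\<delta>) \<le> y / C" using C assms by (simp add: powr_minus)
  have "?s powr (-\<alpha>+\<delta>) \<le> ((C / y) powr (1 / (\<alpha> - \<delta>))) powr (-\<alpha>+\<delta>)"
    using C assms \<delta> by (intro powr_mono2') (auto simp: quantile_bound_def)
  also have "\<dots> = (C / y) powr ((1 / (\<alpha> - \<delta>)) * (-\<alpha>+\<delta>))" by (rule powr_powr)
  also have "(1 / (\<alpha> - \<delta>)) * (-\<alpha>+\<delta>) = -1" using \<delta> by (simp add: divide_simps)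
  finally have 2: "?s powr (-\<alpha>+\<delta>) \<le> y / C" using C assms by (simp add: powr_minus)
  have "real n * measure \<mu> {?s * a n<..} \<le> C * max (?s powr (-\<alpha>-\<delta>)) (?s powr (-\<alpha>+\<delta>))"
    using assms(1) s by (rule dom)
  also have "\<dots> \<le> C * (y / C)" using 1 2 C by (intro mult_left_mono) auto
  finally show ?thesis using q_le_iff[of n y ?s] assms n0 s C by simp
qed

lemma measurable_q[measurable]: "q n \<in> borel_measurable borel"
proof -
  have "(\<lambda>\<omega>. indicat_real {0<..<1} \<omega> *\<^sub>R \<mu>.I \<omega>) \<in> borel_measurable borel"
    using \<mu>.measurable_CI by (subst borel_measurable_restrict_space_iff[symmetric]) auto
  then have "(\<lambda>y. (indicat_real {0<..<1} (1 - y / real n) *\<^sub>R \<mu>.I (1 - y / real n)) / a n) \<in> borel_measurable borel"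
    by measurable
  also have "(\<lambda>y. (indicat_real {0<..<1} (1 - y / real n) *\<^sub>R \<mu>.I (1 - y / real n)) / a n) = q n"
    by (cases "n = 0") (auto simp: q_def fun_eq_iff indicator_def divide_simps)
  finally show ?thesis .
qed

text \<open>The affine substitution \<open>\<omega> = 1 - y / n\<close> has Jacobian
  \<open>1 / n\<close>, which the factor \<open>n\<close> cancels, and \<open>k 0 = 0\<close>
  removes \<open>y \<ge> n\<close>. The domain of integration no longer depends on \<open>n\<close>,
  as dominated convergence requires.\<close>

lemma expectation_eq_q:
  fixes k :: "real \<Rightarrow> complex"
  assumes n: "n \<ge> 1" and k[measurable]: "k \<in> borel_measurable borel" and k0: "k 0 = 0"
  shows "real n * (\<integral>x. k (u * (x / a n)) \<partial>\<mu>) = (LINT y:{0<..}|lborel. k (u * q n y))"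
proof -
  have [measurable]: "\<mu>.I \<in> borel_measurable (restrict_space lborel {0<..<1})"
    using \<mu>.measurable_CI
    by (subst measurable_cong_sets[OF sets_restrict_space_cong[OF sets_lborel] refl])
  have "(\<integral>x. k (u * (x / a n)) \<partial>\<mu>)
      = (\<integral>x. k (u * (x / a n)) \<partial>distr (restrict_space lborel {0<..<1::real}) borel \<mu>.I)"
    by (simp add: \<mu>.distr_I_eq_M)
  also have "\<dots> = (\<integral>\<omega>. k (u * (\<mu>.I \<omega> / a n)) \<partial>restrict_space lborel {0<..<1::real})"
    by (rule integral_distr) measurable
  also have "\<dots> = (\<integral>\<omega>. indicat_real {0<..<1} \<omega> *\<^sub>R k (u * (\<mu>.I \<omega> / a n)) \<partial>lborel)"
    by (rule integral_restrict_space) simp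
  also have "\<dots> = \<bar>- 1 / real n\<bar> *\<^sub>R (\<integral>y. indicat_real {0<..<1} (1 + (- 1 / real n) * y) *\<^sub>R
        k (u * (\<mu>.I (1 + (- 1 / real n) * y) / a n)) \<partial>lborel)"
    by (rule lborel_integral_real_affine) (use n in simp)
  also have "(\<integral>y. indicat_real {0<..<1} (1 + (- 1 / real n) * y) *\<^sub>R
        k (u * (\<mu>.I (1 + (- 1 / real n) * y) / a n)) \<partial>lborel) =
      (\<integral>y. indicat_real {0<..} y *\<^sub>R k (u * q n y) \<partial>lborel)"
    by (rule Bochner_Integration.integral_cong)
       (use n k0 in \<open>auto simp: q_def indicator_def divide_simps\<close>)
  finally show ?thesis using n by (simp add: set_lebesgue_integral_def scaleR_conv_of_real)
qed

context
  fixes k :: "real \<Rightarrow> complex" and K a' b' :: real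
  assumes k_cont: "continuous_on UNIV k"
    and k_bound: "\<And>v. v \<ge> 0 \<Longrightarrow> norm (k v) \<le> K * min (v powr a') (v powr b')"
    and b': "0 < b'" "b' < \<alpha> - \<delta>" and a': "\<alpha> + \<delta> < a'"
begin

lemma K_nonneg: "0 \<le> K"
  using order_trans[OF norm_ge_zero k_bound[of 1]] by simp

lemma k_0: "k 0 = 0"
  using k_bound[of 0] by simp

lemma k_measurable[measurable]: "k \<in> borel_measurable borel"
  using k_cont by (rule borel_measurable_continuous_onI)

text \<open>Powers of a product split, so the frequency \<open>u\<close> separates from the quantile
  and one integrable function of \<open>y\<close> serves all frequencies.\<close>

lemma k_scaled_bound:
  assumes "0 \<le> u" "0 \<le> v" "v \<le> w"
  shows "norm (k (u * v)) \<le> K * max (u powr a') (u powr b') * min (w powr a') (w powr b')"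
proof -
  have "norm (k (u * v)) \<le> K * min ((u * v) powr a') ((u * v) powr b')"
    using assms by (intro k_bound) auto
  also have "min ((u * v) powr a') ((u * v) powr b') \<le> max (u powr a') (u powr b') * min (v powr a') (v powr b')"
  proof -
    have "(u * v) powr a' \<le> max (u powr a') (u powr b') * v powr a'"
      "(u * v) powr b' \<le> max (u powr a') (u powr b') * v powr b'"
      using assms by (auto simp: powr_mult intro!: mult_right_mono)
    then show ?thesis by (auto simp: min_def)
  qed
  also have "\<dots> \<le> max (u powr a') (u powr b') * min (w powr a') (w powr b')"
  proof -
    have "v powr a' \<le> w powr a'" "v powr b' \<le> w powr b'"
      using assms a' b' \<delta> by (auto intro: powr_mono2)
    then show ?thesis by (intro mult_left_mono) (auto simp: le_max_iff_disj)
  qed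
  finally show ?thesis using K_nonneg by (simp add: mult_left_mono mult.assoc)
qed

abbreviation W :: "real \<Rightarrow> real" where
  "W y \<equiv> min (quantile_bound C (\<alpha> - \<delta>) (\<alpha> + \<delta>) y powr a') (quantile_bound C (\<alpha> - \<delta>) (\<alpha> + \<delta>) y powr b')"

lemma W_integrable: "set_integrable lborel {0<..} W"
  using set_integrable_quantile_bound[of C "\<alpha> - \<delta>" "\<alpha> + \<delta>" b' a'] C \<delta> a' b' by auto

lemma UW_integrable: "integrable lborel (\<lambda>y. indicat_real {0<..} y *\<^sub>R (c * W y))"
proof -
  have "(\<lambda>y. indicat_real {0<..} y *\<^sub>R (c * W y)) = (\<lambda>y. c * (indicat_real {0<..} y *\<^sub>R W y))"
    by auto
  then show ?thesis using W_integrable unfolding set_integrable_def by simp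
qed

text \<open>After integration over \<open>y\<close> all that remains of \<open>u\<close> is a
  maximum of two powers. This is the form in which the bound is later integrated over a random
  frequency.\<close>

lemma expectation_bound:
  assumes "n \<ge> n0" "0 \<le> u"
  shows "norm (real n * (\<integral>x. k (u * (x / a n)) \<partial>\<mu>))
       \<le> K * (LINT y:{0<..}|lborel. W y) * max (u powr a') (u powr b')"
proof -
  let ?U = "K * max (u powr a') (u powr b')"
  have "norm (real n * (\<integral>x. k (u * (x / a n)) \<partial>\<mu>)) = norm (LINT y:{0<..}|lborel. k (u * q n y))"
    using expectation_eq_q[of n k u] assms n0 k_0 by simp
  also have "\<dots> \<le> (LINT y:{0<..}|lborel. ?U * W y)"
    unfolding set_lebesgue_integral_def
  proof (rule Bochner_Integration.integral_norm_bound_integral)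
    show b: "norm (indicat_real {0<..} y *\<^sub>R k (u * q n y)) \<le> indicat_real {0<..} y *\<^sub>R (?U * W y)" for y
      using assms n0 q_nonneg q_le_bound k_scaled_bound by (auto simp: indicator_def)
    show "integrable lborel (\<lambda>y. indicat_real {0<..} y *\<^sub>R k (u * q n y))"
      by (rule Bochner_Integration.integrable_bound[OF UW_integrable]) (use order_trans[OF b abs_ge_self] in auto)
  qed (rule UW_integrable)
  also have "\<dots> = ?U * (LINT y:{0<..}|lborel. W y)" by simp
  finally show ?thesis by (simp add: mult_ac)
qed

text \<open>Pointwise convergence comes from \<open>q_tendsto\<close>, domination from
  \<open>W\<close>. The scaling of Lebesgue measure then extracts \<open>p\<close> and
  \<open>u\<close>, so that only one constant per kernel remains to be computed. Indices are shifted
  by \<open>n0\<close>, from where the quantile bound holds.\<close>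

lemma expectation_tendsto:
  assumes "0 \<le> u"
  shows "(\<lambda>n. real n * (\<integral>x. k (u * (x / a n)) \<partial>\<mu>)) \<longlonglongrightarrow>
     of_real (p * u powr \<alpha>) * (LINT y:{0<..}|lborel. k (y powr (-1 / \<alpha>)))"
proof -
  let ?U = "K * max (u powr a') (u powr b')"
  have \<alpha>: "\<alpha> > 0" using \<delta> by simp
  have "(\<lambda>n. LINT y:{0<..}|lborel. k (u * q (n + n0) y)) \<longlonglongrightarrow>
      (LINT y:{0<..}|lborel. k (u * (p / y) powr (1 / \<alpha>)))"
    unfolding set_lebesgue_integral_def
  proof (rule integral_dominated_convergence)
    show "integrable lborel (\<lambda>y. indicat_real {0<..} y *\<^sub>R (?U * W y))" by (rule UW_integrable)
    show "AE y in lborel. (\<lambda>n. indicat_real {0<..} y *\<^sub>R k (u * q (n + n0) y)) \<longlonglongrightarrow>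
        indicat_real {0<..} y *\<^sub>R k (u * (p / y) powr (1 / \<alpha>))"
    proof (intro AE_I2)
      fix y :: real
      show "(\<lambda>n. indicat_real {0<..} y *\<^sub>R k (u * q (n + n0) y)) \<longlonglongrightarrow>
        indicat_real {0<..} y *\<^sub>R k (u * (p / y) powr (1 / \<alpha>))"
      proof (cases "0 < y")
        case True
        have "(\<lambda>n. k (u * q (n + n0) y)) \<longlonglongrightarrow> k (u * (p / y) powr (1 / \<alpha>))"
          by (intro isCont_tendsto_compose[of _ k] tendsto_mult tendsto_const
                LIMSEQ_ignore_initial_segment q_tendsto True)
             (use k_cont in \<open>auto simp: continuous_on_eq_continuous_at\<close>)
        then show ?thesis by (intro tendsto_scaleR tendsto_const)
      qed simp
    qed
  qed (use assms n0 q_nonneg q_le_bound k_scaled_bound in \<open>auto simp: indicator_def\<close>)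
  moreover have "real (n + n0) * (\<integral>x. k (u * (x / a (n + n0))) \<partial>\<mu>) = (LINT y:{0<..}|lborel. k (u * q (n + n0) y))" for n
    by (rule expectation_eq_q) (use n0 k_0 in auto)
  ultimately have "(\<lambda>n. real (n + n0) * (\<integral>x. k (u * (x / a (n + n0))) \<partial>\<mu>)) \<longlonglongrightarrow>
      (LINT y:{0<..}|lborel. k (u * (p / y) powr (1 / \<alpha>)))" by simp
  then have 1: "(\<lambda>n. real n * (\<integral>x. k (u * (x / a n)) \<partial>\<mu>)) \<longlonglongrightarrow>
      (LINT y:{0<..}|lborel. k (u * (p / y) powr (1 / \<alpha>)))"
    by (rule LIMSEQ_offset)
  have 2: "(LINT y:{0<..}|lborel. k (u * (p / y) powr (1 / \<alpha>))) =
      of_real (p * u powr \<alpha>) * (LINT y:{0<..}|lborel. k (y powr (-1 / \<alpha>)))"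
  proof (cases "p = 0 \<or> u = 0")
    case True
    then show ?thesis using k_0 by (auto simp: set_lebesgue_integral_def)
  next
    case False
    then have pu: "p > 0" "u > 0" using p assms by auto
    \<comment> \<open>With this scaling factor,
      \<open>u * (p / (?c * y)) powr (1 / \<alpha>)\<close> collapses to
      \<open>y powr (-1 / \<alpha>)\<close>.\<close>
    let ?c = "p * u powr \<alpha>"
    have c: "?c > 0" using pu by simp
    have "(LINT y:{0<..}|lborel. k (u * (p / y) powr (1 / \<alpha>))) =
       \<bar>?c\<bar> *\<^sub>R (\<integral>y. indicat_real {0<..} (0 + ?c * y) *\<^sub>R k (u * (p / (0 + ?c * y)) powr (1 / \<alpha>)) \<partial>lborel)"
      unfolding set_lebesgue_integral_def by (rule lborel_integral_real_affine) (use c in auto)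
    also have "(\<integral>y. indicat_real {0<..} (0 + ?c * y) *\<^sub>R k (u * (p / (0 + ?c * y)) powr (1 / \<alpha>)) \<partial>lborel) =
       (LINT y:{0<..}|lborel. k (y powr (-1 / \<alpha>)))"
      unfolding set_lebesgue_integral_def
    proof (rule Bochner_Integration.integral_cong)
      fix y :: real
      have "u * (p / (?c * y)) powr (1 / \<alpha>) = y powr (-1 / \<alpha>)" if "y > 0"
      proof -
        have "(p / (?c * y)) = (1 / u powr \<alpha>) * (1 / y)" using pu by simp
        then have "(p / (?c * y)) powr (1 / \<alpha>) = (1 / u powr \<alpha>) powr (1 / \<alpha>) * (1 / y) powr (1 / \<alpha>)"
          using that by (simp only: powr_mult)
        also have "(1 / u powr \<alpha>) powr (1 / \<alpha>) = 1 / u"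
          using pu \<alpha> by (simp add: powr_divide powr_powr)
        also have "(1 / y) powr (1 / \<alpha>) = y powr (-1 / \<alpha>)"
          using that by (simp add: powr_divide powr_minus_divide)
        finally show ?thesis using pu by simp
      qed
      moreover have "0 < ?c * y \<longleftrightarrow> 0 < y" using c by (metis zero_less_mult_pos mult_pos_pos)
      ultimately show "indicat_real {0<..} (0 + ?c * y) *\<^sub>R k (u * (p / (0 + ?c * y)) powr (1 / \<alpha>)) =
         indicat_real {0<..} y *\<^sub>R k (y powr (-1 / \<alpha>))"
        by (cases "0 < y") (simp_all only: indicator_def greaterThan_iff add_0 if_True if_False simp_thms of_bool_def scaleR_zero_left scaleR_one)
    qed simp
    finally show ?thesis using c by (simp add: scaleR_conv_of_real)
  qed
  show ?thesis using 1 unfolding 2 .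
qed

end
end

section \<open>Integrals of stable kernels\<close>

text \<open>Up to 1 the higher integer power is the smaller one, beyond 1 the lower, and real
  exponents in between are bracketed accordingly. This leads from Taylor bounds to the real
  exponents around \<alpha>.\<close>

lemma min_power_le_min_powr:
  fixes v a b :: real
  assumes "0 \<le> v" "real i \<le> b" "b \<le> a" "a \<le> real m" "0 < b" "0 < m"
  shows "min (v ^ m) (v ^ i) \<le> min (v powr a) (v powr b)"
proof (cases "v = 0 \<or> v \<ge> 1")
  case True
  then show ?thesis
  proof
    assume v: "v \<ge> 1"
    then have "v powr real i \<le> v powr a" "v powr real i \<le> v powr b" using assms by (auto intro: powr_mono)
    then show ?thesis using v by (simp add: powr_realpow min_le_iff_disj)
  qed (use assms in \<open>simp add: min_le_iff_disj zero_power\<close>)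
next
  case False
  then have v: "0 < v" "v < 1" using assms by auto
  then have "v powr real m \<le> v powr a" "v powr real m \<le> v powr b" using assms by (auto intro: powr_mono')
  then show ?thesis using v by (simp add: powr_realpow min_le_iff_disj)
qed

text \<open>The negative of the Taylor remainder of \<open>exp (- w)\<close> after the term of order
  \<open>j\<close>. In the right half-plane it has order \<open>j + 1\<close> at zero and
  \<open>j\<close> at infinity, which makes it integrable along \<open>y powr (-1/\<alpha>)\<close>
  for \<alpha> strictly between \<open>j\<close> and \<open>j + 1\<close>.\<close>

definition exp_remainder :: "nat \<Rightarrow> complex \<Rightarrow> complex" where
  "exp_remainder j w = 1 - exp (- w) - (if j = 0 then 0 else w)"

lemma exp_remainder_deriv:
  "(exp_remainder j has_field_derivative (exp (- w) - (if j = 0 then 0 else 1))) (at w within S)"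
  unfolding exp_remainder_def by (auto intro!: derivative_eq_intros)

text \<open>Mean value inequality on the convex half-plane \<open>Re z \<ge> 0\<close>, where the
  derivative \<open>exp (- z)\<close> has norm at most 1.\<close>

lemma norm_exp_remainder_0:
  assumes "0 \<le> Re w"
  shows "norm (exp_remainder 0 w) \<le> norm w" "norm (exp_remainder 0 w) \<le> 2"
proof -
  have "norm (exp_remainder 0 0 - exp_remainder 0 w) \<le> 1 * norm (0 - w)"
    by (rule field_differentiable_bound[where S = "{z. Re z \<ge> 0}", OF _ exp_remainder_deriv])
       (use assms in \<open>auto simp: convex_halfspace_Re_ge\<close>)
  then show "norm (exp_remainder 0 w) \<le> norm w" by (simp add: exp_remainder_def norm_minus_commute)
  have "norm (exp (- w)) \<le> 1" using assms by simp
  then show "norm (exp_remainder 0 w) \<le> 2"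
    using norm_triangle_ineq4[of 1 "exp (-w)"] unfolding exp_remainder_def by (simp del: norm_exp_eq_Re)
qed

text \<open>The derivative \<open>exp (- z) - 1\<close> has norm at most \<open>norm z\<close> by
  the case of order 0. Intersecting the half-plane with a ball makes this at most
  \<open>norm w\<close>, and the increment contributes the second factor
  \<open>norm w\<close>.\<close>

lemma norm_exp_remainder_1:
  assumes "0 \<le> Re w"
  shows "norm (exp_remainder 1 w) \<le> (norm w)\<^sup>2" "norm (exp_remainder 1 w) \<le> 2 * norm w"
proof -
  have d: "norm (exp (- z) - 1) \<le> norm z" if "0 \<le> Re z" for z
    using norm_exp_remainder_0(1)[OF that] by (simp add: exp_remainder_def norm_minus_commute)
  have "norm (exp_remainder 1 0 - exp_remainder 1 w) \<le> norm w * norm (0 - w)"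
    by (rule field_differentiable_bound[where S = "{z. Re z \<ge> 0} \<inter> cball 0 (norm w)", OF _ exp_remainder_deriv])
       (use assms order_trans[OF d] in \<open>auto simp: convex_halfspace_Re_ge intro!: convex_Int\<close>)
  then show "norm (exp_remainder 1 w) \<le> (norm w)\<^sup>2" by (simp add: exp_remainder_def power2_eq_square norm_minus_commute)
  show "norm (exp_remainder 1 w) \<le> 2 * norm w"
    using norm_triangle_ineq4[of "exp_remainder 0 w" w] norm_exp_remainder_0(1)[OF assms]
    by (simp add: exp_remainder_def)
qed

lemma norm_exp_remainder:
  assumes "0 \<le> Re w" "j \<le> 1"
  shows "norm (exp_remainder j w) \<le> 2 * min (norm w ^ (j + 1)) (norm w ^ j)"
proof (cases "j = 0")
  case True
  then show ?thesis using norm_exp_remainder_0[OF assms(1)] by (auto simp: min_def intro: order_trans[of _ "norm w"])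
next
  case False
  then have "j = 1" using assms by simp
  then show ?thesis using norm_exp_remainder_1[OF assms(1)] by (auto simp: min_def power2_eq_square intro: order_trans[of _ "norm w * norm w"])
qed

section \<open>Rotation of the ray of integration\<close>

locale rotation =
  fixes \<alpha> :: real and j :: nat
  assumes \<alpha>: "real j < \<alpha>" "\<alpha> < real j + 1" and j: "j \<le> 1"
begin

lemma norm_integrand_le:
  assumes "y > 0" "\<theta> \<in> {-pi/2..pi/2}"
  shows "norm (exp_remainder j (cis \<theta> * of_real (y powr (-1/\<alpha>))))
     \<le> 2 * min (quantile_bound 1 \<alpha> \<alpha> y powr real (j + 1)) (quantile_bound 1 \<alpha> \<alpha> y powr real j)"
proof -
  have q: "quantile_bound 1 \<alpha> \<alpha> y = y powr (-1/\<alpha>)"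
    using assms \<alpha> by (simp add: quantile_bound_def powr_divide powr_minus_divide)
  have "0 \<le> cos \<theta>" using assms by (intro cos_ge_zero) auto
  then have "0 \<le> Re (cis \<theta> * of_real (y powr (-1/\<alpha>)))" by simp
  from norm_exp_remainder[OF this j] show ?thesis unfolding q
    using assms by (simp add: norm_mult powr_realpow[symmetric] powr_add)
qed

lemma integrable:
  assumes "\<theta> \<in> {-pi/2..pi/2}"
  shows "set_integrable lborel {0<..} (\<lambda>y. exp_remainder j (cis \<theta> * of_real (y powr (-1/\<alpha>))))"
proof (rule set_integrable_bound)
  show "set_integrable lborel {0<..} (\<lambda>y. 2 *
      min (quantile_bound 1 \<alpha> \<alpha> y powr real (j + 1)) (quantile_bound 1 \<alpha> \<alpha> y powr real j))"
    by (intro set_integrable_mult_right set_integrable_quantile_bound) (use \<alpha> in auto)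
  show "set_borel_measurable lborel {0<..} (\<lambda>y. exp_remainder j (cis \<theta> * of_real (y powr (-1/\<alpha>))))"
    unfolding set_borel_measurable_def exp_remainder_def by measurable
  show "AE y in lborel. y \<in> {0<..} \<longrightarrow> norm (exp_remainder j (cis \<theta> * of_real (y powr (-1/\<alpha>))))
    \<le> norm (2 * min (quantile_bound 1 \<alpha> \<alpha> y powr real (j + 1)) (quantile_bound 1 \<alpha> \<alpha> y powr real j))"
    using norm_integrand_le[OF _ assms] by (intro AE_I2) auto
qed

lemma cis_has_vector_derivative: "(cis has_vector_derivative \<i> * cis x) (at x within S)"
  unfolding has_vector_derivative_def by (rule has_derivative_cis) simp

abbreviation trunc :: "real \<Rightarrow> real \<Rightarrow> real \<Rightarrow> complex" where
  "trunc \<epsilon> R \<theta> \<equiv> integral {\<epsilon>..R} (\<lambda>y. cis (-\<alpha>*\<theta>) * exp_remainder j (cis \<theta> * of_real (y powr (-1/\<alpha>))))"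

text \<open>The point \<open>w = cis \<theta> * y powr (-1/\<alpha>)\<close> is multiplied by
  \<open>\<i>\<close> under differentiation in \<theta> and by \<open>- 1 / (\<alpha> * y)\<close>
  under differentiation in \<open>y\<close>. Hence the \<theta>-derivative of the compensated
  integrand is a multiple of the \<open>y\<close>-derivative of
  \<open>y * exp_remainder j w\<close>, and only boundary terms survive. This takes the place of
  Cauchy's theorem.\<close>

lemma trunc_deriv:
  assumes \<epsilon>: "0 < \<epsilon>" "\<epsilon> \<le> R" and \<theta>: "\<theta> \<in> {-pi/2..pi/2}"
  shows "(trunc \<epsilon> R has_vector_derivative
     - \<i> * \<alpha> * cis (-\<alpha>*\<theta>) * (R * exp_remainder j (cis \<theta> * of_real (R powr (-1/\<alpha>)))
        - \<epsilon> * exp_remainder j (cis \<theta> * of_real (\<epsilon> powr (-1/\<alpha>))))) (at \<theta> within {-pi/2..pi/2})"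
proof -
  define d where "d = (\<lambda>w. exp (- w) - (if j = 0 then 0 else 1 :: complex))"
  let ?w = "\<lambda>\<theta> y. cis \<theta> * complex_of_real (y powr (-1/\<alpha>))"
  let ?f = "\<lambda>\<theta> y. cis (-\<alpha>*\<theta>) * exp_remainder j (?w \<theta> y)"
  let ?g = "\<lambda>\<theta> y. - \<i> * \<alpha> * cis (-\<alpha>*\<theta>) * (exp_remainder j (?w \<theta> y) - d (?w \<theta> y) * ?w \<theta> y / \<alpha>)"
  have a0: "\<alpha> > 0" using \<alpha> by linarith
  have dd: "(exp_remainder j has_field_derivative d w) (at w within S)" for w S
    unfolding d_def by (rule exp_remainder_deriv)
  have 1: "((\<lambda>\<theta>. integral (cbox \<epsilon> R) (?f \<theta>)) has_vector_derivative integral (cbox \<epsilon> R) (?g \<theta>))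
      (at \<theta> within {-pi/2..pi/2})"
  proof (rule leibniz_rule_vector_derivative)
    fix x y assume "x \<in> {-pi/2..pi/2}" "y \<in> cbox \<epsilon> R"
    have c: "(cis has_vector_derivative \<i> * cis x) (at x within {-pi/2..pi/2})"
      by (rule cis_has_vector_derivative)
    have "((\<lambda>\<theta>. ?w \<theta> y) has_vector_derivative \<i> * cis x * complex_of_real (y powr (-1/\<alpha>))) (at x within {-pi/2..pi/2})"
      by (intro has_vector_derivative_mult_left c)
    from field_vector_diff_chain_within[OF this dd]
    have "((\<lambda>\<theta>. exp_remainder j (?w \<theta> y)) has_vector_derivative
        \<i> * cis x * complex_of_real (y powr (-1/\<alpha>)) * d (?w x y)) (at x within {-pi/2..pi/2})"
      by (simp add: o_def)
    moreover have "((\<lambda>\<theta>. cis (-\<alpha>*\<theta>)) has_vector_derivative (- \<alpha>) *\<^sub>R (\<i> * cis (-\<alpha> * x))) (at x within {-pi/2..pi/2})"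
    proof -
      have "((\<lambda>\<theta>. -\<alpha>*\<theta>) has_vector_derivative (-\<alpha>)) (at x within {-pi/2..pi/2})"
        by (auto intro!: derivative_eq_intros)
      from vector_diff_chain_within[OF this cis_has_vector_derivative]
      show ?thesis by (simp add: o_def)
    qed
    ultimately have "((\<lambda>\<theta>. ?f \<theta> y) has_vector_derivative
        cis (-\<alpha>*x) * (\<i> * cis x * complex_of_real (y powr (-1/\<alpha>)) * d (?w x y)) +
        (- \<alpha>) *\<^sub>R (\<i> * cis (-\<alpha> * x)) * exp_remainder j (?w x y)) (at x within {-pi/2..pi/2})"
      by (rule has_vector_derivative_mult[rotated])
    also have "cis (-\<alpha>*x) * (\<i> * cis x * complex_of_real (y powr (-1/\<alpha>)) * d (?w x y)) +
        (- \<alpha>) *\<^sub>R (\<i> * cis (-\<alpha> * x)) * exp_remainder j (?w x y) = ?g x y"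
      using a0 by (simp add: scaleR_conv_of_real field_simps)
    finally show "((\<lambda>\<theta>. ?f \<theta> y) has_vector_derivative ?g x y) (at x within {-pi/2..pi/2})" .
  next
    show "?f x integrable_on cbox \<epsilon> R" for x
      unfolding exp_remainder_def using \<epsilon>
      by (intro integrable_continuous, cases "j = 0") (auto intro!: continuous_intros)
  next
    show "continuous_on ({-pi/2..pi/2} \<times> cbox \<epsilon> R) (\<lambda>(x, y). ?g x y)"
      unfolding exp_remainder_def d_def case_prod_unfold using \<epsilon> a0
      by (auto intro!: continuous_intros continuous_on_cis)
  qed (use \<theta> in auto)
  have "((\<lambda>y. exp_remainder j (?w \<theta> y) - d (?w \<theta> y) * ?w \<theta> y / \<alpha>) has_integral
      R * exp_remainder j (?w \<theta> R) - \<epsilon> * exp_remainder j (?w \<theta> \<epsilon>)) {\<epsilon>..R}"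
  proof (rule fundamental_theorem_of_calculus[OF \<epsilon>(2)])
    fix y assume y: "y \<in> {\<epsilon>..R}"
    have "((\<lambda>y. y powr (-1/\<alpha>)) has_real_derivative (-1/\<alpha>) * y powr (-1/\<alpha> - 1)) (at y within {\<epsilon>..R})"
      using y \<epsilon> a0 by (auto intro!: derivative_eq_intros simp: field_simps)
    then have "((\<lambda>y. ?w \<theta> y) has_vector_derivative cis \<theta> * of_real ((-1/\<alpha>) * y powr (-1/\<alpha> - 1))) (at y within {\<epsilon>..R})"
      by (intro has_vector_derivative_mult_right has_vector_derivative_of_real)
    from field_vector_diff_chain_within[OF this dd]
    have "((\<lambda>y. exp_remainder j (?w \<theta> y)) has_vector_derivative
        cis \<theta> * of_real ((-1/\<alpha>) * y powr (-1/\<alpha> - 1)) * d (?w \<theta> y)) (at y within {\<epsilon>..R})"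
      by (simp add: o_def)
    moreover have "(complex_of_real has_vector_derivative 1) (at y within {\<epsilon>..R})"
      using has_vector_derivative_of_real[OF DERIV_ident] by simp
    ultimately have "((\<lambda>y. complex_of_real y * exp_remainder j (?w \<theta> y)) has_vector_derivative
        of_real y * (cis \<theta> * of_real ((-1/\<alpha>) * y powr (-1/\<alpha> - 1)) * d (?w \<theta> y)) + 1 * exp_remainder j (?w \<theta> y))
        (at y within {\<epsilon>..R})" by (rule has_vector_derivative_mult[rotated])
    moreover have "y powr (-1/\<alpha>) = y * y powr (-1/\<alpha> - 1)"
      using y \<epsilon> powr_mult_base[of y "-1/\<alpha> - 1"] by simp
    ultimately show "((\<lambda>y. complex_of_real y * exp_remainder j (?w \<theta> y)) has_vector_derivative
         exp_remainder j (?w \<theta> y) - d (?w \<theta> y) * ?w \<theta> y / \<alpha>) (at y within {\<epsilon>..R})"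
      by (simp add: mult_ac)
  qed
  from has_integral_mult_right[OF this]
  have "integral {\<epsilon>..R} (?g \<theta>) = - \<i> * \<alpha> * cis (-\<alpha>*\<theta>) *
     (R * exp_remainder j (?w \<theta> R) - \<epsilon> * exp_remainder j (?w \<theta> \<epsilon>))"
    by (rule integral_unique)
  note E = this
  show ?thesis using 1 unfolding box_real(2) E .
qed

text \<open>At \<open>R\<close> the argument of the remainder is small and the estimate of order
  \<open>j + 1\<close> is used, at \<epsilon> it is large and the one of order \<open>j\<close> is
  used. Since \<open>j < \<alpha> < j + 1\<close>, the exponent of \<open>R\<close> is negative and
  that of \<epsilon> positive, so both boundary terms vanish in the limit.\<close>

lemma trunc_diff:
  assumes \<epsilon>: "0 < \<epsilon>" "\<epsilon> \<le> R" and \<theta>: "\<theta> \<in> {-pi/2..pi/2}"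
  shows "norm (trunc \<epsilon> R \<theta> - trunc \<epsilon> R 0) \<le>
     \<alpha> * (2 * R powr (1 - (j + 1) / \<alpha>) + 2 * \<epsilon> powr (1 - j / \<alpha>)) * \<bar>\<theta>\<bar>"
proof -
  have a0: "\<alpha> > 0" using \<alpha> by linarith
  have b: "norm (of_real y * exp_remainder j (cis x * of_real (y powr (-1/\<alpha>)))) \<le> 2 * y powr (1 - (j + 1) / \<alpha>)"
     "norm (of_real y * exp_remainder j (cis x * of_real (y powr (-1/\<alpha>)))) \<le> 2 * y powr (1 - j / \<alpha>)"
    if "x \<in> {-pi/2..pi/2}" "y > 0" for x y
  proof -
    have q: "quantile_bound 1 \<alpha> \<alpha> y = y powr (-1/\<alpha>)"
      using that a0 by (simp add: quantile_bound_def powr_divide powr_minus_divide)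
    have p: "y * (y powr (-1/\<alpha>)) powr t = y powr (1 - t / \<alpha>)" for t
      using that powr_mult_base[of y "-t/\<alpha>"] by (simp add: powr_powr)
    have "norm (of_real y * exp_remainder j (cis x * of_real (y powr (-1/\<alpha>)))) \<le> y * (2 *
      min (quantile_bound 1 \<alpha> \<alpha> y powr real (j + 1)) (quantile_bound 1 \<alpha> \<alpha> y powr real j))"
      using norm_integrand_le[OF that(2,1)] that by (simp add: norm_mult mult_left_mono)
    then have b: "norm (of_real y * exp_remainder j (cis x * of_real (y powr (-1/\<alpha>)))) \<le>
      2 * min (y * quantile_bound 1 \<alpha> \<alpha> y powr real (j + 1)) (y * quantile_bound 1 \<alpha> \<alpha> y powr real j)"
      using that by (simp add: min_mult_distrib_left mult.left_commute)
    show "norm (of_real y * exp_remainder j (cis x * of_real (y powr (-1/\<alpha>)))) \<le> 2 * y powr (1 - (j + 1) / \<alpha>)"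
      using b unfolding q p by simp
    show "norm (of_real y * exp_remainder j (cis x * of_real (y powr (-1/\<alpha>)))) \<le> 2 * y powr (1 - j / \<alpha>)"
      using b unfolding q p by simp
  qed
  have "norm (trunc \<epsilon> R \<theta> - trunc \<epsilon> R 0) \<le>
     \<alpha> * (2 * R powr (1 - (j + 1) / \<alpha>) + 2 * \<epsilon> powr (1 - j / \<alpha>)) * norm (\<theta> - 0)"
  proof (rule differentiable_bound[OF _ trunc_deriv[OF \<epsilon>, unfolded has_vector_derivative_def]], goal_cases)
    case (3 x)
    show ?case
    proof (rule onorm_le)
      fix t :: real
      let ?D = "R * exp_remainder j (cis x * of_real (R powr (-1/\<alpha>)))
        - \<epsilon> * exp_remainder j (cis x * of_real (\<epsilon> powr (-1/\<alpha>)))"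
      have "norm ?D \<le> 2 * R powr (1 - (j + 1) / \<alpha>) + 2 * \<epsilon> powr (1 - j / \<alpha>)"
        using b(1)[OF 3, of R] b(2)[OF 3, of \<epsilon>] \<epsilon> a0
        by (intro order_trans[OF norm_triangle_ineq4] add_mono) auto
      then have "\<alpha> * norm ?D \<le> \<alpha> * (2 * R powr (1 - (j + 1) / \<alpha>) + 2 * \<epsilon> powr (1 - j / \<alpha>))"
        using a0 by (intro mult_left_mono) auto
      moreover have "norm (t *\<^sub>R (- \<i> * \<alpha> * cis (-\<alpha>*x) * ?D)) = \<alpha> * norm ?D * norm t"
        using a0 by (simp add: norm_mult del: of_real_mult)
      ultimately show "norm (t *\<^sub>R (- \<i> * \<alpha> * cis (-\<alpha>*x) * ?D))
        \<le> \<alpha> * (2 * R powr (1 - (j + 1) / \<alpha>) + 2 * \<epsilon> powr (1 - j / \<alpha>)) * norm t"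
        by (simp only:) (rule mult_right_mono, auto)
    qed
  qed (use \<theta> in auto)
  then show ?thesis by simp
qed

lemma trunc_tendsto:
  assumes \<theta>: "\<theta> \<in> {-pi/2..pi/2}"
  shows "(\<lambda>n. trunc (1 / Suc n) (Suc n) \<theta>) \<longlonglongrightarrow>
     cis (-\<alpha>*\<theta>) * (LINT y:{0<..}|lborel. exp_remainder j (cis \<theta> * of_real (y powr (-1/\<alpha>))))"
proof -
  let ?f = "\<lambda>y. cis (-\<alpha>*\<theta>) * exp_remainder j (cis \<theta> * of_real (y powr (-1/\<alpha>)))"
  have i: "set_integrable lborel {0<..} ?f" using integrable[OF \<theta>] by simp
  have e: "trunc (1 / Suc n) (Suc n) \<theta> = (LINT y:{1 / Suc n..Suc n}|lborel. ?f y)" for n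
  proof (rule set_borel_integral_eq_integral(2)[symmetric])
    show "set_integrable lborel {1 / Suc n..Suc n} ?f"
      by (rule set_integrable_subset[OF i]) (auto simp: field_simps intro: less_le_trans[of 0 "1 / Suc n"])
  qed
  have "(\<lambda>n. LINT y:{1 / Suc n..Suc n}|lborel. ?f y) \<longlonglongrightarrow> (LINT y:{0<..}|lborel. ?f y)"
    unfolding set_lebesgue_integral_def
  proof (rule integral_dominated_convergence)
    show "integrable lborel (\<lambda>y. norm (indicat_real {0<..} y *\<^sub>R ?f y))"
      using i unfolding set_integrable_def by (rule integrable_norm)
    show "AE y in lborel. (\<lambda>n. indicat_real {1 / Suc n..Suc n} y *\<^sub>R ?f y) \<longlonglongrightarrow> indicat_real {0<..} y *\<^sub>R ?f y"
    proof (intro AE_I2)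
      fix y :: real
      show "(\<lambda>n. indicat_real {1 / Suc n..Suc n} y *\<^sub>R ?f y) \<longlonglongrightarrow> indicat_real {0<..} y *\<^sub>R ?f y"
      proof (cases "0 < y")
        case True
        have "\<forall>\<^sub>F n in sequentially. 1 / Suc n < y"
          using LIMSEQ_inverse_real_of_nat order_tendstoD(2)[OF _ True] by (simp add: inverse_eq_divide)
        moreover have "\<forall>\<^sub>F n in sequentially. y \<le> Suc n"
        proof -
          obtain N :: nat where "y \<le> N" using real_arch_simple by blast
          show ?thesis using eventually_ge_at_top[of N]
            by (rule eventually_mono) (use \<open>y \<le> N\<close> in linarith)
        qed
        ultimately have "\<forall>\<^sub>F n in sequentially. indicat_real {1 / Suc n..Suc n} y *\<^sub>R ?f y = indicat_real {0<..} y *\<^sub>R ?f y"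
          by eventually_elim (use True in auto)
        then show ?thesis by (rule tendsto_eventually)
      next
        case False
        have "indicat_real {1 / Suc n..Suc n} y = 0" for n
          using False less_le_trans[of 0 "1 / Suc n" y] by (auto simp: indicator_def)
        then show ?thesis using False by simp
      qed
    qed
    show "AE y in lborel. norm (indicat_real {1 / Suc n..Suc n} y *\<^sub>R ?f y) \<le> norm (indicat_real {0<..} y *\<^sub>R ?f y)" for n
    proof (intro AE_I2)
      fix y :: real
      have "0 < y" if "1 / Suc n \<le> y" using that by (rule less_le_trans[rotated]) simp
      then show "norm (indicat_real {1 / Suc n..Suc n} y *\<^sub>R ?f y) \<le> norm (indicat_real {0<..} y *\<^sub>R ?f y)"
        by (auto simp: indicator_def)
    qed
    show "(\<lambda>y. indicat_real {0<..} y *\<^sub>R ?f y) \<in> borel_measurable lborel"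
      using i unfolding set_integrable_def by (rule borel_measurable_integrable)
  qed (auto simp: exp_remainder_def)
  then show ?thesis unfolding e by simp
qed

text \<open>On the windows from \<open>1 / (n + 1)\<close> to \<open>n + 1\<close> the boundary
  terms tend to 0, so the compensated integral at angle \<theta> agrees with the one at angle
  0.\<close>

lemma rotate:
  assumes \<theta>: "\<theta> \<in> {-pi/2..pi/2}"
  shows "(LINT y:{0<..}|lborel. exp_remainder j (cis \<theta> * of_real (y powr (-1/\<alpha>)))) =
    cis (\<alpha> * \<theta>) * (LINT y:{0<..}|lborel. exp_remainder j (of_real (y powr (-1/\<alpha>))))"
proof -
  have a0: "\<alpha> > 0" using \<alpha> by linarith
  have "(\<lambda>n. trunc (1 / Suc n) (Suc n) \<theta> - trunc (1 / Suc n) (Suc n) 0) \<longlonglongrightarrow> 0"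
  proof (rule Lim_null_comparison)
    show "\<forall>\<^sub>F n in sequentially. norm (trunc (1 / Suc n) (Suc n) \<theta> - trunc (1 / Suc n) (Suc n) 0) \<le>
     \<alpha> * (2 * (Suc n) powr (1 - (j + 1) / \<alpha>) + 2 * (1 / Suc n) powr (1 - j / \<alpha>)) * \<bar>\<theta>\<bar>"
      by (intro always_eventually allI trunc_diff \<theta>) (auto simp: field_simps)
    have s: "filterlim (\<lambda>n. real (Suc n)) at_top sequentially"
      using filterlim_real_sequentially by (subst filterlim_sequentially_Suc)
    have 1: "(\<lambda>n. real (Suc n) powr (1 - (j + 1) / \<alpha>)) \<longlonglongrightarrow> 0"
      by (rule tendsto_neg_powr[OF _ s]) (use \<alpha> a0 in \<open>auto simp: field_simps\<close>)
    have "(\<lambda>n. real (Suc n) powr - (1 - j / \<alpha>)) \<longlonglongrightarrow> 0"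
      by (rule tendsto_neg_powr[OF _ s]) (use \<alpha> a0 in \<open>auto simp: field_simps\<close>)
    then have 2: "(\<lambda>n. (1 / real (Suc n)) powr (1 - j / \<alpha>)) \<longlonglongrightarrow> 0"
      unfolding powr_minus_divide by (simp add: powr_divide del: of_nat_Suc)
    have "(\<lambda>n. \<alpha> * (2 * (Suc n) powr (1 - (j + 1) / \<alpha>) + 2 * (1 / Suc n) powr (1 - j / \<alpha>)) * \<bar>\<theta>\<bar>)
       \<longlonglongrightarrow> \<alpha> * (2 * 0 + 2 * 0) * \<bar>\<theta>\<bar>"
      by (intro tendsto_intros 1 2)
    then show "(\<lambda>n. \<alpha> * (2 * (Suc n) powr (1 - (j + 1) / \<alpha>) + 2 * (1 / Suc n) powr (1 - j / \<alpha>)) * \<bar>\<theta>\<bar>) \<longlonglongrightarrow> 0"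
      by simp
  qed
  moreover have "(\<lambda>n. trunc (1 / Suc n) (Suc n) \<theta> - trunc (1 / Suc n) (Suc n) 0) \<longlonglongrightarrow>
     cis (-\<alpha>*\<theta>) * (LINT y:{0<..}|lborel. exp_remainder j (cis \<theta> * of_real (y powr (-1/\<alpha>)))) -
     cis (-\<alpha>*0) * (LINT y:{0<..}|lborel. exp_remainder j (cis 0 * of_real (y powr (-1/\<alpha>))))"
    by (intro tendsto_diff trunc_tendsto \<theta>) auto
  ultimately have "cis (-\<alpha>*\<theta>) * (LINT y:{0<..}|lborel. exp_remainder j (cis \<theta> * of_real (y powr (-1/\<alpha>)))) -
     cis (-\<alpha>*0) * (LINT y:{0<..}|lborel. exp_remainder j (cis 0 * of_real (y powr (-1/\<alpha>)))) = 0"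
    using LIMSEQ_unique by blast
  then have "cis (\<alpha>*\<theta>) * (cis (-\<alpha>*\<theta>) * (LINT y:{0<..}|lborel. exp_remainder j (cis \<theta> * of_real (y powr (-1/\<alpha>))))) =
    cis (\<alpha>*\<theta>) * (LINT y:{0<..}|lborel. exp_remainder j (of_real (y powr (-1/\<alpha>))))" by simp
  then show ?thesis by (simp add: mult.assoc[symmetric] cis_mult)
qed

end

text \<open>\<open>centred_kernel \<alpha>\<close> is \<open>1 - e\<^sup>i\<^sup>v\<close> with the terms removed that do not contribute to the
  characteristic function under the centring or symmetry assumptions.\<close>

definition centred_kernel :: "real \<Rightarrow> real \<Rightarrow> complex" where
  "centred_kernel \<alpha> v =
     (if \<alpha> < 1 then 1 - iexp v else if \<alpha> = 1 then of_real (1 - cos v) else 1 - iexp v + \<i> * v)"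

text \<open>The oscillating kernel is the remainder at the imaginary point
  \<open>- \<i> * v\<close>, on the edge of the half-plane in which the remainder is controlled;
  this is the end point of the rotation.\<close>

lemma centred_kernel_eq_exp_remainder:
  "\<alpha> < 1 \<Longrightarrow> centred_kernel \<alpha> v = exp_remainder 0 (cis (-pi/2) * of_real v)"
  "\<alpha> > 1 \<Longrightarrow> centred_kernel \<alpha> v = exp_remainder 1 (cis (-pi/2) * of_real v)"
proof -
  have "cis (-pi/2) = -\<i>" using cis_minus_pi_half by simp
  then show "\<alpha> < 1 \<Longrightarrow> centred_kernel \<alpha> v = exp_remainder 0 (cis (-pi/2) * of_real v)"
    "\<alpha> > 1 \<Longrightarrow> centred_kernel \<alpha> v = exp_remainder 1 (cis (-pi/2) * of_real v)"
    by (auto simp: centred_kernel_def exp_remainder_def)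
qed

lemma centred_kernel_continuous: "continuous_on UNIV (centred_kernel \<alpha>)"
  unfolding centred_kernel_def by (cases "\<alpha> < 1"; cases "\<alpha> = 1") (auto intro!: continuous_intros)

text \<open>The integer orders at zero and infinity are \<open>(1, 0)\<close>, \<open>(2, 0)\<close>
  and \<open>(2, 1)\<close> for \<alpha> below, equal to and above 1; the conditions on
  \<open>a\<close> and \<open>b\<close> keep them within the respective pair.\<close>

lemma centred_kernel_bound:
  assumes v: "0 \<le> v" and ba: "0 < b" "b \<le> a"
    and "\<alpha> < 1 \<Longrightarrow> a \<le> 1" "a \<le> 2" "\<alpha> > 1 \<Longrightarrow> 1 \<le> b"
  shows "norm (centred_kernel \<alpha> v) \<le> 2 * min (v powr a) (v powr b)"
proof -
  have Re: "0 \<le> Re (cis (-pi/2) * of_real v)" using cis_minus_pi_half by simp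
  consider "\<alpha> < 1" | "\<alpha> = 1" | "\<alpha> > 1" by linarith
  then show ?thesis
  proof cases
    case 1
    have "norm (centred_kernel \<alpha> v) \<le> 2 * min (v ^ 1) (v ^ 0)"
      using norm_exp_remainder[OF Re, of 0] v 1 by (simp add: centred_kernel_eq_exp_remainder norm_mult)
    also have "\<dots> \<le> 2 * min (v powr a) (v powr b)"
      using 1 assms by (intro mult_left_mono min_power_le_min_powr) auto
    finally show ?thesis .
  next
    case 2
    have "1 - cos v = 2 * (sin (v / 2))\<^sup>2" using cos_double_sin[of "v / 2"] by simp
    moreover have "(sin (v / 2))\<^sup>2 \<le> v\<^sup>2"
      using order_trans[OF abs_sin_x_le_abs_x[of "v / 2"], of "\<bar>v\<bar>"] by (simp add: abs_le_square_iff)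
    moreover have "(sin (v / 2))\<^sup>2 \<le> 1" by (simp add: abs_square_le_1)
    ultimately have "1 - cos v \<le> 2 * min (v ^ 2) (v ^ 0)" by (auto simp: min_def power2_eq_square)
    then have "norm (centred_kernel \<alpha> v) \<le> 2 * min (v ^ 2) (v ^ 0)"
      using 2 cos_le_one[of v] by (simp add: centred_kernel_def norm_of_real del: of_real_diff)
    also have "\<dots> \<le> 2 * min (v powr a) (v powr b)"
      using 2 assms by (intro mult_left_mono min_power_le_min_powr) auto
    finally show ?thesis .
  next
    case 3
    have "norm (centred_kernel \<alpha> v) \<le> 2 * min (v ^ 2) (v ^ 1)"
      using norm_exp_remainder[OF Re, of 1] v 3 by (simp add: centred_kernel_eq_exp_remainder norm_mult power2_eq_square)
    also have "\<dots> \<le> 2 * min (v powr a) (v powr b)"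
      using 3 assms by (intro mult_left_mono min_power_le_min_powr) auto
    finally show ?thesis .
  qed
qed

text \<open>For \<alpha> = 1 no rotation is called for: the kernel \<open>1 - cos v\<close> is real
  and nonnegative.\<close>

lemma centred_kernel_integral_1:
  "\<exists>c\<ge>0. (LINT y:{0<..}|lborel. centred_kernel 1 (y powr (-1/1))) = complex_of_real c"
proof (intro exI conjI)
  show "(LINT y:{0<..}|lborel. centred_kernel 1 (y powr (-1/1))) =
      complex_of_real (LINT y:{0<..}|lborel. 1 - cos (y powr (-1/1)))"
    unfolding centred_kernel_def set_lebesgue_integral_def
    by (simp add: scaleR_conv_of_real flip: of_real_mult integral_complex_of_real del: of_real_diff)
  show "0 \<le> (LINT y:{0<..}|lborel. 1 - cos ((y::real) powr (-1/1)))"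
    unfolding set_lebesgue_integral_def by (rule Bochner_Integration.integral_nonneg) simp
qed

text \<open>Rotation by \<open>-pi/2\<close> leads to \<open>cis (- (pi * \<alpha> / 2))\<close>
  times a real integral \<open>r\<close>. Both \<open>r\<close> and
  \<open>cos (pi * \<alpha> / 2)\<close> are nonnegative for \<alpha> < 1 and nonpositive for
  \<alpha> > 1, so their product is an admissible \<open>c\<close>; taking the cosine out of the
  phase produces the tangent.\<close>

lemma centred_kernel_integral:
  assumes "0 < \<alpha>" "\<alpha> < 2" "\<alpha> \<noteq> 1"
  shows "\<exists>c\<ge>0. (LINT y:{0<..}|lborel. centred_kernel \<alpha> (y powr (-1/\<alpha>))) =
     of_real c * (1 - \<i> * of_real (tan (pi * \<alpha> / 2)))"
proof -
  define j :: nat where "j = (if \<alpha> < 1 then 0 else 1)"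
  interpret rotation \<alpha> j using assms by unfold_locales (auto simp: j_def)
  define g where "g v = 1 - exp (-v) - (if j = 0 then 0 else v)" for v :: real
  define r where "r = (LINT y:{0<..}|lborel. g (y powr (-1/\<alpha>)))"
  have g: "exp_remainder j (of_real v) = of_real (g v)" for v
    by (simp add: exp_remainder_def g_def exp_of_real[symmetric])
  have "(LINT y:{0<..}|lborel. centred_kernel \<alpha> (y powr (-1/\<alpha>))) =
     (LINT y:{0<..}|lborel. exp_remainder j (cis (-pi/2) * of_real (y powr (-1/\<alpha>))))"
    using assms by (auto simp: centred_kernel_eq_exp_remainder j_def)
  also have "\<dots> = cis (\<alpha> * (-pi/2)) * (LINT y:{0<..}|lborel. exp_remainder j (of_real (y powr (-1/\<alpha>))))"
    by (rule rotate) (use pi_ge_zero in auto)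
  also have "(LINT y:{0<..}|lborel. exp_remainder j (of_real (y powr (-1/\<alpha>)))) = of_real r"
    unfolding r_def g set_lebesgue_integral_def
    by (simp add: scaleR_conv_of_real flip: of_real_mult integral_complex_of_real)
  finally have 1: "(LINT y:{0<..}|lborel. centred_kernel \<alpha> (y powr (-1/\<alpha>))) = cis (- (pi * \<alpha> / 2)) * of_real r"
    by (simp add: mult.commute)
  have g_sign: "0 \<le> g v" if "\<alpha> < 1" "v \<ge> 0" for v using that by (simp add: g_def j_def)
  have g_sign': "g v \<le> 0" if "\<alpha> > 1" for v using that exp_ge_add_one_self[of "-v"] by (simp add: g_def j_def)
  have c: "cos (pi * \<alpha> / 2) * r \<ge> 0 \<and> cos (pi * \<alpha> / 2) \<noteq> 0"
  proof (cases "\<alpha> < 1")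
    case True
    have "cos (pi * \<alpha> / 2) > 0" using assms True by (intro cos_gt_zero_pi) (auto simp: divide_simps intro: less_le_trans[of _ 0])
    moreover have "r \<ge> 0" unfolding r_def set_lebesgue_integral_def
      using g_sign True by (intro Bochner_Integration.integral_nonneg) (auto simp: indicator_def)
    ultimately show ?thesis by auto
  next
    case False
    then have a: "\<alpha> > 1" using assms by simp
    have "- cos (pi * \<alpha> / 2) = cos (pi * \<alpha> / 2 - pi)" by (simp add: cos_diff)
    also have "cos (pi * \<alpha> / 2 - pi) > 0" using assms a by (intro cos_gt_zero_pi) (auto simp: divide_simps)
    finally have "cos (pi * \<alpha> / 2) < 0" by simp
    moreover have "- r \<ge> 0" unfolding r_def set_lebesgue_integral_def Bochner_Integration.integral_minus[symmetric]
      using g_sign' a by (intro Bochner_Integration.integral_nonneg) (auto simp: indicator_def)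
    ultimately show ?thesis by (auto simp: mult_nonpos_nonpos)
  qed
  have "cis (- (pi * \<alpha> / 2)) * of_real r = of_real (cos (pi * \<alpha> / 2) * r) * (1 - \<i> * of_real (tan (pi * \<alpha> / 2)))"
    using c by (simp add: complex_eq_iff tan_def)
  then show ?thesis using 1 c by auto
qed

section \<open>Levy continuity in Euclidean spaces\<close>

definition plateau :: "real \<Rightarrow> real" where
  "plateau u = min 1 (max 0 (1 / 2 - cos (pi * u)))"

text \<open>The function has period 2, hence the even integer. Its two plateaus read off a ternary
  digit: what follows the ternary point lies in the first third of the unit interval for digit 0 and
  in the last third for digit 2.\<close>

lemma plateau_cases:
  assumes "even N"
  shows "0 \<le> x \<Longrightarrow> x \<le> 1 / 3 \<Longrightarrow> plateau (of_int N + x) = 0"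
    and "2 / 3 \<le> x \<Longrightarrow> x \<le> 1 \<Longrightarrow> plateau (of_int N + x) = 1"
proof -
  obtain k where "N = 2 * k" using assms by blast
  then have c: "cos (pi * (of_int N + x)) = cos (pi * x)"
  proof -
    have "pi * (of_int N + x) = 2 * pi * of_int k + pi * x" using \<open>N = 2 * k\<close> by (simp add: distrib_left)
    then show ?thesis by (simp only: cos_add cos_int_2pin sin_int_2pin)
  qed
  show "plateau (of_int N + x) = 0" if "0 \<le> x" "x \<le> 1 / 3"
  proof -
    have "cos (pi / 3) \<le> cos (pi * x)" using that by (intro cos_monotone_0_pi_le) auto
    then show ?thesis unfolding plateau_def c by (simp add: cos_60)
  qed
  show "plateau (of_int N + x) = 1" if "2 / 3 \<le> x" "x \<le> 1"
  proof -
    have "cos (pi * x) \<le> cos (pi - pi / 3)" using that by (intro cos_monotone_0_pi_le) (auto simp: field_simps)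
    also have "cos (pi - pi / 3) = - 1 / 2" by (simp only: cos_pi_minus cos_60)
    finally show ?thesis unfolding plateau_def c by simp
  qed
qed

text \<open>The point of Cantor's set with ternary digits \<open>2 * b m\<close>. Avoiding the digit
  1 leaves gaps in which a continuous function can switch between the values it reads.\<close>

definition cantor_sum :: "(nat \<Rightarrow> bool) \<Rightarrow> real" where
  "cantor_sum b = (\<Sum>m. 2 * of_bool (b m) / 3 ^ Suc m)"

lemma cantor_sum_summable: "summable (\<lambda>m. 2 * of_bool (b m) / (3::real) ^ Suc m)"
proof (rule summable_comparison_test'[of "\<lambda>m. (2 / 3) * (1 / 3) ^ m" 0])
  show "summable (\<lambda>m. (2 / 3) * (1 / 3 :: real) ^ m)" by (intro summable_mult summable_geometric) simp
qed (auto simp: power_one_over)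

lemma cantor_sum_bounds: "0 \<le> cantor_sum b" "cantor_sum b \<le> 1"
proof -
  show "0 \<le> cantor_sum b" unfolding cantor_sum_def by (intro suminf_nonneg cantor_sum_summable) auto
  have g: "(\<lambda>m. (2 / 3) * (1 / 3 :: real) ^ m) sums ((2 / 3) * (1 / (1 - 1 / 3)))"
    by (intro sums_mult geometric_sums) auto
  have "cantor_sum b \<le> (\<Sum>m. (2 / 3) * (1 / 3 :: real) ^ m)" unfolding cantor_sum_def
    by (rule suminf_le[OF _ cantor_sum_summable sums_summable[OF g]]) (auto simp: power_one_over)
  also have "\<dots> = 1" using sums_unique[OF g] by simp
  finally show "cantor_sum b \<le> 1" .
qed

text \<open>Multiplication by \<open>3 ^ m\<close> moves the first \<open>m\<close> digits before
  the ternary point. Digits 0 and 2 make that integer even, and everything after digit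
  \<open>m\<close> contributes at most a third, which is the situation of
  \<open>plateau_cases\<close>.\<close>

lemma cantor_sum_split:
  "3 ^ m * cantor_sum b = of_int (\<Sum>l<m. 2 * of_bool (b l) * 3 ^ (m - Suc l)) +
     (2 * of_bool (b m) / 3 + cantor_sum (\<lambda>l. b (l + Suc m)) / 3)"
proof -
  have "cantor_sum b = (\<Sum>l. 2 * of_bool (b (l + Suc m)) / 3 ^ Suc (l + Suc m)) + (\<Sum>l<Suc m. 2 * of_bool (b l) / 3 ^ Suc l)"
    unfolding cantor_sum_def by (rule suminf_split_initial_segment[OF cantor_sum_summable])
  also have "(\<Sum>l. 2 * of_bool (b (l + Suc m)) / (3::real) ^ Suc (l + Suc m)) =
     (\<Sum>l. (1 / 3 ^ Suc m) * (2 * of_bool (b (l + Suc m)) / 3 ^ Suc l))"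
    by (simp add: power_add mult_ac)
  also have "\<dots> = (1 / 3 ^ Suc m) * cantor_sum (\<lambda>l. b (l + Suc m))"
    unfolding cantor_sum_def by (rule suminf_mult[OF cantor_sum_summable])
  finally have e: "3 ^ m * cantor_sum b = cantor_sum (\<lambda>l. b (l + Suc m)) / 3 + 3 ^ m * (\<Sum>l<Suc m. 2 * of_bool (b l) / 3 ^ Suc l)"
    by (simp add: distrib_left)
  have "3 ^ m * (\<Sum>l<m. 2 * of_bool (b l) / 3 ^ Suc l) = (\<Sum>l<m. 2 * of_bool (b l) * (3::real) ^ (m - Suc l))"
    unfolding sum_distrib_left
  proof (rule sum.cong)
    fix l assume "l \<in> {..<m}"
    then have "(3::real) ^ m = 3 ^ (m - Suc l) * 3 ^ Suc l" by (simp flip: power_add del: power_Suc)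
    then show "3 ^ m * (2 * of_bool (b l) / 3 ^ Suc l) = 2 * of_bool (b l) * (3::real) ^ (m - Suc l)" by simp
  qed simp
  then show ?thesis unfolding e by (simp add: distrib_left)
qed

lemma plateau_cantor_sum: "plateau (3 ^ m * cantor_sum b) = of_bool (b m)"
proof -
  have ev: "even (\<Sum>l<m. 2 * of_bool (b l) * 3 ^ (m - Suc l) :: int)" by (rule dvd_sum) auto
  show ?thesis unfolding cantor_sum_split
    using plateau_cases[OF ev, of "2 * of_bool (b m) / 3 + cantor_sum (\<lambda>l. b (l + Suc m)) / 3"]
      cantor_sum_bounds[of "\<lambda>l. b (l + Suc m)"] by (cases "b m") auto
qed

definition binary_digit :: "nat \<Rightarrow> real \<Rightarrow> bool" where
  "binary_digit k x \<longleftrightarrow> odd \<lfloor>2 ^ Suc k * x\<rfloor>"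

text \<open>Digit \<open>k\<close> is \<open>\<lfloor>2 ^ Suc k * x\<rfloor>\<close> minus twice
  \<open>\<lfloor>2 ^ k * x\<rfloor>\<close>, so the partial sums telescope to
  \<open>\<lfloor>2 ^ K * x\<rfloor> / 2 ^ K\<close>. The range of \<open>x\<close> makes the
  initial floor vanish.\<close>

lemma binary_digit_sums:
  assumes "0 \<le> x" "x < 1"
  shows "(\<lambda>k. of_bool (binary_digit k x) / 2 ^ Suc k) sums x"
proof -
  have d: "of_bool (binary_digit k x) = \<lfloor>2 ^ Suc k * x\<rfloor> - 2 * \<lfloor>2 ^ k * x\<rfloor>" for k
  proof -
    have "\<lfloor>2 ^ Suc k * x\<rfloor> div 2 = \<lfloor>2 ^ k * x\<rfloor>"
      using floor_divide_real_eq_div[of 2 "2 ^ Suc k * x"] by simp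
    moreover have "of_bool (binary_digit k x) = \<lfloor>2 ^ Suc k * x\<rfloor> mod 2"
      unfolding binary_digit_def by (rule mod_2_eq_odd[symmetric])
    ultimately show ?thesis by (simp add: minus_mult_div_eq_mod[symmetric])
  qed
  have p: "(\<Sum>k<K. of_bool (binary_digit k x) / 2 ^ Suc k) = \<lfloor>2 ^ K * x\<rfloor> / 2 ^ K" for K
  proof (induction K)
    case 0
    have "\<lfloor>x\<rfloor> = 0" using assms by linarith
    then show ?case by simp
  next
    case (Suc K)
    have "real_of_int (of_bool (binary_digit K x)) = real_of_int \<lfloor>2 ^ Suc K * x\<rfloor> - 2 * \<lfloor>2 ^ K * x\<rfloor>"
      unfolding d by simp
    then have "of_bool (binary_digit K x) = real_of_int \<lfloor>2 ^ Suc K * x\<rfloor> - 2 * \<lfloor>2 ^ K * x\<rfloor>" by simp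
    then show ?case using Suc by (simp add: divide_simps del: of_bool_eq_iff)
  qed
  have "(\<lambda>K. \<lfloor>2 ^ K * x\<rfloor> / 2 ^ K) \<longlonglongrightarrow> x"
  proof (rule tendsto_sandwich[of "\<lambda>K. x - (1 / 2) ^ K" _ _ "\<lambda>K. x"])
    have "x - (1 / 2) ^ K \<le> \<lfloor>2 ^ K * x\<rfloor> / 2 ^ K" for K :: nat
    proof -
      have "(2 ^ K * x - 1) / 2 ^ K \<le> \<lfloor>2 ^ K * x\<rfloor> / 2 ^ K" by (rule divide_right_mono, linarith, simp)
      then show ?thesis by (simp add: power_one_over diff_divide_distrib)
    qed
    then show "\<forall>\<^sub>F K in sequentially. x - (1 / 2) ^ K \<le> \<lfloor>2 ^ K * x\<rfloor> / 2 ^ K" by simp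
    have "\<lfloor>2 ^ K * x\<rfloor> / 2 ^ K \<le> x" for K :: nat
      using floor_correct[of "2 ^ K * x"] by (simp add: divide_simps mult.commute)
    then show "\<forall>\<^sub>F K in sequentially. \<lfloor>2 ^ K * x\<rfloor> / 2 ^ K \<le> x" by simp
    have "(\<lambda>K. x - (1 / 2) ^ K) \<longlonglongrightarrow> x - 0" by (intro tendsto_intros LIMSEQ_realpow_zero) auto
    then show "(\<lambda>K. x - (1 / 2) ^ K) \<longlonglongrightarrow> x" by simp
  qed simp
  then show ?thesis unfolding sums_def p .
qed

text \<open>Schoenberg's space-filling curve; the inverse records the interleaved binary digits of the
  coordinates as ternary digits 0 and 2.\<close>

lemma space_filling_curve:
  obtains f :: "real \<Rightarrow> 'a::euclidean_space" and c :: "'a \<Rightarrow> real"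
  where "continuous_on UNIV f" "c \<in> borel_measurable borel" "\<And>z. 0 \<le> c z" "\<And>z. c z \<le> 1"
    "\<And>z. (\<And>i. i \<in> Basis \<Longrightarrow> 0 \<le> z \<bullet> i \<and> z \<bullet> i < 1) \<Longrightarrow> f (c z) = z"
proof -
  define D where "D = DIM('a)"
  have D: "D > 0" by (simp add: D_def)
  obtain e :: "nat \<Rightarrow> 'a" where e: "bij_betw e {..<D} Basis"
    using ex_bij_betw_nat_finite[OF finite_Basis] by (auto simp: D_def lessThan_atLeast0)
  \<comment> \<open>Parameter digit \<open>D * k + j\<close> carries binary digit \<open>k\<close>
    of coordinate \<open>j\<close>; reading it at scale \<open>3 ^ (D * k + j)\<close> gives a
    uniformly convergent series of continuous functions.\<close>
  define g where "g j t = (\<Sum>k. plateau (3 ^ (D * k + j) * t) / 2 ^ Suc k)" for j :: nat and t :: real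
  define f where "f t = (\<Sum>j<D. g j t *\<^sub>R e j)" for t
  define b where "b z m = binary_digit (m div D) (z \<bullet> e (m mod D))" for z :: 'a and m :: nat
  define c where "c z = cantor_sum (b z)" for z
  have pl: "\<bar>plateau u\<bar> \<le> 1" for u by (simp add: plateau_def)
  have geo: "summable (\<lambda>k. 1 / (2::real) ^ Suc k)"
  proof -
    have "summable (\<lambda>k. (1 / 2) * (1 / 2 :: real) ^ k)" by (intro summable_mult summable_geometric) simp
    then show ?thesis by (simp add: power_one_over)
  qed
  have gc: "continuous_on UNIV (g j)" for j
  proof (rule uniform_limit_theorem[of _ "\<lambda>n t. \<Sum>k<n. plateau (3 ^ (D * k + j) * t) / 2 ^ Suc k" sequentially])
    show "uniform_limit UNIV (\<lambda>n t. \<Sum>k<n. plateau (3 ^ (D * k + j) * t) / 2 ^ Suc k) (g j) sequentially"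
      unfolding g_def using pl by (intro Weierstrass_m_test[OF _ geo]) (simp add: divide_right_mono)
  qed (auto intro!: always_eventually continuous_intros simp: plateau_def)
  show ?thesis
  proof (rule that[of f c])
    show "continuous_on UNIV f" unfolding f_def by (intro continuous_intros gc)
    have "(\<lambda>z. of_bool (b z m) :: real) \<in> borel_measurable borel" for m :: nat
    proof -
      have "(\<lambda>z. of_bool (b z m) :: real) = (\<lambda>z. real_of_int (\<lfloor>2 ^ Suc (m div D) * (z \<bullet> e (m mod D))\<rfloor> mod 2))"
        unfolding b_def binary_digit_def mod_2_eq_odd by (intro ext) (simp add: of_bool_def)
      also have "\<dots> \<in> borel_measurable borel" by measurable
      finally show ?thesis .
    qed
    then show "c \<in> borel_measurable borel" unfolding c_def cantor_sum_def
      by (intro borel_measurable_suminf borel_measurable_divide borel_measurable_times) auto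
    show "0 \<le> c z" "c z \<le> 1" for z unfolding c_def by (rule cantor_sum_bounds)+
    fix z :: 'a assume z: "\<And>i. i \<in> Basis \<Longrightarrow> 0 \<le> z \<bullet> i \<and> z \<bullet> i < 1"
    have "g j (c z) = z \<bullet> e j" if j: "j < D" for j
    proof -
      have "plateau (3 ^ (D * k + j) * c z) = of_bool (binary_digit k (z \<bullet> e j))" for k
        unfolding c_def plateau_cantor_sum using j by (simp add: b_def)
      moreover have "e j \<in> Basis" using e j by (auto simp: bij_betw_def)
      ultimately show ?thesis unfolding g_def using binary_digit_sums[of "z \<bullet> e j"] z[of "e j"]
        by (simp add: sums_iff)
    qed
    then have "f (c z) = (\<Sum>j<D. (z \<bullet> e j) *\<^sub>R e j)" by (simp add: f_def)
    also have "\<dots> = (\<Sum>i\<in>Basis. (z \<bullet> i) *\<^sub>R i)" by (rule sum.reindex_bij_betw[OF e])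
    finally show "f (c z) = z" by (simp add: euclidean_representation)
  qed
qed

section \<open>Selection of weak limits in Euclidean spaces\<close>

lemma integral_distr_borel:
  "Z \<in> borel_measurable M \<Longrightarrow> continuous_on UNIV g \<Longrightarrow>
    integral\<^sup>L (distr M borel Z) (g :: _ \<Rightarrow> _::{banach,second_countable_topology}) = (\<integral>\<omega>. g (Z \<omega>) \<partial>M)"
  by (intro integral_distr borel_measurable_continuous_onI) auto

lemma isCont_o_on_open:
  fixes f :: "real \<Rightarrow> 'a::euclidean_space"
  assumes "continuous_on UNIV f" "open U" "f t \<in> U" "continuous_on U h" 
  shows "isCont (\<lambda>t. h (f t)) t"
proof -
  have "isCont f t" using assms by (simp add: continuous_on_eq_continuous_at)
  moreover have "isCont h (f t)" using assms by (simp add: continuous_on_eq_continuous_at)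
  ultimately show ?thesis by (rule isCont_o2)
qed

text \<open>Selection is transported to the line: \<open>H\<close> maps the space into the open unit
  cube \<open>U\<close>, \<open>c\<close> places the cube in the unit interval, and the image laws
  are tight because they live on a bounded set. The way back, first \<open>f\<close> and then
  \<open>K\<close>, is known to be continuous only where \<open>f t \<in> U\<close>; tightness of
  the original laws shows that the limit \<open>N\<close> gives no mass to the other points.\<close>

lemma euclidean_Helly:
  fixes \<mu> :: "nat \<Rightarrow> 'a::euclidean_space measure"
  assumes \<mu>: "\<And>n. prob_space (\<mu> n)" "\<And>n. sets (\<mu> n) = sets borel"
    and tight: "\<And>\<epsilon>. \<epsilon> > 0 \<Longrightarrow> \<exists>R. \<forall>\<^sub>F n in sequentially. measure (\<mu> n) {z. norm z > R} \<le> \<epsilon>"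
    and s: "strict_mono (s :: nat \<Rightarrow> nat)"
  shows "\<exists>r L. strict_mono r \<and> prob_space L \<and> sets L = sets borel \<and>
     (\<forall>g::'a \<Rightarrow> real. continuous_on UNIV g \<longrightarrow> bounded (range g) \<longrightarrow>
        (\<lambda>n. integral\<^sup>L (\<mu> (s (r n))) g) \<longlonglongrightarrow> integral\<^sup>L L g)"
proof -
  obtain f :: "real \<Rightarrow> 'a" and c :: "'a \<Rightarrow> real"
    where f: "continuous_on UNIV f" and c[measurable]: "c \<in> borel_measurable borel" and c01: "\<And>z. 0 \<le> c z" "\<And>z. c z \<le> 1"
      and fc: "\<And>z. (\<And>i. i \<in> Basis \<Longrightarrow> 0 \<le> z \<bullet> i \<and> z \<bullet> i < 1) \<Longrightarrow> f (c z) = z"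
    using space_filling_curve by metis
  note [measurable_cong] = \<mu>(2)
  have f_meas[measurable]: "f \<in> borel_measurable borel" by (rule borel_measurable_continuous_onI[OF f])
  \<comment> \<open>Coordinatewise arctangent, with inverse \<open>K\<close>, so that a curve
    filling a bounded cube serves the whole space.\<close>
  define H where "H z = (\<Sum>i\<in>Basis. (1 / 2 + arctan (z \<bullet> i) / pi) *\<^sub>R i)" for z :: 'a
  define K where "K w = (\<Sum>i\<in>Basis. tan (pi * (w \<bullet> i - 1 / 2)) *\<^sub>R i)" for w :: 'a
  define U where "U = {w::'a. \<forall>i\<in>Basis. 0 < w \<bullet> i \<and> w \<bullet> i < 1}"
  have H_inner: "H z \<bullet> i = 1 / 2 + arctan (z \<bullet> i) / pi" if "i \<in> Basis" for z i
    using that by (simp add: H_def inner_sum_left inner_Basis if_distrib cong: if_cong)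
  have HU: "H z \<in> U" for z
  proof -
    have "0 < 1 / 2 + arctan x / pi" "1 / 2 + arctan x / pi < 1" for x
      using arctan_lbound[of x] arctan_ubound[of x] by (auto simp: field_simps)
    then show ?thesis by (auto simp: U_def H_inner)
  qed
  have KH: "K (H z) = z" for z
    unfolding K_def using euclidean_representation[of z] by (simp add: H_inner tan_arctan)
  have U_open: "open U"
  proof -
    have "U = (\<Inter>i\<in>Basis. {w. 0 < w \<bullet> i} \<inter> {w. w \<bullet> i < 1})" by (auto simp: U_def)
    also have "open \<dots>" by (intro open_INT finite_Basis ballI open_Int open_Collect_less continuous_intros)
    finally show ?thesis .
  qed
  have "continuous_on U (\<lambda>w. tan (pi * (w \<bullet> i - 1 / 2)))" if i: "i \<in> Basis" for i
    unfolding tan_def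
  proof (intro continuous_on_divide continuous_intros ballI)
    fix w assume w: "w \<in> U"
    have "- (pi / 2) < pi * (w \<bullet> i - 1 / 2)" "pi * (w \<bullet> i - 1 / 2) < pi / 2"
      using w i by (auto simp: U_def algebra_simps)
    then show "cos (pi * (w \<bullet> i - 1 / 2)) \<noteq> 0" using cos_gt_zero_pi by (metis less_irrefl)
  qed simp_all
  then have Kcont: "continuous_on U K" unfolding K_def by (intro continuous_intros) auto
  have Hcont: "continuous_on UNIV H" unfolding H_def by (auto intro!: continuous_intros)
  have [measurable]: "H \<in> borel_measurable borel" by (rule borel_measurable_continuous_onI[OF Hcont])
  have [measurable]: "K \<in> borel_measurable borel" unfolding K_def tan_def
    by (intro borel_measurable_sum borel_measurable_scaleR borel_measurable_divide borel_measurable_const) auto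
  have fcH: "f (c (H z)) = H z" for z using HU[of z] by (intro fc) (auto simp: U_def less_imp_le)
  define \<nu> where "\<nu> n = distr (\<mu> n) borel (\<lambda>z. c (H z))" for n
  interpret \<mu>: prob_space "\<mu> n" for n by (rule \<mu>)
  have \<nu>: "real_distribution (\<nu> n)" for n
    unfolding \<nu>_def by (rule \<mu>.real_distribution_distr) measurable
  interpret \<nu>: real_distribution "\<nu> n" for n by (rule \<nu>)
  have \<nu>_int: "integral\<^sup>L (\<nu> n) h = (\<integral>z. h (c (H z)) \<partial>\<mu> n)" if "h \<in> borel_measurable borel" for n and h :: "real \<Rightarrow> real"
    unfolding \<nu>_def by (rule integral_distr) (use that in measurable)
  have "tight \<nu>" unfolding tight_def
  proof (intro conjI allI impI \<nu>)
    fix e :: real assume "e > 0"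
    have "measure (\<nu> n) {-1<..1} = 1" for n
    proof -
      have "measure (\<nu> n) {-1<..1} = measure (\<mu> n) ((\<lambda>z. c (H z)) -` {-1<..1} \<inter> space (\<mu> n))"
        unfolding \<nu>_def by (rule measure_distr) auto
      also have "(\<lambda>z. c (H z)) -` {-1<..1} \<inter> space (\<mu> n) = space (\<mu> n)"
        using c01(2) less_le_trans[OF _ c01(1), of "-1"] by auto
      finally show ?thesis by (simp add: \<mu>.prob_space)
    qed
    then show "\<exists>a b. a < b \<and> (\<forall>n. 1 - e < measure (\<nu> n) {a<..b})"
      using \<open>e > 0\<close> by (intro exI[of _ "-1"] exI[of _ 1]) auto
  qed
  from tight_imp_convergent_subsubsequence[OF this s] obtain r N
    where r: "strict_mono r" and N: "real_distribution N" and conv: "weak_conv_m (\<nu> \<circ> s \<circ> r) N" by blast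
  interpret N: real_distribution N by (rule N)
  have sr: "filterlim (\<lambda>n. s (r n)) sequentially sequentially"
    using filterlim_subseq[OF strict_mono_o[OF s r]] by (simp add: o_def)
  have lim: "(\<lambda>n. integral\<^sup>L (\<nu> (s (r n))) h) \<longlonglongrightarrow> integral\<^sup>L N h"
    if "emeasure N {x. \<not> isCont h x} = 0" "\<And>x. norm (h x) \<le> B" "h \<in> borel_measurable borel" for h :: "real \<Rightarrow> real" and B
    using weak_conv_imp_bdd_ae_continuous_conv[of "\<nu> \<circ> s \<circ> r" N h B, OF _ N conv that] \<nu> by (simp add: o_def)
  \<comment> \<open>A continuous \<open>h'\<close> that vanishes at the image of every
    \<open>z\<close> with \<open>norm z \<le> R\<close> and equals 1 wherever \<open>f t\<close> has
    left \<open>U\<close> carries the tail estimate over to the limit.\<close>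
  have cut: "measure N {t. f t \<notin> U} \<le> \<epsilon>" if \<epsilon>: "\<epsilon> > 0" for \<epsilon>
  proof -
    obtain R where R: "\<forall>\<^sub>F n in sequentially. measure (\<mu> n) {z. norm z > R} \<le> \<epsilon>" using tight[OF \<epsilon>] by blast
    \<comment> \<open>Coordinates of size at most \<open>\<bar>R\<bar>\<close> are sent by
      \<open>H\<close> to within distance \<open>l < 1 / 2\<close> of the centre of the unit
      interval.\<close>
    define l where "l = arctan \<bar>R\<bar> / pi"
    have l: "l < 1 / 2" using arctan_ubound[of "\<bar>R\<bar>"] by (simp add: l_def field_simps)
    define h where "h t = (\<Sum>i\<in>Basis. max 0 (min 1 ((\<bar>f t \<bullet> i - 1 / 2\<bar> - l) / (1 / 2 - l))))" for t
    have hc: "continuous_on UNIV h" unfolding h_def using l by (intro continuous_intros continuous_on_subset[OF f]) auto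
    define h' where "h' t = min 1 (h t)" for t
    have h'c: "continuous_on UNIV h'" unfolding h'_def by (intro continuous_intros hc)
    have [measurable]: "h' \<in> borel_measurable borel" by (rule borel_measurable_continuous_onI[OF h'c])
    have h0: "0 \<le> h t" for t unfolding h_def by (intro sum_nonneg) auto
    have h'01: "0 \<le> h' t" "h' t \<le> 1" for t using h0[of t] by (auto simp: h'_def)
    have "(\<lambda>n. integral\<^sup>L (\<nu> (s (r n))) h') \<longlonglongrightarrow> integral\<^sup>L N h'"
      using h'c h'01 by (intro lim[of _ 1]) (auto simp: continuous_on_eq_continuous_at)
    moreover have "\<forall>\<^sub>F n in sequentially. integral\<^sup>L (\<nu> (s (r n))) h' \<le> \<epsilon>"
    proof (rule eventually_compose_filterlim[OF _ sr])
      show "\<forall>\<^sub>F n in sequentially. integral\<^sup>L (\<nu> n) h' \<le> \<epsilon>"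
        using R
      proof eventually_elim
        case (elim n)
        have "integral\<^sup>L (\<nu> n) h' = (\<integral>z. h' (c (H z)) \<partial>\<mu> n)" by (rule \<nu>_int) measurable
        also have "\<dots> \<le> (\<integral>z. indicator {z. norm z > R} z \<partial>\<mu> n)"
        proof (rule integral_mono)
          show "integrable (\<mu> n) (indicat_real {z. norm z > R})"
            by (rule \<mu>.integrable_const_bound[of _ 1]) auto
          show "integrable (\<mu> n) (\<lambda>z. h' (c (H z)))"
            by (rule \<mu>.integrable_const_bound[of _ 1]) (use h'01 in auto)
          fix z
          show "h' (c (H z)) \<le> indicator {z. norm z > R} z"
          proof (cases "norm z > R")
            case False
            have "\<bar>H z \<bullet> i - 1 / 2\<bar> \<le> l" if i: "i \<in> Basis" for i
            proof -
              have "\<bar>z \<bullet> i\<bar> \<le> \<bar>R\<bar>" using False Basis_le_norm[OF i, of z] by auto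
              then have "\<bar>arctan (z \<bullet> i)\<bar> \<le> arctan \<bar>R\<bar>"
                using arctan_monotone'[of "z \<bullet> i" "\<bar>R\<bar>"] arctan_monotone'[of "-\<bar>R\<bar>" "z \<bullet> i"] by (auto simp: arctan_minus abs_le_iff)
              then show ?thesis using i by (simp add: H_inner l_def divide_right_mono)
            qed
            then have "(\<bar>H z \<bullet> i - 1 / 2\<bar> - l) / (1 / 2 - l) \<le> 0" if "i \<in> Basis" for i
              using l that by (intro divide_nonpos_pos) auto
            then have "h (c (H z)) = 0" unfolding h_def fcH by (intro sum.neutral ballI max_absorb1 min.coboundedI2) blast
            then show ?thesis by (simp add: h'_def)
          qed (use h'01 in auto)
        qed
        also have "\<dots> \<le> \<epsilon>" using elim by simp
        finally show ?case .
      qed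
    qed
    ultimately have "integral\<^sup>L N h' \<le> \<epsilon>" by (rule tendsto_upperbound) auto
    moreover have "measure N {t. f t \<notin> U} \<le> integral\<^sup>L N h'"
    proof -
      have "{t. f t \<in> U} \<in> sets borel" using f U_open by (simp add: open_vimage[OF U_open f, unfolded vimage_def] )
      then have m: "{t. f t \<notin> U} \<in> sets borel" by (metis Collect_neg_eq borel_comp)
      have "measure N {t. f t \<notin> U} = (\<integral>t. indicator {t. f t \<notin> U} t \<partial>N)" using m by simp
      also have "\<dots> \<le> integral\<^sup>L N h'"
      proof (rule integral_mono)
        show "integrable N (indicat_real {t. f t \<notin> U})"
          using m by (intro N.integrable_const_bound[of _ 1]) auto
        show "integrable N h'" by (rule N.integrable_const_bound[of _ 1]) (use h'01 in auto)
        fix t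
        show "indicator {t. f t \<notin> U} t \<le> h' t"
        proof (cases "f t \<in> U")
          case False
          then obtain i where i: "i \<in> Basis" "f t \<bullet> i \<le> 0 \<or> 1 \<le> f t \<bullet> i" by (auto simp: U_def not_less)
          then have "1 / 2 \<le> \<bar>f t \<bullet> i - 1 / 2\<bar>" by auto
          then have "1 \<le> (\<bar>f t \<bullet> i - 1 / 2\<bar> - l) / (1 / 2 - l)" using l by (simp add: le_divide_eq)
          then have "1 \<le> max 0 (min 1 ((\<bar>f t \<bullet> i - 1 / 2\<bar> - l) / (1 / 2 - l)))" by simp
          also have "\<dots> \<le> h t" unfolding h_def by (rule member_le_sum[OF i(1)]) auto
          finally show ?thesis using False by (simp add: h'_def)
        qed (use h'01 in auto)
      qed
      finally show ?thesis .
    qed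
    ultimately show ?thesis by simp
  qed
  have U_meas: "{t. f t \<notin> U} \<in> sets borel"
    using open_vimage[OF U_open f] by (metis Collect_neg_eq borel_comp borel_open vimage_def)
  have "measure N {t. f t \<notin> U} \<le> 0" using cut by (rule field_le_epsilon[of _ 0, simplified])
  then have "measure N {t. f t \<notin> U} = 0" by (rule antisym) simp
  then have U0: "emeasure N {t. f t \<notin> U} = 0" by (simp add: N.emeasure_eq_measure)
  define L where "L = distr N borel (\<lambda>t. K (f t))"
  have "(\<lambda>n. integral\<^sup>L (\<mu> (s (r n))) g) \<longlonglongrightarrow> integral\<^sup>L L g"
    if g: "continuous_on UNIV g" "bounded (range g)" for g :: "'a \<Rightarrow> real"
  proof -
    have [measurable]: "g \<in> borel_measurable borel" by (rule borel_measurable_continuous_onI[OF g(1)])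
    obtain B where B: "\<And>x. norm (g x) \<le> B" using g(2) by (auto simp: bounded_iff)
    have "(\<lambda>n. integral\<^sup>L (\<nu> (s (r n))) (\<lambda>t. g (K (f t)))) \<longlonglongrightarrow> integral\<^sup>L N (\<lambda>t. g (K (f t)))"
    proof (rule lim)
      \<comment> \<open>The transported test function is discontinuous only off \<open>U\<close>, on
        a null set of \<open>N\<close>, so weak convergence still applies to it.\<close>
      have "{t. \<not> isCont (\<lambda>t. g (K (f t))) t} \<subseteq> {t. f t \<notin> U}"
        using isCont_o_on_open[OF f U_open _ continuous_on_compose2[OF g(1) Kcont]] by auto
      then show "emeasure N {t. \<not> isCont (\<lambda>t. g (K (f t))) t} = 0"
        using emeasure_mono[of _ "{t. f t \<notin> U}" N] U0 U_meas by auto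
    qed (use B in auto)
    moreover have "integral\<^sup>L (\<nu> n) (\<lambda>t. g (K (f t))) = integral\<^sup>L (\<mu> n) g" for n
      by (subst \<nu>_int) (auto simp: fcH KH)
    moreover have "integral\<^sup>L N (\<lambda>t. g (K (f t))) = integral\<^sup>L L g"
      unfolding L_def by (subst integral_distr) auto
    ultimately show ?thesis by simp
  qed
  moreover have "prob_space L" unfolding L_def by (rule N.prob_space_distr) measurable
  ultimately show ?thesis using r by (intro exI[of _ r] exI[of _ L]) (auto simp: L_def)
qed

section \<open>Uniqueness of laws with given characteristic function\<close>

lemma bounded_integrable:
  assumes "prob_space L" "sets L = sets borel" "f \<in> borel_measurable borel" "\<And>z. norm (f z) \<le> B"
  shows "integrable L (f :: 'a::topological_space \<Rightarrow> 'b::{banach,second_countable_topology})"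
proof -
  interpret prob_space L by fact
  show ?thesis by (rule integrable_const_bound[of _ B]) (use assms in \<open>auto cong: measurable_cong_sets\<close>)
qed

text \<open>Multiplying by \<open>p \<circ> \<sigma>\<close> with \<open>p\<close> a polynomial and \<open>\<sigma> z = (sin (s z\<^sub>i) / s)\<^sub>i\<close> preserves agreement of
  all Fourier coefficients; since \<open>\<sigma>\<close> has bounded range and tends to the identity as \<open>s \<rightarrow> 0\<close>, the
  Weierstrass theorem and dominated convergence reach every bounded continuous function.\<close>

lemma characteristic_function_unique:
  fixes L1 L2 :: "'a::euclidean_space measure" and g :: "'a \<Rightarrow> real"
  assumes L: "prob_space L1" "prob_space L2" "sets L1 = sets borel" "sets L2 = sets borel"
    and eq: "\<And>x. (\<integral>z. iexp (x \<bullet> z) \<partial>L1) = (\<integral>z. iexp (x \<bullet> z) \<partial>L2)"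
    and g: "continuous_on UNIV g" "bounded (range g)"
  shows "integral\<^sup>L L1 g = integral\<^sup>L L2 g"
proof -
  note [measurable_cong] = L(3,4)
  interpret L1: prob_space L1 by fact
  interpret L2: prob_space L2 by fact
  \<comment> \<open>Agreement is demanded at all frequencies \<open>x\<close>, not only at 0: this
    is what keeps the class closed under multiplication by a sine.\<close>
  define P where "P f \<longleftrightarrow> f \<in> borel_measurable borel \<and> bounded (range f) \<and>
    (\<forall>x. (\<integral>z. of_real (f z) * iexp (x \<bullet> z) \<partial>L1) = (\<integral>z. of_real (f z) * iexp (x \<bullet> z) \<partial>L2))" for f :: "'a \<Rightarrow> real"
  have int: "integrable L1 (\<lambda>z. of_real (f z) * iexp (x \<bullet> z))" "integrable L2 (\<lambda>z. of_real (f z) * iexp (x \<bullet> z))"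
    if [measurable]: "f \<in> borel_measurable borel" and b: "bounded (range f)" for f :: "'a \<Rightarrow> real" and x
  proof -
    obtain B where B: "\<And>z. norm (f z) \<le> B" using b by (auto simp: bounded_iff)
    show "integrable L1 (\<lambda>z. of_real (f z) * iexp (x \<bullet> z))" "integrable L2 (\<lambda>z. of_real (f z) * iexp (x \<bullet> z))"
      using B L by (auto intro!: bounded_integrable[of _ _ B] simp: norm_mult)
  qed
  have P1: "P (\<lambda>z. 1)" using eq by (simp add: P_def)
  have Padd: "P (\<lambda>z. f z + h z)" if "P f" "P h" for f h
    using that unfolding P_def by (auto simp: distrib_right int intro!: bounded_plus_comp)
  have Pscale: "P (\<lambda>z. c * f z)" if "P f" for f c
    using that bounded_scaleR_comp[of f UNIV c] unfolding P_def by (auto simp: mult.assoc)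
  have Psin: "P (\<lambda>z. f z * sin (s * (z \<bullet> i)))" if P: "P f" for f s i
  proof -
    have f[measurable]: "f \<in> borel_measurable borel" and b: "bounded (range f)" using P by (auto simp: P_def)
    obtain B where B: "\<And>z. norm (f z) \<le> B" using b by (auto simp: bounded_iff)
    have "norm (f z * sin (s * (z \<bullet> i))) \<le> B * 1" for z
      unfolding norm_mult using B[of z] by (intro mult_mono) auto
    then have "bounded (range (\<lambda>z. f z * sin (s * (z \<bullet> i))))" by (auto simp: bounded_iff)
    moreover have "(\<integral>z. of_real (f z * sin (s * (z \<bullet> i))) * iexp (x \<bullet> z) \<partial>L1) =
        (\<integral>z. of_real (f z * sin (s * (z \<bullet> i))) * iexp (x \<bullet> z) \<partial>L2)" for x
    proof -
      \<comment> \<open>Euler's formula splits the sine into two exponentials, which shift the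
        frequency \<open>x\<close> by \<open>s *\<^sub>R i\<close> in either direction.\<close>
      have e: "of_real (f z * sin (s * (z \<bullet> i))) * iexp (x \<bullet> z) =
        (-\<i> / 2) * (of_real (f z) * iexp ((x + s *\<^sub>R i) \<bullet> z) - of_real (f z) * iexp ((x - s *\<^sub>R i) \<bullet> z))" for z
      proof -
        have 1: "of_real (sin (s * (z \<bullet> i))) = (-\<i> / 2) * (iexp (s * (z \<bullet> i)) - iexp (- (s * (z \<bullet> i))))"
          unfolding cis_conv_exp[symmetric] by (simp add: complex_eq_iff)
        have 2: "iexp ((x + s *\<^sub>R i) \<bullet> z) = iexp (x \<bullet> z) * iexp (s * (z \<bullet> i))"
          "iexp ((x - s *\<^sub>R i) \<bullet> z) = iexp (x \<bullet> z) * iexp (- (s * (z \<bullet> i)))"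
          by (simp_all add: inner_add_left inner_diff_left inner_commute[of i] exp_add[symmetric] algebra_simps)
        show ?thesis unfolding of_real_mult 1 2 by algebra
      qed
      show ?thesis unfolding e using P by (simp add: int[OF f b] P_def)
    qed
    ultimately show ?thesis by (auto simp: P_def)
  qed
  define \<sigma> where "\<sigma> s z = (\<Sum>i\<in>Basis. (sin (s * (z \<bullet> i)) / s) *\<^sub>R i)" for s :: real and z :: 'a
  have Ppoly: "real_polynomial_function p \<Longrightarrow> P f \<Longrightarrow> P (\<lambda>z. f z * p (\<sigma> s z))" for p f s
  proof (induction p arbitrary: f rule: real_polynomial_function.induct)
    case (linear l)
    interpret l: bounded_linear l by fact
    have "P (\<lambda>z. \<Sum>i\<in>I. (l i / s) * (f z * sin (s * (z \<bullet> i))))" if "finite I" for I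
      using that
    proof (induction I)
      case empty
      show ?case using Pscale[OF linear(2), of 0] by simp
    next
      case (insert j I)
      have "P (\<lambda>z. (l j / s) * (f z * sin (s * (z \<bullet> j))) + (\<Sum>i\<in>I. (l i / s) * (f z * sin (s * (z \<bullet> i)))))"
        by (rule Padd[OF Pscale[OF Psin[OF linear(2)]] insert.IH])
      then show ?case using insert.hyps by simp
    qed
    from this[OF finite_Basis] show ?case
      by (simp add: \<sigma>_def l.sum l.scaleR sum_distrib_left mult_ac)
  next
    case (const c)
    then show ?case using Pscale[of f c] by (simp add: mult.commute)
  next
    case (add p q)
    then show ?case using Padd[OF add.IH(1)[OF add.prems] add.IH(2)[OF add.prems]] by (simp add: distrib_left)
  next
    case (mult p q)
    then show ?case using mult.IH(2)[OF mult.IH(1)[OF mult.prems]] by (simp add: mult.assoc)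
  qed
  obtain B where B: "\<And>z. norm (g z) \<le> B" using g(2) by (auto simp: bounded_iff)
  have \<sigma>_cont: "continuous_on UNIV (\<sigma> s)" for s unfolding \<sigma>_def by (cases "s = 0") (auto intro!: continuous_intros)
  have g\<sigma>: "(\<lambda>z. g (\<sigma> s z)) \<in> borel_measurable borel" for s
    by (intro borel_measurable_continuous_onI continuous_on_compose2[OF g(1) \<sigma>_cont]) auto
  have step: "(\<integral>z. g (\<sigma> s z) \<partial>L1) = (\<integral>z. g (\<sigma> s z) \<partial>L2)" if s: "s > 0" for s
  proof -
    \<comment> \<open>A compact cube containing the range of \<open>\<sigma> s\<close>, so that
      uniform approximation on it controls both integrals.\<close>
    let ?C = "cbox (\<Sum>i\<in>Basis. (- 1 / s) *\<^sub>R i) (\<Sum>i\<in>Basis. (1 / s) *\<^sub>R i) :: 'a set"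
    have \<sigma>C: "\<sigma> s z \<in> ?C" for z
      using s divide_right_mono[OF sin_ge_minus_one, of s] unfolding mem_box \<sigma>_def
      by (auto simp: inner_sum_left inner_Basis if_distrib cong: if_cong intro!: divide_right_mono)
    have "\<bar>(\<integral>z. g (\<sigma> s z) \<partial>L1) - (\<integral>z. g (\<sigma> s z) \<partial>L2)\<bar> \<le> 0 + e" if e: "e > 0" for e
    proof -
      obtain p where p: "real_polynomial_function p" "\<And>w. w \<in> ?C \<Longrightarrow> \<bar>g w - p w\<bar> < e / 2"
        using Stone_Weierstrass_real_polynomial_function[OF compact_cbox continuous_on_subset[OF g(1) subset_UNIV], of "e / 2"] e
        by (metis half_gt_zero)
      have Pp: "P (\<lambda>z. p (\<sigma> s z))" using Ppoly[OF p(1) P1, of s] by simp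
      then have pm: "(\<lambda>z. p (\<sigma> s z)) \<in> borel_measurable borel" and pb: "bounded (range (\<lambda>z. p (\<sigma> s z)))" by (auto simp: P_def)
      obtain B' where B': "\<And>z. norm (p (\<sigma> s z)) \<le> B'" using pb by (auto simp: bounded_iff)
      have i: "integrable L1 (\<lambda>z. g (\<sigma> s z))" "integrable L2 (\<lambda>z. g (\<sigma> s z))"
        "integrable L1 (\<lambda>z. p (\<sigma> s z))" "integrable L2 (\<lambda>z. p (\<sigma> s z))"
        using L g\<sigma> pm B B' by (auto intro!: bounded_integrable)
      have "complex_of_real (\<integral>z. p (\<sigma> s z) \<partial>L1) = complex_of_real (\<integral>z. p (\<sigma> s z) \<partial>L2)"
        using Pp[unfolded P_def, THEN conjunct2, THEN conjunct2, rule_format, of 0] by simp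
      then have pe: "(\<integral>z. p (\<sigma> s z) \<partial>L1) = (\<integral>z. p (\<sigma> s z) \<partial>L2)" by simp
      have d: "\<bar>(\<integral>z. g (\<sigma> s z) \<partial>L) - (\<integral>z. p (\<sigma> s z) \<partial>L)\<bar> \<le> e / 2"
        if L: "prob_space L" "integrable L (\<lambda>z. g (\<sigma> s z))" "integrable L (\<lambda>z. p (\<sigma> s z))" for L
      proof -
        interpret L: prob_space L by fact
        have "\<bar>(\<integral>z. g (\<sigma> s z) \<partial>L) - (\<integral>z. p (\<sigma> s z) \<partial>L)\<bar> = norm (\<integral>z. g (\<sigma> s z) - p (\<sigma> s z) \<partial>L)"
          using L by simp
        also have "\<dots> \<le> (\<integral>z. e / 2 \<partial>L)"
          using L p(2)[OF \<sigma>C] by (intro Bochner_Integration.integral_norm_bound_integral) (auto intro: less_imp_le)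
        finally show ?thesis by (simp add: L.prob_space)
      qed
      show ?thesis using d[OF L(1) i(1) i(3)] d[OF L(2) i(2) i(4)] pe by linarith
    qed
    then have "\<bar>(\<integral>z. g (\<sigma> s z) \<partial>L1) - (\<integral>z. g (\<sigma> s z) \<partial>L2)\<bar> \<le> 0" by (rule field_le_epsilon)
    then show ?thesis by simp
  qed
  have \<sigma>_lim: "(\<lambda>n. \<sigma> (1 / Suc n) z) \<longlonglongrightarrow> z" for z
  proof -
    have "(\<lambda>n. sin ((1 / Suc n) * y) / (1 / Suc n)) \<longlonglongrightarrow> y" for y :: real
    proof -
      have "((\<lambda>x. sin (x * y)) has_real_derivative (cos (0 * y) * y)) (at 0)"
        by (auto intro!: derivative_eq_intros)
      then have "((\<lambda>h. sin (h * y) / h) \<longlongrightarrow> y) (at 0)" by (simp add: DERIV_def)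
      moreover have "filterlim (\<lambda>n. 1 / real (Suc n)) (at 0) sequentially"
        using LIMSEQ_inverse_real_of_nat by (auto simp: filterlim_at inverse_eq_divide)
      ultimately show ?thesis by (rule filterlim_compose)
    qed
    then have "(\<lambda>n. \<sigma> (1 / Suc n) z) \<longlonglongrightarrow> (\<Sum>i\<in>Basis. (z \<bullet> i) *\<^sub>R i)"
      unfolding \<sigma>_def by (intro tendsto_intros)
    then show ?thesis by (simp add: euclidean_representation)
  qed
  have lim: "(\<lambda>n. \<integral>z. g (\<sigma> (1 / Suc n) z) \<partial>L) \<longlonglongrightarrow> integral\<^sup>L L g" if L: "prob_space L" "sets L = sets borel" for L
  proof (rule integral_dominated_convergence[where w = "\<lambda>_. B"])
    interpret L: prob_space L by fact
    note [measurable_cong] = L(2)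
    have "isCont g z" for z using g(1) by (simp add: continuous_on_eq_continuous_at)
    then show "AE z in L. (\<lambda>n. g (\<sigma> (1 / Suc n) z)) \<longlonglongrightarrow> g z"
      by (intro AE_I2 isCont_tendsto_compose[OF _ \<sigma>_lim])
    show "g \<in> borel_measurable L" "(\<lambda>z. g (\<sigma> (1 / Suc n) z)) \<in> borel_measurable L" for n
      using borel_measurable_continuous_onI[OF g(1)] g\<sigma> L(2) by (auto cong: measurable_cong_sets)
    show "integrable L (\<lambda>_. B)" by simp
    show "AE z in L. norm (g (\<sigma> (1 / Suc n) z)) \<le> B" for n using B by simp
  qed
  have "(\<lambda>n. \<integral>z. g (\<sigma> (1 / Suc n) z) \<partial>L1) \<longlonglongrightarrow> integral\<^sup>L L2 g"
    using lim[OF L(2,4)] step[of "1 / Suc n" for n] by simp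
  then show ?thesis using lim[OF L(1,3)] LIMSEQ_unique by blast
qed

section \<open>Tightness and the continuity theorem\<close>

lemma char_std_normal: "(\<integral>x. iexp (t * x) \<partial>std_normal_distribution) = complex_of_real (exp (- t\<^sup>2 / 2))"
  using char_std_normal_distribution by (simp add: char_def fun_eq_iff)

context prob_space
begin

text \<open>Averaging \<open>1 - \<phi>\<close> over a Gaussian frequency bounds the tails.\<close>

lemma gaussian_average_char:
  fixes X :: "'a \<Rightarrow> real"
  assumes [measurable]: "X \<in> borel_measurable M"
  shows "(\<integral>x. 1 - (\<integral>\<omega>. iexp (s * x * X \<omega>) \<partial>M) \<partial>std_normal_distribution) =
     complex_of_real (\<integral>\<omega>. 1 - exp (- (s * X \<omega>)\<^sup>2 / 2) \<partial>M)"
proof -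
  interpret N: real_distribution std_normal_distribution by (rule real_dist_normal_dist)
  interpret P: pair_prob_space std_normal_distribution M ..
  have m: "(\<lambda>(x, \<omega>). iexp (s * x * X \<omega>)) \<in> borel_measurable (std_normal_distribution \<Otimes>\<^sub>M M)" by measurable
  have i: "integrable (std_normal_distribution \<Otimes>\<^sub>M M) (\<lambda>(x, \<omega>). iexp (s * x * X \<omega>))"
    by (rule P.integrable_const_bound[OF _ m, of 1]) auto
  have ix: "integrable std_normal_distribution (\<lambda>x. \<integral>\<omega>. iexp (s * x * X \<omega>) \<partial>M)"
    using P.integrable_fst[OF i] by simp
  have "(\<integral>x. (\<integral>\<omega>. iexp (s * x * X \<omega>) \<partial>M) \<partial>std_normal_distribution) =
      (\<integral>\<omega>. (\<integral>x. iexp (s * x * X \<omega>) \<partial>std_normal_distribution) \<partial>M)"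
    by (rule P.Fubini_integral[OF i, symmetric])
  also have "\<dots> = (\<integral>\<omega>. complex_of_real (exp (- (s * X \<omega>)\<^sup>2 / 2)) \<partial>M)"
    using char_std_normal[of "s * X \<omega>" for \<omega>] by (simp add: mult_ac)
  finally have e: "(\<integral>x. (\<integral>\<omega>. iexp (s * x * X \<omega>) \<partial>M) \<partial>std_normal_distribution) =
      complex_of_real (\<integral>\<omega>. exp (- (s * X \<omega>)\<^sup>2 / 2) \<partial>M)" by simp
  have "integrable M (\<lambda>\<omega>. exp (- (s * X \<omega>)\<^sup>2 / 2))"
    by (rule integrable_const_bound[of _ 1]) auto
  then show ?thesis using ix e N.prob_space by (simp add: prob_space)
qed

text \<open>Continuity of \<phi> at 0 makes the Gaussian average of \<open>1 - \<phi>\<close> small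
  at a small scale \<open>s\<close>. By dominated convergence the averages for the approximating
  characteristic functions are small for large \<open>n\<close>; these are expectations of
  \<open>1 - exp (- (s * y)\<^sup>2 / 2)\<close> at a coordinate \<open>y\<close> of
  \<open>Z n\<close>, and so control the probability of
  \<open>\<bar>y\<bar> > 1 / s\<close>.\<close>

lemma char_tight:
  fixes Z :: "nat \<Rightarrow> 'a \<Rightarrow> 'b::euclidean_space"
  assumes Z[measurable]: "\<And>n. Z n \<in> borel_measurable M"
    and lim: "\<And>x. (\<lambda>n. \<integral>\<omega>. iexp (x \<bullet> Z n \<omega>) \<partial>M) \<longlonglongrightarrow> \<phi> x"
    and \<phi>: "isCont \<phi> 0" and \<epsilon>: "\<epsilon> > 0"
  shows "\<exists>R. \<forall>\<^sub>F n in sequentially. prob {\<omega> \<in> space M. norm (Z n \<omega>) > R} \<le> \<epsilon>"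
proof -
  interpret N: real_distribution std_normal_distribution by (rule real_dist_normal_dist)
  define \<phi>n where "\<phi>n n x = (\<integral>\<omega>. iexp (x \<bullet> Z n \<omega>) \<partial>M)" for n x
  have \<phi>n_le: "norm (\<phi>n n x) \<le> 1" for n x
    unfolding \<phi>n_def using integral_norm_bound[of M "\<lambda>\<omega>. iexp (x \<bullet> Z n \<omega>)"] by (simp add: prob_space)
  have \<phi>_le: "norm (\<phi> x) \<le> 1" for x
    by (rule Lim_norm_ubound[OF _ lim]) (use \<phi>n_le[unfolded \<phi>n_def] in auto)
  have \<phi>0: "\<phi> 0 = 1" using LIMSEQ_unique[OF lim[of 0]] by (simp add: prob_space)
  have mn: "(\<lambda>x. \<phi>n n ((s * x) *\<^sub>R i)) \<in> borel_measurable std_normal_distribution" for n s i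
    unfolding \<phi>n_def by measurable
  have m: "(\<lambda>x. \<phi> ((s * x) *\<^sub>R i)) \<in> borel_measurable std_normal_distribution" for s i
    by (rule borel_measurable_LIMSEQ_metric[where f = "\<lambda>n x. \<phi>n n ((s * x) *\<^sub>R i)", OF mn]) (simp only: \<phi>n_def lim)
  define \<Psi> where "\<Psi> i s = (\<integral>x. 1 - \<phi> ((s * x) *\<^sub>R i) \<partial>std_normal_distribution)" for i s
  define \<Psi>n where "\<Psi>n n i s = (\<integral>\<omega>. 1 - exp (- (s * (Z n \<omega> \<bullet> i))\<^sup>2 / 2) \<partial>M)" for n i s
  have b2: "norm (1 - w) \<le> 2" if "norm w \<le> 1" for w :: complex
    using norm_triangle_ineq4[of 1 w] that by simp
  have conv: "(\<lambda>n. complex_of_real (\<Psi>n n i s)) \<longlonglongrightarrow> \<Psi> i s" for i s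
  proof -
    have "(\<lambda>n. \<integral>x. 1 - \<phi>n n ((s * x) *\<^sub>R i) \<partial>std_normal_distribution) \<longlonglongrightarrow> \<Psi> i s"
      unfolding \<Psi>_def
    proof (rule integral_dominated_convergence[where w = "\<lambda>_. 2"])
      show "AE x in std_normal_distribution. (\<lambda>n. 1 - \<phi>n n ((s * x) *\<^sub>R i)) \<longlonglongrightarrow> 1 - \<phi> ((s * x) *\<^sub>R i)"
        unfolding \<phi>n_def by (intro AE_I2 tendsto_intros lim)
    qed (use mn m b2[OF \<phi>n_le] in auto)
    moreover have "(\<integral>x. 1 - \<phi>n n ((s * x) *\<^sub>R i) \<partial>std_normal_distribution) = \<Psi>n n i s" for n
      using gaussian_average_char[of "\<lambda>\<omega>. Z n \<omega> \<bullet> i" s]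
      by (simp add: \<phi>n_def \<Psi>n_def inner_commute[of i] mult_ac)
    ultimately show ?thesis by simp
  qed
  \<comment> \<open>\<open>1 - exp (- 1 / 2)\<close> bounds the averaged function from below on the
    tail event of one coordinate; dividing by the dimension leaves room for the union over
    coordinates.\<close>
  define \<eta> where "\<eta> = \<epsilon> * (1 - exp (- 1 / 2)) / DIM('b)"
  have e1: "1 - exp (- 1 / 2 :: real) > 0" by simp
  then have \<eta>: "\<eta> > 0" using \<epsilon> by (simp add: \<eta>_def)
  have small: "\<forall>\<^sub>F k in sequentially. norm (\<Psi> i (1 / Suc k)) < \<eta>" for i
  proof -
    have "(\<lambda>k. \<Psi> i (1 / Suc k)) \<longlonglongrightarrow> (\<integral>x. 0 \<partial>std_normal_distribution)"
      unfolding \<Psi>_def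
    proof (rule integral_dominated_convergence[where w = "\<lambda>_. 2"])
      have "(\<lambda>k. (1 / Suc k * x) *\<^sub>R i) \<longlonglongrightarrow> (0 * x) *\<^sub>R i" for x
        using LIMSEQ_inverse_real_of_nat by (intro tendsto_intros) (simp add: inverse_eq_divide)
      then have "(\<lambda>k. \<phi> ((1 / Suc k * x) *\<^sub>R i)) \<longlonglongrightarrow> \<phi> 0" for x
        by (intro isCont_tendsto_compose[OF \<phi>]) simp
      then have "(\<lambda>k. 1 - \<phi> ((1 / Suc k * x) *\<^sub>R i)) \<longlonglongrightarrow> 1 - \<phi> 0" for x
        by (intro tendsto_diff tendsto_const)
      then show "AE x in std_normal_distribution. (\<lambda>k. 1 - \<phi> ((1 / Suc k * x) *\<^sub>R i)) \<longlonglongrightarrow> 0"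
        by (simp add: \<phi>0)
      show "(\<lambda>x. 1 - \<phi> ((1 / Suc k * x) *\<^sub>R i)) \<in> borel_measurable std_normal_distribution" for k
        by (intro borel_measurable_diff m) simp
    qed (use b2[OF \<phi>_le] in auto)
    then have "(\<lambda>k. norm (\<Psi> i (1 / Suc k))) \<longlonglongrightarrow> 0" by (intro tendsto_norm_zero) simp
    then show ?thesis using \<eta> by (rule order_tendstoD(2))
  qed
  have "\<forall>\<^sub>F k in sequentially. \<forall>i\<in>Basis. norm (\<Psi> i (1 / Suc k)) < \<eta>"
    using small by (simp add: eventually_ball_finite_distrib)
  then obtain k where k: "\<And>i. i \<in> Basis \<Longrightarrow> norm (\<Psi> i (1 / Suc k)) < \<eta>"
    by (auto simp: eventually_sequentially)
  define s :: real where "s = 1 / Suc k"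
  have s: "s > 0" by (simp add: s_def)
  have "\<forall>\<^sub>F n in sequentially. \<forall>i\<in>Basis. norm (complex_of_real (\<Psi>n n i s)) < \<eta>"
    unfolding eventually_ball_finite_distrib[OF finite_Basis]

    using k by (auto simp only: s_def intro!: order_tendstoD(2)[OF tendsto_norm[OF conv]])
  then have "\<forall>\<^sub>F n in sequentially. prob {\<omega> \<in> space M. norm (Z n \<omega>) > DIM('b) / s} \<le> \<epsilon>"
  proof eventually_elim
    case (elim n)
    have tail: "prob {\<omega> \<in> space M. \<bar>Z n \<omega> \<bullet> i\<bar> > 1 / s} \<le> \<epsilon> / DIM('b)" if i: "i \<in> Basis" for i
    proof -
      let ?A = "{\<omega> \<in> space M. \<bar>Z n \<omega> \<bullet> i\<bar> > 1 / s}"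
      have "(1 - exp (- 1 / 2)) * prob ?A = (\<integral>\<omega>. (1 - exp (- 1 / 2)) * indicator ?A \<omega> \<partial>M)" by simp
      also have "\<dots> \<le> \<Psi>n n i s" unfolding \<Psi>n_def
      proof (rule integral_mono)
        show "integrable M (\<lambda>\<omega>. (1 - exp (- 1 / 2)) * indicat_real ?A \<omega>)"
          by (rule integrable_const_bound[of _ 1]) (auto simp: indicator_def)
        show "integrable M (\<lambda>\<omega>. 1 - exp (- (s * (Z n \<omega> \<bullet> i))\<^sup>2 / 2))"
          by (rule integrable_const_bound[of _ 1]) auto
        fix \<omega>
        show "(1 - exp (- 1 / 2)) * indicat_real ?A \<omega> \<le> 1 - exp (- (s * (Z n \<omega> \<bullet> i))\<^sup>2 / 2)"
        proof (cases "\<omega> \<in> ?A")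
          case True
          then have "1 \<le> \<bar>s * (Z n \<omega> \<bullet> i)\<bar>" using s by (simp add: abs_mult field_simps)
          then have "1 \<le> (s * (Z n \<omega> \<bullet> i))\<^sup>2" using abs_le_square_iff[of 1 "s * (Z n \<omega> \<bullet> i)"] by simp
          then show ?thesis using True by simp
        qed simp
      qed
      also have "\<dots> \<le> \<eta>" using elim i by auto
      finally have "prob ?A \<le> \<eta> / (1 - exp (- 1 / 2))" using e1 by (simp add: field_simps)
      also have "\<dots> = \<epsilon> / DIM('b)" unfolding \<eta>_def using e1 by simp
      finally show ?thesis .
    qed
    have "{\<omega> \<in> space M. norm (Z n \<omega>) > DIM('b) / s} \<subseteq> (\<Union>i\<in>Basis. {\<omega> \<in> space M. \<bar>Z n \<omega> \<bullet> i\<bar> > 1 / s})"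
    proof
      fix \<omega> assume w: "\<omega> \<in> {\<omega> \<in> space M. norm (Z n \<omega>) > DIM('b) / s}"
      show "\<omega> \<in> (\<Union>i\<in>Basis. {\<omega> \<in> space M. \<bar>Z n \<omega> \<bullet> i\<bar> > 1 / s})"
      proof (rule ccontr)
        assume "\<not> ?thesis"
        then have "\<bar>Z n \<omega> \<bullet> i\<bar> \<le> 1 / s" if "i \<in> Basis" for i using w that by (auto simp: not_less)
        then have "(\<Sum>i\<in>Basis. \<bar>Z n \<omega> \<bullet> i\<bar>) \<le> DIM('b) * (1 / s)"
          by (rule sum_bounded_above)
        then show False using norm_le_l1[of "Z n \<omega>"] w by simp
      qed
    qed
    then have "prob {\<omega> \<in> space M. norm (Z n \<omega>) > DIM('b) / s} \<le> prob (\<Union>i\<in>Basis. {\<omega> \<in> space M. \<bar>Z n \<omega> \<bullet> i\<bar> > 1 / s})"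
      by (intro finite_measure_mono) auto
    also have "\<dots> \<le> (\<Sum>i\<in>Basis. prob {\<omega> \<in> space M. \<bar>Z n \<omega> \<bullet> i\<bar> > 1 / s})"
      by (intro measure_UNION_le) auto
    also have "\<dots> \<le> DIM('b) * (\<epsilon> / DIM('b))" using tail by (rule sum_bounded_above)
    finally show ?case by simp
  qed
  then show ?thesis by blast
qed

text \<open>Every subsequence has a further one with a weak limit, and the characteristic function
  of that limit is \<phi>. By uniqueness such limits integrate bounded continuous functions alike,
  so a subsequence staying away from one fixed \<open>L\<close> is impossible.\<close>

theorem Levy_continuity_euclidean:
  fixes Z :: "nat \<Rightarrow> 'a \<Rightarrow> 'b::euclidean_space"
  assumes Z[measurable]: "\<And>n. Z n \<in> borel_measurable M"
    and lim: "\<And>x. (\<lambda>n. \<integral>\<omega>. iexp (x \<bullet> Z n \<omega>) \<partial>M) \<longlonglongrightarrow> \<phi> x"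
    and \<phi>: "isCont \<phi> 0"
  shows "\<exists>L. prob_space L \<and> sets L = sets borel \<and> (\<forall>x. (\<integral>z. iexp (x \<bullet> z) \<partial>L) = \<phi> x) \<and> conv_in_distr M Z L"
proof -
  define \<mu> where "\<mu> n = distr M borel (Z n)" for n
  have \<mu>: "prob_space (\<mu> n)" "sets (\<mu> n) = sets borel" for n
    unfolding \<mu>_def by (auto intro: prob_space_distr)
  have \<mu>_int: "integral\<^sup>L (\<mu> n) g = (\<integral>\<omega>. g (Z n \<omega>) \<partial>M)" if "continuous_on UNIV g"
    for n and g :: "'b \<Rightarrow> real"
    unfolding \<mu>_def by (rule integral_distr_borel[OF Z that])
  have sub: "\<exists>(r :: nat \<Rightarrow> nat) L. strict_mono r \<and> prob_space L \<and> sets L = sets borel \<and> (\<forall>x. (\<integral>z. iexp (x \<bullet> z) \<partial>L) = \<phi> x) \<and>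
     (\<forall>g::'b \<Rightarrow> real. continuous_on UNIV g \<longrightarrow> bounded (range g) \<longrightarrow>
        (\<lambda>n. \<integral>\<omega>. g (Z (s (r n)) \<omega>) \<partial>M) \<longlonglongrightarrow> integral\<^sup>L L g)" if s: "strict_mono s" for s :: "nat \<Rightarrow> nat"
  proof -
    have "\<exists>R. \<forall>\<^sub>F n in sequentially. measure (\<mu> n) {z. norm z > R} \<le> \<epsilon>" if \<epsilon>: "\<epsilon> > 0" for \<epsilon>
    proof -
      have "measure (\<mu> n) {z. norm z > R} = prob {\<omega> \<in> space M. norm (Z n \<omega>) > R}" for n R
        unfolding \<mu>_def by (subst measure_distr) (auto intro!: arg_cong[where f = prob])
      then show ?thesis using char_tight[OF Z lim \<phi> \<epsilon>] by simp
    qed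
    from euclidean_Helly[OF \<mu> this s] obtain r :: "nat \<Rightarrow> nat" and L where r: "strict_mono r" and L: "prob_space L" "sets L = sets borel"
      and conv: "\<And>g::'b \<Rightarrow> real. continuous_on UNIV g \<Longrightarrow> bounded (range g) \<Longrightarrow>
        (\<lambda>n. integral\<^sup>L (\<mu> (s (r n))) g) \<longlonglongrightarrow> integral\<^sup>L L g" by blast
    have conv': "(\<lambda>n. \<integral>\<omega>. g (Z (s (r n)) \<omega>) \<partial>M) \<longlonglongrightarrow> integral\<^sup>L L g"
      if "continuous_on UNIV g" "bounded (range g)" for g :: "'b \<Rightarrow> real"
      using conv[OF that] \<mu>_int[OF that(1)] by simp
    have sr: "strict_mono (\<lambda>n. s (r n))" using strict_mono_o[OF s r] by (simp add: o_def)
    have "(\<integral>z. iexp (x \<bullet> z) \<partial>L) = \<phi> x" for x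
    proof -
      interpret L: prob_space L by fact
      have cs: "continuous_on UNIV (\<lambda>z. cos (x \<bullet> z))" "continuous_on UNIV (\<lambda>z. sin (x \<bullet> z))"
        by (auto intro!: continuous_intros)
      have bs: "bounded (range (\<lambda>z. cos (x \<bullet> z)))" "bounded (range (\<lambda>z. sin (x \<bullet> z)))"
        by (auto simp: bounded_iff intro!: exI[of _ 1])
      \<comment> \<open>Weak convergence is at hand for real test functions, hence the splitting
        into cosine and sine.\<close>
      have e: "(\<integral>w. iexp (f w) \<partial>K) = Complex (\<integral>w. cos (f w) \<partial>K) (\<integral>w. sin (f w) \<partial>K)"
        if "prob_space K" "f \<in> borel_measurable K" for K :: "'z measure" and f :: "'z \<Rightarrow> real"
      proof -
        interpret K: prob_space K by fact
        have "integrable K (\<lambda>w. iexp (f w))"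
          by (rule K.integrable_iexp) (use that in auto)
        then show ?thesis by (simp add: complex_eq_iff integral_Re[symmetric] integral_Im[symmetric] Re_exp Im_exp)
      qed
      have "(\<lambda>n. \<integral>\<omega>. iexp (x \<bullet> Z (s (r n)) \<omega>) \<partial>M) \<longlonglongrightarrow> Complex (\<integral>z. cos (x \<bullet> z) \<partial>L) (\<integral>z. sin (x \<bullet> z) \<partial>L)"
        by (subst e) (auto intro!: tendsto_Complex conv' cs bs prob_space_axioms)
      also have "Complex (\<integral>z. cos (x \<bullet> z) \<partial>L) (\<integral>z. sin (x \<bullet> z) \<partial>L) = (\<integral>z. iexp (x \<bullet> z) \<partial>L)"
        by (rule e[symmetric]) (use L in \<open>auto cong: measurable_cong_sets\<close>)
      finally show ?thesis
        using LIMSEQ_subseq_LIMSEQ[OF lim[of x] sr] LIMSEQ_unique by (auto simp: o_def)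
    qed
    then show ?thesis using r L conv' by blast
  qed
  obtain r0 L where L: "prob_space L" "sets L = sets borel" "\<And>x. (\<integral>z. iexp (x \<bullet> z) \<partial>L) = \<phi> x"
    using sub[of id] by (auto simp: strict_mono_id)
  have "(\<lambda>n. \<integral>\<omega>. g (Z n \<omega>) \<partial>M) \<longlonglongrightarrow> integral\<^sup>L L g"
    if g: "continuous_on UNIV g" "bounded (range g)" for g :: "'b \<Rightarrow> real"
  proof (rule ccontr)
    assume "\<not> ?thesis"
    then obtain e where e: "e > 0" "\<And>N. \<exists>n\<ge>N. e \<le> dist (\<integral>\<omega>. g (Z n \<omega>) \<partial>M) (integral\<^sup>L L g)"
      by (auto simp: lim_sequentially not_less)
    then have "infinite {n. e \<le> dist (\<integral>\<omega>. g (Z n \<omega>) \<partial>M) (integral\<^sup>L L g)}"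
      by (auto simp: infinite_nat_iff_unbounded_le)
    from infinite_enumerate[OF this] obtain s :: "nat \<Rightarrow> nat" where s: "strict_mono s"
      "\<And>n. e \<le> dist (\<integral>\<omega>. g (Z (s n) \<omega>) \<partial>M) (integral\<^sup>L L g)" by auto
    from sub[OF s(1)] obtain r L' where L': "prob_space L'" "sets L' = sets borel" "\<And>x. (\<integral>z. iexp (x \<bullet> z) \<partial>L') = \<phi> x"
      and c: "(\<lambda>n. \<integral>\<omega>. g (Z (s (r n)) \<omega>) \<partial>M) \<longlonglongrightarrow> integral\<^sup>L L' g" using g by blast
    have "integral\<^sup>L L' g = integral\<^sup>L L g"
      by (rule characteristic_function_unique) (use L L' g in auto)
    then have "\<forall>\<^sub>F n in sequentially. dist (\<integral>\<omega>. g (Z (s (r n)) \<omega>) \<partial>M) (integral\<^sup>L L g) < e"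
      using c e(1) by (simp add: tendsto_iff)
    then show False using s(2) by (auto simp: eventually_sequentially not_less[symmetric])
  qed
  then show ?thesis using L by (auto simp: conv_in_distr_def)
qed

end

section \<open>Sequences adapted to an independent past\<close>

text \<open>General index sets are allowed so that the past of \<open>t\<close> can be divided into
  finitely many recent steps and the remote rest.\<close>

definition block_sigma :: "'w measure \<Rightarrow> (int \<Rightarrow> 'w \<Rightarrow> 'a::topological_space) \<Rightarrow> int set \<Rightarrow> 'w measure" where
  "block_sigma M X S = sigma (space M) {X s -` A \<inter> space M | s A. s \<in> S \<and> A \<in> sets borel}"

lemma past_sigma_eq: "past_sigma M X t = block_sigma M X {..<t}"
  by (simp add: past_sigma_def block_sigma_def)

lemma space_block_sigma[simp]: "space (block_sigma M X S) = space M"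
  unfolding block_sigma_def by (rule space_measure_of) auto

lemma sets_block_sigma:
  "sets (block_sigma M X S) = sigma_sets (space M) {X s -` A \<inter> space M | s A. s \<in> S \<and> A \<in> sets borel}"
  unfolding block_sigma_def by (rule sets_measure_of) auto

lemma sets_block_sigma_mono: "S \<subseteq> T \<Longrightarrow> sets (block_sigma M X S) \<subseteq> sets (block_sigma M X T)"
  unfolding sets_block_sigma by (rule sigma_sets_mono') auto

lemma subalgebra_block_sigma:
  assumes "\<And>s. X s \<in> borel_measurable M"
  shows "subalgebra M (block_sigma M X S)"
proof -
  have "sets (block_sigma M X S) \<subseteq> sets M"
    unfolding sets_block_sigma using measurable_sets[OF assms] by (intro sets.sigma_sets_subset) auto
  then show ?thesis by (simp add: subalgebra_def)
qed

lemma measurable_block_sigma_mono: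
  "V \<in> measurable (block_sigma M X S) N \<Longrightarrow> S \<subseteq> T \<Longrightarrow> V \<in> measurable (block_sigma M X T) N"
  using sets_block_sigma_mono[of S T M X] by (auto simp: measurable_def)

lemma measurable_block_sigma_self: "s \<in> S \<Longrightarrow> X s \<in> borel_measurable (block_sigma M X S)"
  by (rule measurableI) (auto simp: sets_block_sigma intro!: sigma_sets.Basic)

lemma block_vec_measurable:
  assumes "\<And>t. X t \<in> borel_measurable M"
  shows "block_vec J X \<in> measurable M (PiM J (\<lambda>_. borel))"
  unfolding block_vec_def using assms by (intro measurable_restrict)

lemma stationary_expectation:
  fixes F :: "(int \<Rightarrow> 'b::topological_space) \<Rightarrow> 'c::{banach,second_countable_topology}"
  assumes "strictly_stationary M X" "finite J" "F \<in> borel_measurable (PiM J (\<lambda>_. borel))"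
  shows "(\<integral>\<omega>. F (block_vec J (\<lambda>t. X (t + h)) \<omega>) \<partial>M) = (\<integral>\<omega>. F (block_vec J X \<omega>) \<partial>M)"
proof -
  have m: "\<And>t. X t \<in> borel_measurable M" and
    e: "distr M (PiM J (\<lambda>_. borel)) (block_vec J (\<lambda>t. X (t + h))) = distr M (PiM J (\<lambda>_. borel)) (block_vec J X)"
    using assms by (auto simp: strictly_stationary_def)
  have "(\<integral>\<omega>. F (block_vec J (\<lambda>t. X (t + h)) \<omega>) \<partial>M) = integral\<^sup>L (distr M (PiM J (\<lambda>_. borel)) (block_vec J (\<lambda>t. X (t + h)))) F"
    by (rule integral_distr[symmetric, OF block_vec_measurable assms(3)]) (rule m)
  also have "\<dots> = (\<integral>\<omega>. F (block_vec J X \<omega>) \<partial>M)"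
    unfolding e by (rule integral_distr[OF block_vec_measurable assms(3)]) (rule m)
  finally show ?thesis .
qed

lemma stationary_distr:
  assumes "strictly_stationary M X"
  shows "distr M borel (X t) = distr M borel (X s)"
proof -
  have m: "\<And>t. X t \<in> borel_measurable M" using assms by (auto simp: strictly_stationary_def)
  have "distr M (PiM {s} (\<lambda>_. borel)) (block_vec {s} (\<lambda>u. X (u + (t - s)))) = distr M (PiM {s} (\<lambda>_. borel)) (block_vec {s} X)"
    using assms by (auto simp: strictly_stationary_def)
  then have "distr (distr M (PiM {s} (\<lambda>_. borel)) (block_vec {s} (\<lambda>u. X (u + (t - s))))) borel (\<lambda>x. x s) =
     distr (distr M (PiM {s} (\<lambda>_. borel)) (block_vec {s} X)) borel (\<lambda>x. x s)" by simp
  then show ?thesis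
    by (subst (asm) distr_distr, simp, (intro block_vec_measurable m))
       (subst (asm) distr_distr, simp, (intro block_vec_measurable m), simp add: block_vec_def o_def)
qed

section \<open>Decorrelation from the remote past\<close>

context prob_space
begin

text \<open>Preimages under a single variable form intersection-stable generators, and independence
  of such generators passes to the sigma-algebras generated by disjoint groups of indices. The two
  groups are indexed by \<open>bool\<close>.\<close>

lemma indep_block_sigma:
  fixes Y :: "int \<Rightarrow> 'a \<Rightarrow> 'b::topological_space"
  assumes ind: "indep_vars (\<lambda>_. borel) Y UNIV" and dis: "S \<inter> T = {}"
    and V: "V \<in> measurable (block_sigma M Y S) N1" and W: "W \<in> measurable (block_sigma M Y T) N2"
  shows "indep_var N1 V N2 W"
proof -
  have Y: "\<And>s. Y s \<in> borel_measurable M" using ind by (auto simp: indep_vars_def2)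
  let ?E = "\<lambda>s. {Y s -` A \<inter> space M | A. A \<in> sets borel}"
  let ?I = "\<lambda>b. if b then S else T"
  have "indep_sets ?E UNIV" using ind by (simp add: indep_vars_def2)
  then have "indep_sets ?E (\<Union> (?I ` (UNIV :: bool set)))" by (rule indep_sets_mono_index[rotated]) auto
  then have "indep_sets (\<lambda>b. sigma_sets (space M) (\<Union> (?E ` ?I b))) (UNIV :: bool set)"
  proof (rule indep_sets_collect_sigma)
    show "Int_stable (?E i)" for i
    proof (rule Int_stableI)
      fix a b assume "a \<in> ?E i" "b \<in> ?E i"
      then obtain A B where "a = Y i -` A \<inter> space M" "b = Y i -` B \<inter> space M" "A \<in> sets borel" "B \<in> sets borel" by auto
      then show "a \<inter> b \<in> ?E i" by (auto intro!: exI[of _ "A \<inter> B"])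
    qed
    show "disjoint_family_on ?I UNIV" using dis by (auto simp: disjoint_family_on_def)
  qed
  moreover have e: "sigma_sets (space M) (\<Union> (?E ` U)) = sets (block_sigma M Y U)" for U
    unfolding sets_block_sigma by (rule arg_cong[of _ _ "sigma_sets (space M)"]) auto
  ultimately have i: "indep_sets (\<lambda>b. sets (block_sigma M Y (?I b))) UNIV" by simp
  have sub: "sigma_sets (space M) {f -` A \<inter> space M | A. A \<in> sets N} \<subseteq> sets (block_sigma M Y U)"
    if "f \<in> measurable (block_sigma M Y U) N" for f :: "'a \<Rightarrow> 'z" and N U
  proof -
    have "{f -` A \<inter> space M | A. A \<in> sets N} \<subseteq> sets (block_sigma M Y U)"
      using measurable_sets[OF that] by auto
    then show ?thesis using sets.sigma_sets_subset[of _ "block_sigma M Y U"] by simp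
  qed
  have "indep_set (sigma_sets (space M) {V -` A \<inter> space M | A. A \<in> sets N1}) (sigma_sets (space M) {W -` A \<inter> space M | A. A \<in> sets N2})"
    unfolding indep_set_def
    by (rule indep_sets_mono_sets[OF i]) (use sub[OF V] sub[OF W] in \<open>auto split: bool.splits\<close>)
  moreover have "V \<in> measurable M N1" "W \<in> measurable M N2"
    using measurable_from_subalg[OF subalgebra_block_sigma[of Y M, OF Y]] V W by blast+
  ultimately show ?thesis by (simp add: indep_var_eq)
qed

text \<open>One \<open>m\<close> has to serve every remote variable \<eta>: in the application the
  lag varies while \<open>m\<close> is fixed.\<close>

definition decorrelates :: "(int \<Rightarrow> 'a \<Rightarrow> 'b::topological_space) \<Rightarrow> int \<Rightarrow> ('a \<Rightarrow> real) \<Rightarrow> bool" where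
  "decorrelates Y t \<xi> \<longleftrightarrow> (\<forall>\<epsilon>>0. \<exists>m::nat. \<forall>(\<eta>::'a \<Rightarrow> real)\<in>borel_measurable (block_sigma M Y {..<t - int m}).
     (\<forall>\<omega>\<in>space M. \<bar>\<eta> \<omega>\<bar> \<le> 1) \<longrightarrow> \<bar>(\<integral>\<omega>. \<xi> \<omega> * \<eta> \<omega> \<partial>M) - expectation \<xi> * expectation \<eta>\<bar> \<le> \<epsilon>)"

lemma decorrelatesI:
  assumes "\<And>\<epsilon>. \<epsilon> > 0 \<Longrightarrow> \<exists>m::nat. \<forall>(\<eta>::'a \<Rightarrow> real)\<in>borel_measurable (block_sigma M Y {..<t - int m}).
     (\<forall>\<omega>\<in>space M. \<bar>\<eta> \<omega>\<bar> \<le> 1) \<longrightarrow> \<bar>(\<integral>\<omega>. \<xi> \<omega> * \<eta> \<omega> \<partial>M) - expectation \<xi> * expectation \<eta>\<bar> \<le> \<epsilon>"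
  shows "decorrelates Y t \<xi>"
  using assms by (auto simp: decorrelates_def)

lemma decorrelatesE:
  assumes "decorrelates Y t \<xi>" "\<epsilon> > 0"
  obtains m0 :: nat where "\<And>m (\<eta>::'a \<Rightarrow> real). m \<ge> m0 \<Longrightarrow> \<eta> \<in> borel_measurable (block_sigma M Y {..<t - int m}) \<Longrightarrow>
     (\<And>\<omega>. \<omega> \<in> space M \<Longrightarrow> \<bar>\<eta> \<omega>\<bar> \<le> 1) \<Longrightarrow> \<bar>(\<integral>\<omega>. \<xi> \<omega> * \<eta> \<omega> \<partial>M) - expectation \<xi> * expectation \<eta>\<bar> \<le> \<epsilon>"
proof -
  obtain m0 where m0: "\<forall>(\<eta>::'a \<Rightarrow> real)\<in>borel_measurable (block_sigma M Y {..<t - int m0}).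
     (\<forall>\<omega>\<in>space M. \<bar>\<eta> \<omega>\<bar> \<le> 1) \<longrightarrow> \<bar>(\<integral>\<omega>. \<xi> \<omega> * \<eta> \<omega> \<partial>M) - expectation \<xi> * expectation \<eta>\<bar> \<le> \<epsilon>"
    using assms unfolding decorrelates_def by blast
  show ?thesis
  proof (rule that[of m0])
    fix m and \<eta> :: "'a \<Rightarrow> real" assume m: "m \<ge> m0" and \<eta>: "\<eta> \<in> borel_measurable (block_sigma M Y {..<t - int m})"
      and b: "\<And>\<omega>. \<omega> \<in> space M \<Longrightarrow> \<bar>\<eta> \<omega>\<bar> \<le> 1"
    have "\<eta> \<in> borel_measurable (block_sigma M Y {..<t - int m0})"
      by (rule measurable_block_sigma_mono[OF \<eta>]) (use m in auto)
    then show "\<bar>(\<integral>\<omega>. \<xi> \<omega> * \<eta> \<omega> \<partial>M) - expectation \<xi> * expectation \<eta>\<bar> \<le> \<epsilon>" using m0 b by blast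
  qed
qed

lemma integrable_indicator_events[simp]: "A \<in> sets M \<Longrightarrow> integrable M (indicat_real A)"
  by (rule integrable_const_bound[of _ 1]) auto

context
  fixes Y :: "int \<Rightarrow> 'a \<Rightarrow> 'b::topological_space"
  assumes ind: "indep_vars (\<lambda>_. borel) Y UNIV"
begin

lemma Y_measurable: "Y s \<in> borel_measurable M"
  using ind by (auto simp: indep_vars_def2)

lemma block_sigma_borel_measurable: "f \<in> measurable (block_sigma M Y S) N \<Longrightarrow> f \<in> measurable M N"
  using measurable_from_subalg[OF subalgebra_block_sigma] Y_measurable by blast

lemma decorrelates_add:
  assumes "decorrelates Y t \<xi>" "decorrelates Y t \<zeta>" "integrable M \<xi>" "integrable M \<zeta>"
  shows "decorrelates Y t (\<lambda>\<omega>. \<xi> \<omega> + \<zeta> \<omega>)"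
proof (rule decorrelatesI)
  fix \<epsilon> :: real assume "\<epsilon> > 0"
  then have e2: "\<epsilon> / 2 > 0" by simp
  obtain m1 where m1: "\<And>m (\<eta>::'a \<Rightarrow> real). m \<ge> m1 \<Longrightarrow> \<eta> \<in> borel_measurable (block_sigma M Y {..<t - int m}) \<Longrightarrow>
     (\<And>\<omega>. \<omega> \<in> space M \<Longrightarrow> \<bar>\<eta> \<omega>\<bar> \<le> 1) \<Longrightarrow> \<bar>(\<integral>\<omega>. \<xi> \<omega> * \<eta> \<omega> \<partial>M) - expectation \<xi> * expectation \<eta>\<bar> \<le> \<epsilon> / 2"
    using decorrelatesE[OF assms(1) e2] by blast
  obtain m2 where m2: "\<And>m (\<eta>::'a \<Rightarrow> real). m \<ge> m2 \<Longrightarrow> \<eta> \<in> borel_measurable (block_sigma M Y {..<t - int m}) \<Longrightarrow>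
     (\<And>\<omega>. \<omega> \<in> space M \<Longrightarrow> \<bar>\<eta> \<omega>\<bar> \<le> 1) \<Longrightarrow> \<bar>(\<integral>\<omega>. \<zeta> \<omega> * \<eta> \<omega> \<partial>M) - expectation \<zeta> * expectation \<eta>\<bar> \<le> \<epsilon> / 2"
    using decorrelatesE[OF assms(2) e2] by blast
  show "\<exists>m::nat. \<forall>(\<eta>::'a \<Rightarrow> real)\<in>borel_measurable (block_sigma M Y {..<t - int m}).
     (\<forall>\<omega>\<in>space M. \<bar>\<eta> \<omega>\<bar> \<le> 1) \<longrightarrow> \<bar>(\<integral>\<omega>. (\<xi> \<omega> + \<zeta> \<omega>) * \<eta> \<omega> \<partial>M) - expectation (\<lambda>\<omega>. \<xi> \<omega> + \<zeta> \<omega>) * expectation \<eta>\<bar> \<le> \<epsilon>"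
  proof (intro exI[of _ "max m1 m2"] ballI impI)
    fix \<eta> :: "'a \<Rightarrow> real" assume \<eta>: "\<eta> \<in> borel_measurable (block_sigma M Y {..<t - int (max m1 m2)})" "\<forall>\<omega>\<in>space M. \<bar>\<eta> \<omega>\<bar> \<le> 1"
    have [measurable]: "\<eta> \<in> borel_measurable M" using block_sigma_borel_measurable[OF \<eta>(1)] .
    have "integrable M (\<lambda>\<omega>. \<xi> \<omega> * \<eta> \<omega>)" "integrable M (\<lambda>\<omega>. \<zeta> \<omega> * \<eta> \<omega>)"
      by (rule Bochner_Integration.integrable_bound[OF assms(3)] Bochner_Integration.integrable_bound[OF assms(4)];
          use \<eta>(2) assms in \<open>auto simp: abs_mult intro!: mult_left_le\<close>)+
    then have "(\<integral>\<omega>. (\<xi> \<omega> + \<zeta> \<omega>) * \<eta> \<omega> \<partial>M) - expectation (\<lambda>\<omega>. \<xi> \<omega> + \<zeta> \<omega>) * expectation \<eta> =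
      ((\<integral>\<omega>. \<xi> \<omega> * \<eta> \<omega> \<partial>M) - expectation \<xi> * expectation \<eta>) + ((\<integral>\<omega>. \<zeta> \<omega> * \<eta> \<omega> \<partial>M) - expectation \<zeta> * expectation \<eta>)"
      using assms by (simp add: distrib_right)
    moreover have "\<bar>(\<integral>\<omega>. \<xi> \<omega> * \<eta> \<omega> \<partial>M) - expectation \<xi> * expectation \<eta>\<bar> \<le> \<epsilon> / 2"
      by (rule m1[OF max.cobounded1 \<eta>(1)]) (use \<eta>(2) in blast)
    moreover have "\<bar>(\<integral>\<omega>. \<zeta> \<omega> * \<eta> \<omega> \<partial>M) - expectation \<zeta> * expectation \<eta>\<bar> \<le> \<epsilon> / 2"
      by (rule m2[OF max.cobounded2 \<eta>(1)]) (use \<eta>(2) in blast)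
    ultimately show "\<bar>(\<integral>\<omega>. (\<xi> \<omega> + \<zeta> \<omega>) * \<eta> \<omega> \<partial>M) - expectation (\<lambda>\<omega>. \<xi> \<omega> + \<zeta> \<omega>) * expectation \<eta>\<bar> \<le> \<epsilon>"
      by linarith
  qed
qed

text \<open>Against a variable bounded by 1, replacing \<xi> by \<zeta> changes each of the two
  terms by at most their L1 distance. Hence the budget: twice \<open>\<epsilon> / 4\<close> for the
  replacement and \<open>\<epsilon> / 2\<close> for the covariance of \<zeta>.\<close>

lemma decorrelates_approx:
  assumes "integrable M \<xi>"
    and "\<And>\<epsilon>. \<epsilon> > 0 \<Longrightarrow> \<exists>\<zeta>. decorrelates Y t \<zeta> \<and> integrable M \<zeta> \<and> (\<integral>\<omega>. \<bar>\<xi> \<omega> - \<zeta> \<omega>\<bar> \<partial>M) \<le> \<epsilon>"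
  shows "decorrelates Y t \<xi>"
proof (rule decorrelatesI)
  fix \<epsilon> :: real assume "\<epsilon> > 0"
  then have e2: "\<epsilon> / 4 > 0" "\<epsilon> / 2 > 0" by auto
  obtain \<zeta> where \<zeta>: "decorrelates Y t \<zeta>" "integrable M \<zeta>" "(\<integral>\<omega>. \<bar>\<xi> \<omega> - \<zeta> \<omega>\<bar> \<partial>M) \<le> \<epsilon> / 4"
    using assms(2)[OF e2(1)] by blast
  obtain m where m: "\<And>m' (\<eta>::'a \<Rightarrow> real). m' \<ge> m \<Longrightarrow> \<eta> \<in> borel_measurable (block_sigma M Y {..<t - int m'}) \<Longrightarrow>
     (\<And>\<omega>. \<omega> \<in> space M \<Longrightarrow> \<bar>\<eta> \<omega>\<bar> \<le> 1) \<Longrightarrow> \<bar>(\<integral>\<omega>. \<zeta> \<omega> * \<eta> \<omega> \<partial>M) - expectation \<zeta> * expectation \<eta>\<bar> \<le> \<epsilon> / 2"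
    using decorrelatesE[OF \<zeta>(1) e2(2)] by blast
  show "\<exists>m::nat. \<forall>(\<eta>::'a \<Rightarrow> real)\<in>borel_measurable (block_sigma M Y {..<t - int m}).
     (\<forall>\<omega>\<in>space M. \<bar>\<eta> \<omega>\<bar> \<le> 1) \<longrightarrow> \<bar>(\<integral>\<omega>. \<xi> \<omega> * \<eta> \<omega> \<partial>M) - expectation \<xi> * expectation \<eta>\<bar> \<le> \<epsilon>"
  proof (intro exI[of _ m] ballI impI)
    fix \<eta> :: "'a \<Rightarrow> real" assume \<eta>: "\<eta> \<in> borel_measurable (block_sigma M Y {..<t - int m})" "\<forall>\<omega>\<in>space M. \<bar>\<eta> \<omega>\<bar> \<le> 1"
    have \<eta>m[measurable]: "\<eta> \<in> borel_measurable M" using block_sigma_borel_measurable[OF \<eta>(1)] .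
    have i: "integrable M (\<lambda>\<omega>. f \<omega> * \<eta> \<omega>)" "\<bar>\<integral>\<omega>. f \<omega> * \<eta> \<omega> \<partial>M\<bar> \<le> (\<integral>\<omega>. \<bar>f \<omega>\<bar> \<partial>M)" if "integrable M f" for f :: "'a \<Rightarrow> real"
    proof -
      have b: "\<bar>f \<omega> * \<eta> \<omega>\<bar> \<le> \<bar>f \<omega>\<bar>" if "\<omega> \<in> space M" for \<omega>
        unfolding abs_mult using \<eta>(2) that by (intro mult_left_le) auto
      show "integrable M (\<lambda>\<omega>. f \<omega> * \<eta> \<omega>)"
        by (rule Bochner_Integration.integrable_bound[OF that]) (use b that in auto)
      then have "(\<integral>\<omega>. \<bar>f \<omega> * \<eta> \<omega>\<bar> \<partial>M) \<le> (\<integral>\<omega>. \<bar>f \<omega>\<bar> \<partial>M)"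
        by (intro integral_mono b integrable_abs that)
      then show "\<bar>\<integral>\<omega>. f \<omega> * \<eta> \<omega> \<partial>M\<bar> \<le> (\<integral>\<omega>. \<bar>f \<omega>\<bar> \<partial>M)"
        using integral_abs_bound[of M "\<lambda>\<omega>. f \<omega> * \<eta> \<omega>"] by linarith
    qed
    have ex: "\<bar>expectation \<eta>\<bar> \<le> 1"
      using i(2)[of "\<lambda>_. 1"] by (simp add: prob_space)
    let ?d = "\<lambda>\<omega>. \<xi> \<omega> - \<zeta> \<omega>"
    have d: "integrable M ?d" using assms \<zeta> by simp
    have "(\<integral>\<omega>. \<xi> \<omega> * \<eta> \<omega> \<partial>M) - expectation \<xi> * expectation \<eta> =
      ((\<integral>\<omega>. \<zeta> \<omega> * \<eta> \<omega> \<partial>M) - expectation \<zeta> * expectation \<eta>) + ((\<integral>\<omega>. ?d \<omega> * \<eta> \<omega> \<partial>M) - expectation ?d * expectation \<eta>)"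
      using i(1)[OF assms(1)] i(1)[OF \<zeta>(2)] assms(1) \<zeta>(2) by (simp add: left_diff_distrib)
    moreover have "\<bar>expectation ?d * expectation \<eta>\<bar> \<le> (\<integral>\<omega>. \<bar>?d \<omega>\<bar> \<partial>M) * 1"
      unfolding abs_mult using ex d by (intro mult_mono integral_abs_bound) auto
    ultimately show "\<bar>(\<integral>\<omega>. \<xi> \<omega> * \<eta> \<omega> \<partial>M) - expectation \<xi> * expectation \<eta>\<bar> \<le> \<epsilon>"
      using m[OF order_refl \<eta>(1) \<eta>(2)[rule_format]] i(2)[OF d] \<zeta>(3) by linarith
  qed
qed

lemma decorrelates_scale:
  assumes "decorrelates Y t \<xi>"
  shows "decorrelates Y t (\<lambda>\<omega>. c * \<xi> \<omega>)"
proof (cases "c = 0")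
  case False
  show ?thesis
  proof (rule decorrelatesI)
    fix \<epsilon> :: real assume "\<epsilon> > 0"
    then have e: "\<epsilon> / \<bar>c\<bar> > 0" using False by simp
    obtain m where m: "\<And>m' (\<eta>::'a \<Rightarrow> real). m' \<ge> m \<Longrightarrow> \<eta> \<in> borel_measurable (block_sigma M Y {..<t - int m'}) \<Longrightarrow>
       (\<And>\<omega>. \<omega> \<in> space M \<Longrightarrow> \<bar>\<eta> \<omega>\<bar> \<le> 1) \<Longrightarrow> \<bar>(\<integral>\<omega>. \<xi> \<omega> * \<eta> \<omega> \<partial>M) - expectation \<xi> * expectation \<eta>\<bar> \<le> \<epsilon> / \<bar>c\<bar>"
      using decorrelatesE[OF assms e] by blast
    have "\<bar>(\<integral>\<omega>. c * \<xi> \<omega> * \<eta> \<omega> \<partial>M) - expectation (\<lambda>\<omega>. c * \<xi> \<omega>) * expectation \<eta>\<bar> =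
       \<bar>c\<bar> * \<bar>(\<integral>\<omega>. \<xi> \<omega> * \<eta> \<omega> \<partial>M) - expectation \<xi> * expectation \<eta>\<bar>" for \<eta> :: "'a \<Rightarrow> real"
      by (simp add: mult.assoc abs_mult[symmetric] right_diff_distrib)
    then show "\<exists>m::nat. \<forall>(\<eta>::'a \<Rightarrow> real)\<in>borel_measurable (block_sigma M Y {..<t - int m}).
       (\<forall>\<omega>\<in>space M. \<bar>\<eta> \<omega>\<bar> \<le> 1) \<longrightarrow> \<bar>(\<integral>\<omega>. c * \<xi> \<omega> * \<eta> \<omega> \<partial>M) - expectation (\<lambda>\<omega>. c * \<xi> \<omega>) * expectation \<eta>\<bar> \<le> \<epsilon>"
      using m[OF order_refl] False by (intro exI[of _ m]) (simp add: field_simps)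
  qed
qed (auto simp: decorrelates_def)

text \<open>An event determined by the last \<open>m\<close> steps is independent of everything
  before \<open>t - m\<close>, so its covariance is exactly 0. Such events are stable under
  intersection and generate the past; complements follow by linearity and disjoint unions by L1
  closure.\<close>

lemma decorrelates_indicator:
  assumes "A \<in> sets (block_sigma M Y {..<t})"
  shows "decorrelates Y t (indicator A)"
proof -
  define \<G> where "\<G> = (\<Union>m::nat. sets (block_sigma M Y {t - int m..<t}))"
  have sM: "sets (block_sigma M Y S) \<subseteq> sets M" for S
    using subalgebra_block_sigma[of Y M] Y_measurable by (auto simp: subalgebra_def)
  have Int: "Int_stable \<G>"
  proof (rule Int_stableI)
    fix a b assume "a \<in> \<G>" "b \<in> \<G>"
    then obtain m n where "a \<in> sets (block_sigma M Y {t - int m..<t})" "b \<in> sets (block_sigma M Y {t - int n..<t})"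
      by (auto simp: \<G>_def)
    then have "a \<in> sets (block_sigma M Y {t - int (max m n)..<t})" "b \<in> sets (block_sigma M Y {t - int (max m n)..<t})"
      using sets_block_sigma_mono[of "{t - int m..<t}" "{t - int (max m n)..<t}" M Y]
        sets_block_sigma_mono[of "{t - int n..<t}" "{t - int (max m n)..<t}" M Y] by auto
    then have "a \<inter> b \<in> sets (block_sigma M Y {t - int (max m n)..<t})" by (rule sets.Int)
    then show "a \<inter> b \<in> \<G>" unfolding \<G>_def by (rule UN_I[OF UNIV_I])
  qed
  have Pow: "\<G> \<subseteq> Pow (space M)" unfolding \<G>_def using sM sets.sets_into_space by blast
  have gen: "sigma_sets (space M) \<G> = sets (block_sigma M Y {..<t})"
  proof
    have "\<G> \<subseteq> sets (block_sigma M Y {..<t})" unfolding \<G>_def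
      using sets_block_sigma_mono[of "{t - int m..<t}" "{..<t}" M Y for m] by fastforce
    then show "sigma_sets (space M) \<G> \<subseteq> sets (block_sigma M Y {..<t})"
      using sets.sigma_sets_subset[of \<G> "block_sigma M Y {..<t}"] by simp
    show "sets (block_sigma M Y {..<t}) \<subseteq> sigma_sets (space M) \<G>"
      unfolding sets_block_sigma
    proof (rule sigma_sets_mono, safe)
      fix s A assume s: "s < t" and A: "A \<in> sets (borel :: 'b measure)"
      have "Y s -` A \<inter> space M \<in> sets (block_sigma M Y {t - int (nat (t - s))..<t})"
        unfolding sets_block_sigma using s A by (intro sigma_sets.Basic) auto
      then show "Y s -` A \<inter> space M \<in> sigma_sets (space M) \<G>" unfolding \<G>_def
        by (intro sigma_sets.Basic UN_I[OF UNIV_I])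
    qed
  qed
  have "A \<in> sigma_sets (space M) \<G>" using assms gen by simp
  from Int Pow this show ?thesis
  proof (induction rule: sigma_sets_induct_disjoint[consumes 3, case_names basic empty compl disj])
    case (basic A)
    then obtain m where m: "A \<in> sets (block_sigma M Y {t - int m..<t})" by (auto simp: \<G>_def)
    then have A: "A \<in> sets M" using sM by blast
    show ?case
    proof (rule decorrelatesI, intro exI[of _ m] ballI impI)
      fix \<epsilon> :: real and \<eta> :: "'a \<Rightarrow> real" assume e: "\<epsilon> > 0" and \<eta>: "\<eta> \<in> borel_measurable (block_sigma M Y {..<t - int m})" "\<forall>\<omega>\<in>space M. \<bar>\<eta> \<omega>\<bar> \<le> 1"
      have "indep_var borel (indicat_real A) borel \<eta>"
        by (rule indep_block_sigma[OF ind _ _ \<eta>(1), of "{t - int m..<t}"]) (use m in auto)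
      moreover have "integrable M \<eta>"
        by (rule integrable_const_bound[of _ 1]) (use \<eta> block_sigma_borel_measurable in auto)
      ultimately have "(\<integral>\<omega>. indicat_real A \<omega> * \<eta> \<omega> \<partial>M) = expectation (indicat_real A) * expectation \<eta>"
        using A by (intro indep_var_lebesgue_integral) auto
      then show "\<bar>(\<integral>\<omega>. indicat_real A \<omega> * \<eta> \<omega> \<partial>M) - expectation (indicat_real A) * expectation \<eta>\<bar> \<le> \<epsilon>" using e by simp
    qed
  next
    case empty
    show ?case by (auto simp: decorrelates_def)
  next
    case (compl A)
    then have A: "A \<in> sets M" using sM gen by auto
    have c1: "decorrelates Y t (\<lambda>_. 1)" by (auto simp: decorrelates_def prob_space)
    have "decorrelates Y t (\<lambda>\<omega>. 1 + (-1) * indicat_real A \<omega>)"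
      by (intro decorrelates_add decorrelates_scale compl c1) (use A in auto)
    moreover have "(\<integral>\<omega>. (1 + (-1) * indicat_real A \<omega>) * \<eta> \<omega> \<partial>M) = (\<integral>\<omega>. indicat_real (space M - A) \<omega> * \<eta> \<omega> \<partial>M)"
      for \<eta> :: "'a \<Rightarrow> real" by (rule Bochner_Integration.integral_cong) (auto simp: indicator_def)
    moreover have "expectation (\<lambda>\<omega>. 1 + (-1) * indicat_real A \<omega>) = expectation (indicat_real (space M - A))"
      by (rule Bochner_Integration.integral_cong) (auto simp: indicator_def)
    ultimately show ?case unfolding decorrelates_def by simp
  next
    case (disj A)
    have A: "A i \<in> sets M" for i using disj(2) sM gen by blast
    show ?case
    proof (rule decorrelates_approx)
      show "integrable M (indicat_real (\<Union> (range A)))" using A by simp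
      fix \<epsilon> :: real assume e: "\<epsilon> > 0"
      let ?f = "\<lambda>n \<omega>. \<Sum>i<n. indicat_real (A i) \<omega>"
      have f: "decorrelates Y t (?f n) \<and> integrable M (?f n)" for n
      proof (induction n)
        case 0
        show ?case by (auto simp: decorrelates_def)
      next
        case (Suc n)
        then show ?case using decorrelates_add[of t "?f n" "indicat_real (A n)"] disj(3)[of n] A by simp
      qed
      have "(\<lambda>n. \<integral>\<omega>. \<bar>indicat_real (\<Union> (range A)) \<omega> - ?f n \<omega>\<bar> \<partial>M) \<longlonglongrightarrow> (\<integral>\<omega>. 0 \<partial>M)"
      proof (rule integral_dominated_convergence[where w = "\<lambda>_. 1"])
        have fe: "?f n \<omega> = indicat_real (\<Union>i<n. A i) \<omega>" for n \<omega>
          by (rule indicator_UN_disjoint[symmetric]) (use disj(1) in \<open>auto simp: disjoint_family_on_def\<close>)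
        have "(\<lambda>n. indicat_real (\<Union>i<n. A i) \<omega>) \<longlonglongrightarrow> indicat_real (\<Union> (range A)) \<omega>" for \<omega>
          using LIMSEQ_indicator_UN[of A \<omega>] by simp
        then have "(\<lambda>n. \<bar>indicat_real (\<Union> (range A)) \<omega> - indicat_real (\<Union>i<n. A i) \<omega>\<bar>) \<longlonglongrightarrow> \<bar>indicat_real (\<Union> (range A)) \<omega> - indicat_real (\<Union> (range A)) \<omega>\<bar>" for \<omega>
          by (intro tendsto_intros)
        then show "AE \<omega> in M. (\<lambda>n. \<bar>indicat_real (\<Union> (range A)) \<omega> - ?f n \<omega>\<bar>) \<longlonglongrightarrow> 0"
          unfolding fe by simp
        show "AE \<omega> in M. norm \<bar>indicat_real (\<Union> (range A)) \<omega> - ?f n \<omega>\<bar> \<le> 1" for n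
          unfolding fe by (auto simp: indicator_def)
      qed (use A in auto)
      then have "\<forall>\<^sub>F n in sequentially. (\<integral>\<omega>. \<bar>indicat_real (\<Union> (range A)) \<omega> - ?f n \<omega>\<bar> \<partial>M) < \<epsilon>"
        using e by (intro order_tendstoD(2)) auto
      then obtain n where "(\<integral>\<omega>. \<bar>indicat_real (\<Union> (range A)) \<omega> - ?f n \<omega>\<bar> \<partial>M) < \<epsilon>"
        by (auto simp: eventually_sequentially)
      then show "\<exists>\<zeta>. decorrelates Y t \<zeta> \<and> integrable M \<zeta> \<and> (\<integral>\<omega>. \<bar>indicat_real (\<Union> (range A)) \<omega> - \<zeta> \<omega>\<bar> \<partial>M) \<le> \<epsilon>"
        using f[of n] by (intro exI[of _ "?f n"]) auto
    qed
  qed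
qed

text \<open>A quantitative relative of Kolmogorov's zero-one law. Indicators generate all integrable
  functions through sums, multiples and L1 limits, under which the class is closed.\<close>

lemma decorrelates_past:
  assumes "\<xi> \<in> borel_measurable (block_sigma M Y {..<t})" "integrable M \<xi>"
  shows "decorrelates Y t \<xi>"
proof -
  let ?F = "block_sigma M Y {..<t}"
  have sub: "subalgebra M ?F" using subalgebra_block_sigma Y_measurable by blast
  have "integrable (restr_to_subalg M ?F) \<xi>" using integrable_in_subalg[OF sub assms] .
  then show ?thesis
  proof (induction rule: integrable_induct)
    case (base A c)
    then have "A \<in> sets ?F" by (simp add: sets_restr_to_subalg[OF sub])
    from decorrelates_scale[OF decorrelates_indicator[OF this], of c] show ?case by (simp add: mult.commute)
  next
    case (add f g)
    then show ?case by (intro decorrelates_add integrable_from_subalg[OF sub])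
  next
    case (lim f s)
    have i: "integrable M f" "integrable M (s i)" for i using integrable_from_subalg[OF sub] lim.hyps(1,4) by blast+
    show ?case
    proof (rule decorrelates_approx[OF i(1)])
      fix \<epsilon> :: real assume e: "\<epsilon> > 0"
      have sp: "space (restr_to_subalg M ?F) = space M" by (simp add: space_restr_to_subalg)
      have "(\<lambda>n. \<integral>\<omega>. \<bar>f \<omega> - s n \<omega>\<bar> \<partial>M) \<longlonglongrightarrow> (\<integral>\<omega>. 0 \<partial>M)"
      \<comment> \<open>The simple functions of the induction satisfy
        \<open>\<bar>s n \<omega>\<bar> \<le> 2 * \<bar>f \<omega>\<bar>\<close>, hence the factor
        3.\<close>
      proof (rule integral_dominated_convergence[where w = "\<lambda>\<omega>. 3 * \<bar>f \<omega>\<bar>"])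
        have "(\<lambda>n. \<bar>f \<omega> - s n \<omega>\<bar>) \<longlonglongrightarrow> \<bar>f \<omega> - f \<omega>\<bar>" if "\<omega> \<in> space M" for \<omega>
          using lim.hyps(2)[unfolded sp, OF that] by (intro tendsto_intros)
        then show "AE \<omega> in M. (\<lambda>n. \<bar>f \<omega> - s n \<omega>\<bar>) \<longlonglongrightarrow> 0" by (intro AE_I2) simp
        show "AE \<omega> in M. norm \<bar>f \<omega> - s n \<omega>\<bar> \<le> 3 * \<bar>f \<omega>\<bar>" for n
        proof (intro AE_I2)
          fix \<omega> assume "\<omega> \<in> space M"
          from lim.hyps(3)[unfolded sp, OF this, of n] show "norm \<bar>f \<omega> - s n \<omega>\<bar> \<le> 3 * \<bar>f \<omega>\<bar>"
            unfolding real_norm_def by linarith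
        qed
      qed (use i in auto)
      then have "\<forall>\<^sub>F n in sequentially. (\<integral>\<omega>. \<bar>f \<omega> - s n \<omega>\<bar> \<partial>M) < \<epsilon>"
        using e by (intro order_tendstoD(2)) auto
      then obtain n where "(\<integral>\<omega>. \<bar>f \<omega> - s n \<omega>\<bar> \<partial>M) < \<epsilon>" by (auto simp: eventually_sequentially)
      then show "\<exists>\<zeta>. decorrelates Y t \<zeta> \<and> integrable M \<zeta> \<and> (\<integral>\<omega>. \<bar>f \<omega> - \<zeta> \<omega>\<bar> \<partial>M) \<le> \<epsilon>"
        using lim.IH[of n] i by (intro exI[of _ "s n"]) auto
    qed
  qed
qed

end
end

section \<open>Law of large numbers for stationary adapted sequences\<close>

lemma stationary_expectation_1:
  fixes f :: "'b::topological_space \<Rightarrow> 'c::{banach,second_countable_topology}"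
  assumes G: "strictly_stationary M G" and f: "f \<in> borel_measurable borel"
  shows "(\<integral>\<omega>. f (G t \<omega>) \<partial>M) = (\<integral>\<omega>. f (G s \<omega>) \<partial>M)"
    and "integrable M (\<lambda>\<omega>. f (G t \<omega>)) \<longleftrightarrow> integrable M (\<lambda>\<omega>. f (G s \<omega>))"
proof -
  have m: "\<And>t. G t \<in> borel_measurable M" using G by (auto simp: strictly_stationary_def)
  show "(\<integral>\<omega>. f (G t \<omega>) \<partial>M) = (\<integral>\<omega>. f (G s \<omega>) \<partial>M)"
    using integral_distr[OF m f, of t] integral_distr[OF m f, of s] stationary_distr[OF G, of t s] by simp
  show "integrable M (\<lambda>\<omega>. f (G t \<omega>)) \<longleftrightarrow> integrable M (\<lambda>\<omega>. f (G s \<omega>))"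
    using integrable_distr_eq[OF m f, of t] integrable_distr_eq[OF m f, of s] stationary_distr[OF G, of t s] by simp
qed

context prob_space
begin

text \<open>Stationarity moves the later time to 0. The earlier variable then depends only on a
  remote past, so an \<open>m\<close> chosen once for \<open>h (G 0)\<close> serves all pairs at
  distance at least \<open>m\<close>.\<close>

lemma stationary_adapted_covariance:
  fixes Y :: "int \<Rightarrow> 'a \<Rightarrow> 'b::topological_space" and G :: "int \<Rightarrow> 'a \<Rightarrow> 'c::topological_space"
  assumes ind: "indep_vars (\<lambda>_. borel) Y UNIV"
    and G: "strictly_stationary M G" "\<And>t. G t \<in> borel_measurable (past_sigma M Y t)"
    and h[measurable]: "h \<in> borel_measurable borel" and h1: "\<And>x. \<bar>h x :: real\<bar> \<le> 1" and \<epsilon>: "\<epsilon> > 0"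
  shows "\<exists>m::nat. \<forall>s t. \<bar>s - t\<bar> \<ge> int m \<longrightarrow> \<bar>(\<integral>\<omega>. h (G s \<omega>) * h (G t \<omega>) \<partial>M) - (\<integral>\<omega>. h (G 1 \<omega>) \<partial>M)\<^sup>2\<bar> \<le> \<epsilon>"
proof -
  have Gm[measurable]: "\<And>t. G t \<in> borel_measurable M" using G by (auto simp: strictly_stationary_def)
  have hG: "(\<lambda>\<omega>. h (G t \<omega>)) \<in> borel_measurable (block_sigma M Y {..<t})" for t
    using measurable_compose[OF G(2)[of t] h] by (simp add: past_sigma_eq)
  have i: "integrable M (\<lambda>\<omega>. h (G t \<omega>))" for t by (rule integrable_const_bound[of _ 1]) (use h1 in auto)
  obtain m where m: "\<And>m' (\<eta>::'a \<Rightarrow> real). m' \<ge> m \<Longrightarrow> \<eta> \<in> borel_measurable (block_sigma M Y {..<0 - int m'}) \<Longrightarrow>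
     (\<And>\<omega>. \<omega> \<in> space M \<Longrightarrow> \<bar>\<eta> \<omega>\<bar> \<le> 1) \<Longrightarrow> \<bar>(\<integral>\<omega>. h (G 0 \<omega>) * \<eta> \<omega> \<partial>M) - expectation (\<lambda>\<omega>. h (G 0 \<omega>)) * expectation \<eta>\<bar> \<le> \<epsilon>"
    using decorrelatesE[OF decorrelates_past[OF ind hG i] \<epsilon>, of 0] by blast
  have 1: "\<bar>(\<integral>\<omega>. h (G t \<omega>) * h (G s \<omega>) \<partial>M) - (\<integral>\<omega>. h (G 1 \<omega>) \<partial>M)\<^sup>2\<bar> \<le> \<epsilon>" if st: "t - s \<ge> int m" for s t
  proof -
    define k where "k = nat (t - s)"
    have k: "int k = t - s" "k \<ge> m" using st by (auto simp: k_def)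
    have F: "(\<lambda>x. h (x 0) * h (x (s - t))) \<in> borel_measurable (PiM {0, s - t} (\<lambda>_. borel))" by measurable
    have "(\<integral>\<omega>. h (G t \<omega>) * h (G s \<omega>) \<partial>M) = (\<integral>\<omega>. h (G 0 \<omega>) * h (G (s - t) \<omega>) \<partial>M)"
      using stationary_expectation[OF G(1) _ F, of t] by (simp add: block_vec_def)
    moreover have "\<bar>(\<integral>\<omega>. h (G 0 \<omega>) * h (G (s - t) \<omega>) \<partial>M) - expectation (\<lambda>\<omega>. h (G 0 \<omega>)) * expectation (\<lambda>\<omega>. h (G (s - t) \<omega>))\<bar> \<le> \<epsilon>"
      by (rule m[OF k(2)]) (use k hG[of "s - t"] h1 in auto)
    moreover have "expectation (\<lambda>\<omega>. h (G 0 \<omega>)) = expectation (\<lambda>\<omega>. h (G 1 \<omega>))"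
      "expectation (\<lambda>\<omega>. h (G (s - t) \<omega>)) = expectation (\<lambda>\<omega>. h (G 1 \<omega>))"
      by (rule stationary_expectation_1[OF G(1) h])+
    ultimately show ?thesis by (simp add: power2_eq_square)
  qed
  show ?thesis
  proof (intro exI[of _ m] allI impI)
    fix s t :: int assume "int m \<le> \<bar>s - t\<bar>"
    then consider "t - s \<ge> int m" | "s - t \<ge> int m" by linarith
    then show "\<bar>(\<integral>\<omega>. h (G s \<omega>) * h (G t \<omega>) \<partial>M) - (\<integral>\<omega>. h (G 1 \<omega>) \<partial>M)\<^sup>2\<bar> \<le> \<epsilon>"
      by cases (use 1[of s t] 1[of t s] in \<open>simp_all add: mult.commute\<close>)
  qed
qed

text \<open>A second moment argument: at most \<open>2 * m * n\<close> pairs are closer than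
  \<open>m\<close>, contributing \<open>O(m / n)\<close> to the variance of the average, and all
  other pairs have covariance at most \<open>e\<^sup>2 / 4\<close>.\<close>

lemma bounded_adapted_LLN:
  fixes Y :: "int \<Rightarrow> 'a \<Rightarrow> 'b::topological_space" and G :: "int \<Rightarrow> 'a \<Rightarrow> 'c::topological_space"
  assumes ind: "indep_vars (\<lambda>_. borel) Y UNIV"
    and G: "strictly_stationary M G" "\<And>t. G t \<in> borel_measurable (past_sigma M Y t)"
    and h[measurable]: "h \<in> borel_measurable borel" and h1: "\<And>x. \<bar>h x :: real\<bar> \<le> 1" and e: "e > 0"
  shows "\<forall>\<^sub>F n in sequentially. (\<integral>\<omega>. \<bar>(\<Sum>t=1..int n. h (G t \<omega>)) / n - (\<integral>\<omega>. h (G 1 \<omega>) \<partial>M)\<bar> \<partial>M) \<le> e"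
proof -
  have Gm[measurable]: "\<And>t. G t \<in> borel_measurable M" using G by (auto simp: strictly_stationary_def)
  define \<mu> where "\<mu> = (\<integral>\<omega>. h (G 1 \<omega>) \<partial>M)"
  have i: "integrable M (\<lambda>\<omega>. h (G t \<omega>))" for t by (rule integrable_const_bound[of _ 1]) (use h1 in auto)
  have hh: "\<bar>h x * h y\<bar> \<le> 1" for x y using h1[of x] h1[of y] by (simp add: abs_mult mult_le_one)
  have ii: "integrable M (\<lambda>\<omega>. h (G s \<omega>) * h (G t \<omega>))" for s t
    by (rule integrable_const_bound[of _ 1]) (use hh in auto)
  have \<mu>t: "(\<integral>\<omega>. h (G t \<omega>) \<partial>M) = \<mu>" for t unfolding \<mu>_def by (rule stationary_expectation_1[OF G(1) h])
  have b1: "\<bar>expectation f\<bar> \<le> 1" if "\<And>\<omega>. \<bar>f \<omega>\<bar> \<le> 1" "f \<in> borel_measurable M" for f :: "'a \<Rightarrow> real"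
  proof -
    have "integrable M f" by (rule integrable_const_bound[of _ 1]) (use that in auto)
    then have "expectation (\<lambda>\<omega>. \<bar>f \<omega>\<bar>) \<le> expectation (\<lambda>_. 1)" by (intro integral_mono) (use that in auto)
    then have "expectation (\<lambda>\<omega>. \<bar>f \<omega>\<bar>) \<le> 1" by (simp add: prob_space)
    then show ?thesis using integral_abs_bound[of M f] by linarith
  qed
  obtain m where m: "\<And>s t. \<bar>s - t\<bar> \<ge> int m \<Longrightarrow> \<bar>(\<integral>\<omega>. h (G s \<omega>) * h (G t \<omega>) \<partial>M) - \<mu>\<^sup>2\<bar> \<le> e\<^sup>2 / 4"
    using stationary_adapted_covariance[OF ind G h h1, of "e\<^sup>2 / 4"] e unfolding \<mu>_def by auto
  define c where "c s t = (\<integral>\<omega>. h (G s \<omega>) * h (G t \<omega>) \<partial>M) - \<mu>\<^sup>2" for s t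
  have \<mu>1: "\<mu>\<^sup>2 \<le> 1" using b1[of "\<lambda>\<omega>. h (G 1 \<omega>)"] h1 by (simp add: \<mu>_def abs_square_le_1)
  have c2: "\<bar>c s t\<bar> \<le> 2" for s t
  proof -
    have "\<bar>expectation (\<lambda>\<omega>. h (G s \<omega>) * h (G t \<omega>))\<bar> \<le> 1" by (rule b1) (use hh in auto)
    then show ?thesis using \<mu>1 zero_le_power2[of \<mu>] unfolding c_def by linarith
  qed
  have c: "c s t \<le> e\<^sup>2 / 4 + (if \<bar>s - t\<bar> < int m then 2 else 0)" for s t
  proof (cases "\<bar>s - t\<bar> < int m")
    case True
    then show ?thesis using c2[of s t] zero_le_power2[of e] by (simp only: if_True)
  next
    case False
    then have "\<bar>c s t\<bar> \<le> e\<^sup>2 / 4" using m[of s t] by (simp add: c_def)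
    then show ?thesis using False by simp
  qed
  have var: "(\<integral>\<omega>. ((\<Sum>t=1..int n. h (G t \<omega>)) / n - \<mu>)\<^sup>2 \<partial>M) \<le> e\<^sup>2 / 4 + 4 * m / n"
    and vi: "integrable M (\<lambda>\<omega>. ((\<Sum>t=1..int n. h (G t \<omega>)) / n - \<mu>)\<^sup>2)" if n: "n > 0" for n :: nat
  proof -
    have "(\<Sum>t=1..int n. h (G t \<omega>)) / n - \<mu> = (\<Sum>t=1..int n. h (G t \<omega>) - \<mu>) / n" for \<omega>
      using n by (simp add: sum_subtractf diff_divide_distrib)
    then have e1: "((\<Sum>t=1..int n. h (G t \<omega>)) / n - \<mu>)\<^sup>2 = (\<Sum>s=1..int n. \<Sum>t=1..int n. (h (G s \<omega>) - \<mu>) * (h (G t \<omega>) - \<mu>)) / n\<^sup>2" for \<omega>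
      by (simp add: power2_eq_square sum_product)
    have i2: "integrable M (\<lambda>\<omega>. (h (G s \<omega>) - \<mu>) * (h (G t \<omega>) - \<mu>))"
      and e2: "(\<integral>\<omega>. (h (G s \<omega>) - \<mu>) * (h (G t \<omega>) - \<mu>) \<partial>M) = c s t" for s t
    proof -
      have x: "(\<lambda>\<omega>. (h (G s \<omega>) - \<mu>) * (h (G t \<omega>) - \<mu>)) = (\<lambda>\<omega>. h (G s \<omega>) * h (G t \<omega>) - \<mu> * h (G s \<omega>) - \<mu> * h (G t \<omega>) + \<mu>\<^sup>2)"
        by (auto simp: algebra_simps power2_eq_square)
      show "integrable M (\<lambda>\<omega>. (h (G s \<omega>) - \<mu>) * (h (G t \<omega>) - \<mu>))" unfolding x using i ii by simp
      show "(\<integral>\<omega>. (h (G s \<omega>) - \<mu>) * (h (G t \<omega>) - \<mu>) \<partial>M) = c s t" unfolding x c_def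
        using i ii by (simp add: \<mu>t prob_space power2_eq_square)
    qed
    show "integrable M (\<lambda>\<omega>. ((\<Sum>t=1..int n. h (G t \<omega>)) / n - \<mu>)\<^sup>2)" unfolding e1
      by (intro integrable_divide Bochner_Integration.integrable_sum i2)
    have cnt: "(\<Sum>t=1..int n. if \<bar>s - t\<bar> < int m then 2 else 0 :: real) \<le> 4 * m" for s
    proof -
      have "(\<Sum>t=1..int n. if \<bar>s - t\<bar> < int m then 2 else 0 :: real) \<le> (\<Sum>t\<in>{s - int m<..<s + int m}. 2)"
        by (subst sum.inter_filter[symmetric], simp, intro sum_mono2) auto
      also have "\<dots> \<le> 4 * m" by simp
      finally show ?thesis .
    qed
    have "(\<integral>\<omega>. ((\<Sum>t=1..int n. h (G t \<omega>)) / n - \<mu>)\<^sup>2 \<partial>M) = (\<Sum>s=1..int n. \<Sum>t=1..int n. c s t) / n\<^sup>2"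
      unfolding e1 by (simp add: i2 e2)
    also have "\<dots> \<le> (\<Sum>s=1..int n. \<Sum>t=1..int n. e\<^sup>2 / 4 + (if \<bar>s - t\<bar> < int m then 2 else 0)) / n\<^sup>2"
      by (intro divide_right_mono sum_mono c) auto
    also have "\<dots> \<le> (\<Sum>s=1..int n. n * (e\<^sup>2 / 4) + 4 * m) / n\<^sup>2"
      using cnt by (intro divide_right_mono sum_mono) (auto simp: sum.distrib)
    also have "\<dots> = e\<^sup>2 / 4 + 4 * m / n" using n by (simp add: field_simps power2_eq_square)
    finally show "(\<integral>\<omega>. ((\<Sum>t=1..int n. h (G t \<omega>)) / n - \<mu>)\<^sup>2 \<partial>M) \<le> e\<^sup>2 / 4 + 4 * m / n" .
  qed
  have "(\<lambda>n. 4 * real m / real n) \<longlonglongrightarrow> 0" by (rule lim_const_over_n)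
  then have "\<forall>\<^sub>F n in sequentially. 4 * real m / real n < e\<^sup>2 / 4" using e by (intro order_tendstoD(2)) auto
  then show ?thesis using eventually_gt_at_top[of 0]
  proof eventually_elim
    case (elim n)
    let ?X = "\<lambda>\<omega>. (\<Sum>t=1..int n. h (G t \<omega>)) / n - \<mu>"
    \<comment> \<open>Completing the square around \<open>\<bar>x\<bar> = e / 2\<close> trades the
      first moment for the second; a second moment of at most \<open>e\<^sup>2 / 2\<close> then
      yields \<open>3 * e / 4\<close>.\<close>
    have x: "\<bar>x\<bar> \<le> x\<^sup>2 / e + e / 4" for x :: real
    proof -
      have "0 \<le> (\<bar>x\<bar> / e - 1 / 2)\<^sup>2 * e" using e by simp
      also have "\<dots> = x\<^sup>2 / e + e / 4 - \<bar>x\<bar>" using e by (simp add: field_simps power2_eq_square)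
      finally show ?thesis by simp
    qed
    have ix: "integrable M (\<lambda>\<omega>. \<bar>?X \<omega>\<bar>)" using i by (intro integrable_abs) simp
    have "(\<integral>\<omega>. \<bar>?X \<omega>\<bar> \<partial>M) \<le> (\<integral>\<omega>. (?X \<omega>)\<^sup>2 / e + e / 4 \<partial>M)"
      by (rule integral_mono[OF ix]) (use vi[OF elim(2)] x in auto)
    also have "\<dots> = (\<integral>\<omega>. (?X \<omega>)\<^sup>2 \<partial>M) / e + e / 4" using vi[OF elim(2)] by (simp add: prob_space)
    also have "\<dots> \<le> (e\<^sup>2 / 4 + e\<^sup>2 / 4) / e + e / 4"
      using var[OF elim(2)] elim(1) e by (intro add_mono divide_right_mono) auto
    also have "\<dots> \<le> e" using e by (simp add: power2_eq_square)
    finally show ?case unfolding \<mu>_def .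
  qed
qed

text \<open>By stationarity the L1 error of truncating \<open>h\<close> at a level \<open>L\<close>
  is the same for every \<open>t\<close>, so it also bounds the error of the average. The truncated
  function is left to the bounded case.\<close>

theorem adapted_LLN:
  fixes Y :: "int \<Rightarrow> 'a \<Rightarrow> 'b::topological_space" and G :: "int \<Rightarrow> 'a \<Rightarrow> 'c::topological_space"
  assumes ind: "indep_vars (\<lambda>_. borel) Y UNIV"
    and G: "strictly_stationary M G" "\<And>t. G t \<in> borel_measurable (past_sigma M Y t)"
    and h[measurable]: "h \<in> borel_measurable borel" and int: "integrable M (\<lambda>\<omega>. h (G 1 \<omega>) :: real)"
  shows "(\<lambda>n. \<integral>\<omega>. \<bar>(\<Sum>t=1..int n. h (G t \<omega>)) / n - (\<integral>\<omega>. h (G 1 \<omega>) \<partial>M)\<bar> \<partial>M) \<longlonglongrightarrow> 0"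
proof (rule order_tendstoI)
  fix e :: real assume e: "0 < e"
  have Gm[measurable]: "\<And>t. G t \<in> borel_measurable M" using G by (auto simp: strictly_stationary_def)
  define hL where "hL L x = max (- real L) (min (real L) (h x))" for L :: nat and x
  have hLm[measurable]: "hL L \<in> borel_measurable borel" for L unfolding hL_def by measurable
  have hLb: "\<bar>hL L x\<bar> \<le> real L" "\<bar>h x - hL L x\<bar> \<le> \<bar>h x\<bar>" for L x by (auto simp: hL_def)
  have "(\<lambda>L. \<integral>\<omega>. \<bar>h (G 1 \<omega>) - hL L (G 1 \<omega>)\<bar> \<partial>M) \<longlonglongrightarrow> (\<integral>\<omega>. 0 \<partial>M)"
  proof (rule integral_dominated_convergence[where w = "\<lambda>\<omega>. \<bar>h (G 1 \<omega>)\<bar>"])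
    have "\<bar>h x - hL L x\<bar> = 0" if "L \<ge> nat \<lceil>\<bar>h x\<bar>\<rceil>" for L x
    proof -
      have "\<bar>h x\<bar> \<le> L" using that by linarith
      then show ?thesis by (simp add: hL_def)
    qed
    then have "(\<lambda>L. \<bar>h x - hL L x\<bar>) \<longlonglongrightarrow> 0" for x
      by (intro tendsto_eventually eventually_sequentiallyI[of "nat \<lceil>\<bar>h x\<bar>\<rceil>"])
    then show "AE \<omega> in M. (\<lambda>L. \<bar>h (G 1 \<omega>) - hL L (G 1 \<omega>)\<bar>) \<longlonglongrightarrow> 0" by simp
  qed (use hLb int in auto)
  then have "\<forall>\<^sub>F L in sequentially. (\<integral>\<omega>. \<bar>h (G 1 \<omega>) - hL L (G 1 \<omega>)\<bar> \<partial>M) < e / 4"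
    using e by (intro order_tendstoD(2)) auto
  then have "\<forall>\<^sub>F L in sequentially. (\<integral>\<omega>. \<bar>h (G 1 \<omega>) - hL L (G 1 \<omega>)\<bar> \<partial>M) < e / 4 \<and> L > 0"
    using eventually_gt_at_top[of 0] by eventually_elim simp
  then obtain L where L: "(\<integral>\<omega>. \<bar>h (G 1 \<omega>) - hL L (G 1 \<omega>)\<bar> \<partial>M) < e / 4" "L > 0"
    by (auto simp: eventually_sequentially)
  \<comment> \<open>Division by \<open>L\<close> brings the truncated function into the range
    required by the bounded case; the accuracy \<open>e / (4 * L)\<close> undoes it.\<close>
  define g where "g x = hL L x / L" for x
  have g1: "\<bar>g x\<bar> \<le> 1" for x using hLb(1)[of L x] L(2) by (simp add: g_def)
  have gm[measurable]: "g \<in> borel_measurable borel" unfolding g_def by measurable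
  have "e / (4 * L) > 0" using e L by simp
  from bounded_adapted_LLN[OF ind G gm g1 this]
  have "\<forall>\<^sub>F n in sequentially. (\<integral>\<omega>. \<bar>(\<Sum>t=1..int n. g (G t \<omega>)) / n - (\<integral>\<omega>. g (G 1 \<omega>) \<partial>M)\<bar> \<partial>M) \<le> e / (4 * L)" .
  then show "\<forall>\<^sub>F n in sequentially. (\<integral>\<omega>. \<bar>(\<Sum>t=1..int n. h (G t \<omega>)) / n - (\<integral>\<omega>. h (G 1 \<omega>) \<partial>M)\<bar> \<partial>M) < e"
    using eventually_gt_at_top[of 0]
  proof eventually_elim
    case (elim n)
    let ?r = "\<lambda>x. h x - hL L x"
    have iL: "integrable M (\<lambda>\<omega>. hL L (G t \<omega>))" for t by (rule integrable_const_bound[of _ "real L"]) (use hLb in auto)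
    have ih: "integrable M (\<lambda>\<omega>. h (G t \<omega>))" for t using int stationary_expectation_1(2)[OF G(1) h] by blast
    have "(\<lambda>x. \<bar>?r x\<bar>) \<in> borel_measurable borel" by measurable
    from stationary_expectation_1(1)[OF G(1) this]
    have rt: "(\<integral>\<omega>. \<bar>?r (G t \<omega>)\<bar> \<partial>M) = (\<integral>\<omega>. \<bar>?r (G 1 \<omega>)\<bar> \<partial>M)" for t by simp
    have "(\<integral>\<omega>. ?r (G 1 \<omega>) \<partial>M) = (\<integral>\<omega>. h (G 1 \<omega>) \<partial>M) - (\<integral>\<omega>. hL L (G 1 \<omega>) \<partial>M)" using ih iL by simp
    then have r1: "\<bar>(\<integral>\<omega>. h (G 1 \<omega>) \<partial>M) - (\<integral>\<omega>. hL L (G 1 \<omega>) \<partial>M)\<bar> \<le> (\<integral>\<omega>. \<bar>?r (G 1 \<omega>)\<bar> \<partial>M)"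
      using integral_abs_bound[of M "\<lambda>\<omega>. ?r (G 1 \<omega>)"] by simp
    have pt: "\<bar>(\<Sum>t=1..int n. h (G t \<omega>)) / n - (\<integral>\<omega>. h (G 1 \<omega>) \<partial>M)\<bar> \<le>
       (\<Sum>t=1..int n. \<bar>?r (G t \<omega>)\<bar>) / n + (\<integral>\<omega>. \<bar>?r (G 1 \<omega>)\<bar> \<partial>M) +
       L * \<bar>(\<Sum>t=1..int n. g (G t \<omega>)) / n - (\<integral>\<omega>. g (G 1 \<omega>) \<partial>M)\<bar>" for \<omega>
    proof -
      have 1: "\<bar>(\<Sum>t=1..int n. ?r (G t \<omega>)) / n\<bar> \<le> (\<Sum>t=1..int n. \<bar>?r (G t \<omega>)\<bar>) / n"
        by (simp add: divide_right_mono)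
      have "L * ((\<Sum>t=1..int n. g (G t \<omega>)) / n - (\<integral>\<omega>. g (G 1 \<omega>) \<partial>M)) = (\<Sum>t=1..int n. hL L (G t \<omega>)) / n - (\<integral>\<omega>. hL L (G 1 \<omega>) \<partial>M)"
        unfolding g_def using L(2) by (simp add: sum_divide_distrib[symmetric] right_diff_distrib)
      then have 2: "L * \<bar>(\<Sum>t=1..int n. g (G t \<omega>)) / n - (\<integral>\<omega>. g (G 1 \<omega>) \<partial>M)\<bar> = \<bar>(\<Sum>t=1..int n. hL L (G t \<omega>)) / n - (\<integral>\<omega>. hL L (G 1 \<omega>) \<partial>M)\<bar>"
        by (metis abs_mult abs_of_nat)
      have 3: "(\<Sum>t=1..int n. h (G t \<omega>)) / n = (\<Sum>t=1..int n. ?r (G t \<omega>)) / n + (\<Sum>t=1..int n. hL L (G t \<omega>)) / n"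
        by (simp add: sum_subtractf diff_divide_distrib)
      have "\<bar>x - H\<bar> \<le> R + D + c" if "c = \<bar>l - K\<bar>" "x = r + l" "\<bar>r\<bar> \<le> R" "\<bar>H - K\<bar> \<le> D" for x H R D c l K r :: real
        using that by linarith
      from this[OF 2 3 1 r1] show ?thesis .
    qed
    have ig: "integrable M (\<lambda>\<omega>. \<bar>(\<Sum>t=1..int n. g (G t \<omega>)) / n - (\<integral>\<omega>. g (G 1 \<omega>) \<partial>M)\<bar>)"
      unfolding g_def using iL by (intro integrable_abs) simp
    have ir: "integrable M (\<lambda>\<omega>. (\<Sum>t=1..int n. \<bar>?r (G t \<omega>)\<bar>) / n)" using ih iL by simp
    have "(\<integral>\<omega>. \<bar>(\<Sum>t=1..int n. h (G t \<omega>)) / n - (\<integral>\<omega>. h (G 1 \<omega>) \<partial>M)\<bar> \<partial>M) \<le>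
      (\<integral>\<omega>. (\<Sum>t=1..int n. \<bar>?r (G t \<omega>)\<bar>) / n + (\<integral>\<omega>. \<bar>?r (G 1 \<omega>)\<bar> \<partial>M) +
       L * \<bar>(\<Sum>t=1..int n. g (G t \<omega>)) / n - (\<integral>\<omega>. g (G 1 \<omega>) \<partial>M)\<bar> \<partial>M)"
      by (intro integral_mono pt integrable_abs Bochner_Integration.integrable_add ir integrable_mult_right ig) (use ih in auto)
    also have "\<dots> = (\<integral>\<omega>. \<bar>?r (G 1 \<omega>)\<bar> \<partial>M) + (\<integral>\<omega>. \<bar>?r (G 1 \<omega>)\<bar> \<partial>M) +
       L * (\<integral>\<omega>. \<bar>(\<Sum>t=1..int n. g (G t \<omega>)) / n - (\<integral>\<omega>. g (G 1 \<omega>) \<partial>M)\<bar> \<partial>M)"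
    proof -
      have "(\<integral>\<omega>. (\<Sum>t=1..int n. \<bar>?r (G t \<omega>)\<bar>) / n \<partial>M) = (\<Sum>t=1..int n. (\<integral>\<omega>. \<bar>?r (G t \<omega>)\<bar> \<partial>M)) / n"
        using ih iL by simp
      also have "\<dots> = (\<Sum>t=1..int n. (\<integral>\<omega>. \<bar>?r (G 1 \<omega>)\<bar> \<partial>M)) / n"
        by (intro arg_cong2[of _ _ _ _ "(/)"] sum.cong refl rt)
      also have "\<dots> = (\<integral>\<omega>. \<bar>?r (G 1 \<omega>)\<bar> \<partial>M)" using elim(2) by simp
      finally show ?thesis using ir ig by (simp add: prob_space)
    qed
    also have "\<dots> \<le> e / 4 + e / 4 + L * (e / (4 * L))"
      using L elim(1) by (intro add_mono mult_left_mono) auto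
    also have "\<dots> < e" using L e by (simp add: field_simps)
    finally show ?case .
  qed
next
  fix e :: real assume "e < 0"
  then show "\<forall>\<^sub>F n in sequentially. e < (\<integral>\<omega>. \<bar>(\<Sum>t=1..int n. h (G t \<omega>)) / n - (\<integral>\<omega>. h (G 1 \<omega>) \<partial>M)\<bar> \<partial>M)"
    by (intro always_eventually allI) (rule less_le_trans[OF _ Bochner_Integration.integral_nonneg], auto)
qed

end

section \<open>Principle of conditioning\<close>

lemma norm_1_minus_exp_le:
  fixes w :: complex
  assumes "0 \<le> Re w"
  shows "norm (1 - exp (- w)) \<le> norm w"
proof -
  have "norm (exp (- 0) - exp (- w)) \<le> 1 * norm (0 - w)"
    by (rule field_differentiable_bound[where S = "{z. Re z \<ge> 0}" and f' = "\<lambda>z. - exp (- z)"])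
       (use assms in \<open>auto simp: convex_halfspace_Re_ge intro!: derivative_eq_intros\<close>)
  then show ?thesis by simp
qed

lemma norm_exp_diff_le:
  fixes z w :: complex
  assumes "norm z \<le> K" "norm w \<le> K"
  shows "norm (exp z - exp w) \<le> exp K * norm (z - w)"
proof (rule field_differentiable_bound[where S = "cball 0 K"])
  fix x :: complex assume "x \<in> cball 0 K"
  then have "Re x \<le> K" using complex_Re_le_cmod[of x] by simp
  then show "norm (exp x) \<le> exp K" by simp
qed (use assms in \<open>auto intro!: derivative_eq_intros\<close>)

lemma n_times_1_minus_exp:
  fixes w :: complex
  shows "(\<lambda>n. of_real (real n) * (1 - exp (- w / of_real (real n)))) \<longlonglongrightarrow> w"
proof -
  have "((\<lambda>h. 1 - exp (- h * w)) has_field_derivative w) (at 0)"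
    by (auto intro!: derivative_eq_intros)
  then have "((\<lambda>h. (1 - exp (- h * w)) / h) \<longlongrightarrow> w) (at 0)" by (simp add: DERIV_def)
  moreover have "filterlim (\<lambda>n. complex_of_real (1 / real (Suc n))) (at 0) sequentially"
  proof (rule filterlim_atI)
    have "(\<lambda>n. complex_of_real (inverse (real (Suc n)))) \<longlonglongrightarrow> of_real 0"
      by (intro tendsto_of_real LIMSEQ_inverse_real_of_nat)
    then show "(\<lambda>n. complex_of_real (1 / real (Suc n))) \<longlonglongrightarrow> 0"
      by (simp only: inverse_eq_divide of_real_0)
  qed (intro always_eventually allI, simp only: of_real_eq_0_iff, simp)
  ultimately have "(\<lambda>n. (1 - exp (- complex_of_real (1 / real (Suc n)) * w)) / complex_of_real (1 / real (Suc n))) \<longlonglongrightarrow> w"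
    by (rule filterlim_compose)
  then have "(\<lambda>n. of_real (real (Suc n)) * (1 - exp (- w / of_real (real (Suc n))))) \<longlonglongrightarrow> w"
    by (simp add: divide_inverse mult_ac del: of_nat_Suc)
  then show ?thesis by (rule LIMSEQ_imp_Suc[where f = "\<lambda>n. of_real (real n) * (1 - exp (- w / of_real (real n)))"])
qed

context prob_space
begin

lemma prob_Int_block_sigma:
  fixes Y :: "int \<Rightarrow> 'a \<Rightarrow> 'b::topological_space"
  assumes ind: "indep_vars (\<lambda>_. borel) Y UNIV" and dis: "S \<inter> T = {}"
    and A: "A \<in> sets (block_sigma M Y S)" and B: "B \<in> sets (block_sigma M Y T)"
  shows "prob (A \<inter> B) = prob A * prob B"
proof -
  have Ym: "\<And>s. Y s \<in> borel_measurable M" using ind by (auto simp: indep_vars_def2)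
  have [simp]: "A \<in> sets M" "B \<in> sets M"
    using A B subalgebra_block_sigma[of Y M, OF Ym] by (auto simp: subalgebra_def)
  have "indep_var borel (indicat_real A) borel (indicat_real B)"
    by (rule indep_block_sigma[OF ind dis]) (use A B in auto)
  then have "(\<integral>\<omega>. indicat_real A \<omega> * indicat_real B \<omega> \<partial>M) = expectation (indicat_real A) * expectation (indicat_real B)"
    by (intro indep_var_lebesgue_integral integrable_indicator_events) auto
  moreover have "(\<integral>\<omega>. indicat_real A \<omega> * indicat_real B \<omega> \<partial>M) = expectation (indicat_real (A \<inter> B))"
    by (rule Bochner_Integration.integral_cong) (auto simp: indicator_def)
  moreover have "A \<inter> B \<inter> space M = A \<inter> B" by (intro sets.Int_space_eq2 sets.Int) simp_all
  ultimately show ?thesis by simp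
qed

text \<open>A variable measurable in the past of \<open>t\<close> and the variable
  \<open>Y t\<close> have a product law as their joint law, so Fubini permits freezing the first
  while integrating over the second. This stands in for conditional expectations.\<close>

lemma indep_past_integral:
  fixes Y :: "int \<Rightarrow> 'a \<Rightarrow> 'b::{second_countable_topology,t2_space}"
    and F :: "'c \<times> 'b \<Rightarrow> 'd::{banach,second_countable_topology}"
  assumes ind: "indep_vars (\<lambda>_. borel) Y UNIV"
    and X: "X \<in> measurable (past_sigma M Y t) N" and F: "F \<in> borel_measurable (N \<Otimes>\<^sub>M borel)"
    and b: "\<And>z. norm (F z) \<le> B"
  shows "(\<integral>\<omega>. F (X \<omega>, Y t \<omega>) \<partial>M) = (\<integral>\<omega>. (\<integral>\<omega>'. F (X \<omega>, Y t \<omega>') \<partial>M) \<partial>M)"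
proof -
  have Ym: "\<And>s. Y s \<in> borel_measurable M" using ind by (auto simp: indep_vars_def2)
  have Xm[measurable]: "X \<in> measurable M N"
    using X block_sigma_borel_measurable[OF ind] by (simp add: past_sigma_eq)
  have [measurable]: "Y t \<in> borel_measurable M" by (rule Ym)
  interpret D1: prob_space "distr M N X" by (rule prob_space_distr) simp
  interpret D2: prob_space "distr M borel (Y t)" by (rule prob_space_distr) simp
  have e: "distr M N X \<Otimes>\<^sub>M distr M borel (Y t) = distr M (N \<Otimes>\<^sub>M borel) (\<lambda>\<omega>. (X \<omega>, Y t \<omega>))"
  proof (rule pair_measure_eqI)
    show "sigma_finite_measure (distr M N X)" "sigma_finite_measure (distr M borel (Y t))" by unfold_locales
    show "sets (distr M N X \<Otimes>\<^sub>M distr M borel (Y t)) = sets (distr M (N \<Otimes>\<^sub>M borel) (\<lambda>\<omega>. (X \<omega>, Y t \<omega>)))"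
      by (simp cong: sets_pair_measure_cong)
    fix A B assume AB: "A \<in> sets (distr M N X)" "B \<in> sets (distr M borel (Y t))"
    then have [measurable]: "A \<in> sets N" "B \<in> sets borel" by auto
    have "prob ((X -` A \<inter> space M) \<inter> (Y t -` B \<inter> space M)) = prob (X -` A \<inter> space M) * prob (Y t -` B \<inter> space M)"
      by (rule prob_Int_block_sigma[OF ind, of "{..<t}" "{t}"])
         (use measurable_sets[OF X, of A] measurable_sets[OF measurable_block_sigma_self, of t "{t}" B Y M] AB
          in \<open>auto simp: past_sigma_eq\<close>)
    moreover have "emeasure (distr M (N \<Otimes>\<^sub>M borel) (\<lambda>\<omega>. (X \<omega>, Y t \<omega>))) (A \<times> B) =
        prob ((X -` A \<inter> space M) \<inter> (Y t -` B \<inter> space M))"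
      by (subst emeasure_distr) (auto simp: emeasure_eq_measure intro!: arg_cong[where f = prob])
    ultimately show "emeasure (distr M N X) A * emeasure (distr M borel (Y t)) B =
        emeasure (distr M (N \<Otimes>\<^sub>M borel) (\<lambda>\<omega>. (X \<omega>, Y t \<omega>))) (A \<times> B)"
      by (simp add: emeasure_distr emeasure_eq_measure ennreal_mult)
  qed
  interpret P: pair_prob_space "distr M N X" "distr M borel (Y t)" ..
  have F': "F \<in> borel_measurable (distr M N X \<Otimes>\<^sub>M distr M borel (Y t))" using F by (simp cong: measurable_cong_sets)
  have i: "integrable (distr M N X \<Otimes>\<^sub>M distr M borel (Y t)) F"
    by (rule P.integrable_const_bound[OF _ F', of B]) (use b in auto)
  have "(\<integral>\<omega>. F (X \<omega>, Y t \<omega>) \<partial>M) = integral\<^sup>L (distr M (N \<Otimes>\<^sub>M borel) (\<lambda>\<omega>. (X \<omega>, Y t \<omega>))) F"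
    by (rule integral_distr[symmetric]) (use F in auto)
  also have "\<dots> = (\<integral>x. (\<integral>y. F (x, y) \<partial>distr M borel (Y t)) \<partial>distr M N X)"
    unfolding e[symmetric] by (rule P.integral_fst'[OF i, symmetric])
  also have "\<dots> = (\<integral>\<omega>. (\<integral>y. F (X \<omega>, y) \<partial>distr M borel (Y t)) \<partial>M)"
    by (rule integral_distr) (use F in \<open>auto intro!: D2.borel_measurable_lebesgue_integral simp: split_beta' cong: measurable_cong_sets\<close>)
  also have "\<dots> = (\<integral>\<omega>. (\<integral>\<omega>'. F (X \<omega>, Y t \<omega>') \<partial>M) \<partial>M)"
  proof (rule Bochner_Integration.integral_cong)
    fix \<omega> assume "\<omega> \<in> space M"
    then have "X \<omega> \<in> space N" using Xm by (rule measurable_space[rotated])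
    then have "(\<lambda>y. F (X \<omega>, y)) \<in> borel_measurable borel" using F by simp
    then show "(\<integral>y. F (X \<omega>, y) \<partial>distr M borel (Y t)) = (\<integral>\<omega>'. F (X \<omega>, Y t \<omega>') \<partial>M)"
      by (rule integral_distr[rotated]) simp
  qed simp
  finally show ?thesis .
qed

text \<open>Principle of conditioning: with \<open>A\<close> the sum of the conditional exponents, stopped once their
  absolute sum exceeds a fixed level, the product of \<open>exp A\<close> and the exponential of the transform is
  almost a martingale, and by the law of large numbers \<open>A\<close> is asymptotically constant.\<close>

theorem martingale_transform_char:
  fixes Y :: "int \<Rightarrow> 'a \<Rightarrow> real" and V :: "int \<Rightarrow> 'a \<Rightarrow> real" and \<psi> :: "real \<Rightarrow> complex" and H :: "real \<Rightarrow> real"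
  assumes ind: "indep_vars (\<lambda>_. borel) Y UNIV" and id: "\<And>s t. distr M borel (Y s) = distr M borel (Y t)"
    and V: "strictly_stationary M V" "\<And>t. V t \<in> borel_measurable (past_sigma M Y t)"
    and \<psi>[measurable]: "\<psi> \<in> borel_measurable borel" and H[measurable]: "H \<in> borel_measurable borel"
    and lim: "\<And>u. (\<lambda>n. of_real (real n) * (1 - (\<integral>\<omega>. iexp (u * (Y 1 \<omega> / a n)) \<partial>M))) \<longlonglongrightarrow> \<psi> u"
    and dom: "\<And>n u. n \<ge> n0 \<Longrightarrow> norm (of_real (real n) * (1 - (\<integral>\<omega>. iexp (u * (Y 1 \<omega> / a n)) \<partial>M))) \<le> H u"
    and HV: "integrable M (\<lambda>\<omega>. H (V 1 \<omega>))"
  shows "(\<lambda>n. \<integral>\<omega>. iexp (\<Sum>t=1..int n. V t \<omega> * (Y t \<omega> / a n)) \<partial>M) \<longlonglongrightarrow> exp (- (\<integral>\<omega>. \<psi> (V 1 \<omega>) \<partial>M))"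
proof -
  have Ym[measurable]: "\<And>s. Y s \<in> borel_measurable M" using ind by (auto simp: indep_vars_def2)
  have Vm[measurable]: "\<And>t. V t \<in> borel_measurable M" using V by (auto simp: strictly_stationary_def)
  have [measurable]: "(\<lambda>\<omega>. \<psi> (V t \<omega>)) \<in> borel_measurable M" for t by (rule measurable_compose[OF Vm \<psi>])
  define \<phi> where "\<phi> n u = (\<integral>\<omega>. iexp (u * (Y 1 \<omega> / a n)) \<partial>M)" for n u
  have \<phi>m[measurable]: "\<phi> n \<in> borel_measurable borel" for n unfolding \<phi>_def by measurable
  have \<phi>1: "norm (\<phi> n u) \<le> 1" for n u
    unfolding \<phi>_def using integral_norm_bound[of M "\<lambda>\<omega>. iexp (u * (Y 1 \<omega> / a n))"] by (simp add: prob_space)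
  have \<phi>t: "(\<integral>\<omega>. iexp (u * (Y t \<omega> / a n)) \<partial>M) = \<phi> n u" for n u t
  proof -
    have m: "(\<lambda>y. iexp (u * (y / a n))) \<in> borel_measurable borel" by measurable
    show ?thesis unfolding \<phi>_def
      using integral_distr[OF Ym m, of t] integral_distr[OF Ym m, of 1] id[of t 1] by simp
  qed
  have \<psi>H: "norm (\<psi> u) \<le> H u" for u
    by (rule Lim_norm_ubound[OF _ lim]) (use dom in \<open>auto intro: eventually_sequentiallyI[of n0]\<close>)
  have H0: "0 \<le> H u" for u using order_trans[OF norm_ge_zero \<psi>H] .
  have Re\<psi>: "0 \<le> Re (\<psi> u)" for u
  proof (rule tendsto_lowerbound[OF tendsto_Re[OF lim]])
    have "0 \<le> Re (of_real (real n) * (1 - \<phi> n u))" for n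
      using \<phi>1[of n u] complex_Re_le_cmod[of "\<phi> n u"] by simp
    then show "\<forall>\<^sub>F n in sequentially. 0 \<le> Re (of_real (real n) * (1 - (\<integral>\<omega>. iexp (u * (Y 1 \<omega> / a n)) \<partial>M)))"
      by (simp add: \<phi>_def)
  qed simp
  have i\<psi>: "integrable M (\<lambda>\<omega>. \<psi> (V 1 \<omega>))"
    by (rule Bochner_Integration.integrable_bound[OF HV]) (use order_trans[OF \<psi>H abs_ge_self] in auto)
  define B where "B = (\<integral>\<omega>. \<psi> (V 1 \<omega>) \<partial>M)"
  \<comment> \<open>The added 1 is a margin: stopping before time \<open>n\<close> forces the
    average of \<open>norm (\<psi> (V t))\<close> to exceed its mean \<open>K - 1\<close> by more
    than 1, which the law of large numbers makes negligible.\<close>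
  define K where "K = (\<integral>\<omega>. norm (\<psi> (V 1 \<omega>)) \<partial>M) + 1"
  have K: "0 \<le> K" "norm B \<le> K"
    using integral_norm_bound[of M "\<lambda>\<omega>. \<psi> (V 1 \<omega>)"] norm_ge_zero[of B] unfolding K_def B_def by linarith+

  \<comment> \<open>The mean error of replacing the characteristic function of one increment by
    \<open>exp (- \<psi> / n)\<close>. There are \<open>n\<close> increments, so
    \<open>n * \<delta> n\<close> has to vanish.\<close>
  define \<delta> where "\<delta> n = (\<integral>\<omega>. norm (\<phi> n (V 1 \<omega>) - exp (- \<psi> (V 1 \<omega>) / of_real (real n))) \<partial>M)" for n
  have ebd: "norm (exp (- \<psi> u / of_real (real n))) \<le> 1" for u n
    using Re\<psi>[of u] by (simp add: divide_nonneg_nonneg)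
  have \<delta>_int: "integrable M (\<lambda>\<omega>. norm (\<phi> n (V t \<omega>) - exp (- \<psi> (V t \<omega>) / of_real (real n))))" for n t
    by (intro integrable_norm Bochner_Integration.integrable_diff integrable_const_bound[of _ 1] AE_I2 \<phi>1 ebd) measurable
  have \<delta>_lim: "(\<lambda>n. real n * \<delta> n) \<longlonglongrightarrow> 0"
  proof (rule LIMSEQ_offset[of _ n0])
    have "(\<lambda>n. \<integral>\<omega>. norm (of_real (real (n + n0)) * (\<phi> (n + n0) (V 1 \<omega>) - exp (- \<psi> (V 1 \<omega>) / of_real (real (n + n0))))) \<partial>M) \<longlonglongrightarrow> (\<integral>\<omega>. 0 \<partial>M)"
    proof (rule integral_dominated_convergence[where w = "\<lambda>\<omega>. 2 * H (V 1 \<omega>)"])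
      have "(\<lambda>n. of_real (real n) * (\<phi> n u - exp (- \<psi> u / of_real (real n)))) \<longlonglongrightarrow> 0" for u
      proof -
        have "(\<lambda>n. of_real (real n) * (1 - exp (- \<psi> u / of_real (real n))) - of_real (real n) * (1 - \<phi> n u)) \<longlonglongrightarrow> \<psi> u - \<psi> u"
          by (intro tendsto_diff n_times_1_minus_exp) (use lim in \<open>simp add: \<phi>_def\<close>)
        then show ?thesis by (simp add: algebra_simps)
      qed
      then have "(\<lambda>n. of_real (real (n + n0)) * (\<phi> (n + n0) u - exp (- \<psi> u / of_real (real (n + n0))))) \<longlonglongrightarrow> 0" for u
        by (rule LIMSEQ_ignore_initial_segment)
      then show "AE \<omega> in M. (\<lambda>n. norm (of_real (real (n + n0)) * (\<phi> (n + n0) (V 1 \<omega>) - exp (- \<psi> (V 1 \<omega>) / of_real (real (n + n0)))))) \<longlonglongrightarrow> 0"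
        by (intro AE_I2 tendsto_norm_zero)
      show "AE \<omega> in M. norm (norm (of_real (real (n + n0)) * (\<phi> (n + n0) (V 1 \<omega>) - exp (- \<psi> (V 1 \<omega>) / of_real (real (n + n0)))))) \<le> 2 * H (V 1 \<omega>)" for n
      proof (intro AE_I2)
        fix \<omega>
        define u where "u = V 1 \<omega>"
        define N where "N = n + n0"
        have "norm (of_real (real N) * (1 - exp (- (\<psi> u / of_real (real N))))) \<le> real N * norm (\<psi> u / of_real (real N))"
          unfolding norm_mult using Re\<psi>[of u] by (intro mult_mono norm_1_minus_exp_le) (auto simp: divide_nonneg_nonneg)
        also have "\<dots> \<le> norm (\<psi> u)" by (cases "N = 0") (auto simp: norm_divide)
        finally have 1: "norm (of_real (real N) * (1 - exp (- \<psi> u / of_real (real N)))) \<le> H u" using \<psi>H[of u] by simp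
        have 2: "norm (of_real (real N) * (1 - \<phi> N u)) \<le> H u" unfolding \<phi>_def by (rule dom) (simp add: N_def)
        have 3: "of_real (real N) * (\<phi> N u - exp (- \<psi> u / of_real (real N))) =
           of_real (real N) * (1 - exp (- \<psi> u / of_real (real N))) - of_real (real N) * (1 - \<phi> N u)"
          by (simp add: algebra_simps)
        have "norm (of_real (real N) * (\<phi> N u - exp (- \<psi> u / of_real (real N)))) \<le> H u + H u"
          unfolding 3 by (rule order_trans[OF norm_triangle_ineq4 add_mono[OF 1 2]])
        then show "norm (norm (of_real (real (n + n0)) * (\<phi> (n + n0) (V 1 \<omega>) - exp (- \<psi> (V 1 \<omega>) / of_real (real (n + n0)))))) \<le> 2 * H (V 1 \<omega>)"
          by (simp only: real_norm_def abs_norm_cancel N_def[symmetric] u_def[symmetric] mult_2)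
      qed
    qed (use HV in auto)
    then show "(\<lambda>n. real (n + n0) * \<delta> (n + n0)) \<longlonglongrightarrow> 0"
      by (simp add: \<delta>_def norm_mult del: of_nat_add)
  qed

  \<comment> \<open>The sum includes time \<open>t\<close> itself, because \<open>V t\<close> is
    known before \<open>Y t\<close>. The stopping rule is thus predictable, and \<open>A\<close>
    cannot leave the ball of radius \<open>K\<close> even by one step.\<close>
  define ct where "ct n t \<omega> = (if (\<Sum>s=1..int t. norm (\<psi> (V s \<omega>))) / real n \<le> K then 1 else 0 :: real)" for n t :: nat and \<omega>
  define A where "A n t \<omega> = (\<Sum>s=1..t. of_real (ct n s \<omega>) * \<psi> (V (int s) \<omega>) / of_real (real n))" for n t :: nat and \<omega>
  define W where "W n t \<omega> = iexp (\<Sum>s=1..t. ct n s \<omega> * V (int s) \<omega> * (Y (int s) \<omega> / a n))" for n t :: nat and \<omega>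
  have Am: "norm (A n t \<omega>) \<le> K" for n t \<omega>
  proof -
    have "(\<Sum>s=1..t. ct n s \<omega> * norm (\<psi> (V (int s) \<omega>)) / real n) \<le> K"
    proof (induction t)
      case (Suc t)
      show ?case
      proof (cases "ct n (Suc t) \<omega> = 0")
        case False
        then have le: "(\<Sum>s=1..int (Suc t). norm (\<psi> (V s \<omega>))) / real n \<le> K" by (auto simp: ct_def split: if_splits)
        have eq: "(\<Sum>s=1..int (Suc t). norm (\<psi> (V s \<omega>))) = (\<Sum>s=1..Suc t. norm (\<psi> (V (int s) \<omega>)))"
          by (rule sum.reindex_bij_witness[of _ int nat]) auto
        have "(\<Sum>s=1..Suc t. ct n s \<omega> * norm (\<psi> (V (int s) \<omega>)) / real n) \<le> (\<Sum>s=1..Suc t. norm (\<psi> (V (int s) \<omega>)) / real n)"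
          by (intro sum_mono divide_right_mono) (auto simp: ct_def)
        also have "\<dots> \<le> K" using le unfolding eq sum_divide_distrib .
        finally show ?thesis .
      qed (use Suc in simp)
    qed (use K in simp)
    moreover have "norm (A n t \<omega>) \<le> (\<Sum>s=1..t. ct n s \<omega> * norm (\<psi> (V (int s) \<omega>)) / real n)"
      unfolding A_def by (intro sum_norm_le) (auto simp: norm_mult norm_divide ct_def)
    ultimately show ?thesis by simp
  qed
  have expA: "norm (exp (A n t \<omega>)) \<le> exp K" for n t \<omega>
    using Am[of n t \<omega>] complex_Re_le_cmod[of "A n t \<omega>"] by simp
  have W1: "norm (W n t \<omega>) = 1" for n t \<omega> by (simp add: W_def)
  have Vp: "V s \<in> borel_measurable (past_sigma M Y t)" if "s \<le> t" for s t
    unfolding past_sigma_eq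
    by (rule measurable_block_sigma_mono[OF V(2)[of s, unfolded past_sigma_eq]]) (use that in auto)
  have Yp: "Y s \<in> borel_measurable (past_sigma M Y t)" if "s < t" for s t
    unfolding past_sigma_eq using that by (intro measurable_block_sigma_self) auto
  have ctp: "ct n s \<in> borel_measurable (past_sigma M Y (int t))" if "s \<le> t" for n s t
  proof -
    have [measurable]: "V u \<in> borel_measurable (past_sigma M Y (int t))" if "u \<in> {1..int s}" for u
      using Vp that \<open>s \<le> t\<close> by auto
    show ?thesis unfolding ct_def by measurable
  qed
  have ctM[measurable]: "ct n s \<in> borel_measurable M" for n s unfolding ct_def by measurable
  have Ap: "A n s \<in> borel_measurable (past_sigma M Y (int t))" if "s \<le> t" for n s t
    unfolding A_def
  proof (intro borel_measurable_sum borel_measurable_divide borel_measurable_times borel_measurable_const)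
    fix u assume u: "u \<in> {1..s}"
    show "(\<lambda>x. complex_of_real (ct n u x)) \<in> borel_measurable (past_sigma M Y (int t))"
    proof -
      have [measurable]: "ct n u \<in> borel_measurable (past_sigma M Y (int t))" using u that by (intro ctp) auto
      show ?thesis by measurable
    qed
    show "(\<lambda>x. \<psi> (V (int u) x)) \<in> borel_measurable (past_sigma M Y (int t))"
      using Vp[of "int u" "int t"] u that by (intro measurable_compose[OF _ \<psi>]) auto
  qed
  have AM[measurable]: "A n s \<in> borel_measurable M" for n s unfolding A_def by measurable
  have Wp: "W n s \<in> borel_measurable (past_sigma M Y (int t))" if "s < t" for n s t
  proof -
    have "(\<lambda>\<omega>. \<Sum>u=1..s. ct n u \<omega> * V (int u) \<omega> * (Y (int u) \<omega> / a n)) \<in> borel_measurable (past_sigma M Y (int t))"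
      using ctp Vp Yp that by (intro borel_measurable_sum borel_measurable_times borel_measurable_divide borel_measurable_const) auto
    then show ?thesis unfolding W_def by measurable
  qed
  have WM[measurable]: "W n s \<in> borel_measurable M" for n s unfolding W_def by measurable

  have bstep: "norm (x * y) \<le> exp K" if "norm x \<le> 1" "norm y \<le> exp K" for x y :: complex
    using mult_mono[OF that] by (simp add: norm_mult)
  have iWA: "integrable M (\<lambda>\<omega>. W n s \<omega> * exp (A n t \<omega>))" for n s t
    by (rule integrable_const_bound[of _ "exp K"]) (use bstep[OF eq_refl[OF W1] expA] in auto)
  have step: "norm ((\<integral>\<omega>. W n (Suc t) \<omega> * exp (A n (Suc t) \<omega>) \<partial>M) - (\<integral>\<omega>. W n t \<omega> * exp (A n t \<omega>) \<partial>M)) \<le> exp K * \<delta> n" for n t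
  proof -
    define s where "s = int (Suc t)"
    \<comment> \<open>\<open>A\<close> is already taken at the next time, being predictable; the
      only factor not determined by the past is the last exponential in \<open>Y s\<close>.\<close>
    define U where "U \<omega> = W n t \<omega> * exp (A n (Suc t) \<omega>)" for \<omega>
    define v where "v \<omega> = ct n (Suc t) \<omega> * V s \<omega>" for \<omega>
    define \<eta> where "\<eta> \<omega> = of_real (ct n (Suc t) \<omega>) * \<psi> (V s \<omega>) / of_real (real n)" for \<omega>
    have Un: "norm (U \<omega>) \<le> exp K" for \<omega> unfolding U_def by (rule bstep[OF eq_refl[OF W1] expA])
    have Up: "U \<in> borel_measurable (past_sigma M Y s)"
    proof -
      have [measurable]: "A n (Suc t) \<in> borel_measurable (past_sigma M Y (int (Suc t)))"
        "W n t \<in> borel_measurable (past_sigma M Y (int (Suc t)))" by (rule Ap Wp, simp)+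
      show ?thesis unfolding U_def s_def by measurable
    qed
    have vp: "v \<in> borel_measurable (past_sigma M Y s)" unfolding v_def s_def
      by (intro borel_measurable_times ctp V) auto
    have [measurable]: "U \<in> borel_measurable M" "v \<in> borel_measurable M" "\<eta> \<in> borel_measurable M"
      unfolding U_def v_def \<eta>_def by measurable
    have Asuc: "A n (Suc t) \<omega> = A n t \<omega> + \<eta> \<omega>" for \<omega> by (simp add: A_def \<eta>_def s_def)
    have Wsuc: "W n (Suc t) \<omega> = W n t \<omega> * iexp (v \<omega> * (Y s \<omega> / a n))" for \<omega>
      by (simp add: W_def v_def s_def exp_add[symmetric] distrib_left)
    have "(\<integral>\<omega>. W n (Suc t) \<omega> * exp (A n (Suc t) \<omega>) \<partial>M) = (\<integral>\<omega>. U \<omega> * iexp (v \<omega> * (Y s \<omega> / a n)) \<partial>M)"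
      by (simp add: U_def Wsuc mult_ac)
    also have "\<dots> = (\<integral>\<omega>. (\<integral>\<omega>'. U \<omega> * iexp (v \<omega> * (Y s \<omega>' / a n)) \<partial>M) \<partial>M)"
    proof -
      \<comment> \<open>The freezing lemma wants a function bounded at all arguments, whereas only
        the values of \<open>U\<close> are bounded. Clamping real and imaginary parts reconciles the
        two and fixes these values.\<close>
      define g where "g z = max (-exp K) (min (exp K) (Re z)) + \<i> * max (-exp K) (min (exp K) (Im z))" for z :: complex
      have gU: "g (U \<omega>) = U \<omega>" for \<omega>
      proof -
        have "\<bar>Re (U \<omega>)\<bar> \<le> exp K" "\<bar>Im (U \<omega>)\<bar> \<le> exp K"
          using order_trans[OF abs_Re_le_cmod Un] order_trans[OF abs_Im_le_cmod Un] by auto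
        then show ?thesis by (simp add: g_def complex_eq_iff)
      qed
      define F where "F = (\<lambda>p :: (complex \<times> real) \<times> real. g (fst (fst p)) * iexp (snd (fst p) * (snd p / a n)))"
      have Fm: "F \<in> borel_measurable ((borel \<Otimes>\<^sub>M borel) \<Otimes>\<^sub>M borel)" unfolding F_def g_def by measurable
      have gb: "norm (g z) \<le> exp K + exp K" for z
      proof -
        have "\<bar>max (- e) (min e x)\<bar> \<le> e" if "0 \<le> e" for e x :: real using that by auto
        from this[OF exp_ge_zero] show ?thesis unfolding g_def
          by (intro order_trans[OF norm_triangle_ineq] add_mono) (simp_all add: norm_mult norm_of_real del: of_real_exp)
      qed
      have "norm (F z) \<le> exp K + exp K" for z unfolding F_def using gb by (simp add: norm_mult)
      from indep_past_integral[OF ind measurable_Pair[OF Up vp] Fm this]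
      show ?thesis by (simp add: F_def gU)
    qed
    also have "\<dots> = (\<integral>\<omega>. U \<omega> * \<phi> n (v \<omega>) \<partial>M)" using \<phi>t by simp
    finally have 1: "(\<integral>\<omega>. W n (Suc t) \<omega> * exp (A n (Suc t) \<omega>) \<partial>M) = (\<integral>\<omega>. U \<omega> * \<phi> n (v \<omega>) \<partial>M)" .
    have 2: "W n t \<omega> * exp (A n t \<omega>) = U \<omega> * exp (- \<eta> \<omega>)" for \<omega>
      by (simp add: U_def Asuc exp_add exp_minus)
    have \<eta>b: "norm (exp (- \<eta> \<omega>)) \<le> 1" for \<omega>
      using Re\<psi>[of "V s \<omega>"] by (simp add: \<eta>_def ct_def divide_nonneg_nonneg)
    have i1: "integrable M (\<lambda>\<omega>. U \<omega> * \<phi> n (v \<omega>))"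
      by (rule integrable_const_bound[of _ "exp K"]) (use bstep[OF \<phi>1 Un] in \<open>auto simp: mult.commute\<close>)
    have i2: "integrable M (\<lambda>\<omega>. U \<omega> * exp (- \<eta> \<omega>))"
      by (rule integrable_const_bound[of _ "exp K"]) (use bstep[OF \<eta>b Un] in \<open>auto simp: mult.commute\<close>)
    have "(\<integral>\<omega>. W n (Suc t) \<omega> * exp (A n (Suc t) \<omega>) \<partial>M) - (\<integral>\<omega>. W n t \<omega> * exp (A n t \<omega>) \<partial>M)
       = (\<integral>\<omega>. U \<omega> * (\<phi> n (v \<omega>) - exp (- \<eta> \<omega>)) \<partial>M)"
      unfolding 1 2 using i1 i2 by (simp add: right_diff_distrib)
    also have "norm \<dots> \<le> (\<integral>\<omega>. norm (U \<omega> * (\<phi> n (v \<omega>) - exp (- \<eta> \<omega>))) \<partial>M)" by (rule integral_norm_bound)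
    also have "\<dots> \<le> (\<integral>\<omega>. exp K * norm (\<phi> n (V s \<omega>) - exp (- \<psi> (V s \<omega>) / of_real (real n))) \<partial>M)"
    proof (rule integral_mono)
      show "integrable M (\<lambda>\<omega>. norm (U \<omega> * (\<phi> n (v \<omega>) - exp (- \<eta> \<omega>))))"
        using i1 i2 by (intro integrable_norm) (simp add: right_diff_distrib)
      show "integrable M (\<lambda>\<omega>. exp K * norm (\<phi> n (V s \<omega>) - exp (- \<psi> (V s \<omega>) / of_real (real n))))"
        by (intro integrable_mult_right \<delta>_int)
      fix \<omega>
      \<comment> \<open>Once stopped, \<open>v\<close> and \<eta> are 0, both terms equal 1 and the
        difference vanishes.\<close>
      have "norm (\<phi> n (v \<omega>) - exp (- \<eta> \<omega>)) \<le> norm (\<phi> n (V s \<omega>) - exp (- \<psi> (V s \<omega>) / of_real (real n)))"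
        by (cases "ct n (Suc t) \<omega> = 0") (auto simp: v_def \<eta>_def ct_def \<phi>_def prob_space split: if_splits)
      then show "norm (U \<omega> * (\<phi> n (v \<omega>) - exp (- \<eta> \<omega>))) \<le> exp K * norm (\<phi> n (V s \<omega>) - exp (- \<psi> (V s \<omega>) / of_real (real n)))"
        unfolding norm_mult using Un by (intro mult_mono) auto
    qed
    also have "\<dots> = exp K * \<delta> n"
    proof -
      have m: "(\<lambda>u. norm (\<phi> n u - exp (- \<psi> u / of_real (real n)))) \<in> borel_measurable borel" by measurable
      show ?thesis using stationary_expectation_1(1)[OF V(1) m, of s 1] by (simp add: \<delta>_def)
    qed
    finally show ?thesis .
  qed
  have D0: "(\<integral>\<omega>. W n 0 \<omega> * exp (A n 0 \<omega>) \<partial>M) = 1" for n by (simp add: W_def A_def prob_space)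
  have Dn: "norm ((\<integral>\<omega>. W n t \<omega> * exp (A n t \<omega>) \<partial>M) - 1) \<le> real t * (exp K * \<delta> n)" for n t
  proof (induction t)
    case (Suc t)
    have "norm ((\<integral>\<omega>. W n (Suc t) \<omega> * exp (A n (Suc t) \<omega>) \<partial>M) - 1) \<le>
      norm ((\<integral>\<omega>. W n (Suc t) \<omega> * exp (A n (Suc t) \<omega>) \<partial>M) - (\<integral>\<omega>. W n t \<omega> * exp (A n t \<omega>) \<partial>M)) +
      norm ((\<integral>\<omega>. W n t \<omega> * exp (A n t \<omega>) \<partial>M) - 1)"
      using norm_triangle_ineq[of "(\<integral>\<omega>. W n (Suc t) \<omega> * exp (A n (Suc t) \<omega>) \<partial>M) - (\<integral>\<omega>. W n t \<omega> * exp (A n t \<omega>) \<partial>M)"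
        "(\<integral>\<omega>. W n t \<omega> * exp (A n t \<omega>) \<partial>M) - 1"] by simp
    then show ?case using step[of n t] Suc by (simp add: distrib_right)
  qed (simp add: D0)

  define avg where "avg f n \<omega> = (\<Sum>t=1..int n. f (V t \<omega>)) / real n" for f :: "real \<Rightarrow> real" and n :: nat and \<omega>
  have LLN: "(\<lambda>n. \<integral>\<omega>. \<bar>avg f n \<omega> - (\<integral>\<omega>. f (V 1 \<omega>) \<partial>M)\<bar> \<partial>M) \<longlonglongrightarrow> 0"
    if "f \<in> borel_measurable borel" "integrable M (\<lambda>\<omega>. f (V 1 \<omega>))" for f
    unfolding avg_def by (rule adapted_LLN[OF ind V that])
  define e1 where "e1 n = (\<integral>\<omega>. \<bar>avg (\<lambda>u. Re (\<psi> u)) n \<omega> - (\<integral>\<omega>. Re (\<psi> (V 1 \<omega>)) \<partial>M)\<bar> \<partial>M)" for n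
  define e2 where "e2 n = (\<integral>\<omega>. \<bar>avg (\<lambda>u. Im (\<psi> u)) n \<omega> - (\<integral>\<omega>. Im (\<psi> (V 1 \<omega>)) \<partial>M)\<bar> \<partial>M)" for n
  define e3 where "e3 n = (\<integral>\<omega>. \<bar>avg (\<lambda>u. norm (\<psi> u)) n \<omega> - (\<integral>\<omega>. norm (\<psi> (V 1 \<omega>)) \<partial>M)\<bar> \<partial>M)" for n
  have e1: "e1 \<longlonglongrightarrow> 0" unfolding e1_def by (rule LLN) (use i\<psi> in auto)
  have e2: "e2 \<longlonglongrightarrow> 0" unfolding e2_def by (rule LLN) (use i\<psi> in auto)
  have e3: "e3 \<longlonglongrightarrow> 0" unfolding e3_def by (rule LLN) (use i\<psi> in auto)
  have iavg: "integrable M (\<lambda>\<omega>. avg f n \<omega>)" if "f \<in> borel_measurable borel" "integrable M (\<lambda>\<omega>. f (V 1 \<omega>))" for f n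
    unfolding avg_def using that stationary_expectation_1(2)[OF V(1) that(1), of _ 1]
    by (intro integrable_divide Bochner_Integration.integrable_sum) auto

  define X where "X n \<omega> = iexp (\<Sum>t=1..int n. V t \<omega> * (Y t \<omega> / a n))" for n \<omega>
  have X1: "norm (X n \<omega>) = 1" for n \<omega> by (simp add: X_def)
  have [measurable]: "X n \<in> borel_measurable M" for n unfolding X_def by measurable
  have iX: "integrable M (X n)" for n by (rule integrable_const_bound[of _ 1]) (auto simp: X1)
  have main: "norm ((\<integral>\<omega>. X n \<omega> \<partial>M) * exp B - 1) \<le> exp K * (e1 n + e2 n + 2 * e3 n) + real n * (exp K * \<delta> n)" if n: "n > 0" for n
  proof -
    \<comment> \<open>If the average is at most \<open>K\<close>, no stopping has occurred, so
      \<open>W\<close> is \<open>X\<close> and the local Lipschitz bound of \<open>exp\<close>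
      applies. Otherwise the last deviation exceeds 1 and its factor 2 covers the trivial bound
      \<open>2 * exp K\<close>.\<close>
    have pt: "norm (X n \<omega> * exp B - W n n \<omega> * exp (A n n \<omega>)) \<le> exp K *
      (\<bar>avg (\<lambda>u. Re (\<psi> u)) n \<omega> - Re B\<bar> + \<bar>avg (\<lambda>u. Im (\<psi> u)) n \<omega> - Im B\<bar> + 2 * \<bar>avg (\<lambda>u. norm (\<psi> u)) n \<omega> - (K - 1)\<bar>)" for \<omega>
    proof (cases "avg (\<lambda>u. norm (\<psi> u)) n \<omega> \<le> K")
      case True
      have ct1: "ct n s \<omega> = 1" if "s \<in> {1..n}" for s
      proof -
        have "(\<Sum>u=1..int s. norm (\<psi> (V u \<omega>))) / real n \<le> avg (\<lambda>u. norm (\<psi> u)) n \<omega>"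
          unfolding avg_def using that by (intro divide_right_mono sum_mono2) auto
        then show ?thesis using True by (simp add: ct_def)
      qed
      have r: "(\<Sum>t=1..int n. f t) = (\<Sum>t=1..n. f (int t))" for f :: "int \<Rightarrow> 'z::comm_monoid_add"
        by (rule sum.reindex_bij_witness[of _ int nat]) auto
      have XW: "X n \<omega> = W n n \<omega>" unfolding X_def W_def r by (simp add: ct1)
      have "A n n \<omega> = (\<Sum>t=1..int n. \<psi> (V t \<omega>)) / of_real (real n)"
        unfolding A_def r by (simp add: ct1 sum_divide_distrib)
      then have RA: "Re (A n n \<omega>) = avg (\<lambda>u. Re (\<psi> u)) n \<omega>" "Im (A n n \<omega>) = avg (\<lambda>u. Im (\<psi> u)) n \<omega>"
        unfolding avg_def by (simp_all add: Re_divide_of_nat Im_divide_of_nat)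
      have "norm (X n \<omega> * exp B - W n n \<omega> * exp (A n n \<omega>)) = norm (exp (A n n \<omega>) - exp B)"
        unfolding XW right_diff_distrib[symmetric] norm_mult W1 by (simp add: norm_minus_commute)
      also have "\<dots> \<le> exp K * norm (A n n \<omega> - B)" by (rule norm_exp_diff_le[OF Am K(2)])
      also have "norm (A n n \<omega> - B) \<le> \<bar>Re (A n n \<omega> - B)\<bar> + \<bar>Im (A n n \<omega> - B)\<bar>" by (rule cmod_le)
      finally show ?thesis unfolding RA by (simp add: RA distrib_left add_increasing2 mult_left_mono)
    next
      case False
      have "norm (X n \<omega> * exp B) \<le> exp K" "norm (W n n \<omega> * exp (A n n \<omega>)) \<le> exp K"
        using expA[of n n \<omega>] order_trans[OF complex_Re_le_cmod K(2)] by (auto simp: norm_mult X1 W1)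
      then have "norm (X n \<omega> * exp B - W n n \<omega> * exp (A n n \<omega>)) \<le> exp K * 2"
        using norm_triangle_ineq4[of "X n \<omega> * exp B" "W n n \<omega> * exp (A n n \<omega>)"] by linarith
      also have "\<dots> \<le> exp K * (\<bar>avg (\<lambda>u. Re (\<psi> u)) n \<omega> - Re B\<bar> + \<bar>avg (\<lambda>u. Im (\<psi> u)) n \<omega> - Im B\<bar> + 2 * \<bar>avg (\<lambda>u. norm (\<psi> u)) n \<omega> - (K - 1)\<bar>)"
        using False by (intro mult_left_mono) auto
      finally show ?thesis .
    qed
    have ReB: "Re B = (\<integral>\<omega>. Re (\<psi> (V 1 \<omega>)) \<partial>M)" "Im B = (\<integral>\<omega>. Im (\<psi> (V 1 \<omega>)) \<partial>M)"
      unfolding B_def using i\<psi> by auto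
    have ia: "integrable M (\<lambda>\<omega>. \<bar>avg (\<lambda>u. Re (\<psi> u)) n \<omega> - Re B\<bar>)" "integrable M (\<lambda>\<omega>. \<bar>avg (\<lambda>u. Im (\<psi> u)) n \<omega> - Im B\<bar>)"
      "integrable M (\<lambda>\<omega>. \<bar>avg (\<lambda>u. norm (\<psi> u)) n \<omega> - (K - 1)\<bar>)"
      using i\<psi> by (auto intro!: integrable_abs Bochner_Integration.integrable_diff iavg)
    have "norm ((\<integral>\<omega>. X n \<omega> \<partial>M) * exp B - (\<integral>\<omega>. W n n \<omega> * exp (A n n \<omega>) \<partial>M)) =
      norm (\<integral>\<omega>. X n \<omega> * exp B - W n n \<omega> * exp (A n n \<omega>) \<partial>M)"
      using iX iWA by simp
    also have "\<dots> \<le> (\<integral>\<omega>. norm (X n \<omega> * exp B - W n n \<omega> * exp (A n n \<omega>)) \<partial>M)" by (rule integral_norm_bound)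
    also have "\<dots> \<le> (\<integral>\<omega>. exp K * (\<bar>avg (\<lambda>u. Re (\<psi> u)) n \<omega> - Re B\<bar> + \<bar>avg (\<lambda>u. Im (\<psi> u)) n \<omega> - Im B\<bar> +
        2 * \<bar>avg (\<lambda>u. norm (\<psi> u)) n \<omega> - (K - 1)\<bar>) \<partial>M)"
      by (intro integral_mono pt integrable_norm Bochner_Integration.integrable_diff integrable_mult_left
          integrable_mult_right Bochner_Integration.integrable_add ia iX iWA)
    also have "\<dots> = exp K * (e1 n + e2 n + 2 * e3 n)"
      using ia by (simp add: e1_def e2_def e3_def ReB K_def)
    finally have "norm ((\<integral>\<omega>. X n \<omega> \<partial>M) * exp B - (\<integral>\<omega>. W n n \<omega> * exp (A n n \<omega>) \<partial>M)) \<le> exp K * (e1 n + e2 n + 2 * e3 n)" .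
    then show ?thesis
      using Dn[of n n] norm_triangle_ineq[of "(\<integral>\<omega>. X n \<omega> \<partial>M) * exp B - (\<integral>\<omega>. W n n \<omega> * exp (A n n \<omega>) \<partial>M)"
         "(\<integral>\<omega>. W n n \<omega> * exp (A n n \<omega>) \<partial>M) - 1"] by simp
  qed
  have "(\<lambda>n. exp K * (e1 n + e2 n + 2 * e3 n) + exp K * (real n * \<delta> n)) \<longlonglongrightarrow> exp K * (0 + 0 + 2 * 0) + exp K * 0"
    by (intro tendsto_intros e1 e2 e3 \<delta>_lim)
  then have z: "(\<lambda>n. exp K * (e1 n + e2 n + 2 * e3 n) + real n * (exp K * \<delta> n)) \<longlonglongrightarrow> 0"
    by (simp add: mult.left_commute)
  have "(\<lambda>n. (\<integral>\<omega>. X n \<omega> \<partial>M) * exp B - 1) \<longlonglongrightarrow> 0"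
    by (rule Lim_null_comparison[OF _ z]) (use main in \<open>auto intro: eventually_sequentiallyI[of 1]\<close>)
  then have "(\<lambda>n. ((\<integral>\<omega>. X n \<omega> \<partial>M) * exp B - 1 + 1) * exp (- B)) \<longlonglongrightarrow> (0 + 1) * exp (- B)"
    by (intro tendsto_intros)
  then show ?thesis by (simp add: X_def B_def mult.assoc exp_add[symmetric])
qed

end

section \<open>Characteristic functions of regularly varying variables\<close>

context prob_space
begin

definition abs_tail :: "('a \<Rightarrow> real) \<Rightarrow> real \<Rightarrow> real" where
  "abs_tail X x = prob {\<omega> \<in> space M. \<bar>X \<omega>\<bar> > x}"

lemma abs_tail_antimono: "X \<in> borel_measurable M \<Longrightarrow> antimono (abs_tail X)"
  unfolding abs_tail_def by (intro antimonoI finite_measure_mono) auto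

lemma abs_tail_bounds: "0 \<le> abs_tail X x" "abs_tail X x \<le> 1"
  by (auto simp: abs_tail_def)

text \<open>Regular variation in dimension one, where the spectral measure sits on 1 and -1 with
  masses \<open>p\<close> and \<open>q\<close>.\<close>

definition tail_balanced :: "('a \<Rightarrow> real) \<Rightarrow> real \<Rightarrow> real \<Rightarrow> real \<Rightarrow> bool" where
  "tail_balanced X \<alpha> p q \<longleftrightarrow> X \<in> borel_measurable M \<and> 0 \<le> p \<and> 0 \<le> q \<and> p + q = 1 \<and>
    (\<forall>t>0. ((\<lambda>x. abs_tail X (t * x) / abs_tail X x) \<longlongrightarrow> t powr (-\<alpha>)) at_top) \<and>
    (\<forall>t>0. ((\<lambda>x. prob {\<omega> \<in> space M. X \<omega> > t * x} / abs_tail X x) \<longlongrightarrow> p * t powr (-\<alpha>)) at_top) \<and>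
    (\<forall>t>0. ((\<lambda>x. prob {\<omega> \<in> space M. - X \<omega> > t * x} / abs_tail X x) \<longlongrightarrow> q * t powr (-\<alpha>)) at_top)"

text \<open>On the sphere, which consists of 1 and -1, the positive and negative parts of the
  coordinate are continuous and coincide with the indicators of the two points; as test functions
  they separate the two tails.\<close>

lemma regularly_varying_imp_tail_balanced:
  fixes Y :: "int \<Rightarrow> 'a \<Rightarrow> real"
  assumes "regularly_varying M {1} Y \<alpha>"
  shows "\<exists>p q. tail_balanced (Y 1) \<alpha> p q"
proof -
  let ?N = "block_euclidean_norm {1::int} :: (int \<Rightarrow> real) \<Rightarrow> real"
  obtain Q where Q: "spectral_measure M {1} ?N Y \<alpha> Q" using assms by (auto simp: regularly_varying_def)
  then have Ym[measurable]: "Y 1 \<in> borel_measurable M" and "prob_space Q" by (auto simp: spectral_measure_def)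
  interpret Q: prob_space Q by fact
  have N: "?N (block_vec {1} Y \<omega>) = \<bar>Y 1 \<omega>\<bar>" for \<omega>
    by (simp add: block_euclidean_norm_def block_vec_def L2_set_def)
  have lim: "((\<lambda>x. (\<integral>\<omega>. (if \<bar>Y 1 \<omega>\<bar> > t * x then g (\<lambda>s\<in>{1}. Y s \<omega> /\<^sub>R \<bar>Y 1 \<omega>\<bar>) else 0) \<partial>M) / abs_tail (Y 1) x)
      \<longlongrightarrow> t powr (-\<alpha>) * (\<integral>\<theta>. g \<theta> \<partial>Q)) at_top" if "t > 0" "continuous_on UNIV g" for t and g :: "(int \<Rightarrow> real) \<Rightarrow> real"
    using Q that continuous_on_subset[OF that(2), of "block_sphere {1} ?N"] unfolding spectral_measure_def N abs_tail_def
    by blast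
  \<comment> \<open>Turns limits of test integrals into limits of probabilities whenever the tested
    function is the indicator of an event for positive \<open>x\<close>.\<close>
  have ev: "((\<lambda>x. prob {\<omega> \<in> space M. P \<omega> x} / abs_tail (Y 1) x) \<longlongrightarrow> c) at_top"
    if "((\<lambda>x. (\<integral>\<omega>. (if \<bar>Y 1 \<omega>\<bar> > t * x then g (\<lambda>s\<in>{1}. Y s \<omega> /\<^sub>R \<bar>Y 1 \<omega>\<bar>) else 0) \<partial>M) / abs_tail (Y 1) x) \<longlongrightarrow> c) at_top"
      "\<And>x. {\<omega> \<in> space M. P \<omega> x} \<in> sets M"
      "\<And>x \<omega>. x > 0 \<Longrightarrow> (if \<bar>Y 1 \<omega>\<bar> > t * x then g (\<lambda>s\<in>{1}. Y s \<omega> /\<^sub>R \<bar>Y 1 \<omega>\<bar>) else 0) = of_bool (P \<omega> x)"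
    for P t c and g :: "(int \<Rightarrow> real) \<Rightarrow> real"
  proof (rule Lim_transform_eventually[OF that(1)])
    have "(\<integral>\<omega>. (if \<bar>Y 1 \<omega>\<bar> > t * x then g (\<lambda>s\<in>{1}. Y s \<omega> /\<^sub>R \<bar>Y 1 \<omega>\<bar>) else 0) \<partial>M) = prob {\<omega> \<in> space M. P \<omega> x}" if "x > 0" for x
    proof -
      have "(\<integral>\<omega>. (if \<bar>Y 1 \<omega>\<bar> > t * x then g (\<lambda>s\<in>{1}. Y s \<omega> /\<^sub>R \<bar>Y 1 \<omega>\<bar>) else 0) \<partial>M) = (\<integral>\<omega>. indicator {\<omega> \<in> space M. P \<omega> x} \<omega> \<partial>M)"
        unfolding \<open>\<And>x \<omega>. x > 0 \<Longrightarrow> _ = of_bool (P \<omega> x)\<close>[OF that]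
        by (rule Bochner_Integration.integral_cong) auto
      also have "\<dots> = prob {\<omega> \<in> space M. P \<omega> x}" using \<open>\<And>x. {\<omega> \<in> space M. P \<omega> x} \<in> sets M\<close> by simp
      finally show ?thesis .
    qed
    note E = this
    show "\<forall>\<^sub>F x in at_top. (\<integral>\<omega>. (if \<bar>Y 1 \<omega>\<bar> > t * x then g (\<lambda>s\<in>{1}. Y s \<omega> /\<^sub>R \<bar>Y 1 \<omega>\<bar>) else 0) \<partial>M) / abs_tail (Y 1) x
        = prob {\<omega> \<in> space M. P \<omega> x} / abs_tail (Y 1) x"
      by (rule eventually_mono[OF eventually_gt_at_top[of "0::real"]]) (simp only: E)
  qed
  define p where "p = (\<integral>\<theta>. max 0 (\<theta> 1) \<partial>Q)"
  define q where "q = (\<integral>\<theta>. max 0 (- \<theta> 1) \<partial>Q)"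
  have c: "continuous_on UNIV (\<lambda>\<theta>::int \<Rightarrow> real. max 0 (\<theta> 1))" "continuous_on UNIV (\<lambda>\<theta>::int \<Rightarrow> real. max 0 (- \<theta> 1))"
    by (intro continuous_intros continuous_on_product_coordinates)+
  have 1: "((\<lambda>x. abs_tail (Y 1) (t * x) / abs_tail (Y 1) x) \<longlongrightarrow> t powr (-\<alpha>)) at_top" if "t > 0" for t
    using ev[OF lim[OF that, of "\<lambda>_. 1"], of "\<lambda>\<omega> x. \<bar>Y 1 \<omega>\<bar> > t * x"] by (simp add: Q.prob_space abs_tail_def)
  have 2: "((\<lambda>x. prob {\<omega> \<in> space M. Y 1 \<omega> > t * x} / abs_tail (Y 1) x) \<longlongrightarrow> p * t powr (-\<alpha>)) at_top" if t: "t > 0" for t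
  proof (subst mult.commute, rule ev[OF lim[OF that c(1), folded p_def]])
    fix x \<omega> assume x: "(x::real) > 0"
    show "(if t * x < \<bar>Y 1 \<omega>\<bar> then max 0 ((\<lambda>s\<in>{1}. Y s \<omega> /\<^sub>R \<bar>Y 1 \<omega>\<bar>) 1) else 0) = of_bool (t * x < Y 1 \<omega>)"
      using mult_pos_pos[OF t x] by (cases "Y 1 \<omega> > 0") (auto simp: max_def zero_le_mult_iff)
  qed measurable
  have 3: "((\<lambda>x. prob {\<omega> \<in> space M. - Y 1 \<omega> > t * x} / abs_tail (Y 1) x) \<longlongrightarrow> q * t powr (-\<alpha>)) at_top" if t: "t > 0" for t
  proof (subst mult.commute, rule ev[OF lim[OF that c(2), folded q_def]])
    fix x \<omega> assume x: "(x::real) > 0"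
    show "(if t * x < \<bar>Y 1 \<omega>\<bar> then max 0 (- (\<lambda>s\<in>{1}. Y s \<omega> /\<^sub>R \<bar>Y 1 \<omega>\<bar>) 1) else 0) = of_bool (t * x < - Y 1 \<omega>)"
      using mult_pos_pos[OF t x] by (cases "Y 1 \<omega> < 0") (auto simp: max_def mult_le_0_iff)
  qed measurable
  have pq: "0 \<le> p" "0 \<le> q" unfolding p_def q_def by (auto intro: Bochner_Integration.integral_nonneg)
  have "p + q = 1"
  proof (rule tendsto_unique)
    show "((\<lambda>x. prob {\<omega> \<in> space M. Y 1 \<omega> > 1 * x} / abs_tail (Y 1) x + prob {\<omega> \<in> space M. - Y 1 \<omega> > 1 * x} / abs_tail (Y 1) x) \<longlongrightarrow> p + q) at_top"
      using tendsto_add[OF 2[of 1] 3[of 1]] by simp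
    have "\<forall>\<^sub>F x in at_top. abs_tail (Y 1) (1 * x) / abs_tail (Y 1) x =
      prob {\<omega> \<in> space M. Y 1 \<omega> > 1 * x} / abs_tail (Y 1) x + prob {\<omega> \<in> space M. - Y 1 \<omega> > 1 * x} / abs_tail (Y 1) x"
      using eventually_gt_at_top[of "0::real"]
    proof eventually_elim
      case (elim x)
      have "abs_tail (Y 1) (1 * x) = prob ({\<omega> \<in> space M. Y 1 \<omega> > 1 * x} \<union> {\<omega> \<in> space M. - Y 1 \<omega> > 1 * x})"
        unfolding abs_tail_def using elim by (intro arg_cong[where f = prob]) auto
      also have "\<dots> = prob {\<omega> \<in> space M. Y 1 \<omega> > 1 * x} + prob {\<omega> \<in> space M. - Y 1 \<omega> > 1 * x}"
        by (rule finite_measure_Union) (use elim in auto)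
      finally show ?case by (simp only: add_divide_distrib)
    qed
    from Lim_transform_eventually[OF 1[of 1] this]
    show "((\<lambda>x. prob {\<omega> \<in> space M. Y 1 \<omega> > 1 * x} / abs_tail (Y 1) x + prob {\<omega> \<in> space M. - Y 1 \<omega> > 1 * x} / abs_tail (Y 1) x) \<longlongrightarrow> 1) at_top"
      by simp
  qed simp
  then have "tail_balanced (Y 1) \<alpha> p q" using 1 2 3 pq unfolding tail_balanced_def by auto
  then show ?thesis by blast
qed

lemma tail_balanced_Potter:
  assumes X: "tail_balanced X \<alpha> p q" and \<delta>: "0 < \<delta>" "\<delta> < \<alpha>"
  shows "\<exists>C>0. \<exists>x0>0. \<forall>x\<ge>x0. abs_tail X x > 0 \<and>
      (\<forall>s>0. abs_tail X (s * x) \<le> C * max (s powr (-\<alpha>-\<delta>)) (s powr (-\<alpha>+\<delta>)) * abs_tail X x)"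
  by (rule Potter) (use X \<delta> abs_tail_antimono abs_tail_bounds in \<open>auto simp: tail_balanced_def\<close>)

text \<open>The tail is positive everywhere, far out by Potter and elsewhere by monotonicity,
  whereas the tail at \<open>a n\<close> tends to 0. It is therefore eventually below the tail at
  any given \<open>Z\<close>, and monotonicity pushes \<open>a n\<close> beyond
  \<open>Z\<close>.\<close>

lemma normalizing_sequence_at_top:
  assumes X: "tail_balanced X \<alpha> p q" and \<alpha>: "\<alpha> > 0"
    and a: "(\<lambda>n. real n * abs_tail X (a n)) \<longlonglongrightarrow> 1"
  shows "filterlim a at_top sequentially"
  unfolding filterlim_at_top
proof
  fix Z :: real
  have Xm: "X \<in> borel_measurable M" using X by (simp add: tail_balanced_def)
  obtain C x0 where x0: "\<And>x. x \<ge> x0 \<Longrightarrow> abs_tail X x > 0"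
    using tail_balanced_Potter[OF X, of "\<alpha> / 2"] \<alpha> by auto
  have "abs_tail X (max x0 Z) \<le> abs_tail X Z" by (rule antimonoD[OF abs_tail_antimono[OF Xm]]) simp
  then have Z: "abs_tail X Z > 0" using x0[of "max x0 Z"] by simp
  have "(\<lambda>n. (real n * abs_tail X (a n)) * (1 / real n)) \<longlonglongrightarrow> 1 * 0"
    by (intro tendsto_mult a lim_const_over_n)
  then have "\<forall>\<^sub>F n in sequentially. (real n * abs_tail X (a n)) * (1 / real n) < abs_tail X Z"
    using Z by (intro order_tendstoD(2)) auto
  then show "\<forall>\<^sub>F n in sequentially. Z \<le> a n" using eventually_gt_at_top[of 0]
  proof eventually_elim
    case (elim n)
    then have "abs_tail X (a n) < abs_tail X Z" by simp
    then show ?case using antimonoD[OF abs_tail_antimono[OF Xm], of "a n" Z] by linarith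
  qed
qed

text \<open>Meant for \<open>Z = X\<close> and \<open>Z = - X\<close>: both halves are normalised by
  the two-sided tail of \<open>X\<close>, and only the weight \<open>p\<close> tells them
  apart.\<close>

lemma centred_kernel_expectation_half:
  fixes Z X :: "'a \<Rightarrow> real"
  assumes X: "tail_balanced X \<alpha> p' q'" and \<alpha>: "0 < \<alpha>" and a: "\<And>n. n \<ge> 1 \<Longrightarrow> 0 < a n"
    and norm: "(\<lambda>n. real n * abs_tail X (a n)) \<longlonglongrightarrow> 1"
    and Zm: "Z \<in> borel_measurable M" and ZX: "\<And>\<omega>. \<bar>Z \<omega>\<bar> = \<bar>X \<omega>\<bar>" and p: "0 \<le> p"
    and Z: "\<And>t. t > 0 \<Longrightarrow> ((\<lambda>x. prob {\<omega> \<in> space M. Z \<omega> > t * x} / abs_tail X x) \<longlongrightarrow> p * t powr (-\<alpha>)) at_top"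
    and \<eta>: "0 < \<eta>" "\<eta> < \<alpha>" "\<alpha> < 1 \<Longrightarrow> \<alpha> + \<eta> \<le> 1" "\<alpha> + \<eta> \<le> 2" "1 < \<alpha> \<Longrightarrow> 1 \<le> \<alpha> - \<eta>"
  shows "\<And>u. 0 \<le> u \<Longrightarrow> (\<lambda>n. of_real (real n) * (\<integral>\<omega>. centred_kernel \<alpha> (u * (max 0 (Z \<omega>) / a n)) \<partial>M)) \<longlonglongrightarrow>
      of_real (p * u powr \<alpha>) * (LINT y:{0<..}|lborel. centred_kernel \<alpha> (y powr (-1 / \<alpha>)))"
    and "\<exists>D n0. \<forall>n\<ge>n0. \<forall>u\<ge>0. norm (of_real (real n) * (\<integral>\<omega>. centred_kernel \<alpha> (u * (max 0 (Z \<omega>) / a n)) \<partial>M)) \<le>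
      D * max (u powr (\<alpha> + \<eta>)) (u powr (\<alpha> - \<eta>))"
proof -
  have Xm[measurable]: "X \<in> borel_measurable M" using X by (simp add: tail_balanced_def)
  note Zm[measurable]
  \<comment> \<open>Half of \<eta>, so that the Potter exponents
    \<open>\<alpha> \<plusminus> \<delta>\<close> lie strictly between the kernel exponents
    \<open>\<alpha> \<plusminus> \<eta>\<close>.\<close>
  define \<delta> where "\<delta> = \<eta> / 2"
  have \<delta>: "0 < \<delta>" "\<delta> < \<alpha>" "\<delta> < \<eta>" using \<eta> by (auto simp: \<delta>_def)
  obtain C x0 where C: "C > 0" and x0: "x0 > 0" and Pot: "\<And>x. x \<ge> x0 \<Longrightarrow> abs_tail X x > 0 \<and>
      (\<forall>s>0. abs_tail X (s * x) \<le> C * max (s powr (-\<alpha>-\<delta>)) (s powr (-\<alpha>+\<delta>)) * abs_tail X x)"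
    using tail_balanced_Potter[OF X \<delta>(1,2)] by auto
  have at: "filterlim a at_top sequentially" by (rule normalizing_sequence_at_top[OF X \<alpha> norm])
  have "\<forall>\<^sub>F n in sequentially. real n * abs_tail X (a n) < 2" by (rule order_tendstoD(2)[OF norm]) simp
  moreover have "\<forall>\<^sub>F n in sequentially. x0 \<le> a n" using at by (simp add: filterlim_at_top)
  ultimately have "\<forall>\<^sub>F n in sequentially. real n * abs_tail X (a n) < 2 \<and> x0 \<le> a n \<and> n \<ge> 1"
    using eventually_ge_at_top[of 1] by eventually_elim auto
  then obtain n0 where n0: "\<And>n. n \<ge> n0 \<Longrightarrow> real n * abs_tail X (a n) < 2 \<and> x0 \<le> a n \<and> n \<ge> 1"
    unfolding eventually_sequentially by blast
  define \<mu> where "\<mu> = distr M borel (\<lambda>\<omega>. max 0 (Z \<omega>))"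
  interpret \<mu>: real_distribution \<mu> unfolding \<mu>_def by (rule real_distribution_distr) simp
  have tail: "measure \<mu> {x<..} = prob {\<omega> \<in> space M. Z \<omega> > x}" if "x \<ge> 0" for x
    unfolding \<mu>_def by (subst measure_distr) (use that in \<open>auto intro!: arg_cong[where f = prob]\<close>)
  have tail_le: "prob {\<omega> \<in> space M. Z \<omega> > x} \<le> abs_tail X x" for x
    unfolding abs_tail_def by (rule finite_measure_mono) (auto simp: ZX[symmetric])
  \<comment> \<open>The Potter constant is doubled because \<open>n * abs_tail X (a n)\<close> is
    below 2 from \<open>n0\<close> on.\<close>
  interpret R: regularly_varying_tail \<mu> a p \<alpha> \<delta> "2 * C" n0
  proof unfold_locales
    show "AE x in \<mu>. 0 \<le> x" unfolding \<mu>_def by (subst AE_distr_iff) auto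
    show "0 < a n" if "1 \<le> n" for n using a that .
    show "0 \<le> p" "0 < \<delta>" "\<delta> < \<alpha>" "0 < 2 * C" "1 \<le> n0" using p \<delta> C n0[of n0] by auto
    show "(\<lambda>n. real n * measure \<mu> {s * a n<..}) \<longlonglongrightarrow> p * s powr (-\<alpha>)" if s: "s > 0" for s
    proof (rule Lim_transform_eventually)
      show "(\<lambda>n. (real n * abs_tail X (a n)) * (prob {\<omega> \<in> space M. Z \<omega> > s * a n} / abs_tail X (a n))) \<longlonglongrightarrow> p * s powr (-\<alpha>)"
        using tendsto_mult[OF norm filterlim_compose[OF Z[OF s] at]] by simp
      show "\<forall>\<^sub>F n in sequentially. (real n * abs_tail X (a n)) * (prob {\<omega> \<in> space M. Z \<omega> > s * a n} / abs_tail X (a n)) =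
         real n * measure \<mu> {s * a n<..}"
        using eventually_ge_at_top[of n0]
      proof eventually_elim
        case (elim n)
        then have "abs_tail X (a n) > 0" "0 < a n" using n0[OF elim] Pot[of "a n"] a[of n] by auto
        then show ?case using s by (simp add: tail)
      qed
    qed
    show "real n * measure \<mu> {s * a n<..} \<le> 2 * C * max (s powr (-\<alpha>-\<delta>)) (s powr (-\<alpha>+\<delta>))" if n: "n \<ge> n0" and s: "s > 0" for n s
    proof -
      let ?m = "max (s powr (-\<alpha>-\<delta>)) (s powr (-\<alpha>+\<delta>))"
      have an: "0 < a n" using n0[OF n] a by auto
      have m0: "0 \<le> ?m" by (simp add: le_max_iff_disj)
      have "real n * measure \<mu> {s * a n<..} \<le> real n * abs_tail X (s * a n)"
        using tail[of "s * a n"] tail_le an s by (intro mult_left_mono) auto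
      also have "\<dots> \<le> real n * (C * ?m * abs_tail X (a n))"
        using Pot[of "a n"] n0[OF n] s by (intro mult_left_mono) auto
      also have "\<dots> = C * ?m * (real n * abs_tail X (a n))" by simp
      also have "\<dots> \<le> C * ?m * 2" using n0[OF n] C m0 by (intro mult_left_mono) auto
      finally show ?thesis by simp
    qed
  qed
  have k_bound: "norm (centred_kernel \<alpha> v) \<le> 2 * min (v powr (\<alpha> + \<eta>)) (v powr (\<alpha> - \<eta>))" if "v \<ge> 0" for v
    by (rule centred_kernel_bound[OF that]) (use \<eta> in auto)
  have e: "(\<integral>x. centred_kernel \<alpha> (u * (x / a n)) \<partial>\<mu>) = (\<integral>\<omega>. centred_kernel \<alpha> (u * (max 0 (Z \<omega>) / a n)) \<partial>M)" for u n
    unfolding \<mu>_def by (rule integral_distr)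
      (auto intro!: measurable_compose[OF _ borel_measurable_continuous_onI[OF centred_kernel_continuous]])
  have b: "0 < \<alpha> - \<eta>" "\<alpha> - \<eta> < \<alpha> - \<delta>" "\<alpha> + \<delta> < \<alpha> + \<eta>" using \<delta> \<eta> by auto
  show "(\<lambda>n. of_real (real n) * (\<integral>\<omega>. centred_kernel \<alpha> (u * (max 0 (Z \<omega>) / a n)) \<partial>M)) \<longlonglongrightarrow>
      of_real (p * u powr \<alpha>) * (LINT y:{0<..}|lborel. centred_kernel \<alpha> (y powr (-1 / \<alpha>)))" if "0 \<le> u" for u
    using R.expectation_tendsto[OF centred_kernel_continuous k_bound b that] unfolding e by simp
  show "\<exists>D n0. \<forall>n\<ge>n0. \<forall>u\<ge>0. norm (of_real (real n) * (\<integral>\<omega>. centred_kernel \<alpha> (u * (max 0 (Z \<omega>) / a n)) \<partial>M)) \<le>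
      D * max (u powr (\<alpha> + \<eta>)) (u powr (\<alpha> - \<eta>))"
    using R.expectation_bound[OF centred_kernel_continuous k_bound b] unfolding e by blast
qed

end

section \<open>Centring and the characteristic exponent\<close>

lemma centred_kernel_uminus: "centred_kernel \<alpha> (- v) = cnj (centred_kernel \<alpha> v)"
  by (simp add: centred_kernel_def complex_eq_iff Re_exp Im_exp)

lemma centred_kernel_split:
  "centred_kernel \<alpha> v = centred_kernel \<alpha> (max 0 v) + cnj (centred_kernel \<alpha> (max 0 (- v)))"
  unfolding centred_kernel_uminus[symmetric] by (cases "v \<ge> 0") (auto simp: centred_kernel_def max_def)

context prob_space
begin

text \<open>The terms removed from the kernel have expectation 0: the linear one because the mean
  vanishes for \<alpha> > 1, the sine because the law is symmetric for \<alpha> = 1.\<close>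

lemma expectation_centred_kernel:
  assumes X[measurable]: "X \<in> borel_measurable M"
    and m: "1 < \<alpha> \<Longrightarrow> has_bochner_integral M X 0"
    and sym: "\<alpha> = 1 \<Longrightarrow> distr M borel X = distr M borel (\<lambda>\<omega>. - X \<omega>)"
  shows "(\<integral>\<omega>. centred_kernel \<alpha> (u * X \<omega>) \<partial>M) = 1 - (\<integral>\<omega>. iexp (u * X \<omega>) \<partial>M)"
proof -
  have i: "integrable M (\<lambda>\<omega>. iexp (u * X \<omega>))" by (rule integrable_iexp) auto
  consider "\<alpha> < 1" | "\<alpha> = 1" | "\<alpha> > 1" by linarith
  then show ?thesis
  proof cases
    case 1
    then show ?thesis using i by (simp add: centred_kernel_def prob_space)
  next
    case 2
    have c: "integrable M (\<lambda>\<omega>. cos (u * X \<omega>))" "integrable M (\<lambda>\<omega>. sin (u * X \<omega>))"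
      by (rule integrable_const_bound[of _ 1]; simp)+
    have "(\<integral>\<omega>. sin (u * X \<omega>) \<partial>M) = (\<integral>x. sin (u * x) \<partial>distr M borel X)" by (rule integral_distr[symmetric]) auto
    also have "\<dots> = (\<integral>x. sin (u * x) \<partial>distr M borel (\<lambda>\<omega>. - X \<omega>))" using sym[OF 2] by simp
    also have "\<dots> = (\<integral>\<omega>. sin (u * - X \<omega>) \<partial>M)" by (rule integral_distr) auto
    also have "\<dots> = - (\<integral>\<omega>. sin (u * X \<omega>) \<partial>M)" by simp
    finally have s: "(\<integral>\<omega>. sin (u * X \<omega>) \<partial>M) = 0" by simp
    have "(\<integral>\<omega>. centred_kernel \<alpha> (u * X \<omega>) \<partial>M) = (\<integral>\<omega>. complex_of_real (1 - cos (u * X \<omega>)) \<partial>M)"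
      using 2 by (simp add: centred_kernel_def del: of_real_diff)
    also have "\<dots> = complex_of_real (\<integral>\<omega>. 1 - cos (u * X \<omega>) \<partial>M)" by (rule integral_complex_of_real)
    also have "\<dots> = complex_of_real (1 - (\<integral>\<omega>. cos (u * X \<omega>) \<partial>M))" using c by (simp add: prob_space)
    also have "(\<integral>\<omega>. cos (u * X \<omega>) \<partial>M) = Re (\<integral>\<omega>. iexp (u * X \<omega>) \<partial>M)"
      using i by (simp add: integral_Re[symmetric] Re_exp del: integral_Re)
    also have "complex_of_real (1 - Re (\<integral>\<omega>. iexp (u * X \<omega>) \<partial>M)) = 1 - (\<integral>\<omega>. iexp (u * X \<omega>) \<partial>M)"
    proof -
      have "Im (\<integral>\<omega>. iexp (u * X \<omega>) \<partial>M) = (\<integral>\<omega>. Im (iexp (u * X \<omega>)) \<partial>M)" using i by simp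
      also have "\<dots> = 0" using s by (simp add: Im_exp)
      finally show ?thesis by (simp add: complex_eq_iff)
    qed
    finally show ?thesis .
  next
    case 3
    have X0: "integrable M X" "expectation X = 0" using m[OF 3] by (auto simp: has_bochner_integral_iff)
    then have "(\<integral>\<omega>. \<i> * complex_of_real (u * X \<omega>) \<partial>M) = 0" "integrable M (\<lambda>\<omega>. \<i> * complex_of_real (u * X \<omega>))"
      by (auto simp: integral_complex_of_real simp del: of_real_mult)
    then show ?thesis using 3 i by (simp add: centred_kernel_def prob_space)
  qed
qed

text \<open>For \<alpha> \<noteq> 1 the weights \<open>p\<close>, \<open>q\<close> are those of the
  tails. For \<alpha> = 1 the kernel integral is real, so only \<open>p0 + q0 = 1\<close> enters the
  limit and both weights can be taken as 1/2. Negative frequencies follow by conjugation.\<close>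

lemma characteristic_exponent:
  assumes X: "tail_balanced X \<alpha> p0 q0" and \<alpha>: "0 < \<alpha>" "\<alpha> < 2" and a: "\<And>n. n \<ge> 1 \<Longrightarrow> 0 < a n"
    and norm: "(\<lambda>n. real n * abs_tail X (a n)) \<longlonglongrightarrow> 1" and \<epsilon>: "0 < \<epsilon>"
    and m: "1 < \<alpha> \<Longrightarrow> has_bochner_integral M X 0"
    and sym: "\<alpha> = 1 \<Longrightarrow> distr M borel X = distr M borel (\<lambda>\<omega>. - X \<omega>)"
  shows "\<exists>c p q D n0. 0 \<le> c \<and> 0 \<le> p \<and> 0 \<le> q \<and> (\<alpha> = 1 \<longrightarrow> p = q) \<and>
    (\<forall>u. (\<lambda>n. of_real (real n) * (1 - (\<integral>\<omega>. iexp (u * (X \<omega> / a n)) \<partial>M))) \<longlonglongrightarrow>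
       of_real c * (of_real p * stable_exponent \<alpha> u + of_real q * stable_exponent \<alpha> (- u))) \<and>
    (\<forall>n\<ge>n0. \<forall>u. norm (of_real (real n) * (1 - (\<integral>\<omega>. iexp (u * (X \<omega> / a n)) \<partial>M))) \<le> D * (1 + \<bar>u\<bar> powr (\<alpha> + \<epsilon>)))"
proof -
  have Xm[measurable]: "X \<in> borel_measurable M" using X by (simp add: tail_balanced_def)
  have pq: "0 \<le> p0" "0 \<le> q0" "p0 + q0 = 1"
    and Xp: "\<And>t. t > 0 \<Longrightarrow> ((\<lambda>x. prob {\<omega> \<in> space M. X \<omega> > t * x} / abs_tail X x) \<longlongrightarrow> p0 * t powr (-\<alpha>)) at_top"
    and Xq: "\<And>t. t > 0 \<Longrightarrow> ((\<lambda>x. prob {\<omega> \<in> space M. - X \<omega> > t * x} / abs_tail X x) \<longlongrightarrow> q0 * t powr (-\<alpha>)) at_top"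
    using X by (auto simp: tail_balanced_def)
  \<comment> \<open>The integer orders of the kernel at infinity and at zero; \<eta> keeps
    \<open>\<alpha> \<plusminus> \<eta>\<close> between them and below
    \<open>\<alpha> + \<epsilon>\<close>.\<close>
  define lo hi where "lo = (if \<alpha> > 1 then 1 else 0 :: real)" and "hi = (if \<alpha> < 1 then 1 else 2 :: real)"
  define \<eta> where "\<eta> = min \<epsilon> (min (\<alpha> - lo) (hi - \<alpha>)) / 2"
  have "\<alpha> - lo > 0" "hi - \<alpha> > 0" using \<alpha> by (auto simp: lo_def hi_def)
  then have \<eta>: "0 < \<eta>" "\<eta> < \<epsilon>" "\<eta> < \<alpha> - lo" "\<eta> < hi - \<alpha>" using \<epsilon> by (auto simp: \<eta>_def)
  then have \<eta>': "\<eta> < \<alpha>" "\<alpha> < 1 \<Longrightarrow> \<alpha> + \<eta> \<le> 1" "\<alpha> + \<eta> \<le> 2" "1 < \<alpha> \<Longrightarrow> 1 \<le> \<alpha> - \<eta>"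
    by (auto simp: lo_def hi_def split: if_splits)
  define J where "J = (LINT y:{0<..}|lborel. centred_kernel \<alpha> (y powr (-1 / \<alpha>)))"
  define E where "E n u = of_real (real n) * (1 - (\<integral>\<omega>. iexp (u * (X \<omega> / a n)) \<partial>M))" for n u
  define P where "P n u = of_real (real n) * (\<integral>\<omega>. centred_kernel \<alpha> (u * (max 0 (X \<omega>) / a n)) \<partial>M)" for n u
  define R where "R n u = of_real (real n) * (\<integral>\<omega>. centred_kernel \<alpha> (u * (max 0 (- X \<omega>) / a n)) \<partial>M)" for n u
  note half = centred_kernel_expectation_half[OF X \<alpha>(1) a norm]
  have PR: "\<And>u. 0 \<le> u \<Longrightarrow> (\<lambda>n. P n u) \<longlonglongrightarrow> of_real (p0 * u powr \<alpha>) * J" "\<And>u. 0 \<le> u \<Longrightarrow> (\<lambda>n. R n u) \<longlonglongrightarrow> of_real (q0 * u powr \<alpha>) * J"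
    unfolding P_def R_def J_def using half(1)[OF _ Xm _ pq(1) Xp \<eta>(1) \<eta>'] half(1)[of "\<lambda>\<omega>. - X \<omega>" q0, OF _ _ _ pq(2) Xq \<eta>(1) \<eta>'] by auto
  obtain D1 n1 where D1: "\<And>n u. n \<ge> n1 \<Longrightarrow> u \<ge> 0 \<Longrightarrow> norm (P n u) \<le> D1 * max (u powr (\<alpha> + \<eta>)) (u powr (\<alpha> - \<eta>))"
    using half(2)[OF _ Xm _ pq(1) Xp \<eta>(1) \<eta>'] unfolding P_def by blast
  obtain D2 n2 where D2: "\<And>n u. n \<ge> n2 \<Longrightarrow> u \<ge> 0 \<Longrightarrow> norm (R n u) \<le> D2 * max (u powr (\<alpha> + \<eta>)) (u powr (\<alpha> - \<eta>))"
    using half(2)[of "\<lambda>\<omega>. - X \<omega>" q0, OF _ _ _ pq(2) Xq \<eta>(1) \<eta>'] unfolding R_def by auto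
  have ck[measurable]: "centred_kernel \<alpha> \<in> borel_measurable borel"
    by (rule borel_measurable_continuous_onI[OF centred_kernel_continuous])
  have E_eq: "E n u = P n u + cnj (R n u)" if n: "n \<ge> 1" and u: "u \<ge> 0" for n u
  proof -
    have an: "a n > 0" using a n by auto
    have mx: "max 0 (u * (x / a n)) = u * (max 0 x / a n)" for x :: real
      using an u by (auto simp: max_def zero_le_mult_iff zero_le_divide_iff mult_le_0_iff divide_le_0_iff)
    have ik: "integrable M (\<lambda>\<omega>. centred_kernel \<alpha> (u * (X \<omega> / a n)))"
    proof (cases "\<alpha> > 1")
      case True
      then have "integrable M X" using m by (auto simp: has_bochner_integral_iff)
      moreover have "integrable M (\<lambda>\<omega>. iexp (u * (X \<omega> / a n)))" by (rule integrable_iexp) auto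
      ultimately show ?thesis using True by (simp add: centred_kernel_def)
    next
      case False
      have "norm (centred_kernel \<alpha> v) \<le> 2" for v
        using False norm_triangle_ineq4[of 1 "iexp v"] cos_le_one[of v] cos_ge_minus_one[of v]
        by (auto simp: centred_kernel_def norm_of_real simp del: of_real_diff)
      then show ?thesis by (intro integrable_const_bound[of _ 2]) auto
    qed
    have sp: "centred_kernel \<alpha> (u * (X \<omega> / a n)) = centred_kernel \<alpha> (u * (max 0 (X \<omega>) / a n)) + cnj (centred_kernel \<alpha> (u * (max 0 (- X \<omega>) / a n)))" for \<omega>
      using centred_kernel_split[of \<alpha> "u * (X \<omega> / a n)"] mx[of "X \<omega>"] mx[of "- X \<omega>"] by simp
    have k0: "centred_kernel \<alpha> 0 = 0" by (simp add: centred_kernel_def)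
    have i1: "integrable M (\<lambda>\<omega>. centred_kernel \<alpha> (u * (max 0 (X \<omega>) / a n)))"
      by (rule Bochner_Integration.integrable_bound[OF ik]) (auto simp: max_def k0)
    have i2: "integrable M (\<lambda>\<omega>. centred_kernel \<alpha> (u * (max 0 (- X \<omega>) / a n)))"
      by (rule Bochner_Integration.integrable_bound[OF ik])
         (auto simp: max_def k0 centred_kernel_uminus[of \<alpha> "u * X \<omega> / a n" for \<omega>, simplified])
    have "(\<integral>\<omega>. centred_kernel \<alpha> (u / a n * X \<omega>) \<partial>M) = 1 - (\<integral>\<omega>. iexp (u / a n * X \<omega>) \<partial>M)"
      by (rule expectation_centred_kernel[OF Xm m sym])
    then have "E n u = of_real (real n) * (\<integral>\<omega>. centred_kernel \<alpha> (u * (X \<omega> / a n)) \<partial>M)" by (simp add: E_def)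
    also have "\<dots> = P n u + cnj (R n u)" unfolding sp P_def R_def using i1 i2 by (simp add: distrib_left)
    finally show ?thesis .
  qed
  have E_neg: "E n (- u) = cnj (E n u)" for n u
    unfolding E_def by (simp add: exp_cnj flip: Bochner_Integration.integral_cnj)
  \<comment> \<open>The limit at frequency 1. The negative half enters conjugated because the kernel
    at \<open>- v\<close> is the conjugate of the kernel at \<open>v\<close>.\<close>
  define Z where "Z = of_real p0 * J + of_real q0 * cnj J"
  have Elim: "(\<lambda>n. E n u) \<longlonglongrightarrow> of_real (u powr \<alpha>) * Z" if u: "u \<ge> 0" for u
  proof (rule Lim_transform_eventually)
    have "(\<lambda>n. P n u + cnj (R n u)) \<longlonglongrightarrow> of_real (p0 * u powr \<alpha>) * J + cnj (of_real (q0 * u powr \<alpha>) * J)"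
      by (intro tendsto_add tendsto_cnj PR u)
    then show "(\<lambda>n. P n u + cnj (R n u)) \<longlonglongrightarrow> of_real (u powr \<alpha>) * Z" by (simp add: Z_def algebra_simps)
    show "\<forall>\<^sub>F n in sequentially. P n u + cnj (R n u) = E n u"
      using eventually_ge_at_top[of 1] by eventually_elim (use E_eq u in auto)
  qed
  obtain c p q where c: "0 \<le> c" "0 \<le> p" "0 \<le> q" "\<alpha> = 1 \<longrightarrow> p = q"
    and Zc: "\<And>u. u \<ge> 0 \<Longrightarrow> of_real (u powr \<alpha>) * Z = of_real c * (of_real p * stable_exponent \<alpha> u + of_real q * stable_exponent \<alpha> (- u))"
  proof (cases "\<alpha> = 1")
    case True
    obtain c where c: "c \<ge> 0" "J = of_real c" using centred_kernel_integral_1 True by (auto simp: J_def)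
    have Z: "Z = of_real c" using pq(3) c(2) unfolding Z_def by (simp flip: distrib_right of_real_add)
    show ?thesis
      by (rule that[of c "1/2" "1/2"]) (use c Z True in \<open>auto simp: stable_exponent_def algebra_simps\<close>)
  next
    case False
    obtain c where c: "c \<ge> 0" "J = of_real c * (1 - \<i> * of_real (tan (pi * \<alpha> / 2)))"
      using centred_kernel_integral[OF \<alpha> False] by (auto simp: J_def)
    show ?thesis
    proof (rule that[of c p0 q0])
      fix u :: real assume "u \<ge> 0"
      then show "of_real (u powr \<alpha>) * Z = of_real c * (of_real p0 * stable_exponent \<alpha> u + of_real q0 * stable_exponent \<alpha> (- u))"
        using False \<alpha> by (cases "u = 0") (simp_all add: Z_def c(2) stable_exponent_def algebra_simps)
    qed (use c pq False in auto)
  qed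
  have se_cnj: "stable_exponent \<alpha> (- u) = cnj (stable_exponent \<alpha> u)" for u
    by (simp add: stable_exponent_def)
  have L: "(\<lambda>n. E n u) \<longlonglongrightarrow> of_real c * (of_real p * stable_exponent \<alpha> u + of_real q * stable_exponent \<alpha> (- u))" for u
  proof (cases "u \<ge> 0")
    case True
    then show ?thesis using Elim[OF True] Zc[OF True] by simp
  next
    case False
    then have u: "- u \<ge> 0" by simp
    have "(\<lambda>n. cnj (E n (- u))) \<longlonglongrightarrow> cnj (of_real c * (of_real p * stable_exponent \<alpha> (- u) + of_real q * stable_exponent \<alpha> (- (- u))))"
      using tendsto_cnj[OF Elim[OF u]] Zc[OF u] by simp
    then show ?thesis using E_neg[of _ "- u"] by (simp add: se_cnj)
  qed
  \<comment> \<open>Above 1 both powers are at most \<open>u powr (\<alpha> + \<epsilon>)\<close>,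
    below 1 both are at most 1.\<close>
  have mb: "max (u powr (\<alpha> + \<eta>)) (u powr (\<alpha> - \<eta>)) \<le> 1 + u powr (\<alpha> + \<epsilon>)" if "u \<ge> 0" for u :: real
  proof (cases "u \<ge> 1")
    case True
    have "u powr (\<alpha> + \<eta>) \<le> u powr (\<alpha> + \<epsilon>)" "u powr (\<alpha> - \<eta>) \<le> u powr (\<alpha> + \<epsilon>)" using True \<eta> \<epsilon> by (auto intro!: powr_mono)
    then show ?thesis by simp
  next
    case False
    have "u powr (\<alpha> + \<eta>) \<le> 1" "u powr (\<alpha> - \<eta>) \<le> 1" using False that \<eta>' \<eta> \<alpha> by (auto intro!: powr_le1)
    then show ?thesis using powr_ge_zero[of u "\<alpha> + \<epsilon>"] by (simp add: add_increasing2)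
  qed
  define D where "D = \<bar>D1\<bar> + \<bar>D2\<bar>"
  have bd0: "norm (E n u) \<le> D * (1 + u powr (\<alpha> + \<epsilon>))" if n: "n \<ge> max 1 (max n1 n2)" and u: "u \<ge> 0" for n u
  proof -
    let ?m = "max (u powr (\<alpha> + \<eta>)) (u powr (\<alpha> - \<eta>))"
    have m0: "0 \<le> ?m" by (simp add: le_max_iff_disj)
    have "norm (E n u) \<le> norm (P n u) + norm (R n u)"
      using E_eq[of n u] n u norm_triangle_ineq[of "P n u" "cnj (R n u)"] by simp
    also have "\<dots> \<le> D1 * ?m + D2 * ?m" using D1[of n u] D2[of n u] n u by (intro add_mono) auto
    also have "\<dots> \<le> \<bar>D1\<bar> * ?m + \<bar>D2\<bar> * ?m" using m0 by (intro add_mono mult_right_mono) auto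
    also have "\<dots> = D * ?m" by (simp add: D_def distrib_right)
    also have "\<dots> \<le> D * (1 + u powr (\<alpha> + \<epsilon>))" using mb[OF u] by (intro mult_left_mono) (auto simp: D_def)
    finally show ?thesis .
  qed
  have bd: "norm (E n u) \<le> D * (1 + \<bar>u\<bar> powr (\<alpha> + \<epsilon>))" if n: "n \<ge> max 1 (max n1 n2)" for n u
  proof (cases "u \<ge> 0")
    case True
    then show ?thesis using bd0[OF n True] by simp
  next
    case False
    then show ?thesis using bd0[OF n, of "- u"] E_neg[of n u] by simp
  qed
  show ?thesis
    by (rule exI[of _ c], rule exI[of _ p], rule exI[of _ q], rule exI[of _ D], rule exI[of _ "max 1 (max n1 n2)"])
       (use c L bd in \<open>auto simp: E_def\<close>)
qed

end

section \<open>Regular variation of predictable products\<close>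

text \<open>A finite sum of image measures of weighted copies of \<open>M\<close>, encoded as one
  image measure from a product with counting measure. It serves both for the spectral laws of blocks
  and for the directional measure of the stable law.\<close>

definition mixture :: "'w measure \<Rightarrow> 'k set \<Rightarrow> 'b measure \<Rightarrow> ('k \<Rightarrow> 'w \<Rightarrow> real) \<Rightarrow> ('k \<Rightarrow> 'w \<Rightarrow> 'b) \<Rightarrow> 'b measure" where
  "mixture M K N w T = distr (density (count_space K \<Otimes>\<^sub>M M) (\<lambda>(k, \<omega>). ennreal (w k \<omega>))) N (\<lambda>(k, \<omega>). T k \<omega>)"

context
  fixes M :: "'w measure" and K :: "'k set" and N :: "'b measure" and w :: "'k \<Rightarrow> 'w \<Rightarrow> real" and T :: "'k \<Rightarrow> 'w \<Rightarrow> 'b"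
  assumes M: "prob_space M" and K: "finite K"
    and w: "\<And>k. k \<in> K \<Longrightarrow> integrable M (w k)" "\<And>k \<omega>. k \<in> K \<Longrightarrow> 0 \<le> w k \<omega>"
    and T: "\<And>k. k \<in> K \<Longrightarrow> T k \<in> measurable M N"
begin

lemma sets_mixture: "sets (mixture M K N w T) = sets N"
  by (simp add: mixture_def)

lemma measurable_mixture_w: "(\<lambda>(k, \<omega>). w k \<omega>) \<in> borel_measurable (count_space K \<Otimes>\<^sub>M M)"
  by (rule measurable_pair_measure_countable1) (use K w in \<open>auto intro: countable_finite\<close>)

lemma measurable_mixture_T: "(\<lambda>(k, \<omega>). T k \<omega>) \<in> measurable (count_space K \<Otimes>\<^sub>M M) N"
  by (rule measurable_pair_measure_countable1) (use K T in \<open>auto intro: countable_finite\<close>)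

lemma integral_mixture:
  fixes f :: "'b \<Rightarrow> 'c::{banach,second_countable_topology}"
  assumes f: "f \<in> borel_measurable N" and b: "\<And>x. x \<in> space N \<Longrightarrow> norm (f x) \<le> B"
  shows "integral\<^sup>L (mixture M K N w T) f = (\<Sum>k\<in>K. \<integral>\<omega>. w k \<omega> *\<^sub>R f (T k \<omega>) \<partial>M)"
proof -
  interpret M: prob_space M by fact
  interpret C: sigma_finite_measure "count_space K" by (rule sigma_finite_measure_count_space_finite[OF K])
  interpret P: pair_sigma_finite "count_space K" M ..
  note [measurable] = measurable_mixture_w measurable_mixture_T f
  have fT: "(\<lambda>(k, \<omega>). f (T k \<omega>)) \<in> borel_measurable (count_space K \<Otimes>\<^sub>M M)"
    using measurable_compose[OF measurable_mixture_T f] by (simp add: case_prod_unfold)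
  have wf: "(\<lambda>(k, \<omega>). w k \<omega> *\<^sub>R f (T k \<omega>)) \<in> borel_measurable (count_space K \<Otimes>\<^sub>M M)"
    using borel_measurable_scaleR[OF measurable_mixture_w fT] by (simp add: case_prod_unfold)
  have ik: "integrable M (\<lambda>\<omega>. w k \<omega> *\<^sub>R f (T k \<omega>))" if k: "k \<in> K" for k
  proof (rule Bochner_Integration.integrable_bound[of M "\<lambda>\<omega>. B * w k \<omega>"])
    show "integrable M (\<lambda>\<omega>. B * w k \<omega>)" using w(1)[OF k] by simp
    show "(\<lambda>\<omega>. w k \<omega> *\<^sub>R f (T k \<omega>)) \<in> borel_measurable M"
      using w(1)[OF k] measurable_compose[OF T[OF k] f] by (intro borel_measurable_scaleR) auto
    show "AE \<omega> in M. norm (w k \<omega> *\<^sub>R f (T k \<omega>)) \<le> norm (B * w k \<omega>)"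
    proof (intro AE_I2)
      fix \<omega> assume "\<omega> \<in> space M"
      then have "norm (f (T k \<omega>)) \<le> B" by (intro b measurable_space[OF T[OF k]])
      then have "w k \<omega> * norm (f (T k \<omega>)) \<le> w k \<omega> * B" using w(2)[OF k] by (intro mult_left_mono)
      moreover have "0 \<le> B" using norm_ge_zero order_trans \<open>norm (f (T k \<omega>)) \<le> B\<close> by blast
      ultimately show "norm (w k \<omega> *\<^sub>R f (T k \<omega>)) \<le> norm (B * w k \<omega>)" using w(2)[OF k] by (simp add: mult.commute)
    qed
  qed
  have int: "integrable (count_space K \<Otimes>\<^sub>M M) (\<lambda>(k, \<omega>). w k \<omega> *\<^sub>R f (T k \<omega>))"
    by (rule P.Fubini_integrable[OF wf]) (use ik K in \<open>auto simp: AE_count_space integrable_count_space\<close>)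
  have "integral\<^sup>L (mixture M K N w T) f =
      (\<integral>z. f (case z of (k, \<omega>) \<Rightarrow> T k \<omega>) \<partial>density (count_space K \<Otimes>\<^sub>M M) (\<lambda>(k, \<omega>). ennreal (w k \<omega>)))"
    unfolding mixture_def by (rule integral_distr) (simp_all add: f measurable_mixture_T)
  also have "\<dots> = (\<integral>z. f (case z of (k, \<omega>) \<Rightarrow> T k \<omega>) \<partial>density (count_space K \<Otimes>\<^sub>M M) (\<lambda>z. ennreal (case z of (k, \<omega>) \<Rightarrow> w k \<omega>)))"
    by (simp add: case_prod_unfold)
  also have "\<dots> = (\<integral>z. (case z of (k, \<omega>) \<Rightarrow> w k \<omega>) *\<^sub>R f (case z of (k, \<omega>) \<Rightarrow> T k \<omega>) \<partial>(count_space K \<Otimes>\<^sub>M M))"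
    by (rule integral_density)
       (use measurable_compose[OF measurable_mixture_T f] measurable_mixture_w w(2) in \<open>auto intro!: AE_I2 simp: space_pair_measure\<close>)
  also have "\<dots> = (\<integral>k. (\<integral>\<omega>. w k \<omega> *\<^sub>R f (T k \<omega>) \<partial>M) \<partial>count_space K)"
    using P.integral_fst'[OF int] by (simp add: case_prod_unfold)
  also have "\<dots> = (\<Sum>k\<in>K. \<integral>\<omega>. w k \<omega> *\<^sub>R f (T k \<omega>) \<partial>M)" by (rule lebesgue_integral_count_space_finite[OF K])
  finally show ?thesis .
qed

lemma emeasure_mixture: "emeasure (mixture M K N w T) (space N) = ennreal (\<Sum>k\<in>K. \<integral>\<omega>. w k \<omega> \<partial>M)"
proof -
  interpret M: prob_space M by fact
  interpret C: sigma_finite_measure "count_space K" by (rule sigma_finite_measure_count_space_finite[OF K])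
  interpret P: pair_sigma_finite "count_space K" M ..
  have m: "(\<lambda>(k, \<omega>). ennreal (w k \<omega>)) \<in> borel_measurable (count_space K \<Otimes>\<^sub>M M)"
    using measurable_compose[OF measurable_mixture_w measurable_ennreal] by (simp add: case_prod_unfold)
  have "emeasure (mixture M K N w T) (space N) =
      emeasure (density (count_space K \<Otimes>\<^sub>M M) (\<lambda>(k, \<omega>). ennreal (w k \<omega>))) (space (count_space K \<Otimes>\<^sub>M M))"
    unfolding mixture_def using measurable_space[OF measurable_mixture_T]
    by (subst emeasure_distr) (auto intro!: arg_cong2[where f = emeasure] simp: measurable_mixture_T)
  also have "\<dots> = (\<integral>\<^sup>+z. (case z of (k, \<omega>) \<Rightarrow> ennreal (w k \<omega>)) \<partial>(count_space K \<Otimes>\<^sub>M M))"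
    using m by (subst emeasure_density) (auto intro!: nn_integral_cong)
  also have "\<dots> = (\<integral>\<^sup>+k. (\<integral>\<^sup>+\<omega>. ennreal (w k \<omega>) \<partial>M) \<partial>count_space K)"
    using M.nn_integral_fst[OF m] by simp
  also have "\<dots> = (\<Sum>k\<in>K. \<integral>\<^sup>+\<omega>. ennreal (w k \<omega>) \<partial>M)" by (rule nn_integral_count_space_finite[OF K])
  also have "\<dots> = (\<Sum>k\<in>K. ennreal (\<integral>\<omega>. w k \<omega> \<partial>M))"
    by (intro sum.cong refl nn_integral_eq_integral) (use w in auto)
  also have "\<dots> = ennreal (\<Sum>k\<in>K. \<integral>\<omega>. w k \<omega> \<partial>M)"
    by (rule sum_ennreal) (use w(2) in \<open>auto intro: Bochner_Integration.integral_nonneg\<close>)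
  finally show ?thesis .
qed

lemma finite_measure_mixture: "finite_measure (mixture M K N w T)"
  by (rule finite_measureI) (use emeasure_mixture in \<open>simp add: mixture_def\<close>)

lemma prob_space_mixture: "(\<Sum>k\<in>K. \<integral>\<omega>. w k \<omega> \<partial>M) = 1 \<Longrightarrow> prob_space (mixture M K N w T)"
  by (rule prob_spaceI) (use emeasure_mixture in \<open>simp add: mixture_def\<close>)

end

section \<open>Norms on finite families of blocks\<close>

locale block_norm =
  fixes I :: "int set" and N :: "(int \<Rightarrow> 'b::euclidean_space) \<Rightarrow> real" and \<kappa> :: real
  assumes fin: "finite I" and ne: "I \<noteq> {}" and \<kappa>: "0 < \<kappa>"
    and cong: "\<And>x y. (\<And>t. t \<in> I \<Longrightarrow> x t = y t) \<Longrightarrow> N x = N y"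
    and scale: "\<And>c x. N (\<lambda>t. c *\<^sub>R x t) = \<bar>c\<bar> * N x"
    and lip: "\<And>x y. \<bar>N x - N y\<bar> \<le> (\<Sum>t\<in>I. norm (x t - y t))"
    and lower: "\<And>t x. t \<in> I \<Longrightarrow> \<kappa> * norm (x t) \<le> N x"
begin

abbreviation S :: "(int \<Rightarrow> 'b) set" where "S \<equiv> block_sphere I N"

lemma nonneg: "0 \<le> N x"
  using ne lower \<kappa> by (metis all_not_in_conv mult_nonneg_nonneg norm_ge_zero less_imp_le order_trans)

lemma N_0: "N (\<lambda>t. 0) = 0"
  using scale[of 0 "\<lambda>t. 0"] by simp

lemma continuous: "continuous_on UNIV N"
  unfolding continuous_on_def
proof (intro ballI)
  fix x :: "int \<Rightarrow> 'b"
  have c: "((\<lambda>y. y t) \<longlongrightarrow> x t) (at x)" for t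
    using continuous_on_product_coordinates[of t] by (auto simp: continuous_on_def)
  have "((\<lambda>y. N y - N x) \<longlongrightarrow> 0) (at x)"
  proof (rule Lim_null_comparison)
    show "\<forall>\<^sub>F y in at x. norm (N y - N x) \<le> (\<Sum>t\<in>I. norm (y t - x t))" using lip by simp
    have "((\<lambda>y. \<Sum>t\<in>I. norm (y t - x t)) \<longlongrightarrow> (\<Sum>t\<in>I. norm (x t - x t))) (at x)" by (intro tendsto_intros c)
    then show "((\<lambda>y. \<Sum>t\<in>I. norm (y t - x t)) \<longlongrightarrow> 0) (at x)" by simp
  qed
  then show "(N \<longlongrightarrow> N x) (at x)" by (simp add: LIM_zero_iff)
qed

text \<open>Coordinates outside \<open>I\<close> are pinned at \<open>undefined\<close>, so the
  sphere is a closed subset of a product of balls and singletons, which is compact by Tychonoff;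
  \<open>lower\<close> supplies the radius \<open>1 / \<kappa>\<close>.\<close>

lemma compact_sphere: "compact S"
proof -
  define C where "C t = (if t \<in> I then cball 0 (1 / \<kappa>) else {undefined} :: 'b set)" for t
  have "compactin (product_topology (\<lambda>_. euclidean) UNIV) (PiE UNIV C)"
    by (subst compactin_PiE) (auto simp: C_def compactin_euclidean_iff)
  then have c: "compact (PiE UNIV C)" by (simp add: euclidean_product_topology compactin_euclidean_iff)
  have "S = PiE UNIV C \<inter> N -` {1}"
  proof (intro set_eqI iffI)
    fix x assume x: "x \<in> S"
    then have "norm (x t) \<le> 1 / \<kappa>" if "t \<in> I" for t
      using lower[OF that, of x] \<kappa> by (simp add: block_sphere_def field_simps)
    then show "x \<in> PiE UNIV C \<inter> N -` {1}" using x by (auto simp: block_sphere_def C_def PiE_def extensional_def)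
  next
    fix x assume x: "x \<in> PiE UNIV C \<inter> N -` {1}"
    have "x t = undefined" if "t \<notin> I" for t using x that by (auto simp: C_def PiE_def Pi_def split: if_splits)
    then show "x \<in> S" using x by (auto simp: block_sphere_def PiE_def extensional_def)
  qed
  moreover have "closed (N -` {1})" using continuous by (intro closed_vimage) auto
  ultimately show ?thesis using c by (simp add: compact_Int_closed)
qed

text \<open>The metric on functions is a weighted series over an enumeration of all indices. What is
  needed below is closeness block by block, and compactness of the sphere makes the modulus
  uniform.\<close>

lemma uniform_modulus:
  fixes g :: "(int \<Rightarrow> 'b) \<Rightarrow> real"
  assumes "continuous_on S g" "0 < e"
  obtains d where "0 < d" "\<And>x y. x \<in> S \<Longrightarrow> y \<in> S \<Longrightarrow> (\<And>t. t \<in> I \<Longrightarrow> norm (x t - y t) \<le> d) \<Longrightarrow> \<bar>g x - g y\<bar> \<le> e"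
proof -
  have "uniformly_continuous_on S g" by (rule compact_uniformly_continuous[OF assms(1) compact_sphere])
  then obtain d where d: "0 < d" "\<And>x y. x \<in> S \<Longrightarrow> y \<in> S \<Longrightarrow> dist y x < d \<Longrightarrow> dist (g y) (g x) < e"
    using assms(2) unfolding uniformly_continuous_on_def by metis
  show ?thesis
  \<comment> \<open>The weights \<open>(1 / 2) ^ n\<close> add up to 2, so blockwise distance
    \<open>d / 4\<close> means distance at most \<open>d / 2\<close>.\<close>
  proof (rule that[of "d / 4"])
    fix x y assume x: "x \<in> S" and y: "y \<in> S" and xy: "\<And>t. t \<in> I \<Longrightarrow> norm (x t - y t) \<le> d / 4"
    have xyt: "dist (y t) (x t) \<le> d / 4" for t
      using xy[of t] x y d(1) by (cases "t \<in> I") (auto simp: dist_norm norm_minus_commute block_sphere_def PiE_def extensional_def)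
    have "dist y x = (\<Sum>n. (1 / 2) ^ n * min (dist (y (from_nat n)) (x (from_nat n))) 1)" by (simp add: dist_fun_def)
    also have "\<dots> \<le> (\<Sum>n. (1 / 2) ^ n * (d / 4))"
    proof (rule suminf_le)
      show "(1 / 2) ^ n * min (dist (y (from_nat n)) (x (from_nat n))) 1 \<le> (1 / 2) ^ n * (d / 4)" for n :: nat
        using xyt[of "from_nat n"] by (intro mult_left_mono) auto
      show "summable (\<lambda>n. (1 / 2) ^ n * min (dist (y (from_nat n)) (x (from_nat n))) 1)"
        by (rule summable_comparison_test'[of "\<lambda>n. (1 / 2) ^ n" 0]) (auto simp: mult_left_le)
      show "summable (\<lambda>n. (1 / 2 :: real) ^ n * (d / 4))" by (intro summable_mult2 summable_geometric) simp
    qed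
    also have "\<dots> = d / 2" by (subst suminf_mult2[symmetric]) (auto simp: suminf_geometric)
    also have "\<dots> < d" using d(1) by simp
    finally have "dist (g y) (g x) < e" using d(2)[OF x y] by simp
    then show "\<bar>g x - g y\<bar> \<le> e" by (simp add: dist_real_def)
  qed (use d(1) in simp)
qed

end

lemma block_euclidean_norm: "finite I \<Longrightarrow> I \<noteq> {} \<Longrightarrow> block_norm I (block_euclidean_norm I) 1"
proof
  assume fin: "finite I"
  show "block_euclidean_norm I x = block_euclidean_norm I y" if "\<And>t. t \<in> I \<Longrightarrow> x t = y t" for x y :: "int \<Rightarrow> 'a"
    unfolding block_euclidean_norm_def by (rule L2_set_cong) (use that in auto)
  show "block_euclidean_norm I (\<lambda>t. c *\<^sub>R x t) = \<bar>c\<bar> * block_euclidean_norm I x" for c and x :: "int \<Rightarrow> 'a"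
    unfolding block_euclidean_norm_def by (simp add: L2_set_right_distrib)
  have 1: "block_euclidean_norm I x - block_euclidean_norm I y \<le> (\<Sum>t\<in>I. norm (x t - y t))" for x y :: "int \<Rightarrow> 'a"
  proof -
    have "block_euclidean_norm I x \<le> L2_set (\<lambda>t. norm (y t) + norm (x t - y t)) I"
      unfolding block_euclidean_norm_def by (rule L2_set_mono) (use norm_triangle_sub in auto)
    also have "\<dots> \<le> block_euclidean_norm I y + L2_set (\<lambda>t. norm (x t - y t)) I"
      unfolding block_euclidean_norm_def by (rule L2_set_triangle_ineq)
    also have "L2_set (\<lambda>t. norm (x t - y t)) I \<le> (\<Sum>t\<in>I. norm (x t - y t))" by (rule L2_set_le_sum) auto
    finally show ?thesis by simp
  qed
  show "\<bar>block_euclidean_norm I x - block_euclidean_norm I y\<bar> \<le> (\<Sum>t\<in>I. norm (x t - y t))" for x y :: "int \<Rightarrow> 'a"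
    using 1[of x y] 1[of y x] by (simp add: norm_minus_commute abs_le_iff)
  show "1 * norm (x t) \<le> block_euclidean_norm I x" if "t \<in> I" for t and x :: "int \<Rightarrow> 'a"
    using member_le_L2_set[OF fin that, of "\<lambda>t. norm (x t)"] by (simp add: block_euclidean_norm_def)
qed auto

lemma block_max_norm: "finite I \<Longrightarrow> I \<noteq> {} \<Longrightarrow>
  block_norm I (block_max_norm I :: (int \<Rightarrow> 'a::euclidean_space) \<Rightarrow> real) (1 / sqrt DIM('a))"
proof
  assume fin: "finite I" and ne: "I \<noteq> {}"
  show "block_max_norm I x = block_max_norm I y" if "\<And>t. t \<in> I \<Longrightarrow> x t = y t" for x y :: "int \<Rightarrow> 'a"
    unfolding block_max_norm_def using that by (intro arg_cong[where f = Max] image_cong) auto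
  show "block_max_norm I (\<lambda>t. c *\<^sub>R x t) = \<bar>c\<bar> * block_max_norm I x" for c and x :: "int \<Rightarrow> 'a"
  proof -
    have "mono (\<lambda>z. \<bar>c\<bar> * z)" by (intro monoI mult_left_mono) auto
    from mono_Max_commute[OF this, of "(\<lambda>t. infnorm (x t)) ` I"] show ?thesis
      using fin ne by (simp add: block_max_norm_def infnorm_mul image_image)
  qed
  have 1: "block_max_norm I x \<le> block_max_norm I y + (\<Sum>t\<in>I. norm (x t - y t))" for x y :: "int \<Rightarrow> 'a"
    unfolding block_max_norm_def
  proof (rule Max.boundedI)
    fix z assume "z \<in> (\<lambda>t. infnorm (x t)) ` I"
    then obtain t where t: "t \<in> I" "z = infnorm (x t)" by auto
    have "infnorm (x t) \<le> infnorm (y t) + infnorm (x t - y t)" using infnorm_triangle[of "y t" "x t - y t"] by simp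
    also have "infnorm (y t) \<le> Max ((\<lambda>t. infnorm (y t)) ` I)" using fin t by (intro Max_ge) auto
    also have "infnorm (x t - y t) \<le> norm (x t - y t)" by (rule infnorm_le_norm)
    also have "\<dots> \<le> (\<Sum>t\<in>I. norm (x t - y t))" by (rule member_le_sum[OF t(1)]) (use fin in auto)
    finally show "z \<le> Max ((\<lambda>t. infnorm (y t)) ` I) + (\<Sum>t\<in>I. norm (x t - y t))" unfolding t by simp
  qed (use fin ne in auto)
  show "\<bar>block_max_norm I x - block_max_norm I y\<bar> \<le> (\<Sum>t\<in>I. norm (x t - y t))" for x y :: "int \<Rightarrow> 'a"
    using 1[of x y] 1[of y x] by (simp add: norm_minus_commute abs_le_iff)
  show "1 / sqrt DIM('a) * norm (x t) \<le> block_max_norm I x" if "t \<in> I" for t and x :: "int \<Rightarrow> 'a"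
  proof -
    have "norm (x t) \<le> sqrt DIM('a) * infnorm (x t)" by (rule norm_le_infnorm)
    moreover have "infnorm (x t) \<le> block_max_norm I x" unfolding block_max_norm_def using fin that by (intro Max_ge) auto
    ultimately have "norm (x t) \<le> sqrt DIM('a) * block_max_norm I x"
      by (rule order_trans[OF _ mult_left_mono]) simp
    then show ?thesis by (simp add: field_simps)
  qed
qed (auto simp: DIM_positive)

lemma continuous_fun_measurable:
  fixes g :: "(int \<Rightarrow> 'b::euclidean_space) \<Rightarrow> real"
  assumes "continuous_on UNIV g" "\<And>t. (\<lambda>\<omega>. f \<omega> t) \<in> borel_measurable M"
  shows "(\<lambda>\<omega>. g (f \<omega>)) \<in> borel_measurable M"
  using measurable_coordinatewise_then_product[OF assms(2)] borel_measurable_continuous_onI[OF assms(1)]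
  by (rule measurable_compose)

context block_norm
begin

definition axis_block :: "int \<Rightarrow> 'b \<Rightarrow> int \<Rightarrow> 'b" where
  "axis_block j z t = (if t = j then z else 0)"

definition axis_norm :: "int \<Rightarrow> 'b \<Rightarrow> real" where
  "axis_norm j z = N (axis_block j z)"

definition direction :: "(int \<Rightarrow> 'b) \<Rightarrow> int \<Rightarrow> 'b" where
  "direction v = (\<lambda>t\<in>I. v t /\<^sub>R N v)"

lemma axis_block_scale: "axis_block j (c *\<^sub>R z) = (\<lambda>t. c *\<^sub>R axis_block j z t)"
  by (auto simp: axis_block_def)

lemma axis_norm_scale: "axis_norm j (c *\<^sub>R z) = \<bar>c\<bar> * axis_norm j z"
  unfolding axis_norm_def axis_block_scale by (rule scale)

lemma axis_norm_nonneg: "0 \<le> axis_norm j z"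
  unfolding axis_norm_def by (rule nonneg)

lemma axis_norm_le: "axis_norm j z \<le> norm z"
proof -
  have "N (axis_block j z) - N (\<lambda>t. 0) \<le> (\<Sum>t\<in>I. norm (axis_block j z t - 0))"
    using lip[of "axis_block j z" "\<lambda>t. 0"] by simp
  also have "\<dots> = (\<Sum>t\<in>I. if t = j then norm z else 0)" by (rule sum.cong) (auto simp: axis_block_def)
  also have "\<dots> \<le> norm z" using fin by simp
  finally show ?thesis by (simp add: axis_norm_def N_0)
qed

lemma axis_norm_ge: "j \<in> I \<Longrightarrow> \<kappa> * norm z \<le> axis_norm j z"
  using lower[of j "axis_block j z"] by (simp add: axis_norm_def axis_block_def)

lemma axis_norm_pos: "j \<in> I \<Longrightarrow> z \<noteq> 0 \<Longrightarrow> 0 < axis_norm j z"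
  by (rule less_le_trans[OF _ axis_norm_ge]) (use \<kappa> in auto)

lemma direction_in_sphere: "0 < N v \<Longrightarrow> direction v \<in> S"
proof -
  assume v: "0 < N v"
  have "N (direction v) = N (\<lambda>t. inverse (N v) *\<^sub>R v t)" by (rule cong) (simp add: direction_def)
  also have "\<dots> = 1" using v by (simp add: scale)
  finally show ?thesis by (simp add: block_sphere_def direction_def)
qed

lemma direction_scale: "0 < c \<Longrightarrow> direction (axis_block j (c *\<^sub>R z)) = direction (axis_block j z)"
  unfolding direction_def axis_block_scale by (auto simp: scale)

lemma axis_block_continuous: "continuous_on UNIV (\<lambda>z. axis_block j z)"
proof (rule continuous_on_coordinatewise_then_product)
  fix t
  show "continuous_on UNIV (\<lambda>z. axis_block j z t)" unfolding axis_block_def by (cases "t = j") auto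
qed

lemma axis_norm_measurable[measurable]: "axis_norm j \<in> borel_measurable borel"
  unfolding axis_norm_def
  by (intro borel_measurable_continuous_onI continuous_on_compose2[OF continuous axis_block_continuous]) auto

lemma N_measurable:
  assumes "\<And>t. (\<lambda>\<omega>. f \<omega> t) \<in> borel_measurable M"
  shows "(\<lambda>\<omega>. N (f \<omega>)) \<in> borel_measurable M"
  by (rule continuous_fun_measurable[OF continuous assms])

lemma direction_coordinate_measurable:
  assumes "\<And>t. (\<lambda>\<omega>. f \<omega> t) \<in> borel_measurable M"
  shows "(\<lambda>\<omega>. direction (f \<omega>) t) \<in> borel_measurable M"
proof -
  note [measurable] = N_measurable[OF assms] assms
  show ?thesis unfolding direction_def by (cases "t \<in> I") simp_all
qed

lemma axis_coordinate_measurable: "(\<lambda>z. axis_block j z t) \<in> borel_measurable borel"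
  unfolding axis_block_def by (cases "t = j") auto

text \<open>If at most one block exceeds \<open>\<delta> * x\<close>, the norm of \<open>v\<close>
  differs from that of this block alone by at most \<open>card I * \<delta> * x\<close>. The bound
  lists what can go wrong: two large blocks, a displacement of the direction at cost
  \<open>e\<close>, or a norm in the shell around \<open>x\<close> where one indicator fires and the
  other does not.\<close>

lemma block_compare:
  fixes g :: "(int \<Rightarrow> 'b) \<Rightarrow> real" and B e d \<delta> x :: real
  assumes g: "\<And>x. \<bar>g x\<bar> \<le> B" and e: "0 \<le> e"
    and d: "\<And>x y. x \<in> S \<Longrightarrow> y \<in> S \<Longrightarrow> (\<And>t. t \<in> I \<Longrightarrow> norm (x t - y t) \<le> d) \<Longrightarrow> \<bar>g x - g y\<bar> \<le> e"
    and \<delta>: "0 < \<delta>" "real (card I) * \<delta> < 1" "\<delta> * (1 + card I / \<kappa>) \<le> d" and x: "0 < x"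
  shows "\<bar>(if N v > x then g (direction v) else 0) -
      (\<Sum>j\<in>I. if axis_norm j (v j) > x then g (direction (axis_block j (v j))) else 0)\<bar> \<le>
    (1 + card I) * B * of_bool (\<exists>i\<in>I. \<exists>j\<in>I. i \<noteq> j \<and> norm (v i) > \<delta> * x \<and> norm (v j) > \<delta> * x) +
    (\<Sum>j\<in>I. e * of_bool (axis_norm j (v j) > x) +
       2 * B * (of_bool (axis_norm j (v j) > (1 - card I * \<delta>) * x) - of_bool (axis_norm j (v j) > (1 + card I * \<delta>) * x)))"
proof -
  let ?L = "if N v > x then g (direction v) else 0"
  let ?R = "\<Sum>j\<in>I. if axis_norm j (v j) > x then g (direction (axis_block j (v j))) else 0"
  let ?A = "(1 + card I) * B"
  let ?P = "\<exists>i\<in>I. \<exists>j\<in>I. i \<noteq> j \<and> norm (v i) > \<delta> * x \<and> norm (v j) > \<delta> * x"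
  let ?C = "\<lambda>j. e * of_bool (axis_norm j (v j) > x) +
       2 * B * (of_bool (axis_norm j (v j) > (1 - card I * \<delta>) * x) - of_bool (axis_norm j (v j) > (1 + card I * \<delta>) * x))"
  define c where "c = real (card I) * \<delta>"
  have c: "0 \<le> c" "c < 1" using \<delta> by (auto simp: c_def)
  have B: "0 \<le> B" using g[of undefined] by simp
  have \<delta>1: "\<delta> < 1"
  proof -
    have "1 * \<delta> \<le> real (card I) * \<delta>" using fin ne \<delta>(1) by (intro mult_right_mono) (auto simp: card_gt_0_iff Suc_le_eq)
    then show ?thesis using \<delta>(2) by simp
  qed
  have Cnn: "0 \<le> ?C j" for j
  proof -
    have "(1 - c) * x \<le> (1 + c) * x" using c x by (intro mult_right_mono) auto
    then have "of_bool (axis_norm j (v j) > (1 + c) * x) \<le> (of_bool (axis_norm j (v j) > (1 - c) * x) :: real)" by auto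
    then show ?thesis using e B unfolding c_def[symmetric] by simp
  qed
  show ?thesis
  proof (cases ?P)
    case True
    have "\<bar>?L - ?R\<bar> \<le> \<bar>?L\<bar> + \<bar>?R\<bar>" by (rule abs_triangle_ineq4)
    also have "\<dots> \<le> B + (\<Sum>j\<in>I. B)"
      using g B by (intro add_mono order_trans[OF sum_abs] sum_mono) auto
    also have "\<dots> = ?A * of_bool ?P" using True by (simp add: algebra_simps)
    finally show ?thesis using sum_nonneg[of I ?C] Cnn by simp
  next
    case False
    \<comment> \<open>The one block that may exceed \<open>\<delta> * x\<close>, or an arbitrary
      block if none does.\<close>
    obtain i where i: "i \<in> I" and small: "\<And>j. j \<in> I \<Longrightarrow> j \<noteq> i \<Longrightarrow> norm (v j) \<le> \<delta> * x"
    proof (cases "\<exists>i\<in>I. norm (v i) > \<delta> * x")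
      case True
      then obtain i where "i \<in> I" "norm (v i) > \<delta> * x" by auto
      then show ?thesis using that[of i] False by (meson not_less)
    next
      case F: False
      obtain i where "i \<in> I" using ne by auto
      then show ?thesis using that[of i] F by (auto simp: not_less)
    qed
    define r where "r = axis_norm i (v i)"
    have Nr: "\<bar>N v - r\<bar> \<le> c * x"
    proof -
      have "\<bar>N v - r\<bar> \<le> (\<Sum>t\<in>I. norm (v t - axis_block i (v i) t))" unfolding r_def axis_norm_def by (rule lip)
      also have "\<dots> \<le> (\<Sum>t\<in>I. \<delta> * x)"
        using small \<delta> x by (intro sum_mono) (auto simp: axis_block_def)
      finally show ?thesis by (simp add: c_def mult.assoc)
    qed
    have "axis_norm j (v j) \<le> x" if "j \<in> I" "j \<noteq> i" for j
    proof -
      have "axis_norm j (v j) \<le> \<delta> * x" using axis_norm_le small[OF that] by (rule order_trans)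
      also have "\<dots> \<le> 1 * x" using \<delta>1 x by (intro mult_right_mono) auto
      finally show ?thesis by simp
    qed
    then have "?R = (\<Sum>j\<in>I. if j = i then (if r > x then g (direction (axis_block i (v i))) else 0) else 0)"
      by (intro sum.cong) (auto simp: r_def dest: leD)
    then have R: "?R = (if r > x then g (direction (axis_block i (v i))) else 0)" using i fin by simp
    have "\<bar>?L - ?R\<bar> \<le> ?C i"
    proof -
      consider "r > (1 + c) * x" | "r \<le> (1 - c) * x" | "(1 - c) * x < r" "r \<le> (1 + c) * x" by linarith
      then show ?thesis
      proof cases
        case 1
        have "x \<le> (1 + c) * x" using c x by (simp add: algebra_simps)
        then have rx: "r > x" using 1 by simp
        have Nx: "N v > x" using 1 Nr by (simp add: algebra_simps)
        have Npos: "0 < N v" "0 < r" using Nx rx x by auto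
        have "(1 - c) * x \<le> (1 + c) * x" using c x by (intro mult_right_mono) auto
        then have Ci: "?C i = e" using 1 rx unfolding r_def[symmetric] c_def[symmetric] by simp
        \<comment> \<open>Off the axis the direction moves by at most \<delta>, on the axis by at
          most \<open>\<delta> * card I / \<kappa>\<close>; the condition linking \<delta> to
          \<open>d\<close> covers either.\<close>
        have "\<bar>g (direction v) - g (direction (axis_block i (v i)))\<bar> \<le> e"
        proof (rule d)
          show "direction v \<in> S" "direction (axis_block i (v i)) \<in> S"
            using Npos by (auto intro: direction_in_sphere simp: r_def axis_norm_def)
          fix t assume t: "t \<in> I"
          show "norm (direction v t - direction (axis_block i (v i)) t) \<le> d"
          proof (cases "t = i")
            case False
            have "norm (direction v t - direction (axis_block i (v i)) t) = norm (v t) / N v"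
              using t False Npos by (simp add: direction_def axis_block_def divide_inverse)
            also have "\<dots> \<le> (\<delta> * x) / x" using small[OF t False] Nx x \<delta> by (intro frac_le) auto
            also have "\<dots> = \<delta> * 1" using x by simp
            also have "\<dots> \<le> \<delta> * (1 + card I / \<kappa>)" using \<delta> \<kappa> by (intro mult_left_mono) auto
            finally show ?thesis using \<delta>(3) by simp
          next
            case True
            have "direction v t - direction (axis_block i (v i)) t = (inverse (N v) - inverse r) *\<^sub>R v i"
              using t True by (simp add: direction_def axis_block_def r_def axis_norm_def scaleR_diff_left)
            then have "norm (direction v t - direction (axis_block i (v i)) t) = \<bar>inverse (N v) - inverse r\<bar> * norm (v i)" by simp
            also have "\<bar>inverse (N v) - inverse r\<bar> = \<bar>N v - r\<bar> / (N v * r)"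
            proof -
              have "inverse (N v) - inverse r = (r - N v) / (N v * r)" using Npos by (simp add: field_simps)
              then show ?thesis using Npos by (simp add: abs_minus_commute)
            qed
            also have "\<bar>N v - r\<bar> / (N v * r) * norm (v i) \<le> (c * x) / (x * r) * (r / \<kappa>)"
            proof (rule mult_mono)
              show "\<bar>N v - r\<bar> / (N v * r) \<le> (c * x) / (x * r)"
                using Nr Nx x Npos c by (intro frac_le mult_right_mono mult_nonneg_nonneg) auto
              show "norm (v i) \<le> r / \<kappa>" using axis_norm_ge[OF i, of "v i"] \<kappa> by (simp add: r_def field_simps)
            qed (use c x Npos in auto)
            also have "\<dots> = \<delta> * (card I / \<kappa>)" using x Npos by (simp add: c_def)
            also have "\<dots> \<le> \<delta> * (1 + card I / \<kappa>)" using \<delta> by (intro mult_left_mono) auto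
            finally show ?thesis using \<delta>(3) by simp
          qed
        qed
        then show ?thesis unfolding R Ci using rx Nx by simp
      next
        case 2
        then have "N v \<le> x" using Nr by (simp add: algebra_simps)
        moreover have "0 \<le> c * x" using c x by (intro mult_nonneg_nonneg) auto
        then have "r \<le> x" using 2 unfolding left_diff_distrib by linarith
        ultimately have "?L - ?R = 0" unfolding R by simp
        then show ?thesis using Cnn[of i] by simp
      next
        case 3
        have "\<bar>?L - ?R\<bar> \<le> B + B" unfolding R using g B by (intro order_trans[OF abs_triangle_ineq4] add_mono) auto
        also have "\<dots> \<le> ?C i" using 3 e unfolding r_def[symmetric] c_def[symmetric] by simp
        finally show ?thesis .
      qed
    qed
    also have "\<dots> \<le> (\<Sum>j\<in>I. ?C j)" by (rule member_le_sum[OF i]) (use Cnn fin in auto)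
    finally have "\<bar>?L - ?R\<bar> \<le> (\<Sum>j\<in>I. ?C j)" .
    moreover have "(of_bool ?P :: real) = 0" by (simp only: False of_bool_eq)
    ultimately show ?thesis by (simp only: mult_zero_right add_0_left)
  qed
qed

end

section \<open>Tails of products with a predictable factor\<close>

locale predictable_product = prob_space M + bn: block_norm I N \<kappa>
  for M :: "'w measure" and I :: "int set" and N :: "(int \<Rightarrow> 'b::euclidean_space) \<Rightarrow> real" and \<kappa> :: real +
  fixes Y :: "int \<Rightarrow> 'w \<Rightarrow> real" and G :: "int \<Rightarrow> 'w \<Rightarrow> 'b" and \<alpha> \<epsilon> p q :: real
  assumes ind: "indep_vars (\<lambda>_. borel) Y UNIV" and id: "\<And>s t. distr M borel (Y s) = distr M borel (Y t)"
    and G_stat: "strictly_stationary M G" and G_adapted: "\<And>t. G t \<in> borel_measurable (past_sigma M Y t)"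
    and balanced: "tail_balanced (Y 1) \<alpha> p q" and \<alpha>: "0 < \<alpha>" and \<epsilon>: "0 < \<epsilon>"
    and moment: "integrable M (\<lambda>\<omega>. norm (G 1 \<omega>) powr (\<alpha> + \<epsilon>))"
    and nontrivial: "prob {\<omega> \<in> space M. G 1 \<omega> \<noteq> 0} > 0"
begin

abbreviation T :: "real \<Rightarrow> real" where "T \<equiv> abs_tail (Y 1)"

abbreviation X :: "int \<Rightarrow> 'w \<Rightarrow> 'b" where "X t \<omega> \<equiv> Y t \<omega> *\<^sub>R G t \<omega>"

lemma Y_meas[measurable]: "Y t \<in> borel_measurable M"
  using ind by (auto simp: indep_vars_def2)

lemma G_meas[measurable]: "G t \<in> borel_measurable M"
  using G_stat by (auto simp: strictly_stationary_def)

lemma prob_Y: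
  assumes [measurable]: "Measurable.pred borel P"
  shows "prob {\<omega> \<in> space M. P (Y t \<omega>)} = prob {\<omega> \<in> space M. P (Y 1 \<omega>)}"
proof -
  have "prob {\<omega> \<in> space M. P (Y s \<omega>)} = measure (distr M borel (Y s)) {y. P y}" for s
    by (subst measure_distr) (auto intro!: arg_cong[where f = prob])
  then show ?thesis using id[of t 1] by simp
qed

text \<open>Potter's bound at \<open>s = 1 / b\<close>. Choosing \<delta> below \<epsilon> puts the
  powers \<open>b powr (\<alpha> \<plusminus> \<delta>)\<close> under
  \<open>1 + b powr (\<alpha> + \<epsilon>)\<close>, which is integrable when \<open>b\<close> is a
  multiple of \<open>norm (G t)\<close>: the domination in Breiman's argument.\<close>

lemma tail_product_bound:
  "\<exists>C>0. \<exists>x0>0. \<forall>x\<ge>x0. T x > 0 \<and>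
     (\<forall>t. \<forall>b\<ge>0. prob {\<omega> \<in> space M. \<bar>Y t \<omega>\<bar> * b > x} \<le> C * (1 + b powr (\<alpha> + \<epsilon>)) * T x)"
proof -
  define \<delta> where "\<delta> = min \<alpha> \<epsilon> / 2"
  have \<delta>: "0 < \<delta>" "\<delta> < \<alpha>" "\<delta> < \<epsilon>" using \<alpha> \<epsilon> by (auto simp: \<delta>_def)
  obtain C x0 where C: "C > 0" "x0 > 0" and Pot: "\<And>x. x \<ge> x0 \<Longrightarrow> T x > 0 \<and>
      (\<forall>s>0. T (s * x) \<le> C * max (s powr (-\<alpha>-\<delta>)) (s powr (-\<alpha>+\<delta>)) * T x)"
    using tail_balanced_Potter[OF balanced \<delta>(1,2)] by auto
  have "prob {\<omega> \<in> space M. \<bar>Y t \<omega>\<bar> * b > x} \<le> C * (1 + b powr (\<alpha> + \<epsilon>)) * T x" if x: "x \<ge> x0" and b: "b \<ge> 0" for x t b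
  proof (cases "b = 0")
    case True
    then have "prob {\<omega> \<in> space M. \<bar>Y t \<omega>\<bar> * b > x} = 0" using x C by simp
    then show ?thesis using C abs_tail_bounds(1)[of "Y 1" x] by (simp add: add_nonneg_nonneg)
  next
    case False
    then have b0: "b > 0" using b by simp
    have "prob {\<omega> \<in> space M. \<bar>Y t \<omega>\<bar> * b > x} = prob {\<omega> \<in> space M. \<bar>Y 1 \<omega>\<bar> * b > x}"
      by (rule prob_Y) measurable
    also have "\<dots> = T ((1 / b) * x)" unfolding abs_tail_def using b0
      by (intro arg_cong[where f = prob]) (auto simp: field_simps)
    also have "\<dots> \<le> C * max ((1 / b) powr (-\<alpha>-\<delta>)) ((1 / b) powr (-\<alpha>+\<delta>)) * T x"
      by (rule Pot[OF x, THEN conjunct2, rule_format]) (use b0 in simp)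
    also have "\<dots> \<le> C * (1 + b powr (\<alpha> + \<epsilon>)) * T x"
    proof (intro mult_right_mono mult_left_mono)
      have e: "(1 / b) powr (-\<alpha>-\<delta>) = b powr (\<alpha> + \<delta>)" "(1 / b) powr (-\<alpha>+\<delta>) = b powr (\<alpha> - \<delta>)"
      proof -
        have "(1 / b) powr (- c) = b powr c" for c using b0 by (simp add: powr_divide powr_minus_divide)
        from this[of "\<alpha> + \<delta>"] this[of "\<alpha> - \<delta>"]
        show "(1 / b) powr (-\<alpha>-\<delta>) = b powr (\<alpha> + \<delta>)" "(1 / b) powr (-\<alpha>+\<delta>) = b powr (\<alpha> - \<delta>)" by simp_all
      qed
      show "max ((1 / b) powr (-\<alpha>-\<delta>)) ((1 / b) powr (-\<alpha>+\<delta>)) \<le> 1 + b powr (\<alpha> + \<epsilon>)"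
      proof (cases "b \<ge> 1")
        case True
        then have "b powr (\<alpha> + \<delta>) \<le> b powr (\<alpha> + \<epsilon>)" "b powr (\<alpha> - \<delta>) \<le> b powr (\<alpha> + \<epsilon>)"
          using \<delta> by (auto intro!: powr_mono)
        then show ?thesis unfolding e by simp
      next
        case False
        then have "b powr (\<alpha> + \<delta>) \<le> 1" "b powr (\<alpha> - \<delta>) \<le> 1" using b0 \<delta> \<alpha> by (auto intro!: powr_le1)
        then show ?thesis unfolding e using powr_ge_zero[of b "\<alpha> + \<epsilon>"] by (simp add: add_increasing2)
      qed
    qed (use C abs_tail_bounds in auto)
    finally show ?thesis .
  qed
  then show ?thesis using C Pot by blast
qed

lemma moment_integrable: "integrable M (\<lambda>\<omega>. C * (1 + (c * norm (G t \<omega>)) powr (\<alpha> + \<epsilon>)))" if "0 \<le> c"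
proof -
  have "(\<lambda>z::'b. norm z powr (\<alpha> + \<epsilon>)) \<in> borel_measurable borel" by measurable
  from stationary_expectation_1(2)[OF G_stat this, of t 1] moment
  have "integrable M (\<lambda>\<omega>. norm (G t \<omega>) powr (\<alpha> + \<epsilon>))" by blast
  then show ?thesis using that by (simp add: powr_mult)
qed

text \<open>For \<open>i < j\<close> freeze everything except \<open>Y j\<close>. The conditional
  probability that block \<open>j\<close> is large, divided by the tail, is dominated by an
  integrable function of \<open>G j\<close>, while the indicator of block \<open>i\<close> being
  large is eventually 0 at every sample point.\<close>

lemma two_large_blocks:
  assumes ij: "i \<noteq> j" and \<delta>: "\<delta> > 0"
  shows "((\<lambda>x. prob {\<omega> \<in> space M. norm (X i \<omega>) > \<delta> * x \<and> norm (X j \<omega>) > \<delta> * x} / T x) \<longlongrightarrow> 0) at_top"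
proof -
  have main: "((\<lambda>x. prob {\<omega> \<in> space M. norm (X i \<omega>) > \<delta> * x \<and> norm (X j \<omega>) > \<delta> * x} / T x) \<longlongrightarrow> 0) at_top" if ij: "i < j" for i j
  proof -
    obtain C x0 where C: "C > 0" "x0 > 0" and bd: "\<And>x. x \<ge> x0 \<Longrightarrow> T x > 0 \<and>
       (\<forall>t. \<forall>b\<ge>0. prob {\<omega> \<in> space M. \<bar>Y t \<omega>\<bar> * b > x} \<le> C * (1 + b powr (\<alpha> + \<epsilon>)) * T x)"
      using tail_product_bound by blast
    define R where "R x \<omega> = of_bool (norm (X i \<omega>) > \<delta> * x) * prob {\<omega>' \<in> space M. \<bar>Y j \<omega>'\<bar> * (norm (G j \<omega>) / \<delta>) > x}" for x \<omega>
    have Yi: "Y i \<in> borel_measurable (past_sigma M Y j)"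
      unfolding past_sigma_eq using ij by (intro measurable_block_sigma_self) auto
    have Gi: "G i \<in> borel_measurable (past_sigma M Y j)"
      unfolding past_sigma_eq by (rule measurable_block_sigma_mono[OF G_adapted[of i, unfolded past_sigma_eq]]) (use ij in auto)
    have eq: "prob {\<omega> \<in> space M. norm (X i \<omega>) > \<delta> * x \<and> norm (X j \<omega>) > \<delta> * x} = (\<integral>\<omega>. R x \<omega> \<partial>M)" for x
    proof -
      define F where "F = (\<lambda>z :: (real \<times> real) \<times> real. of_bool (fst (fst z) > \<delta> * x) * of_bool (\<bar>snd z\<bar> * (snd (fst z) / \<delta>) > x) :: real)"
      have [measurable]: "F \<in> borel_measurable ((borel \<Otimes>\<^sub>M borel) \<Otimes>\<^sub>M borel)" unfolding F_def by measurable
      have V: "(\<lambda>\<omega>. (norm (X i \<omega>), norm (G j \<omega>))) \<in> measurable (past_sigma M Y j) (borel \<Otimes>\<^sub>M borel)"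
        using Yi Gi G_adapted[of j] by measurable
      have d: "(norm (X j \<omega>) > \<delta> * x) = (\<bar>Y j \<omega>\<bar> * (norm (G j \<omega>) / \<delta>) > x)" for \<omega>
        using \<delta> by (simp add: field_simps)
      have "prob {\<omega> \<in> space M. norm (X i \<omega>) > \<delta> * x \<and> norm (X j \<omega>) > \<delta> * x} =
          (\<integral>\<omega>. indicator {\<omega> \<in> space M. norm (X i \<omega>) > \<delta> * x \<and> norm (X j \<omega>) > \<delta> * x} \<omega> \<partial>M)" by simp
      also have "\<dots> = (\<integral>\<omega>. F ((norm (X i \<omega>), norm (G j \<omega>)), Y j \<omega>) \<partial>M)"
        by (rule Bochner_Integration.integral_cong) (simp_all only: F_def d fst_conv snd_conv, auto)
      also have "\<dots> = (\<integral>\<omega>. (\<integral>\<omega>'. F ((norm (X i \<omega>), norm (G j \<omega>)), Y j \<omega>') \<partial>M) \<partial>M)"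
        by (rule indep_past_integral[OF ind V, of F 1]) (auto simp: F_def)
      also have "\<dots> = (\<integral>\<omega>. R x \<omega> \<partial>M)"
      proof (rule Bochner_Integration.integral_cong)
        fix \<omega>
        have "(\<integral>\<omega>'. of_bool (\<bar>Y j \<omega>'\<bar> * (norm (G j \<omega>) / \<delta>) > x) \<partial>M) = (\<integral>\<omega>'. indicator {\<omega>' \<in> space M. \<bar>Y j \<omega>'\<bar> * (norm (G j \<omega>) / \<delta>) > x} \<omega>' \<partial>M)"
          by (rule Bochner_Integration.integral_cong) auto
        also have "\<dots> = prob {\<omega>' \<in> space M. \<bar>Y j \<omega>'\<bar> * (norm (G j \<omega>) / \<delta>) > x}" by simp
        finally show "(\<integral>\<omega>'. F ((norm (X i \<omega>), norm (G j \<omega>)), Y j \<omega>') \<partial>M) = R x \<omega>"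
          unfolding F_def R_def by simp
      qed simp
      finally show ?thesis .
    qed
    have Rm: "R x \<in> borel_measurable M" for x
    proof -
      have "(\<lambda>b. prob {\<omega>' \<in> space M. \<bar>Y j \<omega>'\<bar> * b > x}) \<in> borel_measurable borel" for x
      proof -
        have "(\<lambda>(b, \<omega>'). of_bool (\<bar>Y j \<omega>'\<bar> * b > x) :: real) \<in> borel_measurable (borel \<Otimes>\<^sub>M M)"
          by measurable
        then have "(\<lambda>b. \<integral>\<omega>'. (of_bool (\<bar>Y j \<omega>'\<bar> * b > x) :: real) \<partial>M) \<in> borel_measurable borel"
          by (rule borel_measurable_lebesgue_integral)
        moreover have "(\<integral>\<omega>'. (of_bool (\<bar>Y j \<omega>'\<bar> * b > x) :: real) \<partial>M) = prob {\<omega>' \<in> space M. \<bar>Y j \<omega>'\<bar> * b > x}" for b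
        proof -
          have "(\<integral>\<omega>'. (of_bool (\<bar>Y j \<omega>'\<bar> * b > x) :: real) \<partial>M) = (\<integral>\<omega>'. indicat_real {\<omega>' \<in> space M. \<bar>Y j \<omega>'\<bar> * b > x} \<omega>' \<partial>M)"
            by (rule Bochner_Integration.integral_cong) (auto simp: indicator_def)
          then show ?thesis by simp
        qed
        ultimately show ?thesis by simp
      qed
      from measurable_compose[OF _ this, of "\<lambda>\<omega>. norm (G j \<omega>) / \<delta>" M]
      show ?thesis unfolding R_def by measurable
    qed
    have Rb: "R x \<omega> / T x \<le> of_bool (norm (X i \<omega>) > \<delta> * x) * (C * (1 + (inverse \<delta> * norm (G j \<omega>)) powr (\<alpha> + \<epsilon>)))" "0 \<le> R x \<omega> / T x" if "x \<ge> x0" for x \<omega>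
    proof -
      have "prob {\<omega>' \<in> space M. \<bar>Y j \<omega>'\<bar> * (norm (G j \<omega>) / \<delta>) > x} \<le> C * (1 + (norm (G j \<omega>) / \<delta>) powr (\<alpha> + \<epsilon>)) * T x"
        by (rule bd[OF that, THEN conjunct2, rule_format]) (use \<delta> in simp)
      moreover have "inverse \<delta> * norm (G j \<omega>) = norm (G j \<omega>) / \<delta>" by (simp add: divide_inverse)
      ultimately have "prob {\<omega>' \<in> space M. \<bar>Y j \<omega>'\<bar> * (norm (G j \<omega>) / \<delta>) > x} / T x \<le> C * (1 + (inverse \<delta> * norm (G j \<omega>)) powr (\<alpha> + \<epsilon>))"
        using bd[OF that] by (simp only: pos_divide_le_eq)
      then show "R x \<omega> / T x \<le> of_bool (norm (X i \<omega>) > \<delta> * x) * (C * (1 + (inverse \<delta> * norm (G j \<omega>)) powr (\<alpha> + \<epsilon>)))"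
        unfolding R_def by auto
      show "0 \<le> R x \<omega> / T x" using bd[OF that] unfolding R_def by (intro divide_nonneg_nonneg mult_nonneg_nonneg) auto
    qed
    have "((\<lambda>x. \<integral>\<omega>. R x \<omega> / T x \<partial>M) \<longlongrightarrow> (\<integral>\<omega>. 0 \<partial>M)) at_top"
    proof (rule integral_dominated_convergence_at_top)
      show "integrable M (\<lambda>\<omega>. C * (1 + (inverse \<delta> * norm (G j \<omega>)) powr (\<alpha> + \<epsilon>)))"
        using \<delta> by (intro moment_integrable) simp
      show "(\<lambda>\<omega>. R t \<omega> / T t) \<in> borel_measurable M" for t using Rm[of t] by measurable
      show "AE \<omega> in M. ((\<lambda>x. R x \<omega> / T x) \<longlongrightarrow> 0) at_top"
      proof (intro AE_I2 tendsto_eventually)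
        fix \<omega>
        show "\<forall>\<^sub>F x in at_top. R x \<omega> / T x = 0"
          using eventually_ge_at_top[of "norm (X i \<omega>) / \<delta>"]
        proof eventually_elim
          case (elim x)
          then have "\<not> norm (X i \<omega>) > \<delta> * x" using \<delta> by (simp add: field_simps)
          then show ?case by (simp add: R_def)
        qed
      qed
      show "\<forall>\<^sub>F x in at_top. AE \<omega> in M. norm (R x \<omega> / T x) \<le> C * (1 + (inverse \<delta> * norm (G j \<omega>)) powr (\<alpha> + \<epsilon>))"
        using eventually_ge_at_top[of x0]
      proof eventually_elim
        case (elim x)
        have "norm (R x \<omega> / T x) \<le> C * (1 + (inverse \<delta> * norm (G j \<omega>)) powr (\<alpha> + \<epsilon>))" for \<omega>
        proof -
          have nn: "0 \<le> C * (1 + (inverse \<delta> * norm (G j \<omega>)) powr (\<alpha> + \<epsilon>))" using C by (simp add: add_nonneg_nonneg)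
          have "R x \<omega> / T x \<le> 1 * (C * (1 + (inverse \<delta> * norm (G j \<omega>)) powr (\<alpha> + \<epsilon>)))"
            by (rule order_trans[OF Rb(1)[OF elim] mult_right_mono[OF _ nn]]) auto
          then show ?thesis using Rb(2)[OF elim, of \<omega>] by simp
        qed
        then show ?case by simp
      qed
    qed simp
    then show ?thesis unfolding eq by simp
  qed
  show ?thesis
  proof (cases "i < j")
    case True
    then show ?thesis by (rule main)
  next
    case False
    then have "j < i" using ij by simp
    from main[OF this] show ?thesis by (simp add: conj_commute)
  qed
qed

text \<open>The value that Breiman's lemma assigns to block \<open>j\<close>, with \<open>g\<close>
  recording the direction. \<open>G 1\<close> stands in for \<open>G j\<close> by
  stationarity.\<close>

definition axis_limit :: "int \<Rightarrow> ((int \<Rightarrow> 'b) \<Rightarrow> real) \<Rightarrow> real" where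
  "axis_limit j g = (\<integral>\<omega>. bn.axis_norm j (G 1 \<omega>) powr \<alpha> *
     (p * g (bn.direction (bn.axis_block j (G 1 \<omega>))) + q * g (bn.direction (bn.axis_block j (- G 1 \<omega>)))) \<partial>M)"

lemma pq: "0 \<le> p" "0 \<le> q" "p + q = 1"
  using balanced by (auto simp: tail_balanced_def)

lemma axis_direction_measurable:
  fixes g :: "(int \<Rightarrow> 'b) \<Rightarrow> real"
  assumes "continuous_on UNIV g"
  shows "(\<lambda>z. g (bn.direction (bn.axis_block j z))) \<in> borel_measurable borel"
  by (rule continuous_fun_measurable[OF assms], rule bn.direction_coordinate_measurable, rule bn.axis_coordinate_measurable)

text \<open>Breiman's lemma with a direction: freezing \<open>G j\<close> leaves a tail of
  \<open>Y\<close> at level \<open>x / axis_norm j z\<close>, whose regular variation produces the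
  power \<alpha> and whose sign decides between \<open>z\<close> and \<open>- z\<close>.\<close>

lemma one_block:
  fixes g :: "(int \<Rightarrow> 'b) \<Rightarrow> real"
  assumes j: "j \<in> I" and g: "continuous_on UNIV g" "\<And>x. \<bar>g x\<bar> \<le> B"
  shows "((\<lambda>x. (\<integral>\<omega>. (if bn.axis_norm j (X j \<omega>) > x then g (bn.direction (bn.axis_block j (X j \<omega>))) else 0) \<partial>M) / T x)
     \<longlongrightarrow> axis_limit j g) at_top"
proof -
  let ?\<rho> = "bn.axis_norm j" and ?d = "\<lambda>z. g (bn.direction (bn.axis_block j z))"
  note [measurable] = axis_direction_measurable[OF g(1)]
  have B: "0 \<le> B" using g(2)[of undefined] by simp
  define \<phi> where "\<phi> x z = (if ?\<rho> z > x then ?d z else 0)" for x z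
  have \<phi>m[measurable]: "\<phi> x \<in> borel_measurable borel" for x unfolding \<phi>_def by measurable
  have \<phi>B: "\<bar>\<phi> x z\<bar> \<le> B" for x z using g(2) B by (simp add: \<phi>_def)
  define h where "h x z = (\<integral>\<omega>. \<phi> x (Y 1 \<omega> *\<^sub>R z) \<partial>M)" for x z
  have hm[measurable]: "h x \<in> borel_measurable borel" for x unfolding h_def by measurable
  have V: "(\<integral>\<omega>. \<phi> x (X j \<omega>) \<partial>M) = (\<integral>\<omega>. h x (G 1 \<omega>) \<partial>M)" for x
  proof -
    have Fm: "(\<lambda>z. \<phi> x (snd z *\<^sub>R fst z)) \<in> borel_measurable (borel \<Otimes>\<^sub>M borel)" by measurable
    have hz: "(\<integral>\<omega>'. \<phi> x (Y j \<omega>' *\<^sub>R z) \<partial>M) = h x z" for z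
    proof -
      have m: "(\<lambda>y. \<phi> x (y *\<^sub>R z)) \<in> borel_measurable borel" by measurable
      show ?thesis unfolding h_def
        using integral_distr[OF Y_meas m, of j] integral_distr[OF Y_meas m, of 1] id[of j 1] by simp
    qed
    have "(\<integral>\<omega>. \<phi> x (X j \<omega>) \<partial>M) = (\<integral>\<omega>. (\<integral>\<omega>'. \<phi> x (Y j \<omega>' *\<^sub>R G j \<omega>) \<partial>M) \<partial>M)"
      using indep_past_integral[OF ind G_adapted[of j] Fm, of B] \<phi>B by simp
    also have "\<dots> = (\<integral>\<omega>. h x (G j \<omega>) \<partial>M)" by (simp only: hz)
    also have "\<dots> = (\<integral>\<omega>. h x (G 1 \<omega>) \<partial>M)" by (rule stationary_expectation_1(1)[OF G_stat hm])
    finally show ?thesis .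
  qed
  obtain C x0 where C: "C > 0" "x0 > 0" and bd: "\<And>x. x \<ge> x0 \<Longrightarrow> T x > 0 \<and>
     (\<forall>t. \<forall>b\<ge>0. prob {\<omega> \<in> space M. \<bar>Y t \<omega>\<bar> * b > x} \<le> C * (1 + b powr (\<alpha> + \<epsilon>)) * T x)"
    using tail_product_bound by blast
  have h_eq: "h x z = prob {\<omega> \<in> space M. Y 1 \<omega> * ?\<rho> z > x} * ?d z + prob {\<omega> \<in> space M. - Y 1 \<omega> * ?\<rho> z > x} * ?d (- z)"
    if x: "x > 0" for x z
  proof -
    have r0: "0 \<le> ?\<rho> z" by (rule bn.axis_norm_nonneg)
    have "\<phi> x (y *\<^sub>R z) = of_bool (y * ?\<rho> z > x) * ?d z + of_bool (- y * ?\<rho> z > x) * ?d (- z)" for y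
    proof -
      consider "y > 0" | "y = 0" | "y < 0" by linarith
      then show ?thesis
      proof cases
        case 1
        then have "\<not> - y * ?\<rho> z > x" using x r0 by (simp add: not_less) (smt (verit) mult_nonneg_nonneg)
        then show ?thesis using 1 by (simp add: \<phi>_def bn.axis_norm_scale bn.direction_scale)
      next
        case 2
        then show ?thesis using x bn.axis_norm_scale[of j 0 z] by (simp add: \<phi>_def)
      next
        case 3
        then have "\<not> y * ?\<rho> z > x" using x r0 mult_nonpos_nonneg[of y "?\<rho> z"] by simp
        moreover have "?d (y *\<^sub>R z) = ?d (- z)"
          using bn.direction_scale[of "- y" j "- z"] 3 by simp
        ultimately show ?thesis using 3 by (simp add: \<phi>_def bn.axis_norm_scale)
      qed
    qed
    then have "h x z = (\<integral>\<omega>. indicator {\<omega> \<in> space M. Y 1 \<omega> * ?\<rho> z > x} \<omega> * ?d z + indicator {\<omega> \<in> space M. - Y 1 \<omega> * ?\<rho> z > x} \<omega> * ?d (- z) \<partial>M)"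
      unfolding h_def by (intro Bochner_Integration.integral_cong) auto
    also have "\<dots> = prob {\<omega> \<in> space M. Y 1 \<omega> * ?\<rho> z > x} * ?d z + prob {\<omega> \<in> space M. - Y 1 \<omega> * ?\<rho> z > x} * ?d (- z)"
      by (subst Bochner_Integration.integral_add) auto
    finally show ?thesis .
  qed
  have lim: "((\<lambda>x. h x z / T x) \<longlongrightarrow> ?\<rho> z powr \<alpha> * (p * ?d z + q * ?d (- z))) at_top" for z
  proof (cases "?\<rho> z = 0")
    case True
    have "\<forall>\<^sub>F x in at_top. h x z / T x = 0"
      using eventually_gt_at_top[of "0::real"] by eventually_elim (simp add: h_eq True)
    then show ?thesis using True by (simp add: tendsto_eventually)
  next
    case False
    then have r: "?\<rho> z > 0" using bn.axis_norm_nonneg[of j z] by simp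
    have P: "((\<lambda>x. prob {\<omega> \<in> space M. Y 1 \<omega> > (1 / ?\<rho> z) * x} / T x) \<longlongrightarrow> p * (1 / ?\<rho> z) powr (-\<alpha>)) at_top"
      "((\<lambda>x. prob {\<omega> \<in> space M. - Y 1 \<omega> > (1 / ?\<rho> z) * x} / T x) \<longlongrightarrow> q * (1 / ?\<rho> z) powr (-\<alpha>)) at_top"
    proof -
      have "1 / ?\<rho> z > 0" using r by simp
      then show "((\<lambda>x. prob {\<omega> \<in> space M. Y 1 \<omega> > (1 / ?\<rho> z) * x} / T x) \<longlongrightarrow> p * (1 / ?\<rho> z) powr (-\<alpha>)) at_top"
        "((\<lambda>x. prob {\<omega> \<in> space M. - Y 1 \<omega> > (1 / ?\<rho> z) * x} / T x) \<longlongrightarrow> q * (1 / ?\<rho> z) powr (-\<alpha>)) at_top"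
        using balanced unfolding tail_balanced_def by blast+
    qed
    have e: "(1 / ?\<rho> z) powr (-\<alpha>) = ?\<rho> z powr \<alpha>" using r by (simp add: powr_divide powr_minus_divide)
    have "((\<lambda>x. prob {\<omega> \<in> space M. Y 1 \<omega> > (1 / ?\<rho> z) * x} / T x * ?d z + prob {\<omega> \<in> space M. - Y 1 \<omega> > (1 / ?\<rho> z) * x} / T x * ?d (- z))
       \<longlongrightarrow> p * ?\<rho> z powr \<alpha> * ?d z + q * ?\<rho> z powr \<alpha> * ?d (- z)) at_top"
      using P unfolding e by (intro tendsto_intros)
    moreover have "\<forall>\<^sub>F x in at_top. prob {\<omega> \<in> space M. Y 1 \<omega> > (1 / ?\<rho> z) * x} / T x * ?d z + prob {\<omega> \<in> space M. - Y 1 \<omega> > (1 / ?\<rho> z) * x} / T x * ?d (- z) = h x z / T x"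
      using eventually_gt_at_top[of "0::real"]
    proof eventually_elim
      case (elim x)
      have s: "(y * ?\<rho> z > x) = (y > (1 / ?\<rho> z) * x)" for y using r by (simp add: field_simps)
      show ?case unfolding h_eq[OF elim] s by (simp add: add_divide_distrib)
    qed
    ultimately have "((\<lambda>x. h x z / T x) \<longlongrightarrow> p * ?\<rho> z powr \<alpha> * ?d z + q * ?\<rho> z powr \<alpha> * ?d (- z)) at_top"
      by (rule Lim_transform_eventually)
    then show ?thesis by (simp add: algebra_simps)
  qed
  have hb: "\<bar>h x z / T x\<bar> \<le> B * C * (1 + (1 * norm z) powr (\<alpha> + \<epsilon>))" if x: "x \<ge> x0" for x z
  proof -
    have Tx: "T x > 0" using bd[OF x] by blast
    have "\<bar>\<phi> x (y *\<^sub>R z)\<bar> \<le> B * of_bool (\<bar>y\<bar> * ?\<rho> z > x)" for y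
      using g(2) by (simp add: \<phi>_def bn.axis_norm_scale)
    then have "\<bar>h x z\<bar> \<le> (\<integral>\<omega>. B * indicator {\<omega> \<in> space M. \<bar>Y 1 \<omega>\<bar> * ?\<rho> z > x} \<omega> \<partial>M)"
      unfolding h_def
      by (intro order_trans[OF integral_abs_bound] integral_mono integrable_abs integrable_const_bound[of _ B])
         (use \<phi>B B in \<open>auto simp: indicator_def\<close>)
    also have "\<dots> = B * prob {\<omega> \<in> space M. \<bar>Y 1 \<omega>\<bar> * ?\<rho> z > x}" by simp
    also have "\<dots> \<le> B * (C * (1 + ?\<rho> z powr (\<alpha> + \<epsilon>)) * T x)"
      using B by (intro mult_left_mono bd[OF x, THEN conjunct2, rule_format] bn.axis_norm_nonneg)
    also have "\<dots> \<le> B * (C * (1 + norm z powr (\<alpha> + \<epsilon>)) * T x)"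
      using B C Tx \<alpha> \<epsilon> bn.axis_norm_le bn.axis_norm_nonneg
      by (intro mult_left_mono mult_right_mono add_left_mono powr_mono2) auto
    finally have "\<bar>h x z\<bar> / T x \<le> B * C * (1 + norm z powr (\<alpha> + \<epsilon>))"
      using Tx by (simp add: pos_divide_le_eq mult.assoc)
    then show ?thesis using Tx by (simp add: abs_divide)
  qed
  have "((\<lambda>x. \<integral>\<omega>. h x (G 1 \<omega>) / T x \<partial>M) \<longlongrightarrow> axis_limit j g) at_top"
    unfolding axis_limit_def
  proof (rule integral_dominated_convergence_at_top)
    show "integrable M (\<lambda>\<omega>. B * C * (1 + (1 * norm (G 1 \<omega>)) powr (\<alpha> + \<epsilon>)))" by (rule moment_integrable) simp
    show "AE \<omega> in M. ((\<lambda>x. h x (G 1 \<omega>) / T x) \<longlongrightarrow> ?\<rho> (G 1 \<omega>) powr \<alpha> * (p * ?d (G 1 \<omega>) + q * ?d (- G 1 \<omega>))) at_top"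
      by (intro AE_I2 lim)
    show "\<forall>\<^sub>F x in at_top. AE \<omega> in M. norm (h x (G 1 \<omega>) / T x) \<le> B * C * (1 + (1 * norm (G 1 \<omega>)) powr (\<alpha> + \<epsilon>))"
      using eventually_ge_at_top[of x0] by eventually_elim (use hb in auto)
    show "(\<lambda>\<omega>. ?\<rho> (G 1 \<omega>) powr \<alpha> * (p * ?d (G 1 \<omega>) + q * ?d (- G 1 \<omega>))) \<in> borel_measurable M"
      using measurable_compose[OF G_meas axis_direction_measurable[OF g(1)]]
        measurable_compose[of "\<lambda>\<omega>. - G 1 \<omega>" M borel, OF _ axis_direction_measurable[OF g(1)]]
      by measurable
  qed measurable
  then show ?thesis unfolding \<phi>_def[symmetric] V by simp
qed

lemma axis_tail:
  assumes j: "j \<in> I" and s: "s > 0"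
  shows "((\<lambda>x. prob {\<omega> \<in> space M. bn.axis_norm j (X j \<omega>) > s * x} / T x) \<longlongrightarrow> axis_limit j (\<lambda>_. 1) * s powr (-\<alpha>)) at_top"
proof -
  have e: "(\<integral>\<omega>. (if bn.axis_norm j (X j \<omega>) > x then 1 else 0 :: real) \<partial>M) = prob {\<omega> \<in> space M. bn.axis_norm j (X j \<omega>) > x}" for x
  proof -
    have "(\<integral>\<omega>. (if bn.axis_norm j (X j \<omega>) > x then 1 else 0 :: real) \<partial>M) = (\<integral>\<omega>. indicator {\<omega> \<in> space M. bn.axis_norm j (X j \<omega>) > x} \<omega> \<partial>M)"
      by (rule Bochner_Integration.integral_cong) auto
    then show ?thesis by simp
  qed
  have sx: "filterlim (\<lambda>x. s * x) at_top at_top" by (rule filterlim_tendsto_pos_mult_at_top[OF tendsto_const s filterlim_ident])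
  have 1: "((\<lambda>x. prob {\<omega> \<in> space M. bn.axis_norm j (X j \<omega>) > s * x} / T (s * x)) \<longlongrightarrow> axis_limit j (\<lambda>_. 1)) at_top"
    using filterlim_compose[OF one_block[OF j, of "\<lambda>_. 1" 1] sx] e by simp
  have 2: "((\<lambda>x. T (s * x) / T x) \<longlongrightarrow> s powr (-\<alpha>)) at_top" using balanced s by (simp add: tail_balanced_def)
  obtain x0 where x0: "x0 > 0" "\<And>x. x \<ge> x0 \<Longrightarrow> T x > 0" using tail_product_bound by blast
  have "\<forall>\<^sub>F x in at_top. prob {\<omega> \<in> space M. bn.axis_norm j (X j \<omega>) > s * x} / T (s * x) * (T (s * x) / T x) =
     prob {\<omega> \<in> space M. bn.axis_norm j (X j \<omega>) > s * x} / T x"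
    using eventually_ge_at_top[of "x0 / s"]
  proof eventually_elim
    case (elim x)
    then have "T (s * x) > 0" using s by (intro x0) (simp add: field_simps)
    then show ?case by simp
  qed
  with tendsto_mult[OF 1 2] show ?thesis by (rule Lim_transform_eventually)
qed

abbreviation vec :: "'w \<Rightarrow> int \<Rightarrow> 'b" where "vec \<omega> \<equiv> block_vec I X \<omega>"

lemma vec_measurable: "(\<lambda>\<omega>. vec \<omega> t) \<in> borel_measurable M"
  unfolding block_vec_def by (cases "t \<in> I") auto

text \<open>Integrating \<open>block_compare\<close> and dividing by the tail, the two-block term
  vanishes by \<open>two_large_blocks\<close>; the other terms converge by \<open>axis_tail\<close>
  to a quantity that is small once first \<open>e\<close> and then \<delta> are chosen
  small.\<close>

lemma block_limit:
  fixes g :: "(int \<Rightarrow> 'b) \<Rightarrow> real"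
  assumes g: "continuous_on UNIV g" "\<And>x. \<bar>g x\<bar> \<le> B"
  shows "((\<lambda>x. (\<integral>\<omega>. (if N (vec \<omega>) > x then g (bn.direction (vec \<omega>)) else 0) \<partial>M) / T x)
     \<longlongrightarrow> (\<Sum>j\<in>I. axis_limit j g)) at_top"
proof -
  let ?V = "\<lambda>x \<omega>. if N (vec \<omega>) > x then g (bn.direction (vec \<omega>)) else 0"
  let ?W = "\<lambda>j x \<omega>. if bn.axis_norm j (X j \<omega>) > x then g (bn.direction (bn.axis_block j (X j \<omega>))) else 0"
  let ?P = "\<lambda>j s x. prob {\<omega> \<in> space M. bn.axis_norm j (X j \<omega>) > s * x}"
  let ?Q = "\<lambda>i j \<delta> x. prob {\<omega> \<in> space M. norm (X i \<omega>) > \<delta> * x \<and> norm (X j \<omega>) > \<delta> * x}"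
  have B: "0 \<le> B" using g(2)[of undefined] by simp
  have Vm[measurable]: "?V x \<in> borel_measurable M" for x
  proof -
    have [measurable]: "(\<lambda>\<omega>. N (vec \<omega>)) \<in> borel_measurable M" by (rule bn.N_measurable, rule vec_measurable)
    have [measurable]: "(\<lambda>\<omega>. g (bn.direction (vec \<omega>))) \<in> borel_measurable M"
      by (rule continuous_fun_measurable[OF g(1)], rule bn.direction_coordinate_measurable, rule vec_measurable)
    show ?thesis by measurable
  qed
  have Wm[measurable]: "?W j x \<in> borel_measurable M" for j x
  proof -
    have [measurable]: "(\<lambda>\<omega>. g (bn.direction (bn.axis_block j (X j \<omega>)))) \<in> borel_measurable M"
      by (rule measurable_compose[OF _ axis_direction_measurable[OF g(1)]]) measurable
    show ?thesis by measurable
  qed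
  have iV: "integrable M (?V x)" for x by (rule integrable_const_bound[of _ B]) (use g(2) B in auto)
  have iW: "integrable M (?W j x)" for j x by (rule integrable_const_bound[of _ B]) (use g(2) B in auto)
  obtain x0 where x0: "x0 > 0" "\<And>x. x \<ge> x0 \<Longrightarrow> T x > 0" using tail_product_bound by blast
  define m where "m = (\<Sum>j\<in>I. axis_limit j (\<lambda>_. 1))"
  have m: "0 \<le> m" unfolding m_def axis_limit_def using pq
    by (intro sum_nonneg Bochner_Integration.integral_nonneg) auto
  have diff: "((\<lambda>x. ((\<integral>\<omega>. ?V x \<omega> \<partial>M) - (\<Sum>j\<in>I. \<integral>\<omega>. ?W j x \<omega> \<partial>M)) / T x) \<longlongrightarrow> 0) at_top"
    unfolding tendsto_iff dist_real_def
  proof (intro allI impI)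
    fix e' :: real assume e': "e' > 0"
    \<comment> \<open>The limit of the error is at most \<open>m * (e + e)\<close>, which this
      choice keeps below \<open>e' / 2\<close>; adding 1 to \<open>m\<close> avoids a zero
      denominator.\<close>
    define e where "e = e' / (4 * (m + 1))"
    have e: "e > 0" using e' m by (simp add: e_def)
    obtain d where d: "0 < d" "\<And>x y. x \<in> bn.S \<Longrightarrow> y \<in> bn.S \<Longrightarrow> (\<And>t. t \<in> I \<Longrightarrow> norm (x t - y t) \<le> d) \<Longrightarrow> \<bar>g x - g y\<bar> \<le> e"
      using bn.uniform_modulus[OF continuous_on_subset[OF g(1) subset_UNIV] e] by blast
    \<comment> \<open>As \<delta> decreases to 0 the shell around \<open>x\<close> shrinks and so
      does its limit mass.\<close>
    have "((\<lambda>\<delta>::real. 2 * B * ((1 - card I * \<delta>) powr (-\<alpha>) - (1 + card I * \<delta>) powr (-\<alpha>))) \<longlongrightarrow>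
        2 * B * ((1 - real (card I) * 0) powr (-\<alpha>) - (1 + real (card I) * 0) powr (-\<alpha>))) (at_right 0)"
    proof -
      have l: "((\<lambda>\<delta>::real. 1 - card I * \<delta>) \<longlongrightarrow> 1 - real (card I) * 0) (at_right 0)"
        "((\<lambda>\<delta>::real. 1 + card I * \<delta>) \<longlongrightarrow> 1 + real (card I) * 0) (at_right 0)"
        by (intro tendsto_intros)+
      show ?thesis by (intro tendsto_mult tendsto_diff tendsto_const tendsto_powr l) auto
    qed
    then have "\<forall>\<^sub>F \<delta> in at_right (0::real). 2 * B * ((1 - card I * \<delta>) powr (-\<alpha>) - (1 + card I * \<delta>) powr (-\<alpha>)) < e"
      by (rule order_tendstoD(2)) (use e in simp)
    moreover have "\<forall>\<^sub>F \<delta> in at_right (0::real). real (card I) * \<delta> < 1"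
      by (rule order_tendstoD(2)[OF tendsto_mult[OF tendsto_const tendsto_ident_at]]) simp
    moreover have "\<forall>\<^sub>F \<delta> in at_right (0::real). \<delta> * (1 + card I / \<kappa>) < d"
      by (rule order_tendstoD(2)[OF tendsto_mult[OF tendsto_ident_at tendsto_const]]) (use d(1) in simp)
    moreover have "\<forall>\<^sub>F \<delta> in at_right (0::real). 0 < \<delta>" by (simp add: eventually_at_filter)
    ultimately have "\<forall>\<^sub>F \<delta> in at_right (0::real). 2 * B * ((1 - card I * \<delta>) powr (-\<alpha>) - (1 + card I * \<delta>) powr (-\<alpha>)) < e \<and>
        real (card I) * \<delta> < 1 \<and> \<delta> * (1 + card I / \<kappa>) < d \<and> 0 < \<delta>" by eventually_elim simp
    then obtain \<delta> :: real where \<delta>: "2 * B * ((1 - card I * \<delta>) powr (-\<alpha>) - (1 + card I * \<delta>) powr (-\<alpha>)) < e"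
        "real (card I) * \<delta> < 1" "\<delta> * (1 + card I / \<kappa>) < d" "0 < \<delta>"
      by (auto dest!: eventually_happens'[OF trivial_limit_at_right_real])
    define c where "c = real (card I) * \<delta>"
    have c: "0 \<le> c" "c < 1" using \<delta> by (auto simp: c_def)
    define PQ where "PQ x = (1 + card I) * B * (\<Sum>i\<in>I. \<Sum>j\<in>I. if i \<noteq> j then ?Q i j \<delta> x else 0) +
       (\<Sum>j\<in>I. e * ?P j 1 x + 2 * B * (?P j (1 - c) x - ?P j (1 + c) x))" for x
    have bound: "\<bar>(\<integral>\<omega>. ?V x \<omega> \<partial>M) - (\<Sum>j\<in>I. \<integral>\<omega>. ?W j x \<omega> \<partial>M)\<bar> \<le> PQ x" if x: "x > 0" for x
    proof -
      let ?R = "\<lambda>\<omega>. (1 + card I) * B * (\<Sum>i\<in>I. \<Sum>j\<in>I. if i \<noteq> j then indicat_real {\<omega> \<in> space M. norm (X i \<omega>) > \<delta> * x \<and> norm (X j \<omega>) > \<delta> * x} \<omega> else 0) +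
       (\<Sum>j\<in>I. e * indicat_real {\<omega> \<in> space M. bn.axis_norm j (X j \<omega>) > 1 * x} \<omega> +
          2 * B * (indicat_real {\<omega> \<in> space M. bn.axis_norm j (X j \<omega>) > (1 - c) * x} \<omega> - indicat_real {\<omega> \<in> space M. bn.axis_norm j (X j \<omega>) > (1 + c) * x} \<omega>))"
      have iif: "integrable M (\<lambda>\<omega>. if i \<noteq> j then indicat_real {\<omega> \<in> space M. norm (X i \<omega>) > \<delta> * x \<and> norm (X j \<omega>) > \<delta> * x} \<omega> else 0)" for i j
        by (cases "i = j") auto
      have iR: "integrable M ?R"
        by (intro Bochner_Integration.integrable_add integrable_mult_right Bochner_Integration.integrable_sum Bochner_Integration.integrable_diff iif) auto
      have "\<bar>(\<integral>\<omega>. ?V x \<omega> \<partial>M) - (\<Sum>j\<in>I. \<integral>\<omega>. ?W j x \<omega> \<partial>M)\<bar> = \<bar>\<integral>\<omega>. ?V x \<omega> - (\<Sum>j\<in>I. ?W j x \<omega>) \<partial>M\<bar>"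
        using iV iW by (subst Bochner_Integration.integral_diff) (auto simp: Bochner_Integration.integral_sum)
      also have "\<dots> \<le> (\<integral>\<omega>. \<bar>?V x \<omega> - (\<Sum>j\<in>I. ?W j x \<omega>)\<bar> \<partial>M)" by (rule integral_abs_bound)
      also have "\<dots> \<le> (\<integral>\<omega>. ?R \<omega> \<partial>M)"
      proof (rule integral_mono[OF _ iR])
        show "integrable M (\<lambda>\<omega>. \<bar>?V x \<omega> - (\<Sum>j\<in>I. ?W j x \<omega>)\<bar>)"
          by (intro integrable_abs Bochner_Integration.integrable_diff iV Bochner_Integration.integrable_sum iW)
        fix \<omega> assume \<omega>: "\<omega> \<in> space M"
        let ?two = "\<exists>i\<in>I. \<exists>j\<in>I. i \<noteq> j \<and> norm (vec \<omega> i) > \<delta> * x \<and> norm (vec \<omega> j) > \<delta> * x"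
        have ve: "vec \<omega> j = X j \<omega>" if "j \<in> I" for j using that by (simp add: block_vec_def)
        have s: "(\<Sum>j\<in>I. ?W j x \<omega>) = (\<Sum>j\<in>I. if bn.axis_norm j (vec \<omega> j) > x then g (bn.direction (bn.axis_block j (vec \<omega> j))) else 0)"
          by (rule sum.cong[OF refl]) (simp only: ve)
        have "\<bar>?V x \<omega> - (\<Sum>j\<in>I. ?W j x \<omega>)\<bar> = \<bar>?V x \<omega> - (\<Sum>j\<in>I. if bn.axis_norm j (vec \<omega> j) > x then g (bn.direction (bn.axis_block j (vec \<omega> j))) else 0)\<bar>"
          by (simp only: s)
        also have "\<dots> \<le> (1 + card I) * B * of_bool ?two +
          (\<Sum>j\<in>I. e * of_bool (bn.axis_norm j (vec \<omega> j) > x) +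
            2 * B * (of_bool (bn.axis_norm j (vec \<omega> j) > (1 - card I * \<delta>) * x) - of_bool (bn.axis_norm j (vec \<omega> j) > (1 + card I * \<delta>) * x)))"
          by (rule bn.block_compare[OF g(2) less_imp_le[OF e] d(2) \<delta>(4,2) less_imp_le[OF \<delta>(3)] x])
        also have "\<dots> \<le> ?R \<omega>"
        proof (rule add_mono)
          have nn: "0 \<le> (\<Sum>j\<in>I. if i \<noteq> j then indicat_real {\<omega> \<in> space M. norm (X i \<omega>) > \<delta> * x \<and> norm (X j \<omega>) > \<delta> * x} \<omega> else 0)" for i
            by (intro sum_nonneg) auto
          have "(of_bool ?two :: real) \<le> (\<Sum>i\<in>I. \<Sum>j\<in>I. if i \<noteq> j then indicat_real {\<omega> \<in> space M. norm (X i \<omega>) > \<delta> * x \<and> norm (X j \<omega>) > \<delta> * x} \<omega> else 0)"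
          proof (cases ?two)
            case True
            then obtain i j where ij: "i \<in> I" "j \<in> I" "i \<noteq> j" "norm (X i \<omega>) > \<delta> * x" "norm (X j \<omega>) > \<delta> * x"
              using ve by auto
            have "(of_bool ?two :: real) = (if i \<noteq> j then indicat_real {\<omega> \<in> space M. norm (X i \<omega>) > \<delta> * x \<and> norm (X j \<omega>) > \<delta> * x} \<omega> else 0)"
              using True ij \<omega> by simp
            also have "\<dots> \<le> (\<Sum>j\<in>I. if i \<noteq> j then indicat_real {\<omega> \<in> space M. norm (X i \<omega>) > \<delta> * x \<and> norm (X j \<omega>) > \<delta> * x} \<omega> else 0)"
              by (rule member_le_sum[OF ij(2)]) (use bn.fin in auto)
            also have "\<dots> \<le> (\<Sum>i\<in>I. \<Sum>j\<in>I. if i \<noteq> j then indicat_real {\<omega> \<in> space M. norm (X i \<omega>) > \<delta> * x \<and> norm (X j \<omega>) > \<delta> * x} \<omega> else 0)"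
              by (rule member_le_sum[OF ij(1)]) (use bn.fin nn in auto)
            finally show ?thesis .
          next
            case False
            have "(of_bool ?two :: real) = 0" by (simp only: False of_bool_eq)
            then show ?thesis using nn by (simp only:) (rule sum_nonneg)
          qed
          then show "(1 + card I) * B * of_bool ?two \<le> (1 + card I) * B * (\<Sum>i\<in>I. \<Sum>j\<in>I. if i \<noteq> j then indicat_real {\<omega> \<in> space M. norm (X i \<omega>) > \<delta> * x \<and> norm (X j \<omega>) > \<delta> * x} \<omega> else 0)"
            using B by (intro mult_left_mono) auto
        qed (use \<omega> ve in \<open>auto intro!: sum_mono simp: c_def indicator_def\<close>)
        finally show "\<bar>?V x \<omega> - (\<Sum>j\<in>I. ?W j x \<omega>)\<bar> \<le> ?R \<omega>" .
      qed
      also have "\<dots> = PQ x"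
      proof -
        have "(\<integral>\<omega>. (if i \<noteq> j then indicat_real {\<omega> \<in> space M. norm (X i \<omega>) > \<delta> * x \<and> norm (X j \<omega>) > \<delta> * x} \<omega> else 0) \<partial>M) = (if i \<noteq> j then ?Q i j \<delta> x else 0)" for i j
          by (cases "i = j") auto
        then show ?thesis unfolding PQ_def using iif by (simp add: Bochner_Integration.integral_sum)
      qed
      finally show ?thesis .
    qed
    have "((\<lambda>x. (1 + card I) * B * (\<Sum>i\<in>I. \<Sum>j\<in>I. if i \<noteq> j then ?Q i j \<delta> x / T x else 0) +
       (\<Sum>j\<in>I. e * (?P j 1 x / T x) + 2 * B * (?P j (1 - c) x / T x - ?P j (1 + c) x / T x))) \<longlongrightarrow>
       (1 + card I) * B * (\<Sum>i\<in>I. \<Sum>j\<in>I. 0) +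
       (\<Sum>j\<in>I. e * (axis_limit j (\<lambda>_. 1) * 1 powr (-\<alpha>)) + 2 * B * (axis_limit j (\<lambda>_. 1) * (1 - c) powr (-\<alpha>) - axis_limit j (\<lambda>_. 1) * (1 + c) powr (-\<alpha>)))) at_top"
    proof (intro tendsto_intros axis_tail)
      show "((\<lambda>x. if i \<noteq> j then ?Q i j \<delta> x / T x else 0) \<longlongrightarrow> 0) at_top" for i j
        using two_large_blocks[of i j \<delta>] \<delta>(4) by (cases "i = j") auto
    qed (use c in auto)
    moreover have "(1 + card I) * B * (\<Sum>i\<in>I. \<Sum>j\<in>I. if i \<noteq> j then ?Q i j \<delta> x / T x else 0) +
       (\<Sum>j\<in>I. e * (?P j 1 x / T x) + 2 * B * (?P j (1 - c) x / T x - ?P j (1 + c) x / T x)) = PQ x / T x" for x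
    proof -
      have "(if i \<noteq> j then ?Q i j \<delta> x / T x else 0) = (if i \<noteq> j then ?Q i j \<delta> x else 0) / T x" for i j by simp
      note q = this
      have "A * (\<Sum>i\<in>I. \<Sum>j\<in>I. r i j / t) + (\<Sum>j\<in>I. e * (a1 j / t) + b * (a2 j / t - a3 j / t)) =
         (A * (\<Sum>i\<in>I. \<Sum>j\<in>I. r i j) + (\<Sum>j\<in>I. e * a1 j + b * (a2 j - a3 j))) / t"
        for A b t :: real and r :: "int \<Rightarrow> int \<Rightarrow> real" and a1 a2 a3 :: "int \<Rightarrow> real"
      proof -
        have s: "(\<Sum>i\<in>I. \<Sum>j\<in>I. r i j / t) = (\<Sum>i\<in>I. \<Sum>j\<in>I. r i j) / t" by (simp only: sum_divide_distrib)
        have "A * (R / t) + (\<Sum>j\<in>I. e * (a1 j / t) + b * (a2 j / t - a3 j / t)) = (A * R + (\<Sum>j\<in>I. e * a1 j + b * (a2 j - a3 j))) / t" for R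
          by (simp add: sum_divide_distrib add_divide_distrib diff_divide_distrib right_diff_distrib)
        then show ?thesis unfolding s .
      qed
      then show ?thesis unfolding PQ_def q .
    qed
    moreover have "(1 + card I) * B * (\<Sum>i\<in>I. \<Sum>j\<in>I. 0) +
       (\<Sum>j\<in>I. e * (axis_limit j (\<lambda>_. 1) * 1 powr (-\<alpha>)) + 2 * B * (axis_limit j (\<lambda>_. 1) * (1 - c) powr (-\<alpha>) - axis_limit j (\<lambda>_. 1) * (1 + c) powr (-\<alpha>)))
       = m * (e + 2 * B * ((1 - c) powr (-\<alpha>) - (1 + c) powr (-\<alpha>)))"
      unfolding m_def sum_distrib_right by (simp add: algebra_simps)
    ultimately have "((\<lambda>x. PQ x / T x) \<longlongrightarrow> m * (e + 2 * B * ((1 - c) powr (-\<alpha>) - (1 + c) powr (-\<alpha>)))) at_top" by simp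
    moreover have "m * (e + 2 * B * ((1 - c) powr (-\<alpha>) - (1 + c) powr (-\<alpha>))) < e'"
    proof -
      have "m * (e + 2 * B * ((1 - c) powr (-\<alpha>) - (1 + c) powr (-\<alpha>))) \<le> m * (e + e)"
        using \<delta>(1) m by (intro mult_left_mono) (auto simp: c_def)
      also have "\<dots> = e' * (m / (2 * (m + 1)))"
      proof -
        have "m * (e' / (4 * k) + e' / (4 * k)) = e' * (m / (2 * k))" if "k > 0" for k :: real
          using that by (simp add: field_simps)
        from this[of "m + 1"] show ?thesis using m by (simp only: e_def)
      qed
      also have "\<dots> < e' * 1" using e' m by (intro mult_strict_left_mono) (auto simp: field_simps)
      finally show ?thesis by simp
    qed
    ultimately have "\<forall>\<^sub>F x in at_top. PQ x / T x < e'" by (rule order_tendstoD(2))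
    then show "\<forall>\<^sub>F x in at_top. \<bar>((\<integral>\<omega>. ?V x \<omega> \<partial>M) - (\<Sum>j\<in>I. \<integral>\<omega>. ?W j x \<omega> \<partial>M)) / T x - 0\<bar> < e'"
      using eventually_ge_at_top[of x0]
    proof eventually_elim
      case (elim x)
      have "T x > 0" "x > 0" using x0(1) x0(2)[OF elim(2)] elim(2) by auto
      then have "\<bar>((\<integral>\<omega>. ?V x \<omega> \<partial>M) - (\<Sum>j\<in>I. \<integral>\<omega>. ?W j x \<omega> \<partial>M)) / T x\<bar> \<le> PQ x / T x"
        using bound[of x] by (simp add: abs_divide divide_right_mono)
      then show ?case using elim(1) by simp
    qed
  qed
  have "((\<lambda>x. ((\<integral>\<omega>. ?V x \<omega> \<partial>M) - (\<Sum>j\<in>I. \<integral>\<omega>. ?W j x \<omega> \<partial>M)) / T x + (\<Sum>j\<in>I. (\<integral>\<omega>. ?W j x \<omega> \<partial>M) / T x)) \<longlongrightarrow>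
     0 + (\<Sum>j\<in>I. axis_limit j g)) at_top"
    by (intro tendsto_add diff tendsto_sum one_block[OF _ g])
  then show ?thesis by (simp add: diff_divide_distrib sum_divide_distrib)
qed

lemma norm_powr_integrable: "integrable M (\<lambda>\<omega>. norm (G 1 \<omega>) powr \<alpha>)"
proof (rule Bochner_Integration.integrable_bound[OF moment_integrable[of 1 1 1]])
  show "AE \<omega> in M. norm (norm (G 1 \<omega>) powr \<alpha>) \<le> norm (1 * (1 + (1 * norm (G 1 \<omega>)) powr (\<alpha> + \<epsilon>)))"
  proof (intro AE_I2)
    fix \<omega>
    have "norm (G 1 \<omega>) powr \<alpha> \<le> 1 + norm (G 1 \<omega>) powr (\<alpha> + \<epsilon>)"
    proof (cases "norm (G 1 \<omega>) \<ge> 1")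
      case True
      then have "norm (G 1 \<omega>) powr \<alpha> \<le> norm (G 1 \<omega>) powr (\<alpha> + \<epsilon>)" using \<epsilon> by (intro powr_mono) auto
      then show ?thesis by simp
    next
      case False
      then have "norm (G 1 \<omega>) powr \<alpha> \<le> 1" using \<alpha> by (intro powr_le1) auto
      then show ?thesis by (simp add: add_increasing2)
    qed
    then show "norm (norm (G 1 \<omega>) powr \<alpha>) \<le> norm (1 * (1 + (1 * norm (G 1 \<omega>)) powr (\<alpha> + \<epsilon>)))" by simp
  qed
qed simp_all

lemma axis_norm_powr_integrable: "integrable M (\<lambda>\<omega>. bn.axis_norm j (G 1 \<omega>) powr \<alpha>)"
proof (rule Bochner_Integration.integrable_bound[OF norm_powr_integrable])
  show "AE \<omega> in M. norm (bn.axis_norm j (G 1 \<omega>) powr \<alpha>) \<le> norm (norm (G 1 \<omega>) powr \<alpha>)"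
    using \<alpha> bn.axis_norm_le bn.axis_norm_nonneg by (intro AE_I2) (simp add: powr_mono2)
qed simp

lemma axis_limit_one: "axis_limit j (\<lambda>_. 1) = (\<integral>\<omega>. bn.axis_norm j (G 1 \<omega>) powr \<alpha> \<partial>M)"
  using pq by (simp add: axis_limit_def)

text \<open>A vanishing moment would force \<open>G 1 = 0\<close> almost surely, because the axis
  norm is positive off 0.\<close>

lemma axis_limit_one_pos:
  assumes j: "j \<in> I"
  shows "0 < axis_limit j (\<lambda>_. 1)"
proof (rule ccontr)
  assume "\<not> ?thesis"
  then have "(\<integral>\<omega>. bn.axis_norm j (G 1 \<omega>) powr \<alpha> \<partial>M) \<le> 0" unfolding axis_limit_one by (rule leI)
  moreover have "0 \<le> (\<integral>\<omega>. bn.axis_norm j (G 1 \<omega>) powr \<alpha> \<partial>M)" by (rule Bochner_Integration.integral_nonneg) simp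
  ultimately have "(\<integral>\<omega>. bn.axis_norm j (G 1 \<omega>) powr \<alpha> \<partial>M) = 0" by (rule order_antisym)
  then have "AE \<omega> in M. bn.axis_norm j (G 1 \<omega>) powr \<alpha> = 0"
    by (subst (asm) integral_nonneg_eq_0_iff_AE[OF axis_norm_powr_integrable]) auto
  then have "AE \<omega> in M. \<not> G 1 \<omega> \<noteq> 0"
    by eventually_elim (use bn.axis_norm_pos[OF j] in force)
  then have "prob {\<omega> \<in> space M. G 1 \<omega> \<noteq> 0} = 0" by (subst prob_Collect_eq_0) auto
  then show False using nontrivial by simp
qed

definition total :: real where "total = (\<Sum>j\<in>I. axis_limit j (\<lambda>_. 1))"

lemma total_pos: "0 < total"
  unfolding total_def using bn.fin bn.ne axis_limit_one_pos by (intro sum_pos) auto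

lemma axis_limit_cong:
  assumes g: "\<And>z. z \<noteq> 0 \<Longrightarrow> g (bn.direction (bn.axis_block j z)) = g' (bn.direction (bn.axis_block j z))"
  shows "axis_limit j g = axis_limit j g'"
  unfolding axis_limit_def
proof (rule Bochner_Integration.integral_cong)
  fix \<omega>
  show "bn.axis_norm j (G 1 \<omega>) powr \<alpha> * (p * g (bn.direction (bn.axis_block j (G 1 \<omega>))) + q * g (bn.direction (bn.axis_block j (- G 1 \<omega>)))) =
    bn.axis_norm j (G 1 \<omega>) powr \<alpha> * (p * g' (bn.direction (bn.axis_block j (G 1 \<omega>))) + q * g' (bn.direction (bn.axis_block j (- G 1 \<omega>))))"
  proof (cases "G 1 \<omega> = 0")
    case True
    then have "bn.axis_norm j (G 1 \<omega>) = 0" using bn.axis_norm_le[of j 0] bn.axis_norm_nonneg[of j 0] by simp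
    then show ?thesis by simp
  qed (simp add: g)
qed simp

lemma axis_limit_cong_sphere:
  assumes j: "j \<in> I" and g: "\<And>x. x \<in> bn.S \<Longrightarrow> g x = g' x"
  shows "axis_limit j g = axis_limit j g'"
  by (intro axis_limit_cong g bn.direction_in_sphere)
     (use bn.axis_norm_pos[OF j] in \<open>simp add: bn.axis_norm_def\<close>)

text \<open>The limit charges only the axes: the blocks are asymptotically independent.\<close>

theorem spectral_measure_exists:
  "\<exists>Q. spectral_measure M I N X \<alpha> Q \<and>
     (\<forall>g. continuous_on bn.S g \<longrightarrow> integral\<^sup>L Q g = (\<Sum>j\<in>I. axis_limit j g) / total)"
proof -
  let ?R = "restrict_space (PiM I (\<lambda>_. borel)) bn.S :: (int \<Rightarrow> 'b) measure"
  obtain j0 where j0: "j0 \<in> I" using bn.ne by auto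
  obtain z0 :: 'b where z0: "z0 \<noteq> 0" using nonzero_Basis SOME_Basis by blast
  define w where "w k \<omega> = (if snd k then p else q) * bn.axis_norm (fst k) (G 1 \<omega>) powr \<alpha> / total" for k :: "int \<times> bool" and \<omega>
  \<comment> \<open>Where \<open>G 1 = 0\<close> there is no direction; a fixed point of the sphere
    is substituted, at weight 0.\<close>
  define D where "D k \<omega> = (if G 1 \<omega> = 0 then bn.direction (bn.axis_block j0 z0)
     else bn.direction (bn.axis_block (fst k) (if snd k then G 1 \<omega> else - G 1 \<omega>)))" for k :: "int \<times> bool" and \<omega>
  let ?K = "I \<times> (UNIV :: bool set)"
  have K: "finite ?K" using bn.fin by simp
  have w: "integrable M (w k)" "0 \<le> w k \<omega>" for k \<omega>
    unfolding w_def using axis_norm_powr_integrable pq total_pos by auto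
  have DS: "D k \<omega> \<in> bn.S" if "k \<in> ?K" for k \<omega>
    using that j0 z0 unfolding D_def by (auto intro!: bn.direction_in_sphere bn.axis_norm_pos[unfolded bn.axis_norm_def])
  have D: "D k \<in> measurable M ?R" if k: "k \<in> ?K" for k
  proof (rule measurable_restrict_space2)
    show "D k \<in> space M \<rightarrow> bn.S" using DS[OF k] by auto
    have "(\<lambda>\<omega>. D k \<omega> t) \<in> borel_measurable M" for t
    proof -
      have [measurable]: "(\<lambda>z. bn.direction (bn.axis_block j z) t) \<in> borel_measurable borel" for j
        by (rule bn.direction_coordinate_measurable, rule bn.axis_coordinate_measurable)
      have "(\<lambda>\<omega>. if G 1 \<omega> = 0 then bn.direction (bn.axis_block j0 z0) t
        else bn.direction (bn.axis_block (fst k) (if snd k then G 1 \<omega> else - G 1 \<omega>)) t) \<in> borel_measurable M"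
        by measurable
      also have "(\<lambda>\<omega>. if G 1 \<omega> = 0 then bn.direction (bn.axis_block j0 z0) t
        else bn.direction (bn.axis_block (fst k) (if snd k then G 1 \<omega> else - G 1 \<omega>)) t) = (\<lambda>\<omega>. D k \<omega> t)"
        by (auto simp: D_def)
      finally show ?thesis .
    qed
    moreover have "D k \<omega> = (\<lambda>t\<in>I. D k \<omega> t)" for \<omega>
      using DS[OF k, of \<omega>] by (auto simp: block_sphere_def intro!: extensional_restrict[symmetric] simp: PiE_def)
    ultimately show "D k \<in> measurable M (PiM I (\<lambda>_. borel))"
      using measurable_restrict[of I "\<lambda>t \<omega>. D k \<omega> t" M "\<lambda>_. borel"] by (metis (no_types, lifting) ext)
  qed
  define Q where "Q = mixture M ?K ?R w D"
  have sQ: "sets Q = sets ?R" unfolding Q_def by (rule sets_mixture[OF prob_space_axioms K w D])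
  have spQ: "space Q = bn.S"
    using sets_eq_imp_space_eq[OF sQ] by (auto simp: space_restrict_space space_PiM block_sphere_def)
  \<comment> \<open>Tietze's theorem mediates between functions on the sphere, tested in the
    definition, and functions on the whole space, used in \<open>block_limit\<close>.\<close>
  have ext: "\<exists>g' B. continuous_on UNIV g' \<and> (\<forall>x\<in>bn.S. g' x = g x) \<and> (\<forall>x. \<bar>g' x\<bar> \<le> B)"
    if g: "continuous_on bn.S g" for g :: "(int \<Rightarrow> 'b) \<Rightarrow> real"
  proof -
    have "compact (g ` bn.S)" by (rule compact_continuous_image[OF g bn.compact_sphere])
    then obtain B where B: "\<And>x. x \<in> bn.S \<Longrightarrow> norm (g x) \<le> B" "0 \<le> B"
      using compact_imp_bounded bounded_pos[of "g ` bn.S"] by force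
    have cl: "closedin (top_of_set UNIV) bn.S" using bn.compact_sphere by (simp add: compact_imp_closed)
    from Tietze[OF g cl B(2,1)] show ?thesis by (metis UNIV_I real_norm_def)
  qed
  have int0: "integral\<^sup>L Q g = (\<Sum>j\<in>I. axis_limit j g) / total"
    if g: "continuous_on UNIV g" "\<And>x. \<bar>g x\<bar> \<le> B" for g :: "(int \<Rightarrow> 'b) \<Rightarrow> real" and B
  proof -
    have gm: "g \<in> borel_measurable ?R"
    proof -
      have "(\<lambda>x :: int \<Rightarrow> 'b. x t) \<in> borel_measurable ?R" for t
      proof (cases "t \<in> I")
        case True
        then show ?thesis by (intro measurable_restrict_space1 measurable_component_singleton)
      next
        case False
        have "(\<lambda>x :: int \<Rightarrow> 'b. x t) \<in> borel_measurable ?R \<longleftrightarrow> (\<lambda>x :: int \<Rightarrow> 'b. undefined :: 'b) \<in> borel_measurable ?R"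
          by (rule measurable_cong) (use False in \<open>auto simp: space_restrict_space block_sphere_def PiE_def extensional_def\<close>)
        then show ?thesis by simp
      qed
      then have "(\<lambda>x. g (\<lambda>t. x t)) \<in> borel_measurable ?R" by (rule continuous_fun_measurable[OF g(1)])
      then show ?thesis by simp
    qed
    have dm: "(\<lambda>z. g (bn.direction (bn.axis_block j z))) \<in> borel_measurable borel" for j
      by (rule axis_direction_measurable[OF g(1)])
    have gDm: "(\<lambda>\<omega>. g (bn.direction (bn.axis_block j (G 1 \<omega>)))) \<in> borel_measurable M"
       "(\<lambda>\<omega>. g (bn.direction (bn.axis_block j (- G 1 \<omega>)))) \<in> borel_measurable M" for j
      using measurable_compose[OF G_meas dm] measurable_compose[of "\<lambda>\<omega>. - G 1 \<omega>" M borel, OF _ dm] by auto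
    have ib: "integrable M (\<lambda>\<omega>. c * bn.axis_norm j (G 1 \<omega>) powr \<alpha> * f \<omega>)"
      if "f \<in> borel_measurable M" "\<And>\<omega>. \<bar>f \<omega>\<bar> \<le> B" for c j and f :: "'w \<Rightarrow> real"
    proof -
      have "integrable M (\<lambda>\<omega>. f \<omega> * (c * bn.axis_norm j (G 1 \<omega>) powr \<alpha>))"
      proof (rule Bochner_Integration.integrable_bound[of M "\<lambda>\<omega>. B * (c * bn.axis_norm j (G 1 \<omega>) powr \<alpha>)"])
        show "integrable M (\<lambda>\<omega>. B * (c * bn.axis_norm j (G 1 \<omega>) powr \<alpha>))" using axis_norm_powr_integrable by simp
        show "AE \<omega> in M. norm (f \<omega> * (c * bn.axis_norm j (G 1 \<omega>) powr \<alpha>)) \<le> norm (B * (c * bn.axis_norm j (G 1 \<omega>) powr \<alpha>))"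
        proof (intro AE_I2)
          fix \<omega>
          have "\<bar>f \<omega>\<bar> \<le> \<bar>B\<bar>" using that(2)[of \<omega>] by linarith
          then show "norm (f \<omega> * (c * bn.axis_norm j (G 1 \<omega>) powr \<alpha>)) \<le> norm (B * (c * bn.axis_norm j (G 1 \<omega>) powr \<alpha>))"
            unfolding real_norm_def abs_mult by (intro mult_right_mono) auto
        qed
      qed (use that in measurable)
      then show ?thesis by (simp add: mult_ac)
    qed
    have t: "(\<integral>\<omega>. w (j, True) \<omega> *\<^sub>R g (D (j, True) \<omega>) \<partial>M) + (\<integral>\<omega>. w (j, False) \<omega> *\<^sub>R g (D (j, False) \<omega>) \<partial>M) = axis_limit j g / total" for j
    proof -
      have z: "bn.axis_norm j 0 = 0" using bn.axis_norm_le[of j 0] bn.axis_norm_nonneg[of j 0] by simp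
      have "(\<integral>\<omega>. w (j, True) \<omega> *\<^sub>R g (D (j, True) \<omega>) \<partial>M) = (\<integral>\<omega>. (p / total) * bn.axis_norm j (G 1 \<omega>) powr \<alpha> * g (bn.direction (bn.axis_block j (G 1 \<omega>))) \<partial>M)"
        by (rule Bochner_Integration.integral_cong) (auto simp: w_def D_def z)
      moreover have "(\<integral>\<omega>. w (j, False) \<omega> *\<^sub>R g (D (j, False) \<omega>) \<partial>M) = (\<integral>\<omega>. (q / total) * bn.axis_norm j (G 1 \<omega>) powr \<alpha> * g (bn.direction (bn.axis_block j (- G 1 \<omega>))) \<partial>M)"
        by (rule Bochner_Integration.integral_cong) (auto simp: w_def D_def z)
      ultimately have "(\<integral>\<omega>. w (j, True) \<omega> *\<^sub>R g (D (j, True) \<omega>) \<partial>M) + (\<integral>\<omega>. w (j, False) \<omega> *\<^sub>R g (D (j, False) \<omega>) \<partial>M) =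
         (\<integral>\<omega>. (p / total) * bn.axis_norm j (G 1 \<omega>) powr \<alpha> * g (bn.direction (bn.axis_block j (G 1 \<omega>))) +
            (q / total) * bn.axis_norm j (G 1 \<omega>) powr \<alpha> * g (bn.direction (bn.axis_block j (- G 1 \<omega>))) \<partial>M)"
        using ib[OF gDm(1) g(2)] ib[OF gDm(2) g(2)] by (subst Bochner_Integration.integral_add) auto
      also have "\<dots> = (\<integral>\<omega>. (bn.axis_norm j (G 1 \<omega>) powr \<alpha> * (p * g (bn.direction (bn.axis_block j (G 1 \<omega>))) + q * g (bn.direction (bn.axis_block j (- G 1 \<omega>))))) / total \<partial>M)"
        by (rule Bochner_Integration.integral_cong) (simp_all add: add_divide_distrib distrib_left mult.assoc mult.left_commute)
      also have "\<dots> = axis_limit j g / total" by (simp add: axis_limit_def)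
      finally show ?thesis .
    qed
    have "integral\<^sup>L Q g = (\<Sum>k\<in>?K. \<integral>\<omega>. w k \<omega> *\<^sub>R g (D k \<omega>) \<partial>M)"
      unfolding Q_def by (rule integral_mixture[OF prob_space_axioms K w D gm]) (use g(2) in auto)
    also have "\<dots> = (\<Sum>j\<in>I. \<Sum>b\<in>UNIV. \<integral>\<omega>. w (j, b) \<omega> *\<^sub>R g (D (j, b) \<omega>) \<partial>M)" by (simp add: sum.cartesian_product)
    also have "\<dots> = (\<Sum>j\<in>I. axis_limit j g / total)" using t by (simp add: UNIV_bool add.commute)
    finally show ?thesis by (simp add: sum_divide_distrib)
  qed
  have int: "integral\<^sup>L Q g = (\<Sum>j\<in>I. axis_limit j g) / total" if g: "continuous_on bn.S g" for g
  proof -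
    obtain g' B where g': "continuous_on UNIV g'" "\<And>x. x \<in> bn.S \<Longrightarrow> g' x = g x" "\<And>x. \<bar>g' x\<bar> \<le> B" using ext[OF g] by blast
    have "integral\<^sup>L Q g = integral\<^sup>L Q g'" by (rule Bochner_Integration.integral_cong) (use g'(2) in \<open>auto simp: spQ\<close>)
    also have "\<dots> = (\<Sum>j\<in>I. axis_limit j g') / total" by (rule int0[OF g'(1,3)])
    also have "(\<Sum>j\<in>I. axis_limit j g') = (\<Sum>j\<in>I. axis_limit j g)" by (intro sum.cong refl axis_limit_cong_sphere g')
    finally show ?thesis .
  qed
  have prob_Q: "prob_space Q"
    unfolding Q_def
  proof (rule prob_space_mixture[OF prob_space_axioms K w D])
    have "(\<Sum>k\<in>?K. \<integral>\<omega>. w k \<omega> \<partial>M) = (\<Sum>j\<in>I. \<Sum>b\<in>UNIV. \<integral>\<omega>. w (j, b) \<omega> \<partial>M)" by (simp add: sum.cartesian_product)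
    also have "\<dots> = (\<Sum>j\<in>I. axis_limit j (\<lambda>_. 1) / total)"
    proof (rule sum.cong[OF refl])
      fix j
      have "(\<Sum>b\<in>UNIV. \<integral>\<omega>. w (j, b) \<omega> \<partial>M) = (p + q) * axis_limit j (\<lambda>_. 1) / total"
        by (simp add: w_def UNIV_bool axis_limit_one add_divide_distrib distrib_right)
      then show "(\<Sum>b\<in>UNIV. \<integral>\<omega>. w (j, b) \<omega> \<partial>M) = axis_limit j (\<lambda>_. 1) / total" using pq(3) by simp
    qed
    also have "\<dots> = 1" using total_pos by (simp add: sum_divide_distrib[symmetric] total_def[symmetric])
    finally show "(\<Sum>k\<in>?K. \<integral>\<omega>. w k \<omega> \<partial>M) = 1" .
  qed
  have "((\<lambda>x. (\<integral>\<omega>. (if N (vec \<omega>) > t * x then g (\<lambda>s\<in>I. X s \<omega> /\<^sub>R N (vec \<omega>)) else 0) \<partial>M)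
          / measure M {\<omega> \<in> space M. N (vec \<omega>) > x}) \<longlongrightarrow> t powr (-\<alpha>) * integral\<^sup>L Q g) at_top"
    if t: "t > 0" and g: "continuous_on bn.S g" for t and g :: "(int \<Rightarrow> 'b) \<Rightarrow> real"
  proof -
    obtain g' B where g': "continuous_on UNIV g'" "\<And>x. x \<in> bn.S \<Longrightarrow> g' x = g x" "\<And>x. \<bar>g' x\<bar> \<le> B" using ext[OF g] by blast
    define V where "V f x = (\<integral>\<omega>. (if N (vec \<omega>) > x then f (bn.direction (vec \<omega>)) else 0) \<partial>M)" for f :: "(int \<Rightarrow> 'b) \<Rightarrow> real" and x
    have dir: "(\<lambda>s\<in>I. X s \<omega> /\<^sub>R N (vec \<omega>)) = bn.direction (vec \<omega>)" for \<omega>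
      by (auto simp: bn.direction_def block_vec_def)
    obtain x0 where x0: "x0 > 0" "\<And>x. x \<ge> x0 \<Longrightarrow> T x > 0" using tail_product_bound by blast
    have [measurable]: "(\<lambda>\<omega>. N (vec \<omega>)) \<in> borel_measurable M" by (rule bn.N_measurable, rule vec_measurable)
    have V1: "V (\<lambda>_. 1) x = measure M {\<omega> \<in> space M. N (vec \<omega>) > x}" for x
    proof -
      have "V (\<lambda>_. 1) x = (\<integral>\<omega>. indicator {\<omega> \<in> space M. N (vec \<omega>) > x} \<omega> \<partial>M)"
        unfolding V_def by (rule Bochner_Integration.integral_cong) auto
      then show ?thesis by simp
    qed
    have tx: "filterlim (\<lambda>x. t * x) at_top at_top" by (rule filterlim_tendsto_pos_mult_at_top[OF tendsto_const t filterlim_ident])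
    have 1: "((\<lambda>x. V g' (t * x) / T (t * x)) \<longlongrightarrow> (\<Sum>j\<in>I. axis_limit j g')) at_top"
      using filterlim_compose[OF block_limit[OF g'(1,3)] tx] by (simp add: V_def)
    have 2: "((\<lambda>x. T (t * x) / T x) \<longlongrightarrow> t powr (-\<alpha>)) at_top" using balanced t by (simp add: tail_balanced_def)
    have 3: "((\<lambda>x. V (\<lambda>_. 1) x / T x) \<longlongrightarrow> total) at_top"
      unfolding V_def total_def by (rule block_limit[where B = 1]) auto
    have "((\<lambda>x. (V g' (t * x) / T (t * x)) * (T (t * x) / T x) / (V (\<lambda>_. 1) x / T x)) \<longlongrightarrow>
        (\<Sum>j\<in>I. axis_limit j g') * t powr (-\<alpha>) / total) at_top"
      by (intro tendsto_mult tendsto_divide 1 2 3) (use total_pos in auto)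
    moreover have "(\<Sum>j\<in>I. axis_limit j g') * t powr (-\<alpha>) / total = t powr (-\<alpha>) * integral\<^sup>L Q g"
    proof -
      have "(\<Sum>j\<in>I. axis_limit j g') = (\<Sum>j\<in>I. axis_limit j g)" by (intro sum.cong refl axis_limit_cong_sphere g')
      then show ?thesis by (simp add: int[OF g] mult.commute)
    qed
    ultimately have 4: "((\<lambda>x. (V g' (t * x) / T (t * x)) * (T (t * x) / T x) / (V (\<lambda>_. 1) x / T x)) \<longlongrightarrow>
        t powr (-\<alpha>) * integral\<^sup>L Q g) at_top" by simp
    show ?thesis
    proof (rule Lim_transform_eventually[OF 4])
      show "\<forall>\<^sub>F x in at_top. (V g' (t * x) / T (t * x)) * (T (t * x) / T x) / (V (\<lambda>_. 1) x / T x) =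
        (\<integral>\<omega>. (if N (vec \<omega>) > t * x then g (\<lambda>s\<in>I. X s \<omega> /\<^sub>R N (vec \<omega>)) else 0) \<partial>M)
          / measure M {\<omega> \<in> space M. N (vec \<omega>) > x}"
        using eventually_ge_at_top[of "max x0 (x0 / t)"]
      proof eventually_elim
        case (elim x)
        then have "T x > 0" "T (t * x) > 0" "x > 0" using t x0(1) by (auto intro!: x0(2) simp: field_simps)
        moreover have "V g' (t * x) = (\<integral>\<omega>. (if N (vec \<omega>) > t * x then g (\<lambda>s\<in>I. X s \<omega> /\<^sub>R N (vec \<omega>)) else 0) \<partial>M)"
          unfolding V_def dir
        proof (rule Bochner_Integration.integral_cong)
          fix \<omega>
          have "g' (bn.direction (vec \<omega>)) = g (bn.direction (vec \<omega>))" if "N (vec \<omega>) > t * x"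
            using that mult_pos_pos[OF t \<open>x > 0\<close>] by (intro g' bn.direction_in_sphere) simp
          then show "(if N (vec \<omega>) > t * x then g' (bn.direction (vec \<omega>)) else 0) = (if N (vec \<omega>) > t * x then g (bn.direction (vec \<omega>)) else 0)" by simp
        qed simp
        ultimately show ?case by (simp add: V1)
      qed
    qed
  qed
  then have "spectral_measure M I N X \<alpha> Q"
    unfolding spectral_measure_def using bn.fin bn.ne \<alpha> prob_Q sQ by auto
  then show ?thesis using int by blast
qed

end

section \<open>The value of the extremal ratio\<close>

lemma continuous_on_Max_image:
  fixes f :: "'i \<Rightarrow> 'a::topological_space \<Rightarrow> real"
  assumes "finite J" "\<And>j. j \<in> J \<Longrightarrow> continuous_on A (f j)"
  shows "continuous_on A (\<lambda>x. Max (insert c ((\<lambda>j. f j x) ` J)))"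
  using assms
proof (induction J rule: finite_induct)
  case (insert i J)
  have "Max (insert c ((\<lambda>j. f j x) ` insert i J)) = max (f i x) (Max (insert c ((\<lambda>j. f j x) ` J)))" for x
    using insert.hyps(1) by (simp add: insert_commute[of c])
  then show ?case using insert by (simp add: continuous_on_max)
qed simp

context predictable_product
begin

text \<open>The limits at \<open>t = 1\<close> in the definition determine the integrals of
  continuous functions, so every admissible \<open>Q\<close> integrates them like the one
  constructed above.\<close>

lemma spectral_measure_integral:
  assumes Q: "spectral_measure M I N X \<alpha> Q" and g: "continuous_on bn.S g"
  shows "integral\<^sup>L Q g = (\<Sum>j\<in>I. axis_limit j g) / total"
proof -
  obtain Q' where Q': "spectral_measure M I N X \<alpha> Q'" "integral\<^sup>L Q' g = (\<Sum>j\<in>I. axis_limit j g) / total"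
    using spectral_measure_exists g by blast
  have "((\<lambda>x. (\<integral>\<omega>. (if N (block_vec I X \<omega>) > 1 * x then g (\<lambda>s\<in>I. X s \<omega> /\<^sub>R N (block_vec I X \<omega>)) else 0) \<partial>M)
      / prob {\<omega> \<in> space M. N (block_vec I X \<omega>) > x}) \<longlongrightarrow> 1 powr (-\<alpha>) * integral\<^sup>L R g) at_top"
    if "spectral_measure M I N X \<alpha> R" for R
    using that g unfolding spectral_measure_def by (blast intro: zero_less_one)
  from tendsto_unique[OF trivial_limit_at_top_linorder this[OF Q] this[OF Q'(1)]] Q'(2)
  show ?thesis by simp
qed

end

text \<open>On axis 0 the other blocks vanish and block 0 has max-norm 1, so subtracting the maximum
  changes nothing; on all other axes both integrands are 0. Numerator and denominator are thus the
  same positive number.\<close>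

lemma (in prob_space) extremal_ratio_eq_1:
  fixes G :: "int \<Rightarrow> 'a \<Rightarrow> 'b::euclidean_space" and k :: nat
  defines "I \<equiv> {- int k..int k}"
  assumes P: "predictable_product M I (block_max_norm I) \<kappa> Y G \<alpha> \<epsilon> p q"
    and Q: "spectral_measure M I (block_max_norm I) (\<lambda>t \<omega>. Y t \<omega> *\<^sub>R G t \<omega>) \<alpha> Q"
  shows "extremal_ratio \<alpha> k Q = 1"
proof -
  interpret P: predictable_product M I "block_max_norm I" \<kappa> Y G \<alpha> \<epsilon> p q by (rule P)
  define f where "f j \<theta> = infnorm (\<theta> j) powr \<alpha>" for j and \<theta> :: "int \<Rightarrow> 'b"
  define m where "m \<theta> = Max (insert 0 ((\<lambda>j. f j \<theta>) ` {1..int k}))" for \<theta>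
  define f1 where "f1 \<theta> = max 0 (f 0 \<theta> - m \<theta>)" for \<theta>
  have f: "continuous_on UNIV (f j)" for j
    unfolding f_def
    by (rule continuous_on_powr'[OF continuous_on_infnorm[OF continuous_on_product_coordinates]])
       (use P.\<alpha> in \<open>auto simp: infnorm_pos_le\<close>)
  have f1: "continuous_on UNIV f1"
    unfolding f1_def m_def by (intro continuous_on_max continuous_on_diff continuous_on_Max_image continuous_on_const f) simp
  have I0: "0 \<in> I" and finI: "finite I" by (auto simp: I_def)
  have z: "P.bn.direction (P.bn.axis_block j z) t = 0" if "t \<in> I" "t \<noteq> j" for j t z
    using that by (simp add: P.bn.direction_def P.bn.axis_block_def)
  have f0: "f t (P.bn.direction (P.bn.axis_block j z)) = 0" if "t \<in> I" "t \<noteq> j" for j t z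
    using z[OF that] by (simp add: f_def infnorm_0)
  have m_nonneg: "0 \<le> m \<theta>" for \<theta> unfolding m_def by (rule Max_ge) auto
  have m0: "m (P.bn.direction (P.bn.axis_block 0 z)) = 0" for z
  proof -
    have "(\<lambda>j. f j (P.bn.direction (P.bn.axis_block 0 z))) ` {1..int k} \<subseteq> {0}"
      using f0[of _ 0 z] by (auto simp: I_def)
    then have e: "insert 0 ((\<lambda>j. f j (P.bn.direction (P.bn.axis_block 0 z))) ` {1..int k}) = {0}" by auto
    show ?thesis unfolding m_def e by simp
  qed
  have f00: "f 0 (P.bn.direction (P.bn.axis_block 0 z)) = 1" if "z \<noteq> 0" for z
  proof -
    have "block_max_norm I (P.bn.axis_block 0 z) = infnorm z"
      unfolding block_max_norm_def
    proof (rule Max_eqI)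
      show "infnorm z \<in> (\<lambda>t. infnorm (P.bn.axis_block 0 z t)) ` I"
        using I0 by (auto simp: P.bn.axis_block_def intro!: image_eqI[of _ _ 0])
    qed (use finI in \<open>auto simp: P.bn.axis_block_def infnorm_0 infnorm_pos_le\<close>)
    moreover have "infnorm z \<noteq> 0" using that by (simp add: infnorm_eq_0)
    ultimately show ?thesis using I0
      by (simp add: f_def P.bn.direction_def P.bn.axis_block_def infnorm_mul abs_of_nonneg[OF infnorm_pos_le])
  qed
  have zero: "P.axis_limit j (\<lambda>_. 0) = 0" for j by (simp add: P.axis_limit_def)
  have l0: "P.axis_limit j (f 0) = (if j = 0 then P.axis_limit 0 (\<lambda>_. 1) else 0)" for j
  proof (cases "j = 0")
    case True
    then show ?thesis using P.axis_limit_cong[of "f 0" 0 "\<lambda>_. 1"] f00 by simp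
  next
    case False
    then show ?thesis using P.axis_limit_cong[of "f 0" j "\<lambda>_. 0"] f0[OF I0] zero by simp
  qed
  have l1: "P.axis_limit j f1 = P.axis_limit j (f 0)" for j
  proof (cases "j = 0")
    case True
    show ?thesis unfolding True by (rule P.axis_limit_cong) (simp add: f1_def m0 f00)
  next
    case False
    show ?thesis by (rule P.axis_limit_cong) (use False m_nonneg in \<open>simp add: f1_def f0[OF I0]\<close>)
  qed
  have "integral\<^sup>L Q f1 = integral\<^sup>L Q (f 0)"
    using P.spectral_measure_integral[OF Q] continuous_on_subset[OF f1] continuous_on_subset[OF f] by (simp add: l1)
  moreover have "integral\<^sup>L Q (f 0) = P.axis_limit 0 (\<lambda>_. 1) / P.total"
    using P.spectral_measure_integral[OF Q, of "f 0"] continuous_on_subset[OF f] I0 finI by (simp add: l0 sum.delta)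
  moreover have "P.axis_limit 0 (\<lambda>_. 1) / P.total > 0" using P.axis_limit_one_pos[OF I0] P.total_pos by simp
  moreover have "extremal_ratio \<alpha> k Q = integral\<^sup>L Q f1 / integral\<^sup>L Q (f 0)"
    unfolding extremal_ratio_def f1_def[abs_def] m_def[abs_def] f_def[abs_def] by simp
  ultimately show ?thesis by (metis div_self less_irrefl)
qed

section \<open>Stable limits of predictable products\<close>

lemma strictly_stationary_compose:
  assumes X: "strictly_stationary M X" and f[measurable]: "f \<in> borel_measurable borel"
  shows "strictly_stationary M (\<lambda>t \<omega>. f (X t \<omega>))"
  unfolding strictly_stationary_def
proof (intro conjI allI impI)
  have X'[measurable]: "X t \<in> borel_measurable M" for t using X by (simp add: strictly_stationary_def)
  show "(\<lambda>\<omega>. f (X t \<omega>)) \<in> borel_measurable M" for t by measurable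
  fix J :: "int set" and h assume J: "finite J"
  define F where "F x = (\<lambda>t\<in>J. f (x t))" for x :: "int \<Rightarrow> 'b"
  have F: "F \<in> measurable (PiM J (\<lambda>_. borel)) (PiM J (\<lambda>_. borel))"
    unfolding F_def by (intro measurable_restrict measurable_compose[OF _ f] measurable_component_singleton)
  have "distr M (PiM J (\<lambda>_. borel)) (block_vec J (\<lambda>t \<omega>. f (X (t + s) \<omega>))) =
     distr (distr M (PiM J (\<lambda>_. borel)) (block_vec J (\<lambda>t. X (t + s)))) (PiM J (\<lambda>_. borel)) F" for s
  proof -
    have "block_vec J (\<lambda>t. X (t + s)) \<in> measurable M (PiM J (\<lambda>_. borel))"
      unfolding block_vec_def by (intro measurable_restrict X')
    from distr_distr[OF F this] show ?thesis
      by (auto simp: F_def block_vec_def comp_def intro!: distr_cong)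
  qed
  from this[of h] this[of 0] X J
  show "distr M (PiM J (\<lambda>_. borel)) (block_vec J (\<lambda>t \<omega>. f (X (t + h) \<omega>))) =
     distr M (PiM J (\<lambda>_. borel)) (block_vec J (\<lambda>t \<omega>. f (X t \<omega>)))"
    by (simp add: strictly_stationary_def)
qed

lemma stable_exponent_measurable[measurable]: "stable_exponent \<alpha> \<in> borel_measurable borel"
  unfolding stable_exponent_def by (cases "\<alpha> = 1") simp_all

lemma abs_mult_ln_le:
  fixes u :: real
  shows "\<bar>u\<bar> * \<bar>ln \<bar>u\<bar>\<bar> \<le> 1 + u\<^sup>2"
proof (cases "u = 0")
  case False
  then have u: "\<bar>u\<bar> > 0" by simp
  show ?thesis
  proof (cases "\<bar>u\<bar> \<ge> 1")
    case True
    then have "\<bar>ln \<bar>u\<bar>\<bar> \<le> \<bar>u\<bar>" using ln_le_minus_one[OF u] ln_ge_zero[OF True] by linarith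
    then have "\<bar>u\<bar> * \<bar>ln \<bar>u\<bar>\<bar> \<le> \<bar>u\<bar> * \<bar>u\<bar>" by (intro mult_left_mono) auto
    then show ?thesis by (simp add: power2_eq_square)
  next
    case f: False
    then have "\<bar>ln \<bar>u\<bar>\<bar> = - ln \<bar>u\<bar>" using u by simp
    also have "\<dots> = ln (1 / \<bar>u\<bar>)" using u by (simp add: ln_div)
    also have "\<dots> \<le> 1 / \<bar>u\<bar>" using ln_le_minus_one[of "1 / \<bar>u\<bar>"] u by (simp add: algebra_simps)
    finally have "\<bar>u\<bar> * \<bar>ln \<bar>u\<bar>\<bar> \<le> \<bar>u\<bar> * (1 / \<bar>u\<bar>)" by (intro mult_left_mono) auto
    then show ?thesis using u by (simp add: add_increasing2)
  qed
qed simp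

text \<open>\<open>integral_mixture\<close> wants a bounded integrand, and on the unit sphere the
  inner product with \<open>x\<close> stays within \<open>norm x\<close>. For \<alpha> = 1 the
  logarithm at 0 is tamed by the factor \<open>\<bar>u\<bar>\<close>.\<close>

lemma stable_exponent_bounded:
  assumes \<alpha>: "0 < \<alpha>"
  obtains B where "\<And>u. \<bar>u\<bar> \<le> R \<Longrightarrow> norm (stable_exponent \<alpha> u) \<le> B"
proof (cases "\<alpha> = 1")
  case True
  show ?thesis
  proof (rule that[of "R + 2 / pi * (1 + R\<^sup>2)"])
    fix u assume u: "\<bar>u\<bar> \<le> R"
    have "norm (stable_exponent \<alpha> u) \<le> \<bar>u\<bar> * (1 + norm (\<i> * of_real (2 / pi * sgn u * ln \<bar>u\<bar>)))"
      unfolding stable_exponent_def using True norm_triangle_ineq[of 1 "\<i> * complex_of_real (2 / pi * sgn u * ln \<bar>u\<bar>)"]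
      by (simp add: norm_mult mult_left_mono)
    also have "\<dots> \<le> \<bar>u\<bar> * (1 + 2 / pi * \<bar>ln \<bar>u\<bar>\<bar>)"
    proof (intro mult_left_mono add_left_mono)
      have "norm (\<i> * complex_of_real (2 / pi * sgn u * ln \<bar>u\<bar>)) = 2 / pi * \<bar>sgn u\<bar> * \<bar>ln \<bar>u\<bar>\<bar>"
        by (simp only: norm_mult norm_ii norm_of_real abs_mult) simp
      then show "norm (\<i> * complex_of_real (2 / pi * sgn u * ln \<bar>u\<bar>)) \<le> 2 / pi * \<bar>ln \<bar>u\<bar>\<bar>"
        by (simp add: abs_sgn_eq)
    qed simp
    also have "\<dots> = \<bar>u\<bar> + 2 / pi * (\<bar>u\<bar> * \<bar>ln \<bar>u\<bar>\<bar>)" by (simp add: algebra_simps)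
    also have "\<dots> \<le> R + 2 / pi * (1 + R\<^sup>2)"
    proof (intro add_mono u mult_left_mono)
      have "u\<^sup>2 \<le> R\<^sup>2" using u by (simp add: abs_le_square_iff[symmetric])
      then show "\<bar>u\<bar> * \<bar>ln \<bar>u\<bar>\<bar> \<le> 1 + R\<^sup>2" using abs_mult_ln_le[of u] by linarith
    qed simp
    finally show "norm (stable_exponent \<alpha> u) \<le> R + 2 / pi * (1 + R\<^sup>2)" .
  qed
next
  case False
  let ?c = "norm (1 - \<i> * complex_of_real (tan (pi * \<alpha> / 2))) + norm (1 + \<i> * complex_of_real (tan (pi * \<alpha> / 2))) + 1"
  show ?thesis
  proof (rule that[of "R powr \<alpha> * ?c"])
    fix u assume u: "\<bar>u\<bar> \<le> R"
    have "norm (stable_exponent \<alpha> u) = \<bar>u\<bar> powr \<alpha> * norm (1 - \<i> * complex_of_real (sgn u * tan (pi * \<alpha> / 2)))"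
      using False by (simp add: stable_exponent_def norm_mult)
    also have "\<dots> \<le> R powr \<alpha> * ?c"
    proof (rule mult_mono)
      show "\<bar>u\<bar> powr \<alpha> \<le> R powr \<alpha>" using u \<alpha> by (intro powr_mono2) auto
      show "norm (1 - \<i> * complex_of_real (sgn u * tan (pi * \<alpha> / 2))) \<le> ?c"
        by (cases u "0::real" rule: linorder_cases) (simp_all add: add_nonneg_nonneg)
    qed auto
    finally show "norm (stable_exponent \<alpha> u) \<le> R powr \<alpha> * ?c" .
  qed
qed

text \<open>For \<open>\<alpha> = 1\<close> the logarithmic terms cancel, which is what the balance of the two weights is for.\<close>

lemma stable_exponent_homogeneous:
  assumes "\<alpha> = 1 \<longrightarrow> p = q" "0 < \<alpha>" "0 \<le> r"
  shows "of_real p * stable_exponent \<alpha> (r * u) + of_real q * stable_exponent \<alpha> (- (r * u)) =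
    of_real (r powr \<alpha>) * (of_real p * stable_exponent \<alpha> u + of_real q * stable_exponent \<alpha> (- u))"
proof (cases "\<alpha> = 1")
  case True
  then have "of_real p * stable_exponent \<alpha> v + of_real q * stable_exponent \<alpha> (- v) = of_real (p * (2 * \<bar>v\<bar>))" for v
    using assms by (simp add: stable_exponent_def sgn_minus algebra_simps)
  then show ?thesis using True assms by (simp add: abs_mult)
next
  case False
  have "stable_exponent \<alpha> (r * v) = of_real (r powr \<alpha>) * stable_exponent \<alpha> v" for v
  proof (cases "r = 0")
    case True
    then show ?thesis by (simp add: stable_exponent_def)
  next
    case r: False
    then show ?thesis using assms False
      by (simp add: stable_exponent_def abs_mult powr_mult sgn_mult)
  qed
  from this[of u] this[of "- u"] show ?thesis by (simp add: algebra_simps)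
qed

context predictable_product
begin

text \<open>Each \<open>x\<close> reduces the problem to the scalar frequencies
  \<open>x \<bullet> G t\<close>, stationary and adapted like \<open>G\<close>. Homogeneity
  separates the length of \<open>G 1\<close> from its direction, which turns the expectation of the
  exponent into an integral over the sphere.\<close>

theorem stable_limit:
  assumes \<alpha>2: "\<alpha> < 2" and a: "\<And>n. n \<ge> 1 \<Longrightarrow> 0 < a n" and norm: "(\<lambda>n. real n * T (a n)) \<longlonglongrightarrow> 1"
    and m: "1 < \<alpha> \<Longrightarrow> has_bochner_integral M (Y 1) 0"
    and sym: "\<alpha> = 1 \<Longrightarrow> distr M borel (Y 1) = distr M borel (\<lambda>\<omega>. - Y 1 \<omega>)"
  shows "\<exists>L. stable_law \<alpha> L \<and> conv_in_distr M (\<lambda>n \<omega>. (\<Sum>t=1..int n. X t \<omega>) /\<^sub>R a n) L"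
proof -
  have "\<exists>c p q D n0. 0 \<le> c \<and> 0 \<le> p \<and> 0 \<le> q \<and> (\<alpha> = 1 \<longrightarrow> p = q) \<and>
    (\<forall>u. (\<lambda>n. of_real (real n) * (1 - (\<integral>\<omega>. iexp (u * (Y 1 \<omega> / a n)) \<partial>M))) \<longlonglongrightarrow>
       of_real c * (of_real p * stable_exponent \<alpha> u + of_real q * stable_exponent \<alpha> (- u))) \<and>
    (\<forall>n\<ge>n0. \<forall>u. cmod (of_real (real n) * (1 - (\<integral>\<omega>. iexp (u * (Y 1 \<omega> / a n)) \<partial>M))) \<le> D * (1 + \<bar>u\<bar> powr (\<alpha> + \<epsilon>)))"
    by (rule characteristic_exponent[OF balanced \<alpha> \<alpha>2 _ norm \<epsilon>]) (fact a m sym)+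
  then obtain c p' q' D n0 where c: "0 \<le> c" "0 \<le> p'" "0 \<le> q'" "\<alpha> = 1 \<longrightarrow> p' = q'"
    and lim: "\<forall>u. (\<lambda>n. of_real (real n) * (1 - (\<integral>\<omega>. iexp (u * (Y 1 \<omega> / a n)) \<partial>M))) \<longlonglongrightarrow>
       of_real c * (of_real p' * stable_exponent \<alpha> u + of_real q' * stable_exponent \<alpha> (- u))"
    and dom: "\<forall>n\<ge>n0. \<forall>u. cmod (of_real (real n) * (1 - (\<integral>\<omega>. iexp (u * (Y 1 \<omega> / a n)) \<partial>M))) \<le> D * (1 + \<bar>u\<bar> powr (\<alpha> + \<epsilon>))"
    by (elim exE conjE) (rule that; assumption)
  define \<psi> where "\<psi> u = of_real c * (of_real p' * stable_exponent \<alpha> u + of_real q' * stable_exponent \<alpha> (- u))" for u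
  have \<psi>m[measurable]: "\<psi> \<in> borel_measurable borel" unfolding \<psi>_def by measurable
  have hom: "\<psi> (r * u) = of_real (r powr \<alpha>) * \<psi> u" if "0 \<le> r" for r u
    unfolding \<psi>_def stable_exponent_homogeneous[OF c(4) \<alpha> that] by (simp add: mult_ac)
  \<comment> \<open>By homogeneity \<psi> is determined by its values at 1 and -1.\<close>
  define K where "K = cmod (\<psi> 1) + cmod (\<psi> (-1))"
  have \<psi>_bound: "cmod (\<psi> u) \<le> K * \<bar>u\<bar> powr \<alpha>" for u
  proof (cases "0 \<le> u")
    case True
    then have "cmod (\<psi> u) = cmod (\<psi> 1) * \<bar>u\<bar> powr \<alpha>" using hom[of u 1] by (simp add: norm_mult)
    then show ?thesis by (simp add: K_def distrib_right)
  next
    case False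
    then have "cmod (\<psi> u) = cmod (\<psi> (-1)) * \<bar>u\<bar> powr \<alpha>" using hom[of "- u" "-1"] by (simp add: norm_mult)
    then show ?thesis by (simp add: K_def distrib_right)
  qed
  have CS: "\<bar>x \<bullet> z\<bar> powr s \<le> (norm x * norm z) powr s" if "0 \<le> s" for x z :: 'b and s
    using that by (intro powr_mono2 Cauchy_Schwarz_ineq2) auto
  define \<phi> where "\<phi> x = exp (- (\<integral>\<omega>. \<psi> (x \<bullet> G 1 \<omega>) \<partial>M))" for x :: 'b
  define H where "H u = D * (1 + \<bar>u\<bar> powr (\<alpha> + \<epsilon>))" for u :: real
  have Hm[measurable]: "H \<in> borel_measurable borel" unfolding H_def by measurable
  have char: "(\<lambda>n. \<integral>\<omega>. iexp (x \<bullet> ((\<Sum>t=1..int n. X t \<omega>) /\<^sub>R a n)) \<partial>M) \<longlonglongrightarrow> \<phi> x" for x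
  proof -
    have st: "strictly_stationary M (\<lambda>t \<omega>. x \<bullet> G t \<omega>)"
      by (rule strictly_stationary_compose[OF G_stat]) measurable
    have ad: "(\<lambda>\<omega>. x \<bullet> G t \<omega>) \<in> borel_measurable (past_sigma M Y t)" for t
      by (intro borel_measurable_inner borel_measurable_const G_adapted)
    have HV: "integrable M (\<lambda>\<omega>. H (x \<bullet> G 1 \<omega>))"
    proof (rule Bochner_Integration.integrable_bound[OF moment_integrable[of "norm x" D 1]])
      show "AE \<omega> in M. norm (H (x \<bullet> G 1 \<omega>)) \<le> norm (D * (1 + (norm x * norm (G 1 \<omega>)) powr (\<alpha> + \<epsilon>)))"
      proof (intro AE_I2)
        fix \<omega>
        have "\<bar>1 + \<bar>x \<bullet> G 1 \<omega>\<bar> powr (\<alpha> + \<epsilon>)\<bar> \<le> \<bar>1 + (norm x * norm (G 1 \<omega>)) powr (\<alpha> + \<epsilon>)\<bar>"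
          using CS[of "\<alpha> + \<epsilon>" x "G 1 \<omega>"] \<alpha> \<epsilon> by simp
        then show "norm (H (x \<bullet> G 1 \<omega>)) \<le> norm (D * (1 + (norm x * norm (G 1 \<omega>)) powr (\<alpha> + \<epsilon>)))"
          unfolding H_def real_norm_def abs_mult by (intro mult_left_mono) auto
      qed
    qed simp_all
    have "(\<lambda>n. \<integral>\<omega>. iexp (\<Sum>t=1..int n. (x \<bullet> G t \<omega>) * (Y t \<omega> / a n)) \<partial>M) \<longlonglongrightarrow> \<phi> x"
      unfolding \<phi>_def
    proof (rule martingale_transform_char[OF ind id st ad \<psi>m Hm _ _ HV])
      show "(\<lambda>n. of_real (real n) * (1 - (\<integral>\<omega>. iexp (u * (Y 1 \<omega> / a n)) \<partial>M))) \<longlonglongrightarrow> \<psi> u" for u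
        unfolding \<psi>_def by (rule lim[rule_format])
      show "cmod (of_real (real n) * (1 - (\<integral>\<omega>. iexp (u * (Y 1 \<omega> / a n)) \<partial>M))) \<le> H u" if "n \<ge> n0" for n u
        unfolding H_def by (rule dom[rule_format, OF that])
    qed
    moreover have "(\<Sum>t=1..int n. (x \<bullet> G t \<omega>) * (Y t \<omega> / a n)) = x \<bullet> ((\<Sum>t=1..int n. X t \<omega>) /\<^sub>R a n)" for n \<omega>
      by (simp add: inner_sum_right sum_distrib_left divide_inverse mult_ac)
    ultimately show ?thesis by (simp only:)
  qed
  have \<phi>: "isCont \<phi> 0"
  proof -
    define E where "E = (\<integral>\<omega>. norm (G 1 \<omega>) powr \<alpha> \<partial>M)"
    have b: "norm (\<integral>\<omega>. \<psi> (x \<bullet> G 1 \<omega>) \<partial>M) \<le> K * norm x powr \<alpha> * E" for x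
    proof -
      have b: "cmod (\<psi> (x \<bullet> G 1 \<omega>)) \<le> K * norm x powr \<alpha> * norm (G 1 \<omega>) powr \<alpha>" for \<omega>
      proof -
        have "K * \<bar>x \<bullet> G 1 \<omega>\<bar> powr \<alpha> \<le> K * (norm x * norm (G 1 \<omega>)) powr \<alpha>"
          using CS[of \<alpha> x "G 1 \<omega>"] \<alpha> by (intro mult_left_mono) (auto simp: K_def)
        then show ?thesis using \<psi>_bound[of "x \<bullet> G 1 \<omega>"] by (simp add: powr_mult mult.assoc)
      qed
      have i: "integrable M (\<lambda>\<omega>. K * norm x powr \<alpha> * norm (G 1 \<omega>) powr \<alpha>)" using norm_powr_integrable by simp
      have "integrable M (\<lambda>\<omega>. cmod (\<psi> (x \<bullet> G 1 \<omega>)))"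
        by (rule Bochner_Integration.integrable_bound[OF i]) (auto intro!: AE_I2 order_trans[OF b])
      then have "norm (\<integral>\<omega>. \<psi> (x \<bullet> G 1 \<omega>) \<partial>M) \<le> (\<integral>\<omega>. K * norm x powr \<alpha> * norm (G 1 \<omega>) powr \<alpha> \<partial>M)"
        by (intro order_trans[OF integral_norm_bound] integral_mono i b)
      then show ?thesis by (simp add: E_def)
    qed
    have "((\<lambda>x::'b. K * norm x powr \<alpha> * E) \<longlongrightarrow> K * 0 * E) (at 0)"
      by (intro tendsto_intros tendsto_zero_powrI[OF tendsto_norm_zero[OF tendsto_ident_at]]) (use \<alpha> in auto)
    then have "((\<lambda>x. \<integral>\<omega>. \<psi> (x \<bullet> G 1 \<omega>) \<partial>M) \<longlongrightarrow> 0) (at 0)"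
      by (subst (asm) mult_zero_right, subst (asm) mult_zero_left) (rule Lim_null_comparison[OF always_eventually], rule allI, rule b)
    from tendsto_exp[OF tendsto_minus[OF this]] show ?thesis
      using \<psi>_bound[of 0] \<alpha> by (simp add: isCont_def \<phi>_def[abs_def])
  qed
  obtain L where L: "prob_space L" "sets L = sets borel" "\<And>x. (\<integral>z. iexp (x \<bullet> z) \<partial>L) = \<phi> x"
    "conv_in_distr M (\<lambda>n \<omega>. (\<Sum>t=1..int n. X t \<omega>) /\<^sub>R a n) L"
    using Levy_continuity_euclidean[of "\<lambda>n \<omega>. (\<Sum>t=1..int n. X t \<omega>) /\<^sub>R a n", OF _ char \<phi>] by auto
  let ?R = "restrict_space borel (sphere (0::'b) 1)"
  define z0 :: 'b where "z0 = (SOME b. b \<in> Basis)"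
  have z0: "norm z0 = 1" unfolding z0_def by (rule norm_Basis[OF SOME_Basis])
  define w where "w k \<omega> = c * (if k then p' else q') * norm (G 1 \<omega>) powr \<alpha>" for k :: bool and \<omega>
  \<comment> \<open>\<open>True\<close> selects the direction of \<open>G 1\<close> and
    \<open>False\<close> the opposite one, matching the weights \<open>p'\<close> and
    \<open>q'\<close>; \<open>z0\<close> only fills the set where \<open>G 1 = 0\<close>, at weight
    0.\<close>
  define d where "d k \<omega> = (if G 1 \<omega> = 0 then z0 else (if k then 1 else - 1) *\<^sub>R (G 1 \<omega> /\<^sub>R norm (G 1 \<omega>)))" for k :: bool and \<omega>
  define \<Gamma> where "\<Gamma> = mixture M (UNIV :: bool set) ?R w d"
  have w: "integrable M (w k)" "0 \<le> w k \<omega>" for k \<omega>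
    unfolding w_def using norm_powr_integrable c by auto
  have ds: "norm (d k \<omega>) = 1" for k \<omega> using z0 by (simp add: d_def)
  have dm[measurable]: "d k \<in> borel_measurable M" for k unfolding d_def by measurable
  have d: "d k \<in> measurable M ?R" for k by (rule measurable_restrict_space2) (use ds in auto)
  have \<Gamma>: "(\<integral>y. stable_exponent \<alpha> (x \<bullet> y) \<partial>\<Gamma>) = (\<integral>\<omega>. \<psi> (x \<bullet> G 1 \<omega>) \<partial>M)" for x
  proof -
    obtain B where B: "\<And>u. \<bar>u\<bar> \<le> norm x \<Longrightarrow> norm (stable_exponent \<alpha> u) \<le> B"
      using stable_exponent_bounded[OF \<alpha>] by blast
    have B': "norm (stable_exponent \<alpha> (x \<bullet> y)) \<le> B" if "norm y = 1" for y
      using Cauchy_Schwarz_ineq2[of x y] that by (intro B) simp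
    have sm: "(\<lambda>y. stable_exponent \<alpha> (x \<bullet> y)) \<in> borel_measurable ?R"
      by (intro measurable_restrict_space1) measurable
    have ik: "integrable M (\<lambda>\<omega>. w k \<omega> *\<^sub>R stable_exponent \<alpha> (x \<bullet> d k \<omega>))" for k
    proof (rule Bochner_Integration.integrable_bound[of M "\<lambda>\<omega>. w k \<omega> * B"])
      show "integrable M (\<lambda>\<omega>. w k \<omega> * B)" using w(1) by simp
      show "(\<lambda>\<omega>. w k \<omega> *\<^sub>R stable_exponent \<alpha> (x \<bullet> d k \<omega>)) \<in> borel_measurable M"
        by (intro borel_measurable_scaleR borel_measurable_integrable[OF w(1)]) measurable
      show "AE \<omega> in M. norm (w k \<omega> *\<^sub>R stable_exponent \<alpha> (x \<bullet> d k \<omega>)) \<le> norm (w k \<omega> * B)"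
      proof (intro AE_I2)
        fix \<omega>
        have "w k \<omega> * norm (stable_exponent \<alpha> (x \<bullet> d k \<omega>)) \<le> w k \<omega> * B" by (intro mult_left_mono B' ds w)
        then show "norm (w k \<omega> *\<^sub>R stable_exponent \<alpha> (x \<bullet> d k \<omega>)) \<le> norm (w k \<omega> * B)" using w(2)[of k \<omega>] by simp
      qed
    qed
    have "(\<integral>y. stable_exponent \<alpha> (x \<bullet> y) \<partial>\<Gamma>) = (\<Sum>k\<in>UNIV. \<integral>\<omega>. w k \<omega> *\<^sub>R stable_exponent \<alpha> (x \<bullet> d k \<omega>) \<partial>M)"
      unfolding \<Gamma>_def by (rule integral_mixture[OF prob_space_axioms _ w d sm]) (auto intro!: B' simp: space_restrict_space)
    also have "\<dots> = (\<integral>\<omega>. w True \<omega> *\<^sub>R stable_exponent \<alpha> (x \<bullet> d True \<omega>) + w False \<omega> *\<^sub>R stable_exponent \<alpha> (x \<bullet> d False \<omega>) \<partial>M)"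
      using ik by (simp add: UNIV_bool add.commute)
    also have "\<dots> = (\<integral>\<omega>. \<psi> (x \<bullet> G 1 \<omega>) \<partial>M)"
    proof (rule Bochner_Integration.integral_cong)
      fix \<omega>
      show "w True \<omega> *\<^sub>R stable_exponent \<alpha> (x \<bullet> d True \<omega>) + w False \<omega> *\<^sub>R stable_exponent \<alpha> (x \<bullet> d False \<omega>) = \<psi> (x \<bullet> G 1 \<omega>)"
      proof (cases "G 1 \<omega> = 0")
        case True
        then show ?thesis using \<psi>_bound[of 0] \<alpha> by (simp add: w_def)
      next
        case False
        define v where "v = x \<bullet> (G 1 \<omega> /\<^sub>R norm (G 1 \<omega>))"
        have "x \<bullet> d True \<omega> = v" "x \<bullet> d False \<omega> = - v" "x \<bullet> G 1 \<omega> = norm (G 1 \<omega>) * v"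
          using False by (simp_all add: d_def v_def)
        moreover from this have "\<psi> (x \<bullet> G 1 \<omega>) = of_real (norm (G 1 \<omega>) powr \<alpha>) * \<psi> v" by (simp only: hom norm_ge_zero)
        ultimately show ?thesis by (simp add: w_def \<psi>_def scaleR_conv_of_real algebra_simps)
      qed
    qed simp
    finally show ?thesis .
  qed
  have "stable_law \<alpha> L"
    unfolding stable_law_def
  \<comment> \<open>The shift vector is 0, since centring and symmetry are already built into
    \<psi>.\<close>
  proof (intro conjI \<alpha> \<alpha>2 L(1,2) exI[of _ \<Gamma>] exI[of _ "0::'b"] allI)
    show "finite_measure \<Gamma>" unfolding \<Gamma>_def by (rule finite_measure_mixture[OF prob_space_axioms _ w d]) simp_all
    show "sets \<Gamma> = sets ?R" unfolding \<Gamma>_def by (rule sets_mixture[OF prob_space_axioms _ w d]) simp_all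
    show "(\<integral>z. iexp (x \<bullet> z) \<partial>L) = exp (- (\<integral>y. stable_exponent \<alpha> (x \<bullet> y) \<partial>\<Gamma>) + \<i> * of_real (x \<bullet> 0))" for x
      using L(3)[of x] \<Gamma>[of x] by (simp add: \<phi>_def)
  qed
  then show ?thesis using L(4) by blast
qed

end

theorem theorem3p2:
  fixes M :: "'w measure"
    and Y :: "int \<Rightarrow> 'w \<Rightarrow> real"
    and G YY :: "int \<Rightarrow> 'w \<Rightarrow> real ^ 'd"
    and S :: "nat \<Rightarrow> 'w \<Rightarrow> real ^ 'd"
    and a :: "nat \<Rightarrow> real"
    and r :: "nat \<Rightarrow> nat"
    and \<alpha> \<epsilon> :: real
  assumes "prob_space M"
    and "iid_seq M Y"
    and "strictly_stationary M G"
    and "measure M {\<omega> \<in> space M. G 1 \<omega> \<noteq> 0} > 0"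
    and "\<And>t. G t \<in> borel_measurable (past_sigma M Y t)"
    and YY_def: "YY = (\<lambda>t \<omega>. Y t \<omega> *\<^sub>R G t \<omega>)"
    and "strictly_stationary M YY"
    and S_def: "S = (\<lambda>n \<omega>. \<Sum>t=1..int n. YY t \<omega>)"
    and "\<And>n. n \<ge> 1 \<Longrightarrow> a n > 0"
    and "(\<lambda>n. measure M {\<omega> \<in> space M. \<bar>Y 1 \<omega>\<bar> > a n}) \<sim>[sequentially] (\<lambda>n. 1 / real n)"
    and "0 < \<alpha>" and "\<alpha> < 2"
    and A1: "regularly_varying M {1} Y \<alpha>"
    and "\<epsilon> > 0"
    and A2: "integrable M (\<lambda>\<omega>. norm (G 1 \<omega>) powr (\<alpha> + \<epsilon>))"
    and A3_mixing: "mixing_A M YY a r"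
    and A3_rate: "(\<lambda>n. real n * real (r n) * (a (r n) / a n) powr (\<alpha> + \<epsilon>)) \<longlonglongrightarrow> 0"
    and "1 < \<alpha> \<Longrightarrow> has_bochner_integral M (Y 1) 0"
    and "\<alpha> = 1 \<Longrightarrow> distr M borel (Y 1) = distr M borel (\<lambda>\<omega>. - Y 1 \<omega>)"
  shows "fdds_regularly_varying M YY \<alpha> \<and>
    (\<forall>k::nat. \<exists>Q. spectral_measure M {- int k..int k} (block_max_norm {- int k..int k}) YY \<alpha> Q) \<and>
    (\<exists>\<gamma>::real.
      (\<forall>Q. (\<forall>k::nat. spectral_measure M {- int k..int k} (block_max_norm {- int k..int k}) YY \<alpha> (Q k))
         \<longrightarrow> (\<lambda>k. extremal_ratio \<alpha> k (Q k)) \<longlonglongrightarrow> \<gamma>) \<and>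
      (\<gamma> > 0 \<longrightarrow>
        (\<exists>L. stable_law \<alpha> L \<and> conv_in_distr M (\<lambda>n \<omega>. S n \<omega> /\<^sub>R a n) L)))"
proof -
  interpret prob_space M by fact
  have ind: "indep_vars (\<lambda>_. borel) Y UNIV" and id: "\<And>s t. distr M borel (Y s) = distr M borel (Y t)"
    using assms(2) by (auto simp: iid_seq_def)
  obtain p q where bal: "tail_balanced (Y 1) \<alpha> p q" using regularly_varying_imp_tail_balanced[OF A1] by blast
  \<comment> \<open>Kept general in the norm: the Euclidean norm gives regular variation, the
    max-norm the extremal ratios.\<close>
  have P: "predictable_product M I N \<kappa> Y G \<alpha> \<epsilon> p q" if "block_norm I N \<kappa>" for I N \<kappa>
    using ind id assms(3,5) bal \<open>0 < \<alpha>\<close> \<open>\<epsilon> > 0\<close> A2 assms(4)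
    by (intro predictable_product.intro that predictable_product_axioms.intro prob_space_axioms) auto
  have sm: "\<exists>Q. spectral_measure M I N YY \<alpha> Q" if "block_norm I N \<kappa>" for I N \<kappa>
    unfolding YY_def using predictable_product.spectral_measure_exists[OF P[OF that]] by blast
  have "fdds_regularly_varying M YY \<alpha>"
    unfolding fdds_regularly_varying_def regularly_varying_def
    by (intro allI impI, rule sm, rule block_euclidean_norm) auto
  moreover have "\<exists>Q. spectral_measure M {- int k..int k} (block_max_norm {- int k..int k}) YY \<alpha> Q" for k :: nat
    by (rule sm, rule block_max_norm) auto
  moreover have "(\<lambda>k. extremal_ratio \<alpha> k (Q k)) \<longlonglongrightarrow> 1"
    if "\<forall>k::nat. spectral_measure M {- int k..int k} (block_max_norm {- int k..int k}) YY \<alpha> (Q k)" for Q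
  proof -
    have "extremal_ratio \<alpha> k (Q k) = 1" for k
      by (rule extremal_ratio_eq_1[OF P[OF block_max_norm]]) (use that in \<open>auto simp: YY_def\<close>)
    then show ?thesis by simp
  qed
  moreover have "\<exists>L. stable_law \<alpha> L \<and> conv_in_distr M (\<lambda>n \<omega>. S n \<omega> /\<^sub>R a n) L"
  proof -
    have norm: "(\<lambda>n. real n * abs_tail (Y 1) (a n)) \<longlonglongrightarrow> 1"
    proof (rule Lim_transform_eventually[OF asymp_equivD[OF assms(10)]])
      show "\<forall>\<^sub>F n in sequentially. (if prob {\<omega> \<in> space M. \<bar>Y 1 \<omega>\<bar> > a n} = 0 \<and> 1 / real n = 0 then 1
          else prob {\<omega> \<in> space M. \<bar>Y 1 \<omega>\<bar> > a n} / (1 / real n)) = real n * abs_tail (Y 1) (a n)"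
        using eventually_gt_at_top[of 0] by eventually_elim (simp add: abs_tail_def mult.commute)
    qed
    \<comment> \<open>A single block suffices to enter the setting of \<open>stable_limit\<close>,
      whose conclusion does not involve the norm.\<close>
    have "block_norm {1::int} (block_euclidean_norm {1} :: (int \<Rightarrow> real ^ 'd) \<Rightarrow> real) 1"
      by (rule block_euclidean_norm) auto
    from predictable_product.stable_limit[OF P[OF this] \<open>\<alpha> < 2\<close> assms(9) norm assms(18,19)]
    show ?thesis unfolding S_def YY_def .
  qed
  \<comment> \<open>The witness for \<gamma> is 1, the constant value of the ratios.\<close>
  ultimately show ?thesis by (intro conjI exI[of _ "1::real"]) simp_all
qed

end
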